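(* A regular matroid $M$ is circuit-difference if and only if every component of $M$ is a series extension of (a matroid isomorphic to) one of the following matroids: $U_{0,1}$; $U_{1,m}$ for some $m\ge 1$; $M^*(K_n)$ for some $n\ge 1$; $M(K_{3,3})$; or $R_{10}$.
   Context: All matroids are finite. A matroid $M$ is circuit-difference if the symmetric difference $C_1\triangle C_2$ is a circuit of $M$ whenever $C_1$ and $C_2$ are distinct circuits of $M$ with $C_1\cap C_2\neq\emptyset$. A one-element series-extension move adds an element $e$ to a matroid $N$ to create a matroid $N'$ in which $\{e,f\}$ is a cocircuit for some element $f$ of $N$ and $N'/e=N$. A matroid $N'$ is a series extension of $N$ if it is obtained from $N$ by a (possibly empty) sequence of one-element series-extension moves. $M(G)$ is the cycle matroid of a graph $G$ and $M^*(G)$ is its dual. $U_{r,n}$ is the uniform matroid of rank $r$ on $n$ elements. $R_{10}$ is the rank-$5$ binary matroid represented over $GF(2)$ by the ten vectors of $GF(2)^5$ having exactly three nonzero coordinates. The components of $M$ are the restrictions of $M$ to its connected components. *)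

theory Defs
  imports
    "Jordan_Normal_Form.Determinant"
    "Jordan_Normal_Form.DL_Submatrix"
    "Jordan_Normal_Form.VS_Connect"
    "HOL-Library.Z2"
begin

section \<open>Finite matroids\<close>

text \<open>
  A matroid is a record consisting of a ground set and the family of independent sets, so that
  equality of records is equality of matroids. The record type alone imposes no axioms; those are
  collected in the locale below.
\<close>

record 'a set_system =
  ground :: "'a set"
  indeps :: "'a set set"

locale matroid =
  fixes M :: "'a set_system"
  assumes finite_ground: "finite (ground M)"
    and indep_subset_ground: "X \<in> indeps M \<Longrightarrow> X \<subseteq> ground M"
    and empty_indep: "{} \<in> indeps M"
    and indep_subset: "X \<in> indeps M \<Longrightarrow> Y \<subseteq> X \<Longrightarrow> Y \<in> indeps M"
    and augmentation: "X \<in> indeps M \<Longrightarrow> Y \<in> indeps M \<Longrightarrow> card X < card Y \<Longrightarrow>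
      \<exists>y \<in> Y - X. insert y X \<in> indeps M"

definition basis :: "'a set_system \<Rightarrow> 'a set \<Rightarrow> bool" where
  "basis M B \<longleftrightarrow> B \<in> indeps M \<and> (\<forall>X \<in> indeps M. B \<subseteq> X \<longrightarrow> X = B)"

definition circuit :: "'a set_system \<Rightarrow> 'a set \<Rightarrow> bool" where
  "circuit M C \<longleftrightarrow> C \<subseteq> ground M \<and> C \<notin> indeps M \<and> (\<forall>X. X \<subset> C \<longrightarrow> X \<in> indeps M)"

text \<open>
  The bases of the dual are the complements of the bases, i.e. a set is independent in the dual
  iff it avoids some basis.
\<close>

definition dual_matroid :: "'a set_system \<Rightarrow> 'a set_system" where
  "dual_matroid M = \<lparr>ground = ground M,
     indeps = {X. X \<subseteq> ground M \<and> (\<exists>B. basis M B \<and> X \<inter> B = {})}\<rparr>"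

definition cocircuit :: "'a set_system \<Rightarrow> 'a set \<Rightarrow> bool" where
  "cocircuit M C \<longleftrightarrow> circuit (dual_matroid M) C"

definition restrict_matroid :: "'a set_system \<Rightarrow> 'a set \<Rightarrow> 'a set_system" where
  "restrict_matroid M X = \<lparr>ground = X, indeps = {I \<in> indeps M. I \<subseteq> X}\<rparr>"

definition delete_matroid :: "'a set_system \<Rightarrow> 'a set \<Rightarrow> 'a set_system" where
  "delete_matroid M T = restrict_matroid M (ground M - T)"

definition contract_matroid :: "'a set_system \<Rightarrow> 'a set \<Rightarrow> 'a set_system" where
  "contract_matroid M T = dual_matroid (delete_matroid (dual_matroid M) T)"

definition matroid_iso :: "'a set_system \<Rightarrow> 'b set_system \<Rightarrow> bool" where
  "matroid_iso M N \<longleftrightarrow> (\<exists>f. bij_betw f (ground M) (ground N) \<and>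
     (\<forall>X. X \<subseteq> ground M \<longrightarrow> (X \<in> indeps M \<longleftrightarrow> f ` X \<in> indeps N)))"

definition connected_rel :: "'a set_system \<Rightarrow> ('a \<times> 'a) set" where
  "connected_rel M = {(e, f). e \<in> ground M \<and> f \<in> ground M \<and>
     (e = f \<or> (\<exists>C. circuit M C \<and> e \<in> C \<and> f \<in> C))}"

definition components :: "'a set_system \<Rightarrow> 'a set_system set" where
  "components M = restrict_matroid M ` (ground M // connected_rel M)"

definition circuit_difference :: "'a set_system \<Rightarrow> bool" where
  "circuit_difference M \<longleftrightarrow> (\<forall>C1 C2. circuit M C1 \<and> circuit M C2 \<and> C1 \<noteq> C2 \<and> C1 \<inter> C2 \<noteq> {} \<longrightarrow>
     circuit M (sym_diff C1 C2))"

definition series_move :: "'a set_system \<Rightarrow> 'a set_system \<Rightarrow> bool" where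
  "series_move N N' \<longleftrightarrow> matroid N \<and> matroid N' \<and>
     (\<exists>e f. e \<notin> ground N \<and> f \<in> ground N \<and> ground N' = insert e (ground N) \<and>
        cocircuit N' {e, f} \<and> contract_matroid N' {e} = N)"

definition series_extension :: "'a set_system \<Rightarrow> 'a set_system \<Rightarrow> bool" where
  "series_extension N N' \<longleftrightarrow> series_move\<^sup>*\<^sup>* N N'"

section \<open>Representable and regular matroids\<close>

text \<open>
  The matroid on \<open>E\<close> represented by the family \<open>\<phi>\<close> of vectors in the \<open>r\<close>-dimensional
  coordinate space. Independence refers to the family, so elements carrying equal
  vectors are dependent; this is the purpose of the injectivity condition.
\<close>

definition vector_matroid :: "nat \<Rightarrow> 'a set \<Rightarrow> ('a \<Rightarrow> 'f::field vec) \<Rightarrow> 'a set_system" where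
  "vector_matroid r E \<phi> = \<lparr>ground = E,
     indeps = {X. X \<subseteq> E \<and> inj_on \<phi> X \<and>
       \<not> module.lin_dep class_ring (module_vec TYPE('f) r) (\<phi> ` X)}\<rparr>"

definition column_matroid :: "'f::field mat \<Rightarrow> nat set_system" where
  "column_matroid A = vector_matroid (dim_row A) {..<dim_col A} (col A)"

definition totally_unimodular :: "real mat \<Rightarrow> bool" where
  "totally_unimodular A \<longleftrightarrow> (\<forall>I J. I \<subseteq> {..<dim_row A} \<and> J \<subseteq> {..<dim_col A} \<and> card I = card J \<longrightarrow>
     det (submatrix A I J) \<in> {-1, 0, 1})"

definition regular_matroid :: "'a set_system \<Rightarrow> bool" where
  "regular_matroid M \<longleftrightarrow> matroid M \<and> (\<exists>A. totally_unimodular A \<and> matroid_iso M (column_matroid A))"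

section \<open>Particular matroids\<close>

definition uniform_matroid :: "nat \<Rightarrow> nat \<Rightarrow> nat set_system" where
  "uniform_matroid r n = \<lparr>ground = {..<n}, indeps = {X. X \<subseteq> {..<n} \<and> card X \<le> r}\<rparr>"

text \<open>
  A simple graph is given by its set of edges, each edge being the set of its two ends; isolated
  vertices do not affect the cycle matroid.
\<close>

definition cycle_edges :: "'v list \<Rightarrow> 'v set set" where
  "cycle_edges vs = {{vs ! i, vs ! (Suc i mod length vs)} |i. i < length vs}"

definition is_cycle :: "'v set set \<Rightarrow> bool" where
  "is_cycle C \<longleftrightarrow> (\<exists>vs. distinct vs \<and> 3 \<le> length vs \<and> C = cycle_edges vs)"

definition cycle_matroid :: "'v set set \<Rightarrow> 'v set set_system" where
  "cycle_matroid G = \<lparr>ground = G, indeps = {X. X \<subseteq> G \<and> (\<forall>C. is_cycle C \<longrightarrow> \<not> C \<subseteq> X)}\<rparr>"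

definition complete_graph :: "nat \<Rightarrow> nat set set" where
  "complete_graph n = {e. e \<subseteq> {..<n} \<and> card e = 2}"

definition complete_bipartite_graph :: "nat \<Rightarrow> nat \<Rightarrow> (nat + nat) set set" where
  "complete_bipartite_graph m n = {{Inl i, Inr j} |i j. i < m \<and> j < n}"

definition R10 :: "bit vec set_system" where
  "R10 = vector_matroid 5 {v \<in> carrier_vec 5. card {i. i < 5 \<and> v $ i \<noteq> 0} = 3} (\<lambda>v. v)"

end

theory Submission
  imports Defs
begin

text \<open>
  A regular matroid is the matroid of a real vector space of functions: the circuits are the minimal
  supports. Let \<open>M\<close> be connected and circuit-difference. A circuit meeting two disjoint circuits
  \<open>C\<close>, \<open>C'\<close> lies inside \<open>C \<union> C'\<close>. If some disjoint pair does not cover the ground set, this forces a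
  partition of the ground set such that the circuits are the unions of two parts, so \<open>M\<close> is a series extension of some
  \<open>U(1,m)\<close>.

  If there is no disjoint pair, the circuits and the empty set form a space \<open>Z\<close> over GF(2) without
  proper inclusions between nonempty members, and one argues by induction on the ground set. The
  members avoiding an element \<open>e\<close> are, up to series classes, the cuts of a complete graph or the
  cycles of \<open>K(3,3)\<close>. In the first case a circuit through \<open>e\<close> puts signs on the edges of the complete
  graph. The signed graph is determined by contracting it to few vertices, where representability
  over the reals enters by excluding the dual of the Fano matroid: either the doubly signed edges
  form a star, and \<open>Z\<close> comes from the cuts of a complete graph with one more vertex, or they form a
  perfect matching on four vertices, and \<open>Z\<close> comes from \<open>K(3,3)\<close>. The second case contains instances
  of the first one.

  If disjoint pairs exist and all of them cover the ground set, the same analysis of the members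
  avoiding \<open>e\<close>, to which now only the complements have to be added, leads to \<open>U(1,4)\<close> and \<open>R10\<close>.
\<close>

section \<open>Signed complete graphs\<close>

text \<open>All members through \<open>e\<close> are sums of one of them, \<open>X\<close>, with
  members avoiding \<open>e\<close>. If the latter are the cuts of a complete graph, the whole space
  is thus encoded by telling which of the elements over each edge lie in \<open>X\<close>, and
  another choice of \<open>X\<close> amounts to switching. Deleting an element of the space
  contracts an edge of the graph, since cuts behave dually to cycles; therefore the signed graphs of
  such spaces are closed under contraction and can be classified from small cases. There are three
  of these. Incomparability says that no switching frees a vertex from \<open>X\<close>, as its cut
  could be added, and that no switching puts all edges into \<open>X\<close>, as \<open>X\<close>
  would then contain a cut. The dual of the Fano matroid appears when three vertices are joined by
  three doubled edges. So on three vertices exactly two edges are doubled, and contraction carries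
  this to larger graphs. If the ground set belongs to the space, it can serve as \<open>X\<close>.
  All signs are then equal, and the obstruction on four vertices is the Fano plane itself, whose
  exclusion over the reals needs a separate computation.\<close>

text \<open>In a signed complete graph \<open>A\<close>, the formula \<open>A u v \<tau>\<close> says that the vertices \<open>u\<close>, \<open>v\<close> are joined by
  an edge of sign \<open>\<tau>\<close>; both signs may occur. Contracting an edge of sign \<open>\<sigma>\<close> between \<open>i\<close> and \<open>j\<close> switches
  the signs at \<open>j\<close> if \<open>\<sigma>\<close> holds.\<close>

definition single :: "('v \<Rightarrow> 'v \<Rightarrow> bool \<Rightarrow> bool) \<Rightarrow> 'v \<Rightarrow> 'v \<Rightarrow> bool" where
  "single A u v \<longleftrightarrow> \<not> (A u v True \<and> A u v False)"

definition contract_edge ::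
    "'v \<Rightarrow> 'v \<Rightarrow> bool \<Rightarrow> ('v \<Rightarrow> 'v \<Rightarrow> bool \<Rightarrow> bool) \<Rightarrow> 'v \<Rightarrow> 'v \<Rightarrow> bool \<Rightarrow> bool" where
  "contract_edge i j \<sigma> A u v \<tau> \<longleftrightarrow>
     (if u = i then A i v \<tau> \<or> A j v (\<tau> \<noteq> \<sigma>)
      else if v = i then A u i \<tau> \<or> A u j (\<tau> \<noteq> \<sigma>)
      else A u v \<tau>)"

text \<open>Switching the vertices where \<open>\<chi>\<close> holds turns every sign inside
  \<open>W\<close> into \<open>False\<close>; in particular no edge inside \<open>W\<close> is
  doubled.\<close>

definition balanced_on :: "'v set \<Rightarrow> ('v \<Rightarrow> 'v \<Rightarrow> bool \<Rightarrow> bool) \<Rightarrow> bool" where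
  "balanced_on W A \<longleftrightarrow> (\<exists>\<chi> :: 'v \<Rightarrow> bool. \<forall>u\<in>W. \<forall>v\<in>W. u \<noteq> v \<longrightarrow> (\<forall>\<tau>. A u v \<tau> \<longleftrightarrow> \<tau> = (\<chi> u \<noteq> \<chi> v)))"

lemma balanced_onE:
  fixes A :: "'v \<Rightarrow> 'v \<Rightarrow> bool \<Rightarrow> bool"
  assumes "balanced_on W A"
  obtains \<chi> :: "'v \<Rightarrow> bool"
  where "\<And>u v \<tau>. u \<in> W \<Longrightarrow> v \<in> W \<Longrightarrow> u \<noteq> v \<Longrightarrow> A u v \<tau> \<longleftrightarrow> \<tau> = (\<chi> u \<noteq> \<chi> v)"
  using assms unfolding balanced_on_def by (elim exE) simp

text \<open>Splitting \<open>l\<close> into two vertices, one for each sign, turns such a graph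
  after switching into a complete graph with one more vertex, in which the element \<open>e\<close>
  will join the two halves of \<open>l\<close>.\<close>

definition star_at :: "'v set \<Rightarrow> ('v \<Rightarrow> 'v \<Rightarrow> bool \<Rightarrow> bool) \<Rightarrow> 'v \<Rightarrow> bool" where
  "star_at V A l \<longleftrightarrow> l \<in> V \<and> (\<forall>v\<in>V - {l}. \<not> single A l v) \<and> balanced_on (V - {l}) A"

text \<open>The last condition says that the 4-cycle \<open>i k j l\<close> of single edges has an
  odd number of edges of sign \<open>True\<close>, a property that switching does not
  change.\<close>

definition matching_at ::
    "('v \<Rightarrow> 'v \<Rightarrow> bool \<Rightarrow> bool) \<Rightarrow> 'v \<Rightarrow> 'v \<Rightarrow> 'v \<Rightarrow> 'v \<Rightarrow> bool" where
  "matching_at A i j k l \<longleftrightarrow> distinct [i, j, k, l] \<and> \<not> single A i j \<and> \<not> single A k l \<and>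
     single A i k \<and> single A i l \<and> single A j k \<and> single A j l \<and>
     ((A i k True \<noteq> A j k True) \<noteq> (A i l True \<noteq> A j l True))"

definition is_matching :: "'v set \<Rightarrow> ('v \<Rightarrow> 'v \<Rightarrow> bool \<Rightarrow> bool) \<Rightarrow> bool" where
  "is_matching V A \<longleftrightarrow> (\<exists>i j k l. V = {i, j, k, l} \<and> matching_at A i j k l)"

text \<open>Switching can make all signs \<open>True\<close>. If the signs come from a circuit, the
  switched circuit then contains every edge and hence a cut.\<close>

definition antibalanced :: "'v set \<Rightarrow> ('v \<Rightarrow> 'v \<Rightarrow> bool \<Rightarrow> bool) \<Rightarrow> bool" where
  "antibalanced W A \<longleftrightarrow> (\<exists>\<chi> :: 'v \<Rightarrow> bool. \<forall>u\<in>W. \<forall>v\<in>W. u \<noteq> v \<longrightarrow> (\<forall>\<tau>. A u v \<tau> \<longleftrightarrow> \<tau> = (\<chi> u = \<chi> v)))"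

lemma signs_eqI:
  assumes "single A u v" "A u v True \<or> A u v False" "A u v True = b"
  shows "A u v \<tau> \<longleftrightarrow> \<tau> = b"
  using assms unfolding single_def by (cases \<tau>) auto

lemma antibalanced_onI:
  assumes "\<And>u v. u \<in> W \<Longrightarrow> v \<in> W \<Longrightarrow> u \<noteq> v \<Longrightarrow> single A u v"
    and "\<And>u v. u \<in> W \<Longrightarrow> v \<in> W \<Longrightarrow> u \<noteq> v \<Longrightarrow> A u v True \<or> A u v False"
    and "\<And>u v. u \<in> W \<Longrightarrow> v \<in> W \<Longrightarrow> u \<noteq> v \<Longrightarrow> A u v True = (\<chi> u = (\<chi> v :: bool))"
  shows "antibalanced W A"
  unfolding antibalanced_def
proof (intro exI[of _ \<chi>] ballI impI allI)
  fix u v \<tau>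
  assume uv: "u \<in> W" "v \<in> W" "u \<noteq> v"
  show "A u v \<tau> \<longleftrightarrow> \<tau> = (\<chi> u = \<chi> v)"
    by (rule signs_eqI[where A = A and u = u and v = v]) (fact assms(1)[OF uv] assms(2)[OF uv] assms(3)[OF uv])+
qed

lemma balanced_onI:
  assumes "\<And>u v. u \<in> W \<Longrightarrow> v \<in> W \<Longrightarrow> u \<noteq> v \<Longrightarrow> single A u v"
    and "\<And>u v. u \<in> W \<Longrightarrow> v \<in> W \<Longrightarrow> u \<noteq> v \<Longrightarrow> A u v True \<or> A u v False"
    and "\<And>u v. u \<in> W \<Longrightarrow> v \<in> W \<Longrightarrow> u \<noteq> v \<Longrightarrow> A u v True = (\<chi> u \<noteq> (\<chi> v :: bool))"
  shows "balanced_on W A"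
  unfolding balanced_on_def
proof (intro exI[of _ \<chi>] ballI impI allI)
  fix u v \<tau>
  assume uv: "u \<in> W" "v \<in> W" "u \<noteq> v"
  show "A u v \<tau> \<longleftrightarrow> \<tau> = (\<chi> u \<noteq> \<chi> v)"
    by (rule signs_eqI[where A = A and u = u and v = v]) (fact assms(1)[OF uv] assms(2)[OF uv] assms(3)[OF uv])+
qed

text \<open>The interface between the matroids and the combinatorial classification.
  \<open>G_three\<close> combines two exclusions, a vertex with only single edges and three doubled
  edges, so that exactly one of the three edges is single.\<close>

locale signed_class =
  fixes G :: "'v set \<Rightarrow> ('v \<Rightarrow> 'v \<Rightarrow> bool \<Rightarrow> bool) \<Rightarrow> bool"
  assumes G_finite: "G V A \<Longrightarrow> finite V"
    and G_sym: "G V A \<Longrightarrow> u \<in> V \<Longrightarrow> v \<in> V \<Longrightarrow> u \<noteq> v \<Longrightarrow> A u v \<tau> = A v u \<tau>"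
    and G_ne: "G V A \<Longrightarrow> u \<in> V \<Longrightarrow> v \<in> V \<Longrightarrow> u \<noteq> v \<Longrightarrow> A u v True \<or> A u v False"
    and G_contract: "G V A \<Longrightarrow> i \<in> V \<Longrightarrow> j \<in> V \<Longrightarrow> i \<noteq> j \<Longrightarrow> A i j \<sigma> \<Longrightarrow>
       G (V - {j}) (contract_edge i j \<sigma> A)"
    and G_three: "G {u, v, w} A \<Longrightarrow> distinct [u, v, w] \<Longrightarrow>
       (single A u v \<and> \<not> single A u w \<and> \<not> single A v w) \<or>
       (\<not> single A u v \<and> single A u w \<and> \<not> single A v w) \<or>
       (\<not> single A u v \<and> \<not> single A u w \<and> single A v w)"
    and G_four: "G V A \<Longrightarrow> card V = 4 \<Longrightarrow> \<not> antibalanced V A"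
begin

text \<open>This is \<open>G_three\<close> for the contraction of \<open>ij\<close>;
  \<open>p\<close>, \<open>q\<close> and \<open>r\<close> say that the edges \<open>ik\<close>,
  \<open>il\<close> and \<open>kl\<close> are single there.\<close>

lemma four_cond:
  assumes "G {i, j, k, l} A" "distinct [i, j, k, l]" "A i j \<sigma>"
  defines "p \<equiv> \<not> ((A i k True \<or> A j k (\<not> \<sigma>)) \<and> (A i k False \<or> A j k \<sigma>))"
    and "q \<equiv> \<not> ((A i l True \<or> A j l (\<not> \<sigma>)) \<and> (A i l False \<or> A j l \<sigma>))"
    and "r \<equiv> \<not> (A k l True \<and> A k l False)"
  shows "(p \<and> \<not> q \<and> \<not> r) \<or> (\<not> p \<and> q \<and> \<not> r) \<or> (\<not> p \<and> \<not> q \<and> r)"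
proof -
  have d: "i \<noteq> j" "i \<noteq> k" "i \<noteq> l" "j \<noteq> k" "j \<noteq> l" "k \<noteq> l"
    "j \<noteq> i" "k \<noteq> i" "l \<noteq> i" "k \<noteq> j" "l \<noteq> j" "l \<noteq> k" using assms(2) by auto
  have "G ({i, j, k, l} - {j}) (contract_edge i j \<sigma> A)"
    using G_contract[OF assms(1), of i j \<sigma>] assms(3) d by auto
  moreover have "{i, j, k, l} - {j} = {i, k, l}" using d by auto
  ultimately have "G {i, k, l} (contract_edge i j \<sigma> A)" by simp
  from G_three[OF this] show ?thesis
    using d by (simp add: single_def contract_edge_def p_def q_def r_def)
qed

text \<open>Each of the six edges can be contracted with each of its signs. The resulting instances
  of \<open>four_cond\<close> leave only stars, matchings and antibalanced graphs, and the last are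
  excluded by \<open>G_four\<close>.\<close>

lemma four_classify:
  assumes G: "G {i, j, k, l} A" and d: "distinct [i, j, k, l]"
  shows "(\<exists>c. star_at {i, j, k, l} A c) \<or> matching_at A i j k l \<or> matching_at A i k j l \<or> matching_at A i l j k"
proof -
  have d': "i \<noteq> j" "i \<noteq> k" "i \<noteq> l" "j \<noteq> k" "j \<noteq> l" "k \<noteq> l"
    "j \<noteq> i" "k \<noteq> i" "l \<noteq> i" "k \<noteq> j" "l \<noteq> j" "l \<noteq> k" using d by auto
  have sym: "A u v = A v u" if "u \<in> {i, j, k, l}" "v \<in> {i, j, k, l}" "u \<noteq> v" for u v
    using G_sym[OF G that] by auto
  have S: "A j i = A i j" "A k i = A i k" "A l i = A i l" "A k j = A j k" "A l j = A j l" "A l k = A k l"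
    using d' sym[of j i] sym[of k i] sym[of l i] sym[of k j] sym[of l j] sym[of l k] by simp_all
  have ne: "A i j True \<or> A i j False" "A i k True \<or> A i k False" "A i l True \<or> A i l False"
    "A j k True \<or> A j k False" "A j l True \<or> A j l False" "A k l True \<or> A k l False"
    using G_ne[OF G] d' by auto
  have E1: "{i, j, k, l} = {i, k, j, l}" "{i, j, k, l} = {i, l, j, k}" "{i, j, k, l} = {j, k, i, l}"
    "{i, j, k, l} = {j, l, i, k}" "{i, j, k, l} = {k, l, i, j}" by auto
  have dd: "distinct [i, k, j, l]" "distinct [i, l, j, k]" "distinct [j, k, i, l]"
    "distinct [j, l, i, k]" "distinct [k, l, i, j]" using d' by simp_all
  note c1 = four_cond[OF G d, unfolded S]
  note c2 = four_cond[OF G[unfolded E1(1)] dd(1), unfolded S]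
  note c3 = four_cond[OF G[unfolded E1(2)] dd(2), unfolded S]
  note c4 = four_cond[OF G[unfolded E1(3)] dd(3), unfolded S]
  note c5 = four_cond[OF G[unfolded E1(4)] dd(4), unfolded S]
  note c6 = four_cond[OF G[unfolded E1(5)] dd(5), unfolded S]
  have na: "\<not> antibalanced {i, j, k, l} A" using G_four[OF G] d by simp
  \<comment> \<open>Antibalance is expressed by triangles: all edges are single, and each of the
    four triangles has an odd number of edges of sign \<open>True\<close>. Then \<open>i\<close>
    gets the value \<open>True\<close> and every other vertex the sign of its edge to
    \<open>i\<close>.\<close>
  have anti: "\<not> (single A i j \<and> single A i k \<and> single A i l \<and> single A j k \<and> single A j l \<and> single A k l \<and>
      (A i j True \<noteq> (A j k True \<noteq> A i k True)) \<and> (A i j True \<noteq> (A j l True \<noteq> A i l True)) \<and>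
      (A i k True \<noteq> (A k l True \<noteq> A i l True)) \<and> (A j k True \<noteq> (A k l True \<noteq> A j l True)))" (is "\<not> ?anti")
  proof
    assume h: ?anti
    define \<chi> where "\<chi> v = (if v = i then True else A i v True)" for v
    have hs: "single A i j" "single A i k" "single A i l" "single A j k" "single A j l" "single A k l"
      using h by blast+
    have sS: "single A j i = single A i j" "single A k i = single A i k" "single A l i = single A i l"
      "single A k j = single A j k" "single A l j = single A j l" "single A l k = single A k l"
      by (simp_all only: single_def S)
    have s: "single A u v" if "u \<in> {i, j, k, l}" "v \<in> {i, j, k, l}" "u \<noteq> v" for u v
      using that by (elim insertE emptyE; simp add: sS hs)
    have F: "A j k True = (A i j True = A i k True)" "A j l True = (A i j True = A i l True)"
      "A k l True = (A i k True = A i l True)" using h by blast+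
    have "A u v True = (\<chi> u = \<chi> v)" if "u \<in> {i, j, k, l}" "v \<in> {i, j, k, l}" "u \<noteq> v" for u v
      using that unfolding \<chi>_def by (elim insertE emptyE; simp only: d' S F if_True if_False simp_thms refl; blast)
    then have "antibalanced {i, j, k, l} A"
      using s G_ne[OF G] by (intro antibalanced_onI[of _ _ \<chi>]) assumption+
    with na show False ..
  qed
  have star: "star_at {i, j, k, l} A a"
    if "distinct [a, b, c, e]" "{i, j, k, l} = {a, b, c, e}" "\<not> single A a b" "\<not> single A a c" "\<not> single A a e"
      "single A b c" "single A b e" "single A c e" "A b c True = (A c e True \<noteq> A b e True)" for a b c e
  proof -
    have n: "b \<noteq> c" "b \<noteq> e" "c \<noteq> e" "c \<noteq> b" "e \<noteq> b" "e \<noteq> c" using that(1) by auto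
    have W: "{i, j, k, l} - {a} = {b, c, e}" and a: "a \<in> {i, j, k, l}"
      unfolding that(2) using that(1) by auto
    have s: "A c b = A b c" "A e b = A b e" "A e c = A c e"
      using sym[unfolded that(2), of c b] sym[unfolded that(2), of e b] sym[unfolded that(2), of e c] n
      by simp_all
    have nn: "A b c True \<or> A b c False" "A b e True \<or> A b e False" "A c e True \<or> A c e False"
      using G_ne[OF G, unfolded that(2)] n by simp_all
    \<comment> \<open>The value at a vertex is the sign of its edge to \<open>b\<close>; this is
      consistent because the triangle \<open>b\<close>, \<open>c\<close>, \<open>e\<close> has an
      even number of edges of sign \<open>True\<close>.\<close>
    define \<chi> where "\<chi> v = (if v = b then False else A b v True)" for v
    have sS: "single A c b = single A b c" "single A e b = single A b e" "single A e c = single A c e"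
      by (simp_all only: single_def s)
    have s': "single A u v" if "u \<in> {b, c, e}" "v \<in> {b, c, e}" "u \<noteq> v" for u v
      using that by (elim insertE emptyE; simp add: sS \<open>single A b c\<close> \<open>single A b e\<close> \<open>single A c e\<close>)
    have F: "A c e True = (A b c True \<noteq> A b e True)" using that(9) by blast
    have "A u v True = (\<chi> u \<noteq> \<chi> v)" if "u \<in> {b, c, e}" "v \<in> {b, c, e}" "u \<noteq> v" for u v
      using that unfolding \<chi>_def
      by (elim insertE emptyE; simp only: n s F if_True if_False simp_thms refl; blast)
    moreover have "A u v True \<or> A u v False" if "u \<in> {b, c, e}" "v \<in> {b, c, e}" "u \<noteq> v" for u v
      using G_ne[OF G[unfolded \<open>{i, j, k, l} = {a, b, c, e}\<close>], of u v] that by simp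
    ultimately have "balanced_on {b, c, e} A"
      using s' by (intro balanced_onI[of _ _ \<chi>]) assumption+
    then show ?thesis unfolding star_at_def W using a that(3-5) by auto
  qed
  \<comment> \<open>After the symmetric entries are identified, this is a statement about twelve
    Boolean variables, two for each edge.\<close>
  have "(\<not> single A i j \<and> \<not> single A i k \<and> \<not> single A i l \<and>
      single A j k \<and> single A j l \<and> single A k l \<and> (A j k True = (A k l True \<noteq> A j l True))) \<or>
    (\<not> single A i j \<and> \<not> single A j k \<and> \<not> single A j l \<and>
      single A i k \<and> single A i l \<and> single A k l \<and> (A i k True = (A k l True \<noteq> A i l True))) \<or>
    (\<not> single A i k \<and> \<not> single A j k \<and> \<not> single A k l \<and>
      single A i j \<and> single A i l \<and> single A j l \<and> (A i j True = (A j l True \<noteq> A i l True))) \<or>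
    (\<not> single A i l \<and> \<not> single A j l \<and> \<not> single A k l \<and>
      single A i j \<and> single A i k \<and> single A j k \<and> (A i j True = (A j k True \<noteq> A i k True))) \<or>
    matching_at A i j k l \<or> matching_at A i k j l \<or> matching_at A i l j k"
    using ne anti c1[of True] c1[of False] c2[of True] c2[of False] c3[of True] c3[of False]
     c4[of True] c4[of False] c5[of True] c5[of False] c6[of True] c6[of False]
    unfolding matching_at_def single_def S
    by (simp add: d' del: de_Morgan_conj de_Morgan_disj) (smt (verit))
  then consider "\<not> single A i j \<and> \<not> single A i k \<and> \<not> single A i l \<and>
      single A j k \<and> single A j l \<and> single A k l \<and> (A j k True = (A k l True \<noteq> A j l True))" |
    "\<not> single A i j \<and> \<not> single A j k \<and> \<not> single A j l \<and>
      single A i k \<and> single A i l \<and> single A k l \<and> (A i k True = (A k l True \<noteq> A i l True))" |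
    "\<not> single A i k \<and> \<not> single A j k \<and> \<not> single A k l \<and>
      single A i j \<and> single A i l \<and> single A j l \<and> (A i j True = (A j l True \<noteq> A i l True))" |
    "\<not> single A i l \<and> \<not> single A j l \<and> \<not> single A k l \<and>
      single A i j \<and> single A i k \<and> single A j k \<and> (A i j True = (A j k True \<noteq> A i k True))" |
    "matching_at A i j k l \<or> matching_at A i k j l \<or> matching_at A i l j k" by argo
  then show ?thesis
  proof cases
    case 1
    then have "star_at {i, j, k, l} A i" by (intro star[of i j k l]) (use d' S in auto)
    then show ?thesis by blast
  next
    case 2
    then have "star_at {i, j, k, l} A j"
      by (intro star[of j i k l]) (use d' S in \<open>auto simp: single_def\<close>)
    then show ?thesis by blast
  next
    case 3
    then have "star_at {i, j, k, l} A k"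
      by (intro star[of k i j l]) (use d' S in \<open>auto simp: single_def\<close>)
    then show ?thesis by blast
  next
    case 4
    then have "star_at {i, j, k, l} A l"
      by (intro star[of l i j k]) (use d' S in \<open>auto simp: single_def\<close>)
    then show ?thesis by blast
  qed blast
qed


text \<open>Serves to rule out a matching as soon as two doubled edges share a vertex.\<close>

lemma matching_unique:
  assumes G: "G V A" and m: "matching_at A p q r s" "V = {p, q, r, s}"
    and x: "x \<in> V" "y \<in> V" "z \<in> V" "distinct [x, y, z]" and n: "\<not> single A x y" "\<not> single A x z"
  shows False
proof -
  have sym: "single A u v = single A v u" if "u \<in> V" "v \<in> V" "u \<noteq> v" for u v
    using G_sym[OF G that] by (simp add: single_def)
  have d: "distinct [p, q, r, s]" using m(1) by (simp add: matching_at_def)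
  have "single A r p" "single A s p" "single A r q" "single A s q"
    using m(1) sym[of r p] sym[of s p] sym[of r q] sym[of s q] d unfolding matching_at_def m(2) by auto
  then show False using m(1) x n d unfolding matching_at_def m(2) by auto
qed

lemma matching_ex_partner:
  assumes G: "G V A" and m: "matching_at A p q r s" "V = {p, q, r, s}" and x: "x \<in> V"
  shows "\<exists>z\<in>V. z \<noteq> x \<and> \<not> single A x z"
proof -
  have d: "p \<noteq> q" "r \<noteq> s" and n: "\<not> single A p q" "\<not> single A r s"
    using m(1) by (simp_all add: matching_at_def)
  have "A q p \<tau> = A p q \<tau>" "A s r \<tau> = A r s \<tau>" for \<tau>
    using G_sym[OF G, of q p] G_sym[OF G, of s r] d m(2) by simp_all
  then have "\<not> single A q p" "\<not> single A s r" using n by (simp_all add: single_def)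
  with n d x show ?thesis unfolding m(2) by auto
qed

text \<open>Makes a matching usable without knowing which of its four names belongs to which vertex:
  one doubled edge fixes the status of all others.\<close>

lemma matching_partner:
  assumes G: "G {w, x, y, z} A" and d: "distinct [w, x, y, z]"
    and m: "matching_at A p q r s" "{w, x, y, z} = {p, q, r, s}"
    and n: "\<not> single A w x"
  shows "\<not> single A y z \<and> single A w y \<and> single A w z \<and> single A x y \<and> single A x z"
proof -
  have sym: "single A u v = single A v u" if "u \<in> {p, q, r, s}" "v \<in> {p, q, r, s}" "u \<noteq> v" for u v
    using G_sym[OF G] that m(2) by (simp add: single_def)
  have d': "distinct [p, q, r, s]" using m(1) by (simp add: matching_at_def)
  have S: "single A r p" "single A s p" "single A r q" "single A s q" "\<not> single A q p" "\<not> single A s r"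
    using m(1) sym[of r p] sym[of s p] sym[of r q] sym[of s q] sym[of q p] sym[of s r] d'
    unfolding matching_at_def by auto
  have w: "w = p \<or> w = q \<or> w = r \<or> w = s" and x: "x = p \<or> x = q \<or> x = r \<or> x = s"
    and y: "y = p \<or> y = q \<or> y = r \<or> y = s" and z: "z = p \<or> z = q \<or> z = r \<or> z = s"
    using m(2) by auto
  have M: "single A p r" "single A p s" "single A q r" "single A q s" "\<not> single A p q" "\<not> single A r s"
    using m(1) by (auto simp: matching_at_def)
  have "(w = p \<and> x = q) \<or> (w = q \<and> x = p) \<or> (w = r \<and> x = s) \<or> (w = s \<and> x = r)"
    using w x n S M d by (elim disjE) simp_all
  then have "(w = p \<and> x = q \<and> (y = r \<and> z = s \<or> y = s \<and> z = r)) \<or> (w = q \<and> x = p \<and> (y = r \<and> z = s \<or> y = s \<and> z = r)) \<or>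
    (w = r \<and> x = s \<and> (y = p \<and> z = q \<or> y = q \<and> z = p)) \<or> (w = s \<and> x = r \<and> (y = p \<and> z = q \<or> y = q \<and> z = p))"
    using y z d d' by (elim disjE conjE) simp_all
  then show ?thesis using S M by blast
qed

text \<open>Away from the center the graph is balanced and has no doubled edges.\<close>

lemma star_center:
  fixes A :: "'v \<Rightarrow> 'v \<Rightarrow> bool \<Rightarrow> bool"
  assumes "star_at V A c" "x \<in> V" "y \<in> V" "x \<noteq> y" "\<not> single A x y"
  shows "c = x \<or> c = y"
proof (rule ccontr)
  assume n: "\<not> (c = x \<or> c = y)"
  have "balanced_on (V - {c}) A" using assms(1) by (simp add: star_at_def)
  then show False
  proof (rule balanced_onE)
    fix \<chi> :: "'v \<Rightarrow> bool"
    assume chi: "\<And>u v \<tau>. u \<in> V - {c} \<Longrightarrow> v \<in> V - {c} \<Longrightarrow> u \<noteq> v \<Longrightarrow> A u v \<tau> \<longleftrightarrow> \<tau> = (\<chi> u \<noteq> \<chi> v)"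
    have "x \<in> V - {c}" "y \<in> V - {c}" using assms(2,3) n by auto
    from chi[OF this assms(4), of True] chi[OF this assms(4), of False] show False
      using assms(5) unfolding single_def by argo
  qed
qed

text \<open>The edge \<open>iw\<close> of the contraction collects the edges \<open>iw\<close> and
  \<open>jw\<close>, the latter possibly with switched signs; a doubled edge among them would stay
  doubled.\<close>

lemma single_contract:
  assumes "i \<noteq> w" "single (contract_edge i j \<sigma> A) i w"
  shows "single A i w \<and> single A j w"
proof (cases \<sigma>)
  case True
  then show ?thesis using assms(2) by (simp add: single_def contract_edge_def) argo
next
  case False
  then show ?thesis using assms(2) by (simp add: single_def contract_edge_def) argo
qed

text \<open>The doubled edges at \<open>l\<close> that avoid \<open>i\<close> and \<open>j\<close>
  are visible before the contraction. Contracting another edge \<open>xm\<close> keeps two doubled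
  edges at \<open>l\<close>, which forces a star with the same center and reveals the edges that the
  first contraction merged.\<close>

lemma star_lift:
  assumes G: "G V A" and c: "5 \<le> card V" and ij: "i \<in> V" "j \<in> V" "i \<noteq> j" "A i j \<sigma>"
    and IH: "\<And>i j \<sigma>. i \<in> V \<Longrightarrow> j \<in> V \<Longrightarrow> i \<noteq> j \<Longrightarrow> A i j \<sigma> \<Longrightarrow>
        (\<exists>l. star_at (V - {j}) (contract_edge i j \<sigma> A) l) \<or> is_matching (V - {j}) (contract_edge i j \<sigma> A)"
    and star: "star_at (V - {j}) (contract_edge i j \<sigma> A) l" and li: "l \<noteq> i"
  shows "star_at V A l"
proof -
  let ?A' = "contract_edge i j \<sigma> A"
  have fin: "finite V" using G_finite[OF G] .
  have lV: "l \<in> V" "l \<noteq> j" using star by (auto simp: star_at_def)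
  have dbl: "\<not> single A l m" if "m \<in> V" "m \<noteq> i" "m \<noteq> j" "m \<noteq> l" for m
    using star that li by (auto simp: star_at_def single_def contract_edge_def)
  have "card (V - {i, j, l}) \<ge> 2" using c fin ij li lV by (subst card_Diff_subset) auto
  \<comment> \<open>These are auxiliary vertices: \<open>m\<close> will be contracted into
    \<open>x\<close>, carrying a doubled edge \<open>lm\<close> along, and \<open>n\<close> keeps a
    second doubled edge at \<open>l\<close>.\<close>
  then obtain m n where mn: "m \<in> V - {i, j, l}" "n \<in> V - {i, j, l}" "m \<noteq> n"
    by (metis card_2_iff insert_subset obtain_subset_with_card_n)
  have other: "\<not> single A l y \<and> single A x y"
    if xy: "x \<in> V" "y \<in> V" "x \<noteq> y" "x \<noteq> l" "y \<noteq> l" "x \<notin> {m, n}" "y \<notin> {m, n}" for x y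
  proof -
    obtain \<sigma>2 where s2: "A x m \<sigma>2" using G_ne[OF G, of x m] xy mn by auto
    let ?B = "contract_edge x m \<sigma>2 A"
    have GB: "G (V - {m}) ?B" using G_contract[OF G, of x m] xy mn s2 by auto
    have b1: "\<not> single ?B l n"
      using dbl[of n] mn xy by (auto simp: single_def contract_edge_def)
    have b2: "\<not> single ?B l x"
      using dbl[of m] mn xy unfolding single_def contract_edge_def by (cases \<sigma>2) auto
    have "\<not> is_matching (V - {m}) ?B"
    proof
      assume "is_matching (V - {m}) ?B"
      then obtain p q r s where "V - {m} = {p, q, r, s}" "matching_at ?B p q r s"
        unfolding is_matching_def by blast
      from matching_unique[OF GB this(2,1) _ _ _ _ b1 b2] show False using lV mn xy by auto
    qed
    then obtain c where c: "star_at (V - {m}) ?B c" using IH[of x m \<sigma>2] xy mn s2 by auto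
    have "c = l"
      using star_center[OF c _ _ _ b1] star_center[OF c _ _ _ b2] lV mn xy by auto
    with c have "\<not> single ?B l y" and bal: "balanced_on (V - {m} - {l}) ?B"
      using xy mn by (auto simp: star_at_def)
    then have 1: "\<not> single A l y" using xy by (auto simp: single_def contract_edge_def)
    have "x \<in> V - {m} - {l}" "y \<in> V - {m} - {l}" using xy mn by auto
    then have "\<exists>b. \<forall>\<tau>. ?B x y \<tau> \<longleftrightarrow> \<tau> = b" using bal xy(3) by (elim balanced_onE) auto
    then obtain b where b: "\<And>\<tau>. ?B x y \<tau> \<longleftrightarrow> \<tau> = b" by metis
    have "single ?B x y" unfolding single_def using b[of True] b[of False] by argo
    then have "single A x y" using single_contract xy(3) by metis
    with 1 show ?thesis ..
  qed
  have o1: "\<not> single A l j \<and> single A i j" using other[of i j] ij li lV mn by auto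
  have o2: "\<not> single A l i" using other[of j i] ij li lV mn by auto
  have "balanced_on (V - {j} - {l}) ?A'" using star by (simp add: star_at_def)
  then obtain \<chi> :: "'v \<Rightarrow> bool" where "\<forall>u\<in>V - {j} - {l}. \<forall>v\<in>V - {j} - {l}. u \<noteq> v \<longrightarrow>
      (\<forall>\<tau>. ?A' u v \<tau> \<longleftrightarrow> \<tau> = (\<chi> u \<noteq> \<chi> v))" unfolding balanced_on_def by (elim exE) (rule that)
        note chi = this[rule_format]
  \<comment> \<open>The contraction knows only the merged vertex; the sign \<open>\<sigma>\<close>
    of the edge \<open>ij\<close> fixes the value at \<open>j\<close> relative to the value at
    \<open>i\<close>.\<close>
  define \<chi>' where "\<chi>' v = (if v = j then (\<chi> i \<noteq> \<sigma>) else \<chi> v)" for v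
  have ne: "A u v True \<or> A u v False" if "u \<in> V" "v \<in> V" "u \<noteq> v" for u v
    using G_ne[OF G that] .
  have base: "A u v \<tau> \<longleftrightarrow> \<tau> = (\<chi> u \<noteq> \<chi> v)" if "u \<in> V - {i, j, l}" "v \<in> V - {i, j, l}" "u \<noteq> v" for u v \<tau>
    using chi[of u v \<tau>] that by (auto simp: contract_edge_def)
  \<comment> \<open>In the contraction the edge \<open>iv\<close> has just one sign. Both edges that
    it collects are present, so each of them has exactly this sign, up to the switch at
    \<open>j\<close>.\<close>
  have i_m: "A i v \<tau> \<longleftrightarrow> \<tau> = (\<chi> i \<noteq> \<chi> v)" if "v \<in> V - {i, j, l}" for v \<tau>
    using chi[of i v True] chi[of i v False] ne[of i v] that ij li unfolding contract_edge_def
    by (cases \<tau>) auto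
  have j_m: "A j v \<tau> \<longleftrightarrow> \<tau> = (\<chi>' j \<noteq> \<chi> v)" if "v \<in> V - {i, j, l}" for v \<tau>
    using chi[of i v True] chi[of i v False] ne[of j v] that ij li unfolding contract_edge_def \<chi>'_def
    by (cases \<tau>; cases \<sigma>) auto
  have i_j: "A i j \<tau> \<longleftrightarrow> \<tau> = (\<chi> i \<noteq> \<chi>' j)" for \<tau>
    using o1 ij(4) unfolding single_def \<chi>'_def by (cases \<tau>; cases \<sigma>) auto
  have sym: "A u v \<tau> = A v u \<tau>" if "u \<in> V" "v \<in> V" "u \<noteq> v" for u v \<tau> using G_sym[OF G that] .
  have "A u v \<tau> \<longleftrightarrow> \<tau> = (\<chi>' u \<noteq> \<chi>' v)" if uv: "u \<in> V - {l}" "v \<in> V - {l}" "u \<noteq> v" for u v \<tau>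
  proof -
    consider "u \<noteq> i" "u \<noteq> j" "v \<noteq> i" "v \<noteq> j" | "u = i" "v \<noteq> j" | "u = j" "v \<noteq> i" | "u = i" "v = j"
      | "v = i" "u \<noteq> j" | "v = j" "u \<noteq> i" | "v = i" "u = j" using uv by blast
    then show ?thesis
    proof cases
      case 1 then show ?thesis using base[of u v] uv by (auto simp: \<chi>'_def)
    next
      case 2 then show ?thesis using i_m[of v] uv ij by (auto simp: \<chi>'_def)
    next
      case 3 then show ?thesis using j_m[of v \<tau>] uv by (simp add: \<chi>'_def)
    next
      case 4 then show ?thesis using i_j[of \<tau>] ij by (simp add: \<chi>'_def)
    next
      case 5 then show ?thesis using i_m[of u \<tau>] uv ij sym[of u v \<tau>] by (auto simp: \<chi>'_def)
    next
      case 6 then show ?thesis using j_m[of u \<tau>] uv sym[of u v \<tau>] by (auto simp: \<chi>'_def)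
    next
      case 7 then show ?thesis using i_j[of \<tau>] ij sym[of u v \<tau>] by (auto simp: \<chi>'_def)
    qed
  qed
  then have "balanced_on (V - {l}) A" unfolding balanced_on_def by (intro exI[of _ \<chi>'] ballI impI allI)
  moreover have "\<not> single A l v" if "v \<in> V - {l}" for v using dbl[of v] o1 o2 that by blast
  ultimately show ?thesis using lV by (simp add: star_at_def)
qed

text \<open>On five or more vertices, either some contraction is a star whose center lifts to the
  whole graph, or comparing several contractions shows that the doubled edges cannot be placed
  consistently.\<close>

theorem classify:
  "G V A \<Longrightarrow> 3 \<le> card V \<Longrightarrow> (\<exists>l. star_at V A l) \<or> (card V = 4 \<and> is_matching V A)"
proof (induction "card V" arbitrary: V A rule: less_induct)
  case less
  note G = \<open>G V A\<close>
  have fin: "finite V" using G_finite[OF G] .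
  have sym: "A u v = A v u" if "u \<in> V" "v \<in> V" "u \<noteq> v" for u v using G_sym[OF G that] by auto
  have ne: "A u v True \<or> A u v False" if "u \<in> V" "v \<in> V" "u \<noteq> v" for u v
    using G_ne[OF G that] .
  consider "card V = 3" | "card V = 4" | "5 \<le> card V" using less.prems by linarith
  then show ?case
  proof cases
    case 1
    then obtain u v w where V: "V = {u, v, w}" "distinct [u, v, w]" by (auto simp: card_3_iff)
    have st: "star_at V A c" if "V = {a, b, c}" "distinct [a, b, c]" "single A a b" "\<not> single A c a" "\<not> single A c b" for a b c
    proof -
      have W: "V - {c} = {a, b}" using that by auto
      have ba: "A b a = A a b" using sym[of b a] that(1,2) by auto
      have "single A b a" using that(3) ba by (simp add: single_def)
      then have "balanced_on {a, b} A"
        using that(2,3) ne[of a b] that(1) ba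
        by (intro balanced_onI[where \<chi> = "\<lambda>x. x = b \<and> A a b True"]) (elim insertE emptyE; simp)+
      then show ?thesis using that unfolding star_at_def W by auto
    qed
    have s: "single A u v = single A v u" "single A u w = single A w u" "single A v w = single A w v"
      using sym V by (auto simp: single_def)
    consider "single A u v" "\<not> single A u w" "\<not> single A v w" | "\<not> single A u v" "single A u w" "\<not> single A v w"
      | "\<not> single A u v" "\<not> single A u w" "single A v w" using G_three[OF G[unfolded V(1)] V(2)] by blast
    then show ?thesis
    proof cases
      case 1 then show ?thesis using st[of u v w] s V by auto
    next
      case 2 then show ?thesis using st[of u w v] s V by (auto simp: insert_commute)
    next
      case 3 then show ?thesis using st[of v w u] s V by (auto simp: insert_commute)
    qed
  next
    case 2
    then obtain i j k l where V: "V = {i, j, k, l}" "distinct [i, j, k, l]"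
      by (auto simp: card_Suc_eq numeral_eq_Suc)
    from four_classify[OF G[unfolded V(1)] V(2)] show ?thesis
    proof (elim disjE)
      assume "matching_at A i j k l"
      then show ?thesis using 2 V(1) unfolding is_matching_def by blast
    next
      assume "matching_at A i k j l"
      moreover have "V = {i, k, j, l}" using V(1) by auto
      ultimately show ?thesis using 2 unfolding is_matching_def by blast
    next
      assume "matching_at A i l j k"
      moreover have "V = {i, l, j, k}" using V(1) by auto
      ultimately show ?thesis using 2 unfolding is_matching_def by blast
    qed (use V(1) in blast)
  next
    case 3
    have con: "G (V - {j}) (contract_edge i j \<sigma> A)" if "i \<in> V" "j \<in> V" "i \<noteq> j" "A i j \<sigma>" for i j \<sigma>
      using G_contract[OF G that] .
    have IH: "(\<exists>l. star_at (V - {j}) (contract_edge i j \<sigma> A) l) \<or>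
        (card V = 5 \<and> is_matching (V - {j}) (contract_edge i j \<sigma> A))"
      if "i \<in> V" "j \<in> V" "i \<noteq> j" "A i j \<sigma>" for i j \<sigma>
    proof -
      have c: "card (V - {j}) = card V - 1" using that(2) fin by simp
      have "card (V - {j}) < card V" "3 \<le> card (V - {j})" using c 3 by linarith+
      from less.hyps[OF this(1) con[OF that] this(2)] show ?thesis using c 3 by auto
    qed
    have lift: "star_at V A l" if "i \<in> V" "j \<in> V" "i \<noteq> j" "A i j \<sigma>"
      "star_at (V - {j}) (contract_edge i j \<sigma> A) l" "l \<noteq> i" for i j \<sigma> l
      using star_lift[OF G 3 that(1-4) _ that(5,6)] IH by blast
    show ?thesis
    proof (cases "\<exists>i j \<sigma> l. i \<in> V \<and> j \<in> V \<and> i \<noteq> j \<and> A i j \<sigma> \<and> star_at (V - {j}) (contract_edge i j \<sigma> A) l")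
      case True
      then obtain i j \<sigma> l where h: "i \<in> V" "j \<in> V" "i \<noteq> j" "A i j \<sigma>"
        "star_at (V - {j}) (contract_edge i j \<sigma> A) l" by blast
      show ?thesis
      proof (rule ccontr)
        assume neg: "\<not> ?thesis"
        \<comment> \<open>A star centered elsewhere would lift. So the center is the merged vertex,
          and the graph is balanced away from \<open>i\<close> and \<open>j\<close>.\<close>
        have "l = i" using lift[OF h] neg by blast
        then have "balanced_on (V - {j} - {i}) (contract_edge i j \<sigma> A)" using h(5) by (simp add: star_at_def)
        then obtain \<chi> :: "'v \<Rightarrow> bool" where "\<forall>u\<in>V - {j} - {i}. \<forall>v\<in>V - {j} - {i}. u \<noteq> v \<longrightarrow>
      (\<forall>\<tau>. contract_edge i j \<sigma> A u v \<tau> \<longleftrightarrow> \<tau> = (\<chi> u \<noteq> \<chi> v))" unfolding balanced_on_def by (elim exE) (rule that)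
        note chi = this[rule_format]
        have bal: "A u v \<tau> \<longleftrightarrow> \<tau> = (\<chi> u \<noteq> \<chi> v)" if "u \<in> V - {i, j}" "v \<in> V - {i, j}" "u \<noteq> v" for u v \<tau>
          using chi[of u v \<tau>] that by (auto simp: contract_edge_def)
        have "card (V - {i, j}) \<ge> 3" using 3 fin h by (subst card_Diff_subset) auto
        then obtain m n p where mnp: "{m, n, p} \<subseteq> V - {i, j}" "distinct [m, n, p]"
          by (metis card_3_iff distinct_length_2_or_more distinct_singleton obtain_subset_with_card_n)
        \<comment> \<open>Contracting \<open>xy\<close> inside the balanced part keeps
          \<open>xp\<close> single, so the result is not a star centered at \<open>x\<close> and
          must be a matching on \<open>i\<close>, \<open>j\<close>, \<open>x\<close>,
          \<open>p\<close>. There \<open>p\<close> is paired with \<open>i\<close> or with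
          \<open>j\<close>, and \<open>x\<close> and \<open>y\<close> have only single edges to that
          vertex.\<close>
        have key: "card V = 5 \<and> ((\<not> single A p j \<and> single A x j \<and> single A y j \<and> single A p i) \<or>
            (\<not> single A p i \<and> single A x i \<and> single A y i \<and> single A p j))"
          if xyp: "x \<in> V - {i, j}" "y \<in> V - {i, j}" "p \<in> V - {i, j}" "distinct [x, y, p]" for x y p
        proof -
          define s where "s = (\<chi> x \<noteq> \<chi> y)"
          have As: "A x y s" using bal[of x y] xyp by (simp add: s_def)
          let ?B = "contract_edge x y s A"
          have GB: "G (V - {y}) ?B" using con[OF _ _ _ As] xyp by auto
          have pn: "p \<noteq> x" "p \<noteq> y" using xyp by auto
          have e: "A x p \<tau> \<longleftrightarrow> \<tau> = (\<chi> x \<noteq> \<chi> p)" "A y p \<tau> \<longleftrightarrow> \<tau> = (\<chi> y \<noteq> \<chi> p)"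
            "A p x \<tau> \<longleftrightarrow> \<tau> = (\<chi> p \<noteq> \<chi> x)" "A p y \<tau> \<longleftrightarrow> \<tau> = (\<chi> p \<noteq> \<chi> y)" for \<tau>
            using bal[of x p \<tau>] bal[of y p \<tau>] bal[of p x \<tau>] bal[of p y \<tau>] xyp pn by simp_all
          have xp: "single ?B x p" and px: "single ?B p x"
            using pn unfolding single_def contract_edge_def s_def
            by (cases "\<chi> x"; cases "\<chi> y"; cases "\<chi> p"; simp add: e)+
          have nostar: "\<not> star_at (V - {y}) ?B c" for c
          proof
            assume st: "star_at (V - {y}) ?B c"
            then have "c = x" using lift[OF _ _ _ As st] neg xyp by auto
            then have "\<not> single ?B x p" using st xyp by (auto simp: star_at_def)
            with xp show False by simp
          qed
          then have c5: "card V = 5" and mat: "is_matching (V - {y}) ?B"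
            using IH[OF _ _ _ As] xyp by auto
          have "{i, j, x, p, y} \<subseteq> V" "card {i, j, x, p, y} = 5" using xyp h by auto
          then have "V = {i, j, x, p, y}" using card_subset_eq[OF fin] c5 by metis
          then have V': "V - {y} = {i, j, x, p}" using xyp by auto
          have d: "distinct [i, j, x, p]" using xyp h(3) by auto
          obtain a b c e where m: "matching_at ?B a b c e" "V - {y} = {a, b, c, e}"
            using mat unfolding is_matching_def by blast
          have sx: "single ?B x i \<Longrightarrow> single A x i \<and> single A y i" "single ?B x j \<Longrightarrow> single A x j \<and> single A y j"
            using single_contract[of x i y s A] single_contract[of x j y s A] d by auto
          have sp: "single ?B p i = single A p i" "single ?B p j = single A p j"
            using d by (auto simp: single_def contract_edge_def)
          have dd: "distinct [x, j, i, p]" "distinct [x, p, i, j]" "distinct [x, i, j, p]"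
            "distinct [p, j, i, x]" "distinct [p, i, j, x]" using d by auto
          have VV: "V - {y} = {x, j, i, p}" "V - {y} = {x, p, i, j}" "V - {y} = {x, i, j, p}"
            "V - {y} = {p, j, i, x}" "V - {y} = {p, i, j, x}"
            using V' by auto
          have sy: "single ?B i x = single ?B x i" "single ?B j x = single ?B x j" "single ?B i p = single ?B p i" "single ?B j p = single ?B p j"
            using G_sym[OF GB] V' d by (auto simp: single_def)
          consider "\<not> single ?B p j" | "\<not> single ?B p i" | "single ?B p i" "single ?B p j" by blast
          then show ?thesis
          proof cases
            case 1
            from matching_partner[OF GB[unfolded VV(4)] dd(4) m(1) _ 1] m(2) VV(4)
            show ?thesis using sx sp sy c5 1 by auto
          next
            case 2
            from matching_partner[OF GB[unfolded VV(5)] dd(5) m(1) _ 2] m(2) VV(5)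
            show ?thesis using sx sp sy c5 2 by auto
          next
            case 3
            have "\<exists>z\<in>V - {y}. z \<noteq> p \<and> \<not> single ?B p z"
              using matching_ex_partner[OF GB m] xyp by auto
            then show ?thesis using 3 px V' by auto
          qed
        qed
        have "m \<in> V - {i, j}" "n \<in> V - {i, j}" "p \<in> V - {i, j}" using mnp by auto
        \<comment> \<open>Three vertices would be assigned to the two vertices \<open>i\<close> and
          \<open>j\<close> without repetition.\<close>
        then show False using key[of m n p] key[of m p n] key[of n p m] mnp(2) by auto
      qed
    next
      case False
      then have mat: "card V = 5 \<and> is_matching (V - {j}) (contract_edge i j \<sigma> A)"
        if "i \<in> V" "j \<in> V" "i \<noteq> j" "A i j \<sigma>" for i j \<sigma>
        using IH[OF that] that by blast
      \<comment> \<open>The contraction of \<open>ij\<close> is a matching, so some doubled edge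
        \<open>bc\<close> avoids \<open>i\<close> and \<open>j\<close>. With \<open>a\<close> the
        fifth vertex, contracting \<open>ab\<close> makes \<open>ac\<close> doubled, and in the
        resulting matching the partner of \<open>ac\<close> is \<open>ij\<close>.\<close>
      have dbl: "\<not> single A i j" if ij: "i \<in> V" "j \<in> V" "i \<noteq> j" for i j
      proof -
        obtain \<sigma> where s: "A i j \<sigma>" using ne[OF ij] by blast
        let ?B = "contract_edge i j \<sigma> A"
        have GB: "G (V - {j}) ?B" using con[OF ij s] .
        have c5: "card V = 5" using mat[OF ij s] by simp
        obtain p q r t where m: "matching_at ?B p q r t" "V - {j} = {p, q, r, t}"
          using mat[OF ij s] unfolding is_matching_def by blast
        have d: "distinct [p, q, r, t]" using m(1) by (simp add: matching_at_def)
        obtain b c where bc: "b \<in> V - {i, j}" "c \<in> V - {i, j}" "b \<noteq> c" "\<not> single A b c"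
        proof (cases "i \<in> {p, q}")
          case True
          then have "\<not> single A r t" "r \<noteq> i" "t \<noteq> i"
            using m(1) d by (auto simp: matching_at_def single_def contract_edge_def)
          then show ?thesis using that[of r t] m(2) d by auto
        next
          case False
          then have "\<not> single A p q" "p \<noteq> i" "q \<noteq> i"
            using m(1) d by (auto simp: matching_at_def single_def contract_edge_def)
          then show ?thesis using that[of p q] m(2) d by auto
        qed
        have "card (V - {i, j, b, c}) = 1" using c5 fin ij bc by (subst card_Diff_subset) auto
        then obtain a where a: "V - {i, j, b, c} = {a}" by (auto simp: card_1_singleton_iff)
        then have aV: "a \<in> V" "a \<notin> {i, j, b, c}" by blast+
        then obtain s' where s': "A a b s'" using ne[of a b] bc by auto
        let ?C = "contract_edge a b s' A"
        have GC: "G (V - {b}) ?C" using con[of a b] bc aV s' by auto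
        have VC: "V - {b} = {c, a, i, j}" using a bc ij by auto
        have "\<not> single ?C c a"
          using bc(4) aV sym[of b c] bc(1-3) unfolding single_def contract_edge_def by (cases s') auto
        moreover obtain p' q' r' t' where "matching_at ?C p' q' r' t'" "V - {b} = {p', q', r', t'}"
          using mat[of a b s'] aV bc s' unfolding is_matching_def by auto
        ultimately have "\<not> single ?C i j"
          using matching_partner[OF GC[unfolded VC], of p' q' r' t'] VC aV bc ij(3) by auto
        then show ?thesis using aV by (auto simp: single_def contract_edge_def)
      qed
      \<comment> \<open>If all edges are doubled, they remain doubled in every contraction, which is
        then not a matching.\<close>
      have "V \<noteq> {}" using 3 by auto
      then obtain i where i: "i \<in> V" by blast
      have "card (V - {i}) \<ge> 1" using 3 fin i by auto
      then have "V - {i} \<noteq> {}" by (metis card.empty not_one_le_zero)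
      then obtain j where j: "j \<in> V" "j \<noteq> i" by blast
      obtain \<sigma> where s: "A i j \<sigma>" using ne[of i j] i j by auto
      let ?B = "contract_edge i j \<sigma> A"
      obtain p q r t where m: "matching_at ?B p q r t" "V - {j} = {p, q, r, t}"
        using mat[OF i j(1) _ s] j unfolding is_matching_def by blast
      have "p \<in> V" "r \<in> V" "p \<noteq> r" using m by (auto simp: matching_at_def)
      then have "\<not> single A p r" using dbl by auto
      then have "\<not> single ?B p r" unfolding single_def contract_edge_def by auto
      then show ?thesis using m(1) by (simp add: matching_at_def)
    qed
  qed
qed

end

section \<open>Binary spaces represented over the reals\<close>

definition cycle_space :: "'a set set \<Rightarrow> bool" where
  "cycle_space Z \<longleftrightarrow> finite (\<Union>Z) \<and> {} \<in> Z \<and> (\<forall>a\<in>Z. \<forall>b\<in>Z. sym_diff a b \<in> Z)"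

definition clutter :: "'a set set \<Rightarrow> bool" where
  "clutter Z \<longleftrightarrow> (\<forall>y\<in>Z. \<forall>z\<in>Z. y \<noteq> {} \<longrightarrow> y \<subseteq> z \<longrightarrow> y = z)"

text \<open>\<open>Z\<close> is meant as the binary cycle space of a matroid that the functions in
  \<open>K\<close> represent over the reals. The condition on supports concerns minimal members
  only, so that it also fits a space that contains the ground set as a union of disjoint
  circuits.\<close>

definition represents :: "('a \<Rightarrow> real) set \<Rightarrow> 'a set set \<Rightarrow> bool" where
  "represents K Z \<longleftrightarrow> (\<forall>k\<in>K. \<forall>l\<in>K. \<forall>t. (\<lambda>x. k x + t * l x) \<in> K) \<and>
     (\<forall>z\<in>Z. z \<noteq> {} \<longrightarrow> (\<forall>y\<in>Z. y \<noteq> {} \<longrightarrow> y \<subseteq> z \<longrightarrow> y = z) \<longrightarrow> (\<exists>k\<in>K. {x. k x \<noteq> 0} = z)) \<and>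
     (\<forall>k\<in>K. (\<exists>x. k x \<noteq> 0) \<longrightarrow> (\<exists>z\<in>Z. z \<noteq> {} \<and> z \<subseteq> {x. k x \<noteq> 0}))"

text \<open>Two nonempty members of such a space are never disjoint, as their union would be a
  further member containing both.\<close>

definition tight :: "'a set set \<Rightarrow> bool" where
  "tight Z \<longleftrightarrow> cycle_space Z \<and> clutter Z \<and> (\<exists>K. represents K Z)"

text \<open>Deletion of \<open>e\<close>, in terms of cycle spaces.\<close>

definition avoid :: "'a set set \<Rightarrow> 'a \<Rightarrow> 'a set set" where
  "avoid Z e = {z \<in> Z. e \<notin> z}"

lemma cycle_space_sym_diff: "cycle_space Z \<Longrightarrow> a \<in> Z \<Longrightarrow> b \<in> Z \<Longrightarrow> sym_diff a b \<in> Z"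
  by (simp add: cycle_space_def)

lemma clutterD: "clutter Z \<Longrightarrow> y \<in> Z \<Longrightarrow> z \<in> Z \<Longrightarrow> y \<noteq> {} \<Longrightarrow> y \<subseteq> z \<Longrightarrow> y = z"
  by (simp add: clutter_def)

lemma cycle_space_avoid:
  assumes "cycle_space Z" shows "cycle_space (avoid Z e)"
proof -
  have "\<Union>(avoid Z e) \<subseteq> \<Union>Z" by (auto simp: avoid_def)
  then show ?thesis using assms unfolding cycle_space_def by (auto simp: avoid_def finite_subset)
qed

lemma represents_add: "represents K Z \<Longrightarrow> k \<in> K \<Longrightarrow> l \<in> K \<Longrightarrow> (\<lambda>x. k x + t * l x) \<in> K"
  by (simp add: represents_def)

lemma represents_support:
  assumes "represents K Z" "k \<in> K" "k x \<noteq> 0"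
  obtains z where "z \<in> Z" "z \<noteq> {}" "z \<subseteq> {x. k x \<noteq> 0}"
proof -
  have "\<forall>k\<in>K. (\<exists>x. k x \<noteq> 0) \<longrightarrow> (\<exists>z\<in>Z. z \<noteq> {} \<and> z \<subseteq> {x. k x \<noteq> 0})"
    using assms(1) unfolding represents_def by (elim conjE)
  with assms(2,3) that show ?thesis by auto
qed

lemma represents_minimal:
  assumes "represents K Z" "z \<in> Z" "z \<noteq> {}" "\<And>y. y \<in> Z \<Longrightarrow> y \<noteq> {} \<Longrightarrow> y \<subseteq> z \<Longrightarrow> y = z"
  obtains k where "k \<in> K" "{x. k x \<noteq> 0} = z"
proof -
  have "\<forall>z\<in>Z. z \<noteq> {} \<longrightarrow> (\<forall>y\<in>Z. y \<noteq> {} \<longrightarrow> y \<subseteq> z \<longrightarrow> y = z) \<longrightarrow> (\<exists>k\<in>K. {x. k x \<noteq> 0} = z)"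
    using assms(1) unfolding represents_def by (elim conjE)
  then have "(\<forall>y\<in>Z. y \<noteq> {} \<longrightarrow> y \<subseteq> z \<longrightarrow> y = z) \<longrightarrow> (\<exists>k\<in>K. {x. k x \<noteq> 0} = z)"
    using assms(2,3) by simp
  moreover have "\<forall>y\<in>Z. y \<noteq> {} \<longrightarrow> y \<subseteq> z \<longrightarrow> y = z" using assms(4) by simp
  ultimately have "\<exists>k\<in>K. {x. k x \<noteq> 0} = z" by (rule mp)
  then show ?thesis using that by (elim bexE)
qed

text \<open>Subsets of a set avoiding \<open>e\<close> avoid \<open>e\<close> as well, so minimality
  is the same in \<open>avoid Z e\<close> and in \<open>Z\<close>; on the real side one passes to
  the functions that vanish at \<open>e\<close>.\<close>

lemma represents_avoid:
  assumes "represents K Z" shows "represents {k \<in> K. k e = 0} (avoid Z e)"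
  unfolding represents_def
proof (intro conjI ballI allI impI)
  fix k l t assume "k \<in> {k \<in> K. k e = 0}" "l \<in> {k \<in> K. k e = 0}"
  then show "(\<lambda>x. k x + t * l x) \<in> {k \<in> K. k e = 0}" using represents_add[OF assms] by simp
next
  fix z assume z: "z \<in> avoid Z e" "z \<noteq> {}" "\<forall>y\<in>avoid Z e. y \<noteq> {} \<longrightarrow> y \<subseteq> z \<longrightarrow> y = z"
  then have "z \<in> Z" and "e \<notin> z" by (auto simp: avoid_def)
  have "y = z" if "y \<in> Z" "y \<noteq> {}" "y \<subseteq> z" for y
    using z(3) that \<open>e \<notin> z\<close> by (auto simp: avoid_def)
  then obtain k where "k \<in> K" "{x. k x \<noteq> 0} = z"
    by (rule represents_minimal[OF assms \<open>z \<in> Z\<close> z(2)])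
  then show "\<exists>k\<in>{k \<in> K. k e = 0}. {x. k x \<noteq> 0} = z" using \<open>e \<notin> z\<close> by auto
next
  fix k assume k: "k \<in> {k \<in> K. k e = 0}" "\<exists>x. k x \<noteq> 0"
  then obtain x where x: "k x \<noteq> 0" and kK: "k \<in> K" by blast
  obtain z where "z \<in> Z" "z \<noteq> {}" "z \<subseteq> {x. k x \<noteq> 0}"
    by (rule represents_support[OF assms kK x])
  then show "\<exists>z\<in>avoid Z e. z \<noteq> {} \<and> z \<subseteq> {x. k x \<noteq> 0}"
    using k(1) by (intro bexI[of _ z]) (auto simp: avoid_def)
qed

lemma tight_avoid:
  assumes "tight Z" shows "tight (avoid Z e)"
proof -
  have "clutter (avoid Z e)" using assms by (simp add: tight_def clutter_def avoid_def)
  moreover obtain K where "represents K Z" using assms by (auto simp: tight_def)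
  from represents_avoid[OF this] have "\<exists>K. represents K (avoid Z e)" by (rule exI)
  moreover have "cycle_space (avoid Z e)" using assms cycle_space_avoid[of Z e] by (simp add: tight_def)
  ultimately show ?thesis unfolding tight_def by (intro conjI)
qed

lemma tight_cycle_space: "tight Z \<Longrightarrow> cycle_space Z"
  and tight_clutter: "tight Z \<Longrightarrow> clutter Z"
  by (simp_all add: tight_def)

text \<open>Subtracting suitable multiples of \<open>k2\<close> and \<open>m\<close> from \<open>k1\<close> removes \<open>p\<close> and a point of the symmetric
  difference from the support, hence the whole support.\<close>

lemma proportional:
  assumes K: "represents K Z" and k: "k1 \<in> K" "k2 \<in> K" "m \<in> K"
    and supp: "{x. k1 x \<noteq> 0} = C1" "{x. k2 x \<noteq> 0} = C2" "{x. m x \<noteq> 0} = sym_diff C1 C2"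
    and only: "\<And>z. z \<in> Z \<Longrightarrow> z \<noteq> {} \<Longrightarrow> z \<subseteq> C1 \<union> C2 \<Longrightarrow> z = C1 \<or> z = C2 \<or> z = sym_diff C1 C2"
    and ne: "C1 \<noteq> C2" and p: "p \<in> C1" "p \<in> C2" and q: "q \<in> C1" "q \<in> C2"
  shows "k1 p * k2 q = k1 q * k2 p"
proof -
  have p0: "k1 p \<noteq> 0" "k2 p \<noteq> 0" using p supp by auto
  define k3 where "k3 x = k1 x + - (k1 p / k2 p) * k2 x" for x
  have k3: "k3 \<in> K" unfolding k3_def[abs_def] using represents_add[OF K] k by blast
  obtain e where e: "e \<in> sym_diff C1 C2" using ne by blast
  then have me: "m e \<noteq> 0" using supp(3) by blast
  define k5 where "k5 x = k3 x + - (k3 e / m e) * m x" for x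
  have k5: "k5 \<in> K" unfolding k5_def[abs_def] using represents_add[OF K k3 k(3)] by blast
  have m0: "m x = 0" if "x \<notin> sym_diff C1 C2" for x using that supp(3) by blast
  have "k5 x = 0" for x
  proof (rule ccontr)
    assume "k5 x \<noteq> 0"
    then obtain z where z: "z \<in> Z" "z \<noteq> {}" "z \<subseteq> {x. k5 x \<noteq> 0}"
      by (rule represents_support[OF K k5])
    have "k5 y = 0" if y: "y \<notin> C1 \<union> C2" for y
    proof -
      have "k1 y = 0" "k2 y = 0" "m y = 0" using y supp by blast+
      then show ?thesis by (simp add: k5_def k3_def)
    qed
    then have "z \<subseteq> C1 \<union> C2" using z(3) by auto
    from only[OF z(1,2) this] have "p \<in> z \<or> e \<in> z" using p e by auto
    moreover have "k5 p = 0" using m0[of p] p p0 by (simp add: k5_def k3_def)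
    moreover have "k5 e = 0" using me by (simp add: k5_def)
    ultimately show False using z(3) by auto
  qed
  from this[of q] have "k3 q = 0" using m0[of q] q by (simp add: k5_def)
  then show ?thesis using p0 by (simp add: k3_def field_simps)
qed

text \<open>In a clutter every nonempty member is minimal.\<close>

lemma represents_circuit:
  assumes "represents K Z" "clutter Z" "z \<in> Z" "z \<noteq> {}"
  obtains k where "k \<in> K" "{x. k x \<noteq> 0} = z"
  by (rule represents_minimal[OF assms(1,3,4)]) (use clutterD[OF assms(2) _ assms(3)] in blast)

text \<open>Up to series classes, the seven members are the circuits of the dual of the Fano matroid, which
  is representable only in characteristic two.\<close>

lemma no_fano:
  assumes Z: "tight Z" and abc: "a \<in> Z" "b \<in> Z" "c \<in> Z"
    and all: "\<And>z. z \<in> Z \<Longrightarrow> z \<noteq> {} \<Longrightarrow> z = a \<or> z = b \<or> z = c \<or> z = sym_diff a b \<or>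
        z = sym_diff a c \<or> z = sym_diff b c \<or> z = sym_diff (sym_diff a b) c"
    and p: "p1 \<in> a - b - c" "p2 \<in> b - a - c" "p3 \<in> c - a - b"
    and q: "q12 \<in> a \<inter> b - c" "q13 \<in> a \<inter> c - b" "q23 \<in> b \<inter> c - a" and r: "r \<in> a \<inter> b \<inter> c"
  shows False
proof -
  obtain K where K: "represents K Z" using Z by (auto simp: tight_def)
  note cl = tight_clutter[OF Z] and sd = cycle_space_sym_diff[OF tight_cycle_space[OF Z]]
  have ne: "a \<noteq> {}" "b \<noteq> {}" "c \<noteq> {}" "sym_diff a b \<noteq> {}" "sym_diff a c \<noteq> {}" "sym_diff b c \<noteq> {}"
    "sym_diff (sym_diff a b) c \<noteq> {}" using p by auto
  obtain ka where ka: "ka \<in> K" "{x. ka x \<noteq> 0} = a" using represents_circuit[OF K cl abc(1) ne(1)] .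
  obtain kb where kb: "kb \<in> K" "{x. kb x \<noteq> 0} = b" using represents_circuit[OF K cl abc(2) ne(2)] .
  obtain kc where kc: "kc \<in> K" "{x. kc x \<noteq> 0} = c" using represents_circuit[OF K cl abc(3) ne(3)] .
  obtain kab where kab: "kab \<in> K" "{x. kab x \<noteq> 0} = sym_diff a b"
    using represents_circuit[OF K cl sd[OF abc(1,2)] ne(4)] .
  obtain kac where kac: "kac \<in> K" "{x. kac x \<noteq> 0} = sym_diff a c"
    using represents_circuit[OF K cl sd[OF abc(1,3)] ne(5)] .
  obtain kbc where kbc: "kbc \<in> K" "{x. kbc x \<noteq> 0} = sym_diff b c"
    using represents_circuit[OF K cl sd[OF abc(2,3)] ne(6)] .
  obtain kabc where kabc: "kabc \<in> K" "{x. kabc x \<noteq> 0} = sym_diff (sym_diff a b) c"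
    using represents_circuit[OF K cl sd[OF sd[OF abc(1,2)] abc(3)] ne(7)] .
  \<comment> \<open>The element \<open>p3\<close> lies outside \<open>a \<union> b\<close> and
    leaves three candidates for \<open>z\<close>; each of the following cases has its own test
    element.\<close>
  have o_ab: "z = a \<or> z = b \<or> z = sym_diff a b" if "z \<in> Z" "z \<noteq> {}" "z \<subseteq> a \<union> b" for z
  proof -
    have "p3 \<notin> z" using p(3) that(3) by blast
    then show ?thesis using all[OF that(1,2)] p(3) by auto
  qed
  have o_ac: "z = a \<or> z = c \<or> z = sym_diff a c" if "z \<in> Z" "z \<noteq> {}" "z \<subseteq> a \<union> c" for z
  proof -
    have "p2 \<notin> z" using p(2) that(3) by blast
    then show ?thesis using all[OF that(1,2)] p(2) by auto
  qed
  have o_bc: "z = b \<or> z = c \<or> z = sym_diff b c" if "z \<in> Z" "z \<noteq> {}" "z \<subseteq> b \<union> c" for z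
  proof -
    have "p1 \<notin> z" using p(1) that(3) by blast
    then show ?thesis using all[OF that(1,2)] p(1) by auto
  qed
  have o_abc: "z = sym_diff a b \<or> z = c \<or> z = sym_diff (sym_diff a b) c"
    if "z \<in> Z" "z \<noteq> {}" "z \<subseteq> sym_diff a b \<union> c" for z
  proof -
    have "q12 \<notin> z" using q(1) that(3) by blast
    then show ?thesis using all[OF that(1,2)] q(1) by auto
  qed
  \<comment> \<open>With this factor \<open>k3\<close> vanishes on \<open>a \<inter> b\<close>. On
    the rest of \<open>a\<close> it agrees with \<open>ka\<close>, on the rest of \<open>b\<close>
    with \<open>- t\<close> times \<open>kb\<close>; this minus sign is the source of the
    contradiction.\<close>
  define t where "t = ka r / kb r"
  define k3 where "k3 x = ka x + - t * kb x" for x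
  have k3: "k3 \<in> K" unfolding k3_def[abs_def] using represents_add[OF K ka(1) kb(1)] by blast
  have r0: "ka r \<noteq> 0" "kb r \<noteq> 0" "kc r \<noteq> 0" using ka kb kc r by auto
  have z: "ka x = 0 \<longleftrightarrow> x \<notin> a" "kb x = 0 \<longleftrightarrow> x \<notin> b" "kc x = 0 \<longleftrightarrow> x \<notin> c" for x
    using ka kb kc by auto
  have ab: "ka r * kb x = ka x * kb r" if "x \<in> a" "x \<in> b" for x
    using proportional[OF K ka(1) kb(1) kab(1) ka(2) kb(2) kab(2) o_ab, of r x] r p that by auto
  have "k3 x \<noteq> 0 \<longleftrightarrow> x \<in> sym_diff a b" for x
    using ab[of x] z(1,2)[of x] r0 by (auto simp: k3_def t_def field_simps)
  then have s3: "{x. k3 x \<noteq> 0} = sym_diff a b" by blast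
  have e1: "ka r * kc q13 = ka q13 * kc r"
    using proportional[OF K ka(1) kc(1) kac(1) ka(2) kc(2) kac(2) o_ac, of r q13] r p q by auto
  have e2: "kb r * kc q23 = kb q23 * kc r"
    using proportional[OF K kb(1) kc(1) kbc(1) kb(2) kc(2) kbc(2) o_bc, of r q23] r p q by auto
  have e3: "k3 q13 * kc q23 = k3 q23 * kc q13"
    using proportional[OF K k3 kc(1) kabc(1) s3 kc(2) kabc(2) o_abc, of q13 q23] r p q by auto
  have "k3 q13 = ka q13" "k3 q23 = - t * kb q23" using z[of q13] z[of q23] q by (auto simp: k3_def)
  then have "ka q13 * kc q23 * kc r = - t * kb q23 * kc q13 * kc r" using e3 by simp
  then have "(ka q13 * kc r) * kc q23 = - t * (kb q23 * kc r) * kc q13" by (simp add: mult_ac)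
  \<comment> \<open>Once all ratios are normalized at \<open>r\<close>, the relation
    \<open>e3\<close> equates a nonzero number with its negative.\<close>
  then have "ka r * kc q13 * kc q23 = - ka r * kc q23 * kc q13"
    unfolding e1[symmetric] e2[symmetric] using r0 by (simp add: t_def)
  moreover have "kc q13 \<noteq> 0" "kc q23 \<noteq> 0" using z q by auto
  ultimately show False using r0 by (simp add: mult_ac)
qed

section \<open>Cuts of complete graphs and the signs induced by a circuit\<close>

definition crosses :: "'v set \<Rightarrow> 'v set \<Rightarrow> bool" where
  "crosses I d \<longleftrightarrow> (\<exists>u v. d = {u, v} \<and> u \<in> I \<and> v \<notin> I)"

lemma crosses_pair [simp]: "crosses I {u, v} \<longleftrightarrow> (u \<in> I) \<noteq> (v \<in> I)"
  unfolding crosses_def by (auto simp: doubleton_eq_iff)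

definition edges :: "'v set \<Rightarrow> 'v set set" where
  "edges V = {{u, v} |u v. u \<in> V \<and> v \<in> V \<and> u \<noteq> v}"

text \<open>The cycle space of the dual of the cycle matroid of a complete graph. A set
  \<open>I\<close> and its complement in \<open>V\<close> give the same cut.\<close>

definition cuts :: "'v set \<Rightarrow> 'v set set set" where
  "cuts V = (\<lambda>I. {d \<in> edges V. crosses I d}) ` Pow V"

text \<open>\<open>Z\<close> arises from \<open>Z0\<close> by replacing every element by its fibre.
  Elements of one fibre lie in the same members, so fibres consist of elements in series.\<close>

definition pulled :: "'a set set \<Rightarrow> ('a \<Rightarrow> 'b) \<Rightarrow> 'b set \<Rightarrow> 'b set set \<Rightarrow> bool" where
  "pulled Z \<pi> F Z0 \<longleftrightarrow> \<pi> ` \<Union>Z = F \<and> Z = (\<lambda>D. {x \<in> \<Union>Z. \<pi> x \<in> D}) ` Z0"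

definition cut_at :: "'a set set \<Rightarrow> ('a \<Rightarrow> 'v set) \<Rightarrow> 'v set \<Rightarrow> 'a set" where
  "cut_at Z \<pi> I = {x \<in> \<Union>Z. crosses I (\<pi> x)}"

lemma pulled_cuts_iff:
  "pulled Z \<pi> (edges V) (cuts V) \<longleftrightarrow> \<pi> ` \<Union>Z = edges V \<and> Z = cut_at Z \<pi> ` Pow V"
proof -
  have "(\<lambda>D. {x \<in> \<Union>Z. \<pi> x \<in> D}) ` cuts V = cut_at Z \<pi> ` Pow V" if "\<pi> ` \<Union>Z = edges V"
    using that unfolding cuts_def cut_at_def image_image
    by (intro image_cong refl) blast
  then show ?thesis unfolding pulled_def by metis
qed

text \<open>Every member through \<open>e\<close> is the sum of \<open>X\<close> and a member
  avoiding \<open>e\<close>, so these data describe all of \<open>Z\<close>.\<close>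

definition signed :: "'a set set \<Rightarrow> 'a \<Rightarrow> 'a set \<Rightarrow> 'v set \<Rightarrow> ('a \<Rightarrow> 'v set) \<Rightarrow> bool" where
  "signed Z e X V \<pi> \<longleftrightarrow> finite V \<and> X \<in> Z \<and> e \<in> X \<and> pulled (avoid Z e) \<pi> (edges V) (cuts V)"

text \<open>The elements over one edge lie in the same members avoiding \<open>e\<close>, but
  \<open>X\<close> may split them; then the edge is doubled.\<close>

definition signs :: "'a set set \<Rightarrow> 'a \<Rightarrow> 'a set \<Rightarrow> ('a \<Rightarrow> 'v set) \<Rightarrow> 'v \<Rightarrow> 'v \<Rightarrow> bool \<Rightarrow> bool" where
  "signs Z e X \<pi> u v \<tau> \<longleftrightarrow> (\<exists>x\<in>\<Union>(avoid Z e). \<pi> x = {u, v} \<and> (x \<in> X) = \<tau>)"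

lemma signedD:
  assumes "signed Z e X V \<pi>"
  shows "finite V" "X \<in> Z" "e \<in> X" "\<pi> ` \<Union>(avoid Z e) = edges V"
    "avoid Z e = cut_at (avoid Z e) \<pi> ` Pow V"
  using assms unfolding signed_def pulled_cuts_iff by blast+

lemma signed_edge:
  assumes "signed Z e X V \<pi>" "x \<in> \<Union>(avoid Z e)"
  obtains u v where "\<pi> x = {u, v}" "u \<in> V" "v \<in> V" "u \<noteq> v"
proof -
  have "\<pi> x \<in> edges V" using signedD(4)[OF assms(1)] assms(2) by blast
  then show ?thesis using that unfolding edges_def by blast
qed

lemma signed_edge_ex:
  assumes "signed Z e X V \<pi>" "u \<in> V" "v \<in> V" "u \<noteq> v"
  obtains x where "x \<in> \<Union>(avoid Z e)" "\<pi> x = {u, v}"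
proof -
  have "{u, v} \<in> \<pi> ` \<Union>(avoid Z e)" using signedD(4)[OF assms(1)] assms(2-) unfolding edges_def by blast
  then show ?thesis using that by (metis imageE)
qed

lemma cut_at_mem:
  assumes "signed Z e X V \<pi>" "I \<subseteq> V"
  shows "cut_at (avoid Z e) \<pi> I \<in> Z" "e \<notin> cut_at (avoid Z e) \<pi> I"
proof -
  have "cut_at (avoid Z e) \<pi> I \<in> avoid Z e" using signedD(5)[OF assms(1)] assms(2) by blast
  then show "cut_at (avoid Z e) \<pi> I \<in> Z" "e \<notin> cut_at (avoid Z e) \<pi> I" by (simp_all add: avoid_def)
qed

text \<open>The circuit through \<open>e\<close> is determined only up to adding cuts; on the signs
  this is the switching operation.\<close>

lemma signed_switch:
  assumes Z: "cycle_space Z" and s: "signed Z e X V \<pi>" and I: "I \<subseteq> V"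
  shows "signed Z e (sym_diff X (cut_at (avoid Z e) \<pi> I)) V \<pi>"
  using s cut_at_mem[OF s I] cycle_space_sym_diff[OF Z] unfolding signed_def by blast

lemma signs_sym: "signs Z e X \<pi> u v \<tau> = signs Z e X \<pi> v u \<tau>"
  unfolding signs_def by (simp add: insert_commute)

lemma signs_switch:
  assumes "u \<noteq> v"
  shows "signs Z e (sym_diff X (cut_at (avoid Z e) \<pi> I)) \<pi> u v \<tau> =
    signs Z e X \<pi> u v (\<tau> \<noteq> ((u \<in> I) \<noteq> (v \<in> I)))"
proof -
  have "(x \<in> sym_diff X (cut_at (avoid Z e) \<pi> I)) = \<tau> \<longleftrightarrow> (x \<in> X) = (\<tau> \<noteq> ((u \<in> I) \<noteq> (v \<in> I)))"
    if "x \<in> \<Union>(avoid Z e)" "\<pi> x = {u, v}" for x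
  proof -
    have "x \<in> cut_at (avoid Z e) \<pi> I \<longleftrightarrow> (u \<in> I) \<noteq> (v \<in> I)"
      using that unfolding cut_at_def by simp
    then show ?thesis by blast
  qed
  then show ?thesis unfolding signs_def by blast
qed

lemma signs_ne:
  assumes "signed Z e X V \<pi>" "u \<in> V" "v \<in> V" "u \<noteq> v"
  shows "signs Z e X \<pi> u v True \<or> signs Z e X \<pi> u v False"
  using signed_edge_ex[OF assms] unfolding signs_def by metis

text \<open>Deleting \<open>f\<close> keeps the cuts with \<open>i\<close> and \<open>j\<close> on
  the same side, and these are the cuts of the complete graph in which \<open>j\<close> is merged
  into \<open>i\<close>. The new circuit has to avoid \<open>f\<close>, so if \<open>f\<close> lies
  in \<open>X\<close> the cut of \<open>j\<close> is added.\<close>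

lemma signed_contract:
  assumes Z: "cycle_space Z" and s: "signed Z e X V \<pi>" and ij: "i \<in> V" "j \<in> V" "i \<noteq> j"
    and f: "f \<in> \<Union>(avoid Z e)" "\<pi> f = {i, j}" "(f \<in> X) = \<sigma>"
  shows "\<exists>X' \<pi>'. signed (avoid Z f) e X' (V - {j}) \<pi>' \<and>
    (\<forall>u\<in>V - {j}. \<forall>v\<in>V - {j}. u \<noteq> v \<longrightarrow> (\<forall>\<tau>.
       signs (avoid Z f) e X' \<pi>' u v \<tau> = contract_edge i j \<sigma> (signs Z e X \<pi>) u v \<tau>))"
proof -
  let ?E = "\<Union>(avoid Z e)"
  define cut where "cut I = cut_at (avoid Z e) \<pi> I" for I
  define X' where "X' = (if \<sigma> then sym_diff X (cut {j}) else X)"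
  define g where "g v = (if v = j then i else v)" for v
  define \<pi>' where "\<pi>' x = g ` \<pi> x" for x
  let ?Y = "avoid (avoid Z f) e"
  have Y: "?Y = {z \<in> avoid Z e. f \<notin> z}" by (auto simp: avoid_def)
  have f_cut: "f \<in> cut I \<longleftrightarrow> (i \<in> I) \<noteq> (j \<in> I)" for I using f by (simp add: cut_def cut_at_def)
  have Yc: "?Y = {cut I |I. I \<subseteq> V \<and> ((i \<in> I) = (j \<in> I))}"
    unfolding Y using signedD(5)[OF s] f_cut by (auto simp: cut_def[symmetric])
  have edge: "\<exists>u v. \<pi> x = {u, v} \<and> u \<in> V \<and> v \<in> V \<and> u \<noteq> v" if "x \<in> ?E" for x
    using signed_edge[OF s that] by metis
  \<comment> \<open>All elements over the edge \<open>ij\<close> are in series with \<open>f\<close>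
    among the members avoiding \<open>e\<close> and disappear with it. Any other edge has an end
    \<open>w\<close> outside \<open>{i, j}\<close> and lies in the cut of \<open>w\<close>.\<close>
  have EY: "\<Union>?Y = {x \<in> ?E. \<pi> x \<noteq> {i, j}}"
  proof (intro equalityI subsetI)
    fix x assume "x \<in> \<Union>?Y"
    then obtain I where "x \<in> cut I" "(i \<in> I) = (j \<in> I)" unfolding Yc by auto
    then show "x \<in> {x \<in> ?E. \<pi> x \<noteq> {i, j}}" by (auto simp: cut_def cut_at_def)
  next
    fix x assume x: "x \<in> {x \<in> ?E. \<pi> x \<noteq> {i, j}}"
    obtain u v where uv: "\<pi> x = {u, v}" "u \<in> V" "v \<in> V" "u \<noteq> v" using edge[of x] x by auto
    have "\<exists>w. w \<in> {u, v} \<and> w \<notin> {i, j}" using uv x by auto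
    then obtain w where w: "w \<in> {u, v}" "w \<notin> {i, j}" by blast
    have "x \<in> cut {w}" using x w(1) uv by (auto simp: cut_def cut_at_def)
    moreover have "cut {w} \<in> ?Y" unfolding Yc using w uv by auto
    ultimately show "x \<in> \<Union>?Y" by blast
  qed
  have cr: "crosses I (\<pi> x) \<longleftrightarrow> crosses (I - {j}) (\<pi>' x)"
    if x: "x \<in> ?E" and I: "(i \<in> I) = (j \<in> I)" for x I
  proof -
    obtain u v where uv: "\<pi> x = {u, v}" "u \<noteq> v" using edge[of x] x by auto
    have "\<pi>' x = {g u, g v}" using uv(1) by (simp add: \<pi>'_def)
    then show ?thesis using I ij(3) unfolding uv(1) by (auto simp: g_def)
  qed
  have "\<pi>' ` \<Union>?Y = edges (V - {j})"
  proof (intro equalityI subsetI)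
    fix d assume "d \<in> \<pi>' ` \<Union>?Y"
    then obtain x where x: "x \<in> ?E" "\<pi> x \<noteq> {i, j}" "d = \<pi>' x" unfolding EY by auto
    obtain u v where uv: "\<pi> x = {u, v}" "u \<in> V" "v \<in> V" "u \<noteq> v" using edge[of x] x by auto
    have "g u \<noteq> g v" using uv x(2) unfolding g_def by (auto split: if_splits)
    moreover have "g u \<in> V - {j}" "g v \<in> V - {j}" using uv ij by (auto simp: g_def)
    moreover have "d = {g u, g v}" using x(3) uv(1) by (simp add: \<pi>'_def)
    ultimately show "d \<in> edges (V - {j})" unfolding edges_def by blast
  next
    fix d assume "d \<in> edges (V - {j})"
    then obtain u v where uv: "d = {u, v}" "u \<in> V - {j}" "v \<in> V - {j}" "u \<noteq> v"
      unfolding edges_def by auto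
    then obtain x where x: "x \<in> ?E" "\<pi> x = {u, v}" using signed_edge_ex[OF s, of u v] by auto
    then have "x \<in> \<Union>?Y" unfolding EY using uv by (auto simp: doubleton_eq_iff)
    moreover have "\<pi>' x = d" using x uv by (simp add: \<pi>'_def g_def)
    ultimately show "d \<in> \<pi>' ` \<Union>?Y" by blast
  qed
  moreover have "?Y = cut_at ?Y \<pi>' ` Pow (V - {j})"
  proof -
    have c: "cut I = cut_at ?Y \<pi>' (I - {j})" if I: "(i \<in> I) = (j \<in> I)" for I
    proof -
      have "x \<in> cut I \<longleftrightarrow> x \<in> cut_at ?Y \<pi>' (I - {j})" for x
        using cr[of x I] I unfolding cut_def cut_at_def EY by auto
      then show ?thesis by blast
    qed
    have "cut_at ?Y \<pi>' I \<in> ?Y" if "I \<subseteq> V - {j}" for I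
    proof -
      \<comment> \<open>A cut of the contracted graph is lifted by putting \<open>j\<close> on the
        side of \<open>i\<close>.\<close>
      let ?J = "I \<union> (if i \<in> I then {j} else {})"
      have "(i \<in> ?J) = (j \<in> ?J)" "?J \<subseteq> V" "?J - {j} = I" using that ij by auto
      moreover from this c[of ?J] have "cut ?J = cut_at ?Y \<pi>' I" by simp
      ultimately have "cut_at ?Y \<pi>' I = cut ?J \<and> ?J \<subseteq> V \<and> (i \<in> ?J) = (j \<in> ?J)" by (simp only:)
      then have "cut_at ?Y \<pi>' I \<in> {cut I |I. I \<subseteq> V \<and> ((i \<in> I) = (j \<in> I))}"
        unfolding mem_Collect_eq by (rule exI[of _ ?J])
      then show ?thesis by (simp only: Yc[symmetric])
    qed
    moreover have "z \<in> cut_at ?Y \<pi>' ` Pow (V - {j})" if "z \<in> ?Y" for z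
      using that c unfolding Yc by blast
    ultimately show ?thesis by blast
  qed
  moreover have "X' \<in> avoid Z f"
    using signedD(2)[OF s] cut_at_mem[OF s, of "{j}"] cycle_space_sym_diff[OF Z, of X "cut {j}"] f f_cut[of "{j}"] ij
    by (auto simp: X'_def avoid_def cut_def)
  moreover have "e \<in> X'" using signedD(3)[OF s] cut_at_mem[OF s, of "{j}"] ij by (auto simp: X'_def cut_def)
  ultimately have sgn: "signed (avoid Z f) e X' (V - {j}) \<pi>'"
    unfolding signed_def pulled_cuts_iff using signedD(1)[OF s] by blast
  \<comment> \<open>Adding the cut of \<open>j\<close> changes membership exactly at the edges
    through \<open>j\<close>; this is the sign change prescribed by
    \<open>contract_edge\<close>.\<close>
  have xX': "x \<in> X' \<longleftrightarrow> (x \<in> X) \<noteq> (\<sigma> \<and> j \<in> \<pi> x)" if xE: "x \<in> ?E" for x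
  proof -
    obtain u v where "\<pi> x = {u, v}" "u \<noteq> v" using edge[OF xE] by auto
    then have "x \<in> cut {j} \<longleftrightarrow> j \<in> \<pi> x" using xE by (auto simp: cut_def cut_at_def)
    then show ?thesis by (auto simp: X'_def)
  qed
  have pe: "\<pi>' x = {u, v} \<longleftrightarrow> \<pi> x = {u, v} \<or> (u = i \<and> \<pi> x = {j, v}) \<or> (v = i \<and> \<pi> x = {u, j})"
    if x: "x \<in> ?E" "\<pi> x \<noteq> {i, j}" and uv: "u \<in> V - {j}" "v \<in> V - {j}" "u \<noteq> v" for x u v
  proof -
    obtain a b where ab: "\<pi> x = {a, b}" "a \<noteq> b" using edge[OF x(1)] by auto
    have "\<pi>' x = {g a, g b}" using ab(1) by (simp add: \<pi>'_def)
    have x2: "\<not> (a = i \<and> b = j)" "\<not> (a = j \<and> b = i)" using x(2) ab(1) by auto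
    have uv': "u \<noteq> j" "v \<noteq> j" "u \<noteq> v" using uv by auto
    show ?thesis
    proof (cases "a = j")
      case True
      then have "g a = i" "g b = b" "b \<noteq> i" using ab(2) x2 by (auto simp: g_def)
      with True \<open>\<pi>' x = {g a, g b}\<close> show ?thesis using uv' ij(3) unfolding ab(1)
        by (auto simp: doubleton_eq_iff)
    next
      case a: False
      show ?thesis
      proof (cases "b = j")
        case True
        then have "g b = i" "g a = a" "a \<noteq> i" using ab(2) x2 by (auto simp: g_def)
        with True \<open>\<pi>' x = {g a, g b}\<close> show ?thesis using uv' ij(3) unfolding ab(1)
          by (auto simp: doubleton_eq_iff)
      next
        case False
        then have "\<pi>' x = {a, b}" using a \<open>\<pi>' x = {g a, g b}\<close> by (simp add: g_def)
        with a False show ?thesis using uv' unfolding ab(1) by (auto simp: doubleton_eq_iff)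
      qed
    qed
  qed
  have "signs (avoid Z f) e X' \<pi>' u v \<tau> = contract_edge i j \<sigma> (signs Z e X \<pi>) u v \<tau>"
    if uv: "u \<in> V - {j}" "v \<in> V - {j}" "u \<noteq> v" for u v \<tau>
  proof -
    have L: "signs (avoid Z f) e X' \<pi>' u v \<tau> \<longleftrightarrow> (\<exists>x\<in>?E. (\<pi> x = {u, v} \<and> (x \<in> X) = \<tau>) \<or>
       (u = i \<and> \<pi> x = {j, v} \<and> (x \<in> X) = (\<tau> \<noteq> \<sigma>)) \<or> (v = i \<and> \<pi> x = {u, j} \<and> (x \<in> X) = (\<tau> \<noteq> \<sigma>)))"
    proof -
      have "x \<in> ?E \<and> \<pi> x \<noteq> {i, j} \<and> \<pi>' x = {u, v} \<and> (x \<in> X') = \<tau> \<longleftrightarrow>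
         x \<in> ?E \<and> ((\<pi> x = {u, v} \<and> (x \<in> X) = \<tau>) \<or>
       (u = i \<and> \<pi> x = {j, v} \<and> (x \<in> X) = (\<tau> \<noteq> \<sigma>)) \<or> (v = i \<and> \<pi> x = {u, j} \<and> (x \<in> X) = (\<tau> \<noteq> \<sigma>)))" for x
      proof (cases "x \<in> ?E \<and> \<pi> x \<noteq> {i, j}")
        case True
        have j: "\<pi> x = {u, v} \<Longrightarrow> j \<notin> \<pi> x" "\<pi> x = {j, v} \<Longrightarrow> j \<in> \<pi> x" "\<pi> x = {u, j} \<Longrightarrow> j \<in> \<pi> x"
          using uv by auto
        have "\<pi>' x = {u, v} \<longleftrightarrow> \<pi> x = {u, v} \<or> (u = i \<and> \<pi> x = {j, v}) \<or> (v = i \<and> \<pi> x = {u, j})"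
          using pe[of x u v] True uv by simp
        moreover have "x \<in> X' \<longleftrightarrow> (x \<in> X) \<noteq> (\<sigma> \<and> j \<in> \<pi> x)" using xX' True by simp
        ultimately show ?thesis using True j by (cases \<sigma>; cases \<tau>; simp only: simp_thms; metis)
      next
        case False
        show ?thesis
        proof (cases "x \<in> ?E")
          case True
          with False have p: "\<pi> x = {i, j}" by blast
          have "{i, j} \<noteq> {u, v}" "{i, j} = {j, v} \<Longrightarrow> v = i" "{i, j} = {u, j} \<Longrightarrow> u = i"
            using uv ij(3) by (auto simp: doubleton_eq_iff)
          then show ?thesis unfolding p using uv(3) by metis
        qed (simp only: simp_thms)
      qed
      note eq = this
      show ?thesis by (simp only: signs_def EY Bex_def mem_Collect_eq conj_assoc eq)
    qed
    show ?thesis unfolding L contract_edge_def using uv signs_def by (auto simp: signs_def insert_commute)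
  qed
  with sgn show ?thesis by blast
qed

lemma cut_at_sym_diff:
  assumes "\<And>x. x \<in> \<Union>W \<Longrightarrow> \<exists>u v. \<pi> x = {u, v}"
  shows "sym_diff (cut_at W \<pi> I) (cut_at W \<pi> J) = cut_at W \<pi> (sym_diff I J)"
proof -
  have "x \<in> sym_diff (cut_at W \<pi> I) (cut_at W \<pi> J) \<longleftrightarrow> x \<in> cut_at W \<pi> (sym_diff I J)" for x
  proof (cases "x \<in> \<Union>W")
    case True
    then obtain u v where "\<pi> x = {u, v}" using assms by blast
    then show ?thesis by (simp add: cut_at_def) blast
  qed (simp add: cut_at_def)
  then show ?thesis by blast
qed

lemma signed_cutE:
  assumes "signed Z e X V \<pi>" "z \<in> avoid Z e"
  obtains I where "I \<subseteq> V" "z = cut_at (avoid Z e) \<pi> I"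
proof -
  have "z \<in> cut_at (avoid Z e) \<pi> ` Pow V"
    using equalityD1[OF signedD(5)[OF assms(1)], THEN subsetD, OF assms(2)] .
  then show ?thesis using that by blast
qed

text \<open>If all edges at \<open>u\<close> were single, switching their other ends would give a
  circuit without any edge at \<open>u\<close>. Adding the cut of \<open>u\<close> to it would then
  produce a strictly larger member.\<close>

lemma no_single_star:
  assumes Z: "tight Z" and s: "signed Z e X V \<pi>" and u: "u \<in> V" "v0 \<in> V" "u \<noteq> v0"
  shows "\<exists>v\<in>V - {u}. \<not> single (signs Z e X \<pi>) u v"
proof (rule ccontr)
  assume n: "\<not> (\<exists>v\<in>V - {u}. \<not> single (signs Z e X \<pi>) u v)"
  define I where "I = {v \<in> V - {u}. signs Z e X \<pi> u v True}"
  let ?c = "cut_at (avoid Z e) \<pi>"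
  define Y where "Y = sym_diff X (?c I)"
  have cy: "cycle_space Z" and cl: "clutter Z" using Z by (auto simp: tight_def)
  have I: "I \<subseteq> V" by (auto simp: I_def)
  have Y: "Y \<in> Z" "e \<in> Y" using signedD(2,3)[OF signed_switch[OF cy s I]] by (auto simp: Y_def)
  have uV: "{u} \<subseteq> V" using u by simp
  have dis: "x \<notin> Y" if x: "x \<in> ?c {u}" for x
  proof -
    have xE: "x \<in> \<Union>(avoid Z e)" using x by (simp add: cut_at_def)
    obtain a b where ab: "\<pi> x = {a, b}" "a \<in> V" "b \<in> V" "a \<noteq> b" using signed_edge[OF s xE] by blast
    then have "u \<in> {a, b}" using x by (auto simp: cut_at_def)
    then obtain v where v: "\<pi> x = {u, v}" "v \<in> V" "v \<noteq> u" using ab by auto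
    have "single (signs Z e X \<pi>) u v" using n v by blast
    moreover have "signs Z e X \<pi> u v (x \<in> X)" using xE v by (auto simp: signs_def)
    ultimately have "x \<in> X \<longleftrightarrow> signs Z e X \<pi> u v True" unfolding single_def by (cases "x \<in> X") auto
    then have "x \<in> X \<longleftrightarrow> v \<in> I" using v by (simp add: I_def)
    moreover have "x \<in> ?c I \<longleftrightarrow> v \<in> I" using xE v by (auto simp: cut_at_def I_def)
    ultimately show ?thesis by (simp add: Y_def)
  qed
  have "sym_diff Y (?c {u}) \<in> Z" using cycle_space_sym_diff[OF cy Y(1)] cut_at_mem(1)[OF s uV] by blast
  moreover have "Y \<subseteq> sym_diff Y (?c {u})" using dis by blast
  ultimately have "Y = sym_diff Y (?c {u})" using clutterD[OF cl Y(1)] Y(2) by blast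
  moreover obtain x where "x \<in> \<Union>(avoid Z e)" "\<pi> x = {u, v0}" using signed_edge_ex[OF s u] by blast
  then have "x \<in> ?c {u}" using u by (simp add: cut_at_def)
  ultimately show False using dis by blast
qed

text \<open>Otherwise switching puts all edges into the circuit, which then properly contains the
  cut of \<open>u\<close>.\<close>

lemma no_antibalanced:
  assumes Z: "tight Z" and s: "signed Z e X V \<pi>" and uv: "u \<in> V" "v \<in> V" "u \<noteq> v"
  shows "\<not> antibalanced V (signs Z e X \<pi>)"
proof
  assume "antibalanced V (signs Z e X \<pi>)"
  then obtain \<chi> :: "'b \<Rightarrow> bool" where "\<forall>u\<in>V. \<forall>v\<in>V. u \<noteq> v \<longrightarrow> (\<forall>\<tau>. signs Z e X \<pi> u v \<tau> \<longleftrightarrow> \<tau> = (\<chi> u = \<chi> v))"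
    unfolding antibalanced_def by (elim exE) (rule that)
  note chi = this[rule_format]
  let ?c = "cut_at (avoid Z e) \<pi>"
  define Y where "Y = sym_diff X (?c {v \<in> V. \<chi> v})"
  have cy: "cycle_space Z" and cl: "clutter Z" using Z by (auto simp: tight_def)
  have Y: "Y \<in> Z" "e \<in> Y" using signedD(2,3)[OF signed_switch[OF cy s, of "{v \<in> V. \<chi> v}"]] by (auto simp: Y_def)
  have all: "x \<in> Y" if xE: "x \<in> \<Union>(avoid Z e)" for x
  proof -
    obtain a b where ab: "\<pi> x = {a, b}" "a \<in> V" "b \<in> V" "a \<noteq> b" using signed_edge[OF s xE] by blast
    have "signs Z e X \<pi> a b (x \<in> X)" using xE ab by (auto simp: signs_def)
    then have "(x \<in> X) = (\<chi> a = \<chi> b)" using chi[OF ab(2-4), of "x \<in> X"] by simp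
    moreover have "x \<in> ?c {v \<in> V. \<chi> v} \<longleftrightarrow> \<chi> a \<noteq> \<chi> b" using xE ab by (simp add: cut_at_def)
    ultimately show ?thesis by (auto simp: Y_def)
  qed
  have uV: "{u} \<subseteq> V" using uv by simp
  obtain x where x: "x \<in> \<Union>(avoid Z e)" "\<pi> x = {u, v}" using signed_edge_ex[OF s uv] by blast
  then have "x \<in> ?c {u}" using uv by (simp add: cut_at_def)
  moreover have "?c {u} \<subseteq> Y" using all by (auto simp: cut_at_def)
  ultimately have "?c {u} = Y" by (intro clutterD[OF cl cut_at_mem(1)[OF s uV] Y(1)]) auto
  then show False using cut_at_mem(2)[OF s uV] Y(2) by simp
qed

text \<open>The cuts of \<open>u\<close> and \<open>v\<close> generate the space together with
  \<open>X\<close>. If all three edges are doubled, six elements over them and \<open>e\<close>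
  realize the seven intersection patterns required by \<open>no_fano\<close>.\<close>

lemma not_all_double:
  assumes Z: "tight Z" and s: "signed Z e X {u, v, w} \<pi>" and d: "distinct [u, v, w]"
  shows "single (signs Z e X \<pi>) u v \<or> single (signs Z e X \<pi>) u w \<or> single (signs Z e X \<pi>) v w"
proof (rule ccontr)
  assume n: "\<not> ?thesis"
  let ?c = "cut_at (avoid Z e) \<pi>"
  have cy: "cycle_space Z" using Z by (auto simp: tight_def)
  have u: "{u} \<subseteq> {u, v, w}" and v: "{v} \<subseteq> {u, v, w}" by auto
  have edge: "\<exists>a b. \<pi> x = {a, b}" if "x \<in> \<Union>(avoid Z e)" for x using signed_edge[OF s that] by metis
  have av: "z = {} \<or> z = ?c {u} \<or> z = ?c {v} \<or> z = sym_diff (?c {u}) (?c {v})" if zav: "z \<in> avoid Z e" for z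
  proof -
    obtain I where I: "I \<subseteq> {u, v, w}" "z = ?c I" by (rule signed_cutE[OF s zav])
    \<comment> \<open>Every cut can be written with the side that avoids \<open>w\<close>, so there
      are four of them.\<close>
    have co: "?c J = ?c ({u, v, w} - J)" if "J \<subseteq> {u, v, w}" for J
    proof -
      have "crosses J (\<pi> x) \<longleftrightarrow> crosses ({u, v, w} - J) (\<pi> x)" if "x \<in> \<Union>(avoid Z e)" for x
      proof -
        obtain a b where ab: "\<pi> x = {a, b}" "a \<in> {u, v, w}" "b \<in> {u, v, w}" "a \<noteq> b"
          using signed_edge[OF s \<open>x \<in> \<Union>(avoid Z e)\<close>] by blast
        then show ?thesis unfolding ab(1) crosses_pair by blast
      qed
      then show ?thesis unfolding cut_at_def by blast
    qed
    obtain J where J: "J \<subseteq> {u, v}" "z = ?c J"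
    proof (cases "w \<in> I")
      case True
      have "{u, v, w} - I \<subseteq> {u, v}" using True by blast
      moreover have "z = ?c ({u, v, w} - I)" using I co[OF I(1)] by simp
      ultimately show ?thesis by (rule that)
    next
      case False
      then have "I \<subseteq> {u, v}" using I(1) by blast
      then show ?thesis using I(2) by (rule that)
    qed
    have "J = {} \<or> J = {u} \<or> J = {v} \<or> J = {u, v}" using J(1) by blast
    moreover have "?c {} = {}" by (auto simp: cut_at_def crosses_def)
    moreover have "?c {u, v} = sym_diff (?c {u}) (?c {v})"
    proof -
      have "sym_diff {u} {v} = {u, v}" using d by auto
      then show ?thesis using cut_at_sym_diff[of "avoid Z e" \<pi> "{u}" "{v}"] edge by simp
    qed
    ultimately show ?thesis using J(2) by auto
  qed
  note X = signedD(2,3)[OF s]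
  have all: "z = ?c {u} \<or> z = ?c {v} \<or> z = X \<or> z = sym_diff (?c {u}) (?c {v}) \<or> z = sym_diff (?c {u}) X \<or>
      z = sym_diff (?c {v}) X \<or> z = sym_diff (sym_diff (?c {u}) (?c {v})) X" if z: "z \<in> Z" "z \<noteq> {}" for z
  proof (cases "e \<in> z")
    case False
    then have "z \<in> avoid Z e" using z(1) by (simp add: avoid_def)
    from av[OF this] z(2) show ?thesis by argo
  next
    case True
    then have "sym_diff z X \<in> avoid Z e" using cycle_space_sym_diff[OF cy z(1) X(1)] X(2) by (simp add: avoid_def)
    from av[OF this] have "sym_diff z X = {} \<or> sym_diff z X = ?c {u} \<or> sym_diff z X = ?c {v} \<or> sym_diff z X = sym_diff (?c {u}) (?c {v})" .
    moreover have inv: "sym_diff z X = t \<Longrightarrow> z = sym_diff t X" for t by blast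
    moreover have "sym_diff z X = {} \<Longrightarrow> z = X" by blast
    ultimately show ?thesis using inv[of "?c {u}"] inv[of "?c {v}"] inv[of "sym_diff (?c {u}) (?c {v})"] by argo
  qed
  have ex: "\<exists>x\<in>\<Union>(avoid Z e). \<pi> x = {a, b} \<and> (x \<in> X) = \<tau>" if "\<not> single (signs Z e X \<pi>) a b" for a b \<tau>
    using that unfolding single_def signs_def by (cases \<tau>) auto
  have n': "\<not> single (signs Z e X \<pi>) u v" "\<not> single (signs Z e X \<pi>) u w" "\<not> single (signs Z e X \<pi>) v w"
    using n by auto
  \<comment> \<open>The elements \<open>p1\<close>, \<open>p2\<close>, \<open>q12\<close> avoid
    \<open>X\<close>, while \<open>q13\<close>, \<open>q23\<close>, \<open>r\<close> lie in
    \<open>X\<close>; the remaining pattern, in \<open>X\<close> but in neither cut, is realized by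
    \<open>e\<close>.\<close>
  obtain p1 where p1: "p1 \<in> \<Union>(avoid Z e)" "\<pi> p1 = {u, w}" "(p1 \<in> X) = False" using ex[OF n'(2), of False] by (elim bexE conjE) (rule that)
  obtain p2 where p2: "p2 \<in> \<Union>(avoid Z e)" "\<pi> p2 = {v, w}" "(p2 \<in> X) = False" using ex[OF n'(3), of False] by (elim bexE conjE) (rule that)
  obtain q12 where q12: "q12 \<in> \<Union>(avoid Z e)" "\<pi> q12 = {u, v}" "(q12 \<in> X) = False" using ex[OF n'(1), of False] by (elim bexE conjE) (rule that)
  obtain q13 where q13: "q13 \<in> \<Union>(avoid Z e)" "\<pi> q13 = {u, w}" "(q13 \<in> X) = True" using ex[OF n'(2), of True] by (elim bexE conjE) (rule that)
  obtain q23 where q23: "q23 \<in> \<Union>(avoid Z e)" "\<pi> q23 = {v, w}" "(q23 \<in> X) = True" using ex[OF n'(3), of True] by (elim bexE conjE) (rule that)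
  obtain r where r: "r \<in> \<Union>(avoid Z e)" "\<pi> r = {u, v}" "(r \<in> X) = True" using ex[OF n'(1), of True] by (elim bexE conjE) (rule that)
  have mem: "x \<in> ?c {a} \<longleftrightarrow> x \<in> \<Union>(avoid Z e) \<and> (p = a) \<noteq> (q = a)" if "\<pi> x = {p, q}" for x a p q
    using that by (simp add: cut_at_def)
  have dd: "u \<noteq> v" "u \<noteq> w" "v \<noteq> w" "v \<noteq> u" "w \<noteq> u" "w \<noteq> v" using d by auto
  show False
    by (rule no_fano[OF Z cut_at_mem(1)[OF s u] cut_at_mem(1)[OF s v] X(1) all, of p1 p2 e q12 q13 q23 r])
      (use p1 p2 q12 q13 q23 r X(2) cut_at_mem(2)[OF s u] cut_at_mem(2)[OF s v] dd
        in \<open>simp_all add: mem[OF p1(2)] mem[OF p2(2)] mem[OF q12(2)] mem[OF q13(2)] mem[OF q23(2)] mem[OF r(2)]\<close>)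
qed

text \<open>Signs are compared only between distinct vertices of \<open>V\<close>, since the values
  of a contraction on the diagonal or at the removed vertex have no meaning. The type argument fixes
  the element type of the space hidden by the existential quantifier.\<close>

definition realizable :: "'a itself \<Rightarrow> 'v set \<Rightarrow> ('v \<Rightarrow> 'v \<Rightarrow> bool \<Rightarrow> bool) \<Rightarrow> bool" where
  "realizable T V A \<longleftrightarrow> (\<exists>(Z :: 'a set set) e X \<pi>. tight Z \<and> signed Z e X V \<pi> \<and>
     (\<forall>u\<in>V. \<forall>v\<in>V. u \<noteq> v \<longrightarrow> (\<forall>\<tau>. A u v \<tau> = signs Z e X \<pi> u v \<tau>)))"

lemma realizableE:
  assumes "realizable (T :: 'a itself) V A"
  obtains Z :: "'a set set" and e X \<pi> where "tight Z" "signed Z e X V \<pi>"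
    "\<And>u v \<tau>. u \<in> V \<Longrightarrow> v \<in> V \<Longrightarrow> u \<noteq> v \<Longrightarrow> A u v \<tau> = signs Z e X \<pi> u v \<tau>"
proof -
  from assms obtain Z :: "'a set set" and e X \<pi> where h: "tight Z" "signed Z e X V \<pi>"
    "\<forall>u\<in>V. \<forall>v\<in>V. u \<noteq> v \<longrightarrow> (\<forall>\<tau>. A u v \<tau> = signs Z e X \<pi> u v \<tau>)"
    unfolding realizable_def by (elim exE conjE) (rule that)
  show ?thesis by (rule that[OF h(1,2)]) (rule h(3)[rule_format])
qed

lemma realizableI:
  fixes Z :: "'a set set"
  assumes "tight Z" "signed Z e X V \<pi>" 
    "\<And>u v \<tau>. u \<in> V \<Longrightarrow> v \<in> V \<Longrightarrow> u \<noteq> v \<Longrightarrow> A u v \<tau> = signs Z e X \<pi> u v \<tau>"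
  shows "realizable (T :: 'a itself) V A"
  unfolding realizable_def
  by (rule exI[of _ Z], rule exI[of _ e], rule exI[of _ X], rule exI[of _ \<pi>]) (intro conjI ballI allI impI assms)

text \<open>An edge of sign \<open>\<sigma>\<close> is witnessed by an element \<open>f\<close>, and
  deleting \<open>f\<close> realizes the contraction. On three vertices,
  \<open>no_single_star\<close> at each vertex gives at least two doubled edges and
  \<open>not_all_double\<close> at most two.\<close>

lemma signed_class_realizable: "signed_class (realizable (T :: 'a itself) :: 'v set \<Rightarrow> _)"
proof
  fix V :: "'v set" and A
  assume "realizable T V A" then show "finite V" by (elim realizableE) (rule signedD(1))
next
  fix V :: "'v set" and A u v \<tau>
  assume h: "realizable T V A" "u \<in> V" "v \<in> V" "u \<noteq> v"
  from h(1) show "A u v \<tau> = A v u \<tau>"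
    by (rule realizableE) (use h(2-4) in \<open>simp add: signs_sym\<close>)
next
  fix V :: "'v set" and A u v
  assume h: "realizable T V A" "u \<in> V" "v \<in> V" "u \<noteq> v"
  from h(1) show "A u v True \<or> A u v False"
  proof (rule realizableE)
    fix Z :: "'a set set" and e X \<pi>
    assume s: "signed Z e X V \<pi>" and A: "\<And>u v \<tau>. u \<in> V \<Longrightarrow> v \<in> V \<Longrightarrow> u \<noteq> v \<Longrightarrow> A u v \<tau> = signs Z e X \<pi> u v \<tau>"
    show ?thesis unfolding A[OF h(2-4)] by (rule signs_ne[OF s h(2-4)])
  qed
next
  fix V :: "'v set" and A i j \<sigma>
  assume h: "realizable T V A" "i \<in> V" "j \<in> V" "i \<noteq> j" "A i j \<sigma>"
  from h(1) show "realizable T (V - {j}) (contract_edge i j \<sigma> A)"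
  proof (rule realizableE)
    fix Z :: "'a set set" and e X \<pi>
    assume Z: "tight Z" and s: "signed Z e X V \<pi>"
      and A: "\<And>u v \<tau>. u \<in> V \<Longrightarrow> v \<in> V \<Longrightarrow> u \<noteq> v \<Longrightarrow> A u v \<tau> = signs Z e X \<pi> u v \<tau>"
    have "signs Z e X \<pi> i j \<sigma>" using A[OF h(2-4), of \<sigma>] h(5) by simp
    then obtain f where f: "f \<in> \<Union>(avoid Z e)" "\<pi> f = {i, j}" "(f \<in> X) = \<sigma>" unfolding signs_def by blast
    obtain X' \<pi>' where s': "signed (avoid Z f) e X' (V - {j}) \<pi>'"
      and A': "\<forall>u\<in>V - {j}. \<forall>v\<in>V - {j}. u \<noteq> v \<longrightarrow> (\<forall>\<tau>.
       signs (avoid Z f) e X' \<pi>' u v \<tau> = contract_edge i j \<sigma> (signs Z e X \<pi>) u v \<tau>)"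
      using signed_contract[OF tight_cycle_space[OF Z] s h(2-4) f] by (elim exE conjE) (rule that)
    show ?thesis
    proof (rule realizableI[OF tight_avoid[OF Z] s'])
      fix u v \<tau> assume uv: "u \<in> V - {j}" "v \<in> V - {j}" "u \<noteq> v"
      have "contract_edge i j \<sigma> A u v \<tau> = contract_edge i j \<sigma> (signs Z e X \<pi>) u v \<tau>"
        using uv A[of u v] A[of j v] A[of u j] A[of i v] A[of u i] h(2-4) unfolding contract_edge_def by auto
      then show "contract_edge i j \<sigma> A u v \<tau> = signs (avoid Z f) e X' \<pi>' u v \<tau>"
        using A'[rule_format, OF uv] by simp
    qed
  qed
next
  fix u v w :: 'v and A
  assume h: "realizable T {u, v, w} A" "distinct [u, v, w]"
  from h(1) show "(single A u v \<and> \<not> single A u w \<and> \<not> single A v w) \<or>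
       (\<not> single A u v \<and> single A u w \<and> \<not> single A v w) \<or>
       (\<not> single A u v \<and> \<not> single A u w \<and> single A v w)"
  proof (rule realizableE)
    fix Z :: "'a set set" and e X \<pi>
    assume Z: "tight Z" and s: "signed Z e X {u, v, w} \<pi>"
      and A: "\<And>a b \<tau>. a \<in> {u, v, w} \<Longrightarrow> b \<in> {u, v, w} \<Longrightarrow> a \<noteq> b \<Longrightarrow> A a b \<tau> = signs Z e X \<pi> a b \<tau>"
    let ?B = "signs Z e X \<pi>"
    have AB: "single A a b = single ?B a b" if "a \<in> {u, v, w}" "b \<in> {u, v, w}" "a \<noteq> b" for a b
      unfolding single_def A[OF that] ..
    have sy: "single ?B a b = single ?B b a" for a b unfolding single_def signs_sym[of Z e X \<pi> a b] ..
    have d: "u \<noteq> v" "u \<noteq> w" "v \<noteq> w" "v \<noteq> u" "w \<noteq> u" "w \<noteq> v" using h(2) by auto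
    have W: "{u, v, w} - {u} = {v, w}" "{u, v, w} - {v} = {u, w}" "{u, v, w} - {w} = {u, v}" using d by auto
    have "\<not> single ?B u v \<or> \<not> single ?B u w" "\<not> single ?B v u \<or> \<not> single ?B v w" "\<not> single ?B w u \<or> \<not> single ?B w v"
      using no_single_star[OF Z s, of u v] no_single_star[OF Z s, of v u] no_single_star[OF Z s, of w u] d
      unfolding W by auto
    then have B: "\<not> single ?B u v \<or> \<not> single ?B u w" "\<not> single ?B u v \<or> \<not> single ?B v w" "\<not> single ?B u w \<or> \<not> single ?B v w"
      using sy[of u v] sy[of u w] sy[of v w] by blast+
    have AB': "single A u v = single ?B u v" "single A u w = single ?B u w" "single A v w = single ?B v w"
      using AB d by simp_all
    show ?thesis unfolding AB' using not_all_double[OF Z s h(2)] B by blast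
  qed
next
  fix V :: "'v set" and A
  assume h: "realizable T V A" "card V = 4"
  from h(1) show "\<not> antibalanced V A"
  proof (rule realizableE)
    fix Z :: "'a set set" and e X \<pi>
    assume Z: "tight Z" and s: "signed Z e X V \<pi>"
      and A: "\<And>u v \<tau>. u \<in> V \<Longrightarrow> v \<in> V \<Longrightarrow> u \<noteq> v \<Longrightarrow> A u v \<tau> = signs Z e X \<pi> u v \<tau>"
    obtain u v where uv: "u \<in> V" "v \<in> V" "u \<noteq> v"
      using h(2) by (auto simp: card_Suc_eq numeral_eq_Suc)
    have "antibalanced V A = antibalanced V (signs Z e X \<pi>)"
      unfolding antibalanced_def by (intro ex_cong1 ball_cong refl) (simp add: A)
    then show ?thesis using no_antibalanced[OF Z s uv] by simp
  qed
qed

lemma signed_classify: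
  assumes "tight Z" "signed Z e X V \<pi>" "3 \<le> card V"
  shows "(\<exists>l. star_at V (signs Z e X \<pi>) l) \<or> (card V = 4 \<and> is_matching V (signs Z e X \<pi>))"
  by (rule signed_class.classify[OF signed_class_realizable[of "TYPE('a)"]])
    (use assms in \<open>auto intro: realizableI\<close>)

section \<open>From the members avoiding an element to the whole space\<close>

lemma pulledI:
  assumes "\<pi> ` \<Union>Z = F"
    and "\<And>z. z \<in> Z \<Longrightarrow> \<exists>D\<in>Z0. \<forall>x\<in>\<Union>Z. x \<in> z \<longleftrightarrow> \<pi> x \<in> D"
    and "\<And>D. D \<in> Z0 \<Longrightarrow> \<exists>z\<in>Z. \<forall>x\<in>\<Union>Z. x \<in> z \<longleftrightarrow> \<pi> x \<in> D"
  shows "pulled Z \<pi> F Z0"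
proof -
  have "z \<in> (\<lambda>D. {x \<in> \<Union>Z. \<pi> x \<in> D}) ` Z0" if z: "z \<in> Z" for z
  proof -
    obtain D where D: "D \<in> Z0" "\<forall>x\<in>\<Union>Z. x \<in> z \<longleftrightarrow> \<pi> x \<in> D" using assms(2)[OF z] by blast
    have "z = {x \<in> \<Union>Z. \<pi> x \<in> D}" using D(2) z by blast
    then show ?thesis using D(1) by blast
  qed
  moreover have "{x \<in> \<Union>Z. \<pi> x \<in> D} \<in> Z" if D: "D \<in> Z0" for D
  proof -
    obtain z where z: "z \<in> Z" "\<forall>x\<in>\<Union>Z. x \<in> z \<longleftrightarrow> \<pi> x \<in> D" using assms(3)[OF D] by blast
    have "z = {x \<in> \<Union>Z. \<pi> x \<in> D}" using z by blast
    then show ?thesis using z(1) by simp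
  qed
  ultimately have "Z = (\<lambda>D. {x \<in> \<Union>Z. \<pi> x \<in> D}) ` Z0" by blast
  with assms(1) show ?thesis unfolding pulled_def by (rule conjI)
qed

lemma pulled_mem:
  assumes "pulled Z \<pi> F Z0" shows "D \<in> Z0 \<Longrightarrow> {x \<in> \<Union>Z. \<pi> x \<in> D} \<in> Z"
proof -
  have "(\<lambda>D. {x \<in> \<Union>Z. \<pi> x \<in> D}) ` Z0 \<subseteq> Z" using assms unfolding pulled_def by (elim conjE equalityD2)
  then show "D \<in> Z0 \<Longrightarrow> {x \<in> \<Union>Z. \<pi> x \<in> D} \<in> Z" by blast
qed

lemma pulledE:
  assumes "pulled Z \<pi> F Z0" "z \<in> Z"
  obtains D where "D \<in> Z0" "z = {x \<in> \<Union>Z. \<pi> x \<in> D}"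
proof -
  have "Z \<subseteq> (\<lambda>D. {x \<in> \<Union>Z. \<pi> x \<in> D}) ` Z0" using assms(1) unfolding pulled_def by (elim conjE equalityD1)
  then show ?thesis using assms(2) that by blast
qed

lemma pulled_surj: "pulled Z \<pi> F Z0 \<Longrightarrow> \<pi> ` \<Union>Z = F"
  by (simp add: pulled_def)

text \<open>If of two members through \<open>e\<close> only one contained \<open>x\<close>, their
  sum would contain \<open>x\<close> and avoid \<open>e\<close>.\<close>

lemma class_iff:
  assumes Z: "cycle_space Z" and x: "x \<in> \<Union>Z" "x \<notin> \<Union>(avoid Z e)" and z: "z \<in> Z"
  shows "x \<in> z \<longleftrightarrow> e \<in> z"
proof
  assume "x \<in> z" then show "e \<in> z" using x(2) z by (auto simp: avoid_def)
next
  assume e: "e \<in> z"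
  obtain z' where z': "z' \<in> Z" "x \<in> z'" using x(1) by blast
  then have "e \<in> z'" using x(2) by (auto simp: avoid_def)
  show "x \<in> z"
  proof (rule ccontr)
    assume "x \<notin> z"
    then have "x \<in> sym_diff z z'" "e \<notin> sym_diff z z'" using z' e \<open>e \<in> z'\<close> by auto
    then show False using cycle_space_sym_diff[OF Z z z'(1)] x(2) unfolding avoid_def by blast
  qed
qed

lemma avoid_subset: "\<Union>(avoid Z e) \<subseteq> \<Union>Z"
  by (auto simp: avoid_def)

text \<open>The coordinates of a member are the truth value of \<open>e \<in> z\<close> and a vertex
  set \<open>I\<close>; they describe it on all elements not in series with
  \<open>e\<close>.\<close>

lemma signed_form:
  assumes Z: "cycle_space Z" and s: "signed Z e X V \<pi>" and z: "z \<in> Z"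
  obtains I where "I \<subseteq> V" "\<forall>x\<in>\<Union>(avoid Z e). x \<in> z \<longleftrightarrow> ((e \<in> z \<and> x \<in> X) \<noteq> crosses I (\<pi> x))"
proof -
  note X = signedD(2,3)[OF s]
  define y where "y = (if e \<in> z then sym_diff z X else z)"
  have "y \<in> avoid Z e" using z X cycle_space_sym_diff[OF Z z X(1)] by (auto simp: y_def avoid_def)
  then obtain I where I: "I \<subseteq> V" "y = cut_at (avoid Z e) \<pi> I" by (rule signed_cutE[OF s])
  have "x \<in> z \<longleftrightarrow> ((e \<in> z \<and> x \<in> X) \<noteq> crosses I (\<pi> x))" if x: "x \<in> \<Union>(avoid Z e)" for x
  proof -
    have "x \<in> y \<longleftrightarrow> crosses I (\<pi> x)" unfolding I(2) cut_at_def using x by blast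
    then show ?thesis by (auto simp: y_def split: if_splits)
  qed
  then show ?thesis using that I(1) by simp
qed

lemma signed_form_ex:
  assumes Z: "cycle_space Z" and s: "signed Z e X V \<pi>" and I: "I \<subseteq> V"
  obtains z where "z \<in> Z" "(e \<in> z) = t" "\<forall>x\<in>\<Union>(avoid Z e). x \<in> z \<longleftrightarrow> ((t \<and> x \<in> X) \<noteq> crosses I (\<pi> x))"
proof -
  note X = signedD(2,3)[OF s] and c = cut_at_mem[OF s I]
  let ?c = "cut_at (avoid Z e) \<pi> I"
  have mc: "x \<in> ?c \<longleftrightarrow> crosses I (\<pi> x)" if "x \<in> \<Union>(avoid Z e)" for x
    unfolding cut_at_def using that by blast
  show ?thesis
  proof (rule that[of "if t then sym_diff X ?c else ?c"])
    show "(if t then sym_diff X ?c else ?c) \<in> Z"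
      using c X cycle_space_sym_diff[OF Z X(1) c(1)] by simp
    show "(e \<in> (if t then sym_diff X ?c else ?c)) = t" using c X by simp
    show "\<forall>x\<in>\<Union>(avoid Z e). x \<in> (if t then sym_diff X ?c else ?c) \<longleftrightarrow> ((t \<and> x \<in> X) \<noteq> crosses I (\<pi> x))"
    proof
      fix x assume "x \<in> \<Union>(avoid Z e)"
      from mc[OF this] show "x \<in> (if t then sym_diff X ?c else ?c) \<longleftrightarrow> ((t \<and> x \<in> X) \<noteq> crosses I (\<pi> x))"
        by (cases t) auto
    qed
  qed
qed

text \<open>After switching, \<open>X\<close> consists of elements over edges at \<open>l\<close>
  and of the elements in series with \<open>e\<close>. Moving those edges from \<open>l\<close> to a
  new vertex \<open>w\<close>, and letting \<open>e\<close> join \<open>l\<close> and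
  \<open>w\<close>, makes \<open>X\<close> the cut of \<open>w\<close>.\<close>

lemma star_pulled:
  fixes V :: "nat set"
  assumes Z: "cycle_space Z" and s0: "signed Z e X0 V \<pi>" and st: "star_at V (signs Z e X0 \<pi>) l"
  obtains w \<pi>' where "w \<notin> V" "pulled Z \<pi>' (edges (insert w V)) (cuts (insert w V))"
proof -
  let ?E = "\<Union>(avoid Z e)"
  have l: "l \<in> V" and dbl: "\<And>v. v \<in> V - {l} \<Longrightarrow> \<not> single (signs Z e X0 \<pi>) l v"
    and bal: "balanced_on (V - {l}) (signs Z e X0 \<pi>)" using st by (auto simp: star_at_def)
  from bal obtain \<chi> :: "nat \<Rightarrow> bool" where "\<forall>u\<in>V - {l}. \<forall>v\<in>V - {l}. u \<noteq> v \<longrightarrow>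
      (\<forall>\<tau>. signs Z e X0 \<pi> u v \<tau> \<longleftrightarrow> \<tau> = (\<chi> u \<noteq> \<chi> v))" unfolding balanced_on_def by (elim exE) (rule that)
  note chi = this[rule_format]
  \<comment> \<open>Switching by the balancing function removes from the circuit all elements over
    edges that avoid \<open>l\<close>.\<close>
  define I0 where "I0 = {v \<in> V - {l}. \<chi> v}"
  define X where "X = sym_diff X0 (cut_at (avoid Z e) \<pi> I0)"
  have s: "signed Z e X V \<pi>" unfolding X_def by (rule signed_switch[OF Z s0]) (auto simp: I0_def)
  have X: "X \<in> Z" "e \<in> X" using signedD(2,3)[OF s] by auto
  have off: "x \<notin> X" if x: "x \<in> ?E" "\<pi> x = {u, v}" "u \<in> V - {l}" "v \<in> V - {l}" "u \<noteq> v" for x u v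
  proof -
    have "signs Z e X \<pi> u v (x \<in> X)" using x by (auto simp: signs_def)
    then have "signs Z e X0 \<pi> u v ((x \<in> X) \<noteq> ((u \<in> I0) \<noteq> (v \<in> I0)))"
      unfolding X_def signs_switch[OF x(5)] .
    then have "((x \<in> X) \<noteq> ((u \<in> I0) \<noteq> (v \<in> I0))) = (\<chi> u \<noteq> \<chi> v)" by (rule iffD1[OF chi[OF x(3-5)]])
    then show ?thesis using x(3,4) by (auto simp: I0_def)
  qed
  have both: "\<exists>x\<in>?E. \<pi> x = {l, v} \<and> (x \<in> X) = \<tau>" if v: "v \<in> V - {l}" for v \<tau>
  proof -
    have h: "signs Z e X0 \<pi> l v b" for b using dbl[OF v] unfolding single_def by (cases b) auto
    have "l \<noteq> v" using v by auto
    then have "signs Z e X \<pi> l v \<tau>" unfolding X_def by (subst signs_switch) (assumption, rule h)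
    then show ?thesis unfolding signs_def .
  qed
  \<comment> \<open>Vertices are natural numbers so that a fresh one is always available.\<close>
  obtain w where w: "w \<notin> V" using ex_new_if_finite[OF infinite_UNIV_nat signedD(1)[OF s]] by blast
  \<comment> \<open>The elements outside \<open>?E\<close> are in series with \<open>e\<close> and
    become the edge \<open>lw\<close>.\<close>
  define \<pi>' where "\<pi>' x = (if x \<notin> ?E then {l, w} else if l \<in> \<pi> x \<and> x \<in> X then insert w (\<pi> x - {l}) else \<pi> x)" for x
  have ABC: "(\<exists>u v. u \<in> V - {l} \<and> v \<in> V - {l} \<and> u \<noteq> v \<and> \<pi> x = {u, v} \<and> \<pi>' x = {u, v} \<and> x \<notin> X) \<or>
     (\<exists>v\<in>V - {l}. \<pi> x = {l, v} \<and> \<pi>' x = {l, v} \<and> x \<notin> X) \<or>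
     (\<exists>v\<in>V - {l}. \<pi> x = {l, v} \<and> \<pi>' x = {w, v} \<and> x \<in> X)" if x: "x \<in> ?E" for x
  proof -
    obtain u v where uv: "\<pi> x = {u, v}" "u \<in> V" "v \<in> V" "u \<noteq> v" using signed_edge[OF s x] by blast
    show ?thesis
    proof (cases "l \<in> {u, v}")
      case False
      then have "\<pi>' x = {u, v}" "x \<notin> X" using uv x off[OF x uv(1)] by (auto simp: \<pi>'_def)
      then show ?thesis using False uv by blast
    next
      case True
      then obtain v' where v': "\<pi> x = {l, v'}" "v' \<in> V - {l}" using uv by auto
      then have "\<pi>' x = (if x \<in> X then {w, v'} else {l, v'})" using x by (auto simp: \<pi>'_def)
      then show ?thesis using v' by (cases "x \<in> X") auto
    qed
  qed
  let ?W = "insert w V"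
  have lw: "l \<noteq> w" using l w by auto
  have N: "\<pi>' x = {l, w}" if "x \<notin> ?E" for x using that by (simp add: \<pi>'_def)
  have inE: "\<pi>' x \<in> edges ?W" for x
  proof (cases "x \<in> ?E")
    case True
    from ABC[OF this] show ?thesis using l w unfolding edges_def by blast
  next
    case False
    then show ?thesis using N lw l unfolding edges_def by blast
  qed
  have eE: "e \<in> \<Union>Z" "e \<notin> ?E" using X by (auto simp: avoid_def)
  have surj: "\<pi>' ` \<Union>Z = edges ?W"
  proof
    show "\<pi>' ` \<Union>Z \<subseteq> edges ?W" using inE by blast
    show "edges ?W \<subseteq> \<pi>' ` \<Union>Z"
    proof
      fix d assume "d \<in> edges ?W"
      then obtain u v where d: "d = {u, v}" "u \<in> ?W" "v \<in> ?W" "u \<noteq> v" unfolding edges_def by blast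
      have l_case: "\<exists>x\<in>\<Union>Z. \<pi>' x = {l, b}" if b: "b \<in> V - {l}" for b
      proof -
        obtain x where x: "x \<in> ?E" "\<pi> x = {l, b}" "(x \<in> X) = False"
          using both[OF b, of False] by (elim bexE conjE) (rule that)
        then have "\<pi>' x = {l, b}" by (simp add: \<pi>'_def)
        then show ?thesis using x(1) avoid_subset[of Z e] by blast
      qed
      have w_case: "\<exists>x\<in>\<Union>Z. \<pi>' x = {w, b}" if b: "b \<in> V" for b
      proof (cases "b = l")
        case True then show ?thesis using N[OF eE(2)] eE(1) by (auto simp: insert_commute)
      next
        case False
        then have b': "b \<in> V - {l}" using b by simp
        obtain x where x: "x \<in> ?E" "\<pi> x = {l, b}" "(x \<in> X) = True"
          using both[OF b', of True] by (elim bexE conjE) (rule that)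
        then have "\<pi>' x = {w, b}" using b' by (auto simp: \<pi>'_def)
        then show ?thesis using x(1) avoid_subset[of Z e] by blast
      qed
      have o_case: "\<exists>x\<in>\<Union>Z. \<pi>' x = {a, b}" if ab: "a \<in> V - {l}" "b \<in> V - {l}" "a \<noteq> b" for a b
      proof -
        obtain x where x: "x \<in> ?E" "\<pi> x = {a, b}" using signed_edge_ex[OF s, of a b] ab by blast
        then have "\<pi>' x = {a, b}" using off[OF x ab] by (simp add: \<pi>'_def)
        then show ?thesis using x(1) avoid_subset[of Z e] by blast
      qed
      have "\<exists>x\<in>\<Union>Z. \<pi>' x = {u, v}"
      proof (cases "u = w \<or> v = w")
        case True
        then show ?thesis using w_case[of u] w_case[of v] d by (metis insert_commute insert_iff)
      next
        case False
        then show ?thesis using l_case[of u] l_case[of v] o_case[of u v] d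
          by (metis Diff_iff insert_commute insert_iff singletonD)
      qed
      then show "d \<in> \<pi>' ` \<Union>Z" unfolding d(1) by blast
    qed
  qed
  have main: "x \<in> z \<longleftrightarrow> crosses J (\<pi>' x)"
    if x: "x \<in> \<Union>Z" and z: "z \<in> Z" and I: "I \<subseteq> V"
      and f: "\<And>x. x \<in> ?E \<Longrightarrow> x \<in> z \<longleftrightarrow> ((e \<in> z \<and> x \<in> X) \<noteq> crosses I (\<pi> x))"
      and J: "J \<subseteq> ?W" "I = J - {w}" "(e \<in> z) = ((l \<in> J) \<noteq> (w \<in> J))" for x z I J
  proof (cases "x \<in> ?E")
    case True
    have ne: "v \<noteq> w" if "v \<in> V" for v using w that by blast
    from ABC[OF True] show ?thesis
    proof (elim disjE exE bexE conjE)
      fix u v assume h: "u \<in> V - {l}" "v \<in> V - {l}" "u \<noteq> v" "\<pi> x = {u, v}" "\<pi>' x = {u, v}" "x \<notin> X"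
      show ?thesis unfolding f[OF True] h(4,5) crosses_pair J(2) using h(1,2,6) ne[of u] ne[of v] by auto
    next
      fix v assume h: "v \<in> V - {l}" "\<pi> x = {l, v}" "\<pi>' x = {l, v}" "x \<notin> X"
      show ?thesis unfolding f[OF True] h(2,3) crosses_pair J(2) using h(1,4) ne[of v] lw by auto
    next
      fix v assume h: "v \<in> V - {l}" "\<pi> x = {l, v}" "\<pi>' x = {w, v}" "x \<in> X"
      show ?thesis unfolding f[OF True] h(2,3) crosses_pair J(2) J(3) using h(1,4) ne[of v] lw by auto
    qed
  next
    case False
    show ?thesis unfolding class_iff[OF Z x False z] N[OF False] crosses_pair J(3) ..
  qed
  have "pulled Z \<pi>' (edges ?W) (cuts ?W)"
  proof (rule pulledI[OF surj])
    fix z assume z: "z \<in> Z"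
    obtain I where I0: "I \<subseteq> V" "\<forall>x\<in>?E. x \<in> z \<longleftrightarrow> ((e \<in> z \<and> x \<in> X) \<noteq> crosses I (\<pi> x))"
      by (rule signed_form[OF Z s z])
    note I = I0(1) I0(2)[rule_format]
    \<comment> \<open>The new vertex is put on the side of \<open>l\<close> exactly when
      \<open>z\<close> avoids \<open>e\<close>.\<close>
    define J where "J = I \<union> (if (l \<in> I) \<noteq> (e \<in> z) then {w} else {})"
    have wI: "w \<notin> I" using I(1) w by blast
    have J: "J \<subseteq> ?W" "I = J - {w}" "(e \<in> z) = ((l \<in> J) \<noteq> (w \<in> J))" using I(1) wI lw by (auto simp: J_def)
    show "\<exists>D\<in>cuts ?W. \<forall>x\<in>\<Union>Z. x \<in> z \<longleftrightarrow> \<pi>' x \<in> D"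
    proof (rule bexI[of _ "{d \<in> edges ?W. crosses J d}"])
      show "\<forall>x\<in>\<Union>Z. x \<in> z \<longleftrightarrow> \<pi>' x \<in> {d \<in> edges ?W. crosses J d}"
        using main[OF _ z I J] inE by simp
      show "{d \<in> edges ?W. crosses J d} \<in> cuts ?W" unfolding cuts_def using J(1) by blast
    qed
  next
    fix D assume "D \<in> cuts ?W"
    then obtain J where J: "J \<subseteq> ?W" "D = {d \<in> edges ?W. crosses J d}" unfolding cuts_def by blast
    have I: "J - {w} \<subseteq> V" using J(1) by blast
    obtain z where z0: "z \<in> Z" "(e \<in> z) = ((l \<in> J) \<noteq> (w \<in> J))"
      "\<forall>x\<in>?E. x \<in> z \<longleftrightarrow> ((((l \<in> J) \<noteq> (w \<in> J)) \<and> x \<in> X) \<noteq> crosses (J - {w}) (\<pi> x))"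
      by (rule signed_form_ex[OF Z s I])
    note z = z0(1,2) z0(3)[rule_format]
    have "\<forall>x\<in>\<Union>Z. x \<in> z \<longleftrightarrow> \<pi>' x \<in> D"
      using main[OF _ z(1) I z(3)[folded z(2)] J(1) refl z(2)] inE unfolding J(2) by simp
    then show "\<exists>z\<in>Z. \<forall>x\<in>\<Union>Z. x \<in> z \<longleftrightarrow> \<pi>' x \<in> D" using z(1) by blast
  qed
  with w show ?thesis by (rule that)
qed

section \<open>The cycle space of \<open>K(3,3)\<close> on a grid of nine cells\<close>

definition grid :: "(nat \<times> nat) set" where
  "grid = {(0,0),(0,1),(0,2),(1,0),(1,1),(1,2),(2,0),(2,1),(2,2)}"

text \<open>Cells are the edges of \<open>K(3,3)\<close>, rows and columns its vertices. The
  equations say that \<open>D\<close> has an even number of cells in every line, which describes the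
  cycle space in a form suited to propositional reasoning.\<close>

definition grid_even :: "(nat \<times> nat) set \<Rightarrow> bool" where
  "grid_even D \<longleftrightarrow> D \<subseteq> grid \<and>
     (\<forall>r\<in>{0,1,2}. ((r,2) \<in> D) = (((r,0) \<in> D) \<noteq> ((r,1) \<in> D))) \<and>
     (\<forall>c\<in>{0,1,2}. ((2,c) \<in> D) = (((0,c) \<in> D) \<noteq> ((1,c) \<in> D)))"

text \<open>After switching, \<open>jl\<close> is the only single edge of sign \<open>True\<close>.
  Row 0 and column 0 consist of \<open>e\<close> and the two copies of a doubled edge; the other
  four lines are the triangles, with copies chosen so that an even number of edges has sign
  \<open>True\<close>. Each of these lines meets every member evenly.\<close>

lemma matching_pulled:
  assumes Z: "cycle_space Z" and s0: "signed Z e X0 V \<pi>" and V: "V = {i, j, k, l}"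
    and m: "matching_at (signs Z e X0 \<pi>) i j k l"
  obtains \<pi>' where "pulled Z \<pi>' grid (Collect grid_even)"
proof -
  let ?E = "\<Union>(avoid Z e)"
  let ?S0 = "signs Z e X0 \<pi>"
  have d: "i \<noteq> j" "i \<noteq> k" "i \<noteq> l" "j \<noteq> k" "j \<noteq> l" "k \<noteq> l" "j \<noteq> i" "k \<noteq> i" "l \<noteq> i" "k \<noteq> j" "l \<noteq> j" "l \<noteq> k"
    using m by (auto simp: matching_at_def)
  \<comment> \<open>This switching removes \<open>ik\<close>, \<open>il\<close> and
    \<open>jk\<close> from the circuit; the odd 4-cycle then forces \<open>jl\<close> into
    it.\<close>
  define I0 where "I0 = (if ?S0 i k True then {k} else {}) \<union> (if ?S0 i l True then {l} else {}) \<union>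
     (if ?S0 j k True \<noteq> ?S0 i k True then {j} else {})"
  define X where "X = sym_diff X0 (cut_at (avoid Z e) \<pi> I0)"
  have s: "signed Z e X V \<pi>" unfolding X_def by (rule signed_switch[OF Z s0]) (auto simp: I0_def V)
  have X: "X \<in> Z" "e \<in> X" using signedD(2,3)[OF s] by auto
  have I0: "i \<notin> I0" "k \<in> I0 \<longleftrightarrow> ?S0 i k True" "l \<in> I0 \<longleftrightarrow> ?S0 i l True" "j \<in> I0 \<longleftrightarrow> (?S0 j k True \<noteq> ?S0 i k True)"
    using d by (auto simp: I0_def)
  have sgl: "x \<in> X \<longleftrightarrow> (?S0 a b True \<noteq> ((a \<in> I0) \<noteq> (b \<in> I0)))"
    if x: "x \<in> ?E" "\<pi> x = {a, b}" "a \<noteq> b" and sg: "single ?S0 a b" for x a b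
  proof -
    have "signs Z e X \<pi> a b (x \<in> X)" using x by (auto simp: signs_def)
    then have "?S0 a b ((x \<in> X) \<noteq> ((a \<in> I0) \<noteq> (b \<in> I0)))"
      unfolding X_def signs_switch[OF x(3)] .
    then have "((x \<in> X) \<noteq> ((a \<in> I0) \<noteq> (b \<in> I0))) = ?S0 a b True"
      using sg unfolding single_def by (cases "(x \<in> X) \<noteq> ((a \<in> I0) \<noteq> (b \<in> I0))") auto
    then show ?thesis by blast
  qed
  have mm: "single ?S0 i k" "single ?S0 i l" "single ?S0 j k" "single ?S0 j l" "\<not> single ?S0 i j" "\<not> single ?S0 k l"
    "(?S0 i k True \<noteq> ?S0 j k True) \<noteq> (?S0 i l True \<noteq> ?S0 j l True)"
    using m by (auto simp: matching_at_def)
  have ik: "x \<notin> X" if "x \<in> ?E" "\<pi> x = {i, k}" for x using sgl[OF that d(2) mm(1)] I0 by simp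
  have il: "x \<notin> X" if "x \<in> ?E" "\<pi> x = {i, l}" for x using sgl[OF that d(3) mm(2)] I0 by simp
  have jk: "x \<notin> X" if "x \<in> ?E" "\<pi> x = {j, k}" for x using sgl[OF that d(4) mm(3)] I0 by auto
  have jl: "x \<in> X" if "x \<in> ?E" "\<pi> x = {j, l}" for x using sgl[OF that d(5) mm(4)] I0 mm(7) by auto
  have both: "\<exists>x\<in>?E. \<pi> x = {a, b} \<and> (x \<in> X) = \<tau>" if "\<not> single ?S0 a b" "a \<noteq> b" for a b \<tau>
  proof -
    have "?S0 a b t" for t using that(1) unfolding single_def by (cases t) auto
    then have "signs Z e X \<pi> a b \<tau>" unfolding X_def signs_switch[OF that(2)] .
    then show ?thesis unfolding signs_def .
  qed
  define \<pi>' :: "_ \<Rightarrow> nat \<times> nat" where "\<pi>' x = (if x \<notin> ?E then (0,0) else if \<pi> x = {i, j} then (if x \<in> X then (0,2) else (0,1))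
     else if \<pi> x = {k, l} then (if x \<in> X then (2,0) else (1,0)) else if \<pi> x = {i, k} then (1,1)
     else if \<pi> x = {i, l} then (1,2) else if \<pi> x = {j, k} then (2,1) else (2,2))" for x
  have dd: "{i, j} \<noteq> {k, l}" "{i, j} \<noteq> {i, k}" "{i, j} \<noteq> {i, l}" "{i, j} \<noteq> {j, k}" "{i, j} \<noteq> {j, l}"
    "{k, l} \<noteq> {i, k}" "{k, l} \<noteq> {i, l}" "{k, l} \<noteq> {j, k}" "{k, l} \<noteq> {j, l}" "{i, k} \<noteq> {i, l}" "{i, k} \<noteq> {j, k}"
    "{i, k} \<noteq> {j, l}" "{i, l} \<noteq> {j, k}" "{i, l} \<noteq> {j, l}" "{j, k} \<noteq> {j, l}"
    using d by (simp_all add: doubleton_eq_iff)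
  have p: "\<pi> x = {i, j} \<Longrightarrow> \<pi>' x = (if x \<in> X then (0,2) else (0,1))"
    "\<pi> x = {k, l} \<Longrightarrow> \<pi>' x = (if x \<in> X then (2,0) else (1,0))"
    "\<pi> x = {i, k} \<Longrightarrow> \<pi>' x = (1,1)" "\<pi> x = {i, l} \<Longrightarrow> \<pi>' x = (1,2)" "\<pi> x = {j, k} \<Longrightarrow> \<pi>' x = (2,1)"
    "\<pi> x = {j, l} \<Longrightarrow> \<pi>' x = (2,2)" if "x \<in> ?E" for x
    using that by (simp_all only: \<pi>'_def dd dd[symmetric] simp_thms if_True if_False if_cancel not_True_eq_False)
  have N: "\<pi>' x = (0,0)" if "x \<notin> ?E" for x using that by (simp add: \<pi>'_def)
  have cases: "\<pi> x = {i, j} \<or> \<pi> x = {k, l} \<or> \<pi> x = {i, k} \<or> \<pi> x = {i, l} \<or> \<pi> x = {j, k} \<or> \<pi> x = {j, l}" if x: "x \<in> ?E" for x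
  proof -
    obtain u v where "\<pi> x = {u, v}" "u \<in> {i, j, k, l}" "v \<in> {i, j, k, l}" "u \<noteq> v"
      using signed_edge[OF s x] V by blast
    then show ?thesis by (elim insertE emptyE) (simp_all add: insert_commute)
  qed
  have inG: "\<pi>' x \<in> grid" for x
  proof (cases "x \<in> ?E")
    case True
    from cases[OF this] show ?thesis using p[OF True] unfolding grid_def by (elim disjE) simp_all
  qed (simp add: N grid_def)
  have eE: "e \<in> \<Union>Z" "e \<notin> ?E" using X by (auto simp: avoid_def)
  have surj: "\<pi>' ` \<Union>Z = grid"
  proof
    show "\<pi>' ` \<Union>Z \<subseteq> grid" using inG by blast
    have im: "c \<in> \<pi>' ` \<Union>Z" if "x \<in> ?E" "\<pi>' x = c" for x c using that avoid_subset[of Z e] by blast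
    obtain x1 where x1: "x1 \<in> ?E" "\<pi> x1 = {i, j}" "(x1 \<in> X) = False" using both[OF mm(5) d(1), of False] by (elim bexE conjE) (rule that)
    obtain x2 where x2: "x2 \<in> ?E" "\<pi> x2 = {i, j}" "(x2 \<in> X) = True" using both[OF mm(5) d(1), of True] by (elim bexE conjE) (rule that)
    obtain x3 where x3: "x3 \<in> ?E" "\<pi> x3 = {k, l}" "(x3 \<in> X) = False" using both[OF mm(6) d(6), of False] by (elim bexE conjE) (rule that)
    obtain x4 where x4: "x4 \<in> ?E" "\<pi> x4 = {k, l}" "(x4 \<in> X) = True" using both[OF mm(6) d(6), of True] by (elim bexE conjE) (rule that)
    obtain x5 where x5: "x5 \<in> ?E" "\<pi> x5 = {i, k}" using signed_edge_ex[OF s, of i k] d V by blast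
    obtain x6 where x6: "x6 \<in> ?E" "\<pi> x6 = {i, l}" using signed_edge_ex[OF s, of i l] d V by blast
    obtain x7 where x7: "x7 \<in> ?E" "\<pi> x7 = {j, k}" using signed_edge_ex[OF s, of j k] d V by blast
    obtain x8 where x8: "x8 \<in> ?E" "\<pi> x8 = {j, l}" using signed_edge_ex[OF s, of j l] d V by blast
    have "(0,0) \<in> \<pi>' ` \<Union>Z" using N[OF eE(2)] eE(1) by (metis imageI)
    moreover have "(0,1) \<in> \<pi>' ` \<Union>Z" using im[OF x1(1)] p(1)[OF x1(1,2)] x1(3) by simp
    moreover have "(0,2) \<in> \<pi>' ` \<Union>Z" using im[OF x2(1)] p(1)[OF x2(1,2)] x2(3) by simp
    moreover have "(1,0) \<in> \<pi>' ` \<Union>Z" using im[OF x3(1)] p(2)[OF x3(1,2)] x3(3) by simp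
    moreover have "(2,0) \<in> \<pi>' ` \<Union>Z" using im[OF x4(1)] p(2)[OF x4(1,2)] x4(3) by simp
    moreover have "(1,1) \<in> \<pi>' ` \<Union>Z" using im[OF x5(1) p(3)[OF x5]] .
    moreover have "(1,2) \<in> \<pi>' ` \<Union>Z" using im[OF x6(1) p(4)[OF x6]] .
    moreover have "(2,1) \<in> \<pi>' ` \<Union>Z" using im[OF x7(1) p(5)[OF x7]] .
    moreover have "(2,2) \<in> \<pi>' ` \<Union>Z" using im[OF x8(1) p(6)[OF x8]] .
    ultimately show "grid \<subseteq> \<pi>' ` \<Union>Z" unfolding grid_def by (simp only: insert_subset empty_subsetI simp_thms)
  qed
  have main: "\<forall>x\<in>\<Union>Z. x \<in> z \<longleftrightarrow> \<pi>' x \<in> D"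
    if z: "z \<in> Z" and f: "\<And>x. x \<in> ?E \<Longrightarrow> x \<in> z \<longleftrightarrow> ((e \<in> z \<and> x \<in> X) \<noteq> crosses I (\<pi> x))"
    and D: "(0,0) \<in> D \<longleftrightarrow> e \<in> z" "(0,1) \<in> D \<longleftrightarrow> (i \<in> I) \<noteq> (j \<in> I)" "(0,2) \<in> D \<longleftrightarrow> (e \<in> z) \<noteq> ((i \<in> I) \<noteq> (j \<in> I))"
      "(1,0) \<in> D \<longleftrightarrow> (k \<in> I) \<noteq> (l \<in> I)" "(2,0) \<in> D \<longleftrightarrow> (e \<in> z) \<noteq> ((k \<in> I) \<noteq> (l \<in> I))"
      "(1,1) \<in> D \<longleftrightarrow> (i \<in> I) \<noteq> (k \<in> I)" "(1,2) \<in> D \<longleftrightarrow> (i \<in> I) \<noteq> (l \<in> I)"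
      "(2,1) \<in> D \<longleftrightarrow> (j \<in> I) \<noteq> (k \<in> I)" "(2,2) \<in> D \<longleftrightarrow> (e \<in> z) \<noteq> ((j \<in> I) \<noteq> (l \<in> I))" for z I D
  proof
    fix x assume x: "x \<in> \<Union>Z"
    show "x \<in> z \<longleftrightarrow> \<pi>' x \<in> D"
    proof (cases "x \<in> ?E")
      case False
      show ?thesis unfolding class_iff[OF Z x False z] N[OF False] D(1) ..
    next
      case True
      note h = p[OF True] and f' = f[OF True]
      from cases[OF True] show ?thesis
      proof (elim disjE)
        assume c: "\<pi> x = {i, j}" show ?thesis unfolding f' h(1)[OF c] c crosses_pair using D(2,3) by (cases "x \<in> X") simp_all
      next
        assume c: "\<pi> x = {k, l}" show ?thesis unfolding f' h(2)[OF c] c crosses_pair using D(4,5) by (cases "x \<in> X") simp_all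
      next
        assume c: "\<pi> x = {i, k}" show ?thesis unfolding f' h(3)[OF c] c crosses_pair D using ik[OF True c] by simp
      next
        assume c: "\<pi> x = {i, l}" show ?thesis unfolding f' h(4)[OF c] c crosses_pair D using il[OF True c] by simp
      next
        assume c: "\<pi> x = {j, k}" show ?thesis unfolding f' h(5)[OF c] c crosses_pair D using jk[OF True c] by simp
      next
        assume c: "\<pi> x = {j, l}" show ?thesis unfolding f' h(6)[OF c] c crosses_pair D using jl[OF True c] by simp
      qed
    qed
  qed
  have "pulled Z \<pi>' grid (Collect grid_even)"
  proof (rule pulledI[OF surj])
    fix z assume z: "z \<in> Z"
    obtain I where I0: "I \<subseteq> V" "\<forall>x\<in>?E. x \<in> z \<longleftrightarrow> ((e \<in> z \<and> x \<in> X) \<noteq> crosses I (\<pi> x))"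
      by (rule signed_form[OF Z s z])
    note I = I0(1) I0(2)[rule_format]
    define D :: "(nat \<times> nat) set" where "D = {c. c = (0,0) \<and> e \<in> z \<or> c = (0,1) \<and> (i \<in> I) \<noteq> (j \<in> I) \<or> c = (0,2) \<and> (e \<in> z) \<noteq> ((i \<in> I) \<noteq> (j \<in> I))
      \<or> c = (1,0) \<and> (k \<in> I) \<noteq> (l \<in> I) \<or> c = (2,0) \<and> (e \<in> z) \<noteq> ((k \<in> I) \<noteq> (l \<in> I))
      \<or> c = (1,1) \<and> (i \<in> I) \<noteq> (k \<in> I) \<or> c = (1,2) \<and> (i \<in> I) \<noteq> (l \<in> I)
      \<or> c = (2,1) \<and> (j \<in> I) \<noteq> (k \<in> I) \<or> c = (2,2) \<and> (e \<in> z) \<noteq> ((j \<in> I) \<noteq> (l \<in> I))}"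
    have D: "(0,0) \<in> D \<longleftrightarrow> e \<in> z" "(0,1) \<in> D \<longleftrightarrow> (i \<in> I) \<noteq> (j \<in> I)" "(0,2) \<in> D \<longleftrightarrow> (e \<in> z) \<noteq> ((i \<in> I) \<noteq> (j \<in> I))"
      "(1,0) \<in> D \<longleftrightarrow> (k \<in> I) \<noteq> (l \<in> I)" "(2,0) \<in> D \<longleftrightarrow> (e \<in> z) \<noteq> ((k \<in> I) \<noteq> (l \<in> I))"
      "(1,1) \<in> D \<longleftrightarrow> (i \<in> I) \<noteq> (k \<in> I)" "(1,2) \<in> D \<longleftrightarrow> (i \<in> I) \<noteq> (l \<in> I)"
      "(2,1) \<in> D \<longleftrightarrow> (j \<in> I) \<noteq> (k \<in> I)" "(2,2) \<in> D \<longleftrightarrow> (e \<in> z) \<noteq> ((j \<in> I) \<noteq> (l \<in> I))"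
      unfolding D_def by simp_all
    have "D \<subseteq> grid" unfolding D_def grid_def by blast
    then have "grid_even D" unfolding grid_even_def by (simp only: ball_simps D) blast
    then show "\<exists>D\<in>Collect grid_even. \<forall>x\<in>\<Union>Z. x \<in> z \<longleftrightarrow> \<pi>' x \<in> D"
      using main[OF z I(2) D] by (intro bexI[of _ D]) simp_all
  next
    fix D assume "D \<in> Collect grid_even"
    then have g: "\<forall>r\<in>{0,1,2}. ((r,2) \<in> D) = (((r,0) \<in> D) \<noteq> ((r,1) \<in> D))" "\<forall>c\<in>{0,1,2}. ((2,c) \<in> D) = (((0,c) \<in> D) \<noteq> ((1,c) \<in> D))"
      unfolding mem_Collect_eq grid_even_def by argo+
    \<comment> \<open>One side of a cut may be assumed to avoid \<open>i\<close>; the other vertices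
      are read off from the cells of \<open>ij\<close>, \<open>ik\<close> and
      \<open>il\<close>.\<close>
    define I where "I = (if (0,1) \<in> D then {j} else {}) \<union> (if (1,1) \<in> D then {k} else {}) \<union> (if (1,2) \<in> D then {l} else {})"
    have I: "I \<subseteq> V" by (auto simp: I_def V)
    have mI: "i \<notin> I" "j \<in> I \<longleftrightarrow> (0,1) \<in> D" "k \<in> I \<longleftrightarrow> (1,1) \<in> D" "l \<in> I \<longleftrightarrow> (1,2) \<in> D" using d by (auto simp: I_def)
    obtain z where z0: "z \<in> Z" "(e \<in> z) = ((0,0) \<in> D)"
      "\<forall>x\<in>?E. x \<in> z \<longleftrightarrow> (((0,0) \<in> D \<and> x \<in> X) \<noteq> crosses I (\<pi> x))"
      by (rule signed_form_ex[OF Z s I])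
    note z = z0(1,2) z0(3)[rule_format]
    have g': "(0,2) \<in> D \<longleftrightarrow> ((0,0) \<in> D) \<noteq> ((0,1) \<in> D)" "(1,2) \<in> D \<longleftrightarrow> ((1,0) \<in> D) \<noteq> ((1,1) \<in> D)" "(2,2) \<in> D \<longleftrightarrow> ((2,0) \<in> D) \<noteq> ((2,1) \<in> D)"
      "(2,0) \<in> D \<longleftrightarrow> ((0,0) \<in> D) \<noteq> ((1,0) \<in> D)" "(2,1) \<in> D \<longleftrightarrow> ((0,1) \<in> D) \<noteq> ((1,1) \<in> D)"
      using g by auto
    have "\<forall>x\<in>\<Union>Z. x \<in> z \<longleftrightarrow> \<pi>' x \<in> D"
    proof (rule main[OF z(1) z(3)[folded z(2)]])
      show "(0,0) \<in> D \<longleftrightarrow> e \<in> z" "(0,1) \<in> D \<longleftrightarrow> (i \<in> I) \<noteq> (j \<in> I)" "(0,2) \<in> D \<longleftrightarrow> (e \<in> z) \<noteq> ((i \<in> I) \<noteq> (j \<in> I))"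
      "(1,0) \<in> D \<longleftrightarrow> (k \<in> I) \<noteq> (l \<in> I)" "(2,0) \<in> D \<longleftrightarrow> (e \<in> z) \<noteq> ((k \<in> I) \<noteq> (l \<in> I))"
      "(1,1) \<in> D \<longleftrightarrow> (i \<in> I) \<noteq> (k \<in> I)" "(1,2) \<in> D \<longleftrightarrow> (i \<in> I) \<noteq> (l \<in> I)"
      "(2,1) \<in> D \<longleftrightarrow> (j \<in> I) \<noteq> (k \<in> I)" "(2,2) \<in> D \<longleftrightarrow> (e \<in> z) \<noteq> ((j \<in> I) \<noteq> (l \<in> I))"
        using z(2) mI g' by argo+
    qed
    then show "\<exists>z\<in>Z. \<forall>x\<in>\<Union>Z. x \<in> z \<longleftrightarrow> \<pi>' x \<in> D" using z(1) by blast
  qed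
  then show ?thesis by (rule that)
qed

section \<open>Spaces in which the members avoiding an element come from
  \<open>K(3,3)\<close>\<close>

lemma pulled_ex:
  assumes "pulled Z \<pi> F Z0" "c \<in> F" shows "\<exists>x\<in>\<Union>Z. \<pi> x = c"
proof -
  have "c \<in> \<pi> ` \<Union>Z" using assms by (simp add: pulled_def)
  then show ?thesis by (elim imageE) (rule bexI, rule sym)
qed

text \<open>The analogue of \<open>signs\<close> for an arbitrary target: both values occur when
  \<open>X\<close> splits the fibre of \<open>c\<close>.\<close>

definition marks :: "'a set set \<Rightarrow> 'a \<Rightarrow> 'a set \<Rightarrow> ('a \<Rightarrow> 'c) \<Rightarrow> 'c \<Rightarrow> bool \<Rightarrow> bool" where
  "marks Z e X \<pi> c \<tau> \<longleftrightarrow> (\<exists>x\<in>\<Union>(avoid Z e). \<pi> x = c \<and> (x \<in> X) = \<tau>)"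

lemma edgesI: "u \<in> V \<Longrightarrow> v \<in> V \<Longrightarrow> u \<noteq> v \<Longrightarrow> {u, v} \<in> edges V"
  unfolding edges_def by blast

text \<open>Deleting an edge of \<open>K(3,3)\<close> leaves two vertices of degree two. The two
  edges at each of them are in series, and suppressing both vertices gives a complete graph on four
  vertices, which is self-dual, so its cycles are also the cuts of such a graph. Hence the deletion
  is again described by a signed graph.\<close>

lemma grid_contract:
  assumes Z: "cycle_space Z" and X: "X \<in> Z" "e \<in> X"
    and P: "pulled (avoid Z e) \<pi> grid (Collect grid_even)"
    and f: "f \<in> \<Union>(avoid Z e)" "\<pi> f = (0,0)" "(f \<in> X) = \<sigma>"
  obtains X' \<pi>' where "signed (avoid Z f) e X' {0,1,2,3::nat} \<pi>'"
    "\<forall>\<tau>. signs (avoid Z f) e X' \<pi>' 0 1 \<tau> \<longleftrightarrow> marks Z e X \<pi> (0,1) (\<tau> \<noteq> \<sigma>) \<or> marks Z e X \<pi> (0,2) \<tau>"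
    "\<forall>\<tau>. signs (avoid Z f) e X' \<pi>' 2 3 \<tau> \<longleftrightarrow> marks Z e X \<pi> (1,0) (\<tau> \<noteq> \<sigma>) \<or> marks Z e X \<pi> (2,0) \<tau>"
    "\<forall>\<tau>. signs (avoid Z f) e X' \<pi>' 0 2 \<tau> \<longleftrightarrow> marks Z e X \<pi> (1,1) (\<tau> \<noteq> \<sigma>)"
    "\<forall>\<tau>. signs (avoid Z f) e X' \<pi>' 0 3 \<tau> \<longleftrightarrow> marks Z e X \<pi> (1,2) \<tau>"
    "\<forall>\<tau>. signs (avoid Z f) e X' \<pi>' 1 2 \<tau> \<longleftrightarrow> marks Z e X \<pi> (2,1) \<tau>"
    "\<forall>\<tau>. signs (avoid Z f) e X' \<pi>' 1 3 \<tau> \<longleftrightarrow> marks Z e X \<pi> (2,2) \<tau>"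
proof -
  let ?E = "\<Union>(avoid Z e)" and ?Y = "avoid (avoid Z f) e"
  define cut where "cut D = {x \<in> ?E. \<pi> x \<in> D}" for D
  \<comment> \<open>A 4-cycle through the cell \<open>(0,0)\<close>, used to remove \<open>f\<close>
    from \<open>X\<close>. It flips the marks at its other three cells, which explains the shifts
    \<open>\<tau> \<noteq> \<sigma>\<close>.\<close>
  define D0 :: "(nat \<times> nat) set" where "D0 = {(0,0),(0,1),(1,0),(1,1)}"
  define X' where "X' = (if \<sigma> then sym_diff X (cut D0) else X)"
  \<comment> \<open>The labelling of \<open>matching_pulled\<close> with 0, 1, 2, 3 in place of
    \<open>i\<close>, \<open>j\<close>, \<open>k\<close>, \<open>l\<close>, and with each of the two
    series pairs sent to one edge.\<close>
  define h :: "nat \<times> nat \<Rightarrow> nat set" where "h c = (if c = (0,1) \<or> c = (0,2) then {0,1} else if c = (1,0) \<or> c = (2,0) then {2,3}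
     else if c = (1,1) then {0,2} else if c = (1,2) then {0,3} else if c = (2,1) then {1,2} else {1,3})" for c
  have hv: "h (0,1) = {0,1}" "h (0,2) = {0,1}" "h (1,0) = {2,3}" "h (2,0) = {2,3}" "h (1,1) = {0,2}" "h (1,2) = {0,3}"
    "h (2,1) = {1,2}" "h (2,2) = {1,3}" by (simp_all add: h_def)
  have cutZ: "cut D \<in> Z" "e \<notin> cut D" if "grid_even D" for D
  proof -
    have "cut D \<in> avoid Z e" unfolding cut_def by (rule pulled_mem[OF P]) (simp add: that)
    then show "cut D \<in> Z" "e \<notin> cut D" by (auto simp: avoid_def)
  qed
  have g0: "grid_even D0" by (simp add: D0_def grid_even_def grid_def)
  have pg: "\<pi> x \<in> grid" if "x \<in> ?E" for x using pulled_surj[OF P] that by blast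
  have gc: "c = (0,0) \<or> c = (0,1) \<or> c = (0,2) \<or> c = (1,0) \<or> c = (2,0) \<or> c = (1,1) \<or> c = (1,2) \<or> c = (2,1) \<or> c = (2,2)"
    if "c \<in> grid" for c using that unfolding grid_def by blast
  have Y: "z \<in> ?Y \<longleftrightarrow> z \<in> avoid Z e \<and> f \<notin> z" for z by (auto simp: avoid_def)
  have Yc: "\<exists>D. grid_even D \<and> (0,0) \<notin> D \<and> z = cut D" if z: "z \<in> ?Y" for z
  proof -
    from z have "z \<in> avoid Z e" "f \<notin> z" unfolding Y by auto
    obtain D where D: "D \<in> Collect grid_even" "z = {x \<in> ?E. \<pi> x \<in> D}" by (rule pulledE[OF P \<open>z \<in> avoid Z e\<close>])
    then show ?thesis using \<open>f \<notin> z\<close> f(1,2) unfolding cut_def by auto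
  qed
  have cY: "cut D \<in> ?Y" if "grid_even D" "(0,0) \<notin> D" for D
    using cutZ[OF that(1)] f that(2) by (auto simp: avoid_def cut_def)
  have EY: "\<Union>?Y = {x \<in> ?E. \<pi> x \<noteq> (0,0)}"
  proof (intro equalityI subsetI)
    fix x assume "x \<in> \<Union>?Y"
    then obtain z where z: "z \<in> ?Y" "x \<in> z" by blast
    from Yc[OF z(1)] obtain D where "grid_even D" "(0,0) \<notin> D" "z = cut D" by blast
    then show "x \<in> {x \<in> ?E. \<pi> x \<noteq> (0,0)}" using z(2) by (auto simp: cut_def)
  next
    fix x assume x: "x \<in> {x \<in> ?E. \<pi> x \<noteq> (0,0)}"
    \<comment> \<open>Three cycles that avoid \<open>(0,0)\<close> and together cover all other
      cells.\<close>
    define D1 :: "(nat \<times> nat) set" where "D1 = {(0,1),(0,2),(1,1),(1,2)}"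
    define D2 :: "(nat \<times> nat) set" where "D2 = {(1,0),(2,0),(1,1),(2,1)}"
    define D3 :: "(nat \<times> nat) set" where "D3 = {(1,1),(1,2),(2,1),(2,2)}"
    have "grid_even D1" "grid_even D2" "grid_even D3" "(0,0) \<notin> D1" "(0,0) \<notin> D2" "(0,0) \<notin> D3"
      by (simp_all add: D1_def D2_def D3_def grid_even_def grid_def)
    then have "cut D1 \<in> ?Y" "cut D2 \<in> ?Y" "cut D3 \<in> ?Y" using cY by blast+
    moreover have "\<pi> x \<in> D1 \<or> \<pi> x \<in> D2 \<or> \<pi> x \<in> D3"
      using gc[of "\<pi> x"] pg[of x] x unfolding D1_def D2_def D3_def by auto
    then have "x \<in> cut D1 \<or> x \<in> cut D2 \<or> x \<in> cut D3" using x by (simp add: cut_def)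
    ultimately show "x \<in> \<Union>?Y" by blast
  qed
  define \<pi>' where "\<pi>' x = h (\<pi> x)" for x
  have ed: "edges {0,1,2,3::nat} = {{0,1},{2,3},{0,2},{0,3},{1,2},{1,3}}"
  proof (intro equalityI subsetI)
    fix d assume "d \<in> edges {0,1,2,3::nat}"
    then obtain u v where "d = {u, v}" "u \<in> {0,1,2,3}" "v \<in> {0,1,2,3}" "u \<noteq> v" unfolding edges_def by blast
    then show "d \<in> {{0,1},{2,3},{0,2},{0,3},{1,2},{1,3}}"
      by (elim insertE emptyE; simp add: insert_commute)
  next
    fix d assume "d \<in> {{0,1},{2,3},{0,2},{0,3},{1,2},{1,3::nat}}"
    then show "d \<in> edges {0,1,2,3}" by (elim insertE emptyE) (simp_all add: edgesI)
  qed
  have surj: "\<pi>' ` \<Union>?Y = edges {0,1,2,3}"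
  proof
    show "\<pi>' ` \<Union>?Y \<subseteq> edges {0,1,2,3}"
    proof
      fix d assume "d \<in> \<pi>' ` \<Union>?Y"
      then obtain x where x: "x \<in> ?E" "\<pi> x \<noteq> (0,0)" "d = h (\<pi> x)" unfolding EY \<pi>'_def by blast
      show "d \<in> edges {0,1,2,3}" using gc[OF pg[OF x(1)]] x(2) unfolding x(3) ed by (elim disjE) (simp_all add: h_def)
    qed
    have ex: "h c \<in> \<pi>' ` \<Union>?Y" if c: "c \<in> grid" "c \<noteq> (0,0)" for c
    proof -
      obtain x where "x \<in> ?E" "\<pi> x = c" using pulled_ex[OF P c(1)] by (elim bexE) (rule that)
      then show ?thesis unfolding EY \<pi>'_def using c(2) by blast
    qed
    show "edges {0,1,2,3} \<subseteq> \<pi>' ` \<Union>?Y" unfolding ed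
      using ex[of "(0,1)"] ex[of "(1,0)"] ex[of "(1,1)"] ex[of "(1,2)"] ex[of "(2,1)"] ex[of "(2,2)"]
      by (simp add: h_def grid_def)
  qed
  have cell: "c \<in> D \<longleftrightarrow> crosses I (h c)"
    if g: "grid_even D" "(0,0) \<notin> D" and c: "c \<in> grid" "c \<noteq> (0,0)" and
      I: "0 \<notin> I" "1 \<in> I \<longleftrightarrow> (0,1) \<in> D" "2 \<in> I \<longleftrightarrow> (1,1) \<in> D" "3 \<in> I \<longleftrightarrow> (1,2) \<in> D" for c D I
  proof -
    have g': "((0,2) \<in> D) = (((0,0) \<in> D) \<noteq> ((0,1) \<in> D))" "((1,2) \<in> D) = (((1,0) \<in> D) \<noteq> ((1,1) \<in> D))"
      "((2,2) \<in> D) = (((2,0) \<in> D) \<noteq> ((2,1) \<in> D))" "((2,0) \<in> D) = (((0,0) \<in> D) \<noteq> ((1,0) \<in> D))"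
      "((2,1) \<in> D) = (((0,1) \<in> D) \<noteq> ((1,1) \<in> D))" using g(1) unfolding grid_even_def by blast+
    show ?thesis using gc[OF c(1)] c(2)
      by (elim disjE; hypsubst; (simp only: hv crosses_pair)?) (use g' g(2) I in \<open>argo | simp\<close>)+
  qed
  have "pulled ?Y \<pi>' (edges {0,1,2,3}) (cuts {0,1,2,3})"
  proof (rule pulledI[OF surj])
    fix z assume "z \<in> ?Y"
    from Yc[OF this] obtain D where D: "grid_even D" "(0,0) \<notin> D" "z = cut D" by blast
    define I :: "nat set" where "I = (if (0,1) \<in> D then {1} else {}) \<union> (if (1,1) \<in> D then {2} else {}) \<union> (if (1,2) \<in> D then {3} else {})"
    have I: "0 \<notin> I" "1 \<in> I \<longleftrightarrow> (0,1) \<in> D" "2 \<in> I \<longleftrightarrow> (1,1) \<in> D" "3 \<in> I \<longleftrightarrow> (1,2) \<in> D" "I \<subseteq> {0,1,2,3}"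
      by (simp_all add: I_def)
    show "\<exists>D\<in>cuts {0,1,2,3}. \<forall>x\<in>\<Union>?Y. x \<in> z \<longleftrightarrow> \<pi>' x \<in> D"
    proof (rule bexI[of _ "{d \<in> edges {0,1,2,3}. crosses I d}"])
      show "\<forall>x\<in>\<Union>?Y. x \<in> z \<longleftrightarrow> \<pi>' x \<in> {d \<in> edges {0,1,2,3}. crosses I d}"
      proof
        fix x assume x: "x \<in> \<Union>?Y"
        then have x': "x \<in> ?E" "\<pi> x \<noteq> (0,0)" unfolding EY by auto
        have "\<pi>' x \<in> edges {0,1,2,3}" using surj x by blast
        then show "x \<in> z \<longleftrightarrow> \<pi>' x \<in> {d \<in> edges {0,1,2,3}. crosses I d}"
          using cell[OF D(1,2) pg[OF x'(1)] x'(2) I(1-4)] x'(1) unfolding D(3) cut_def \<pi>'_def by simp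
      qed
      show "{d \<in> edges {0,1,2,3}. crosses I d} \<in> cuts {0,1,2,3}" unfolding cuts_def using I(5) by blast
    qed
  next
    fix C assume "C \<in> cuts {0,1,2,3::nat}"
    then obtain I where I: "I \<subseteq> {0,1,2,3}" "C = {d \<in> edges {0,1,2,3}. crosses I d}" unfolding cuts_def by blast
    define D where "D = {c \<in> grid. c \<noteq> (0,0) \<and> crosses I (h c)}"
    have m: "(0,0) \<notin> D" "(0,1) \<in> D \<longleftrightarrow> (0 \<in> I) \<noteq> (1 \<in> I)" "(0,2) \<in> D \<longleftrightarrow> (0 \<in> I) \<noteq> (1 \<in> I)" "(1,0) \<in> D \<longleftrightarrow> (2 \<in> I) \<noteq> (3 \<in> I)"
      "(2,0) \<in> D \<longleftrightarrow> (2 \<in> I) \<noteq> (3 \<in> I)" "(1,1) \<in> D \<longleftrightarrow> (0 \<in> I) \<noteq> (2 \<in> I)" "(1,2) \<in> D \<longleftrightarrow> (0 \<in> I) \<noteq> (3 \<in> I)"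
      "(2,1) \<in> D \<longleftrightarrow> (1 \<in> I) \<noteq> (2 \<in> I)" "(2,2) \<in> D \<longleftrightarrow> (1 \<in> I) \<noteq> (3 \<in> I)"
      unfolding D_def mem_Collect_eq hv crosses_pair by (simp_all add: grid_def)
    have "D \<subseteq> grid" by (auto simp: D_def)
    then have g: "grid_even D" unfolding grid_even_def by (simp only: ball_simps m) blast
    show "\<exists>z\<in>?Y. \<forall>x\<in>\<Union>?Y. x \<in> z \<longleftrightarrow> \<pi>' x \<in> C"
    proof (rule bexI[OF _ cY[OF g m(1)]], rule ballI)
      fix x assume x: "x \<in> \<Union>?Y"
      then have x': "x \<in> ?E" "\<pi> x \<noteq> (0,0)" unfolding EY by auto
      have "\<pi>' x \<in> edges {0,1,2,3}" using surj x by blast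
      then show "x \<in> cut D \<longleftrightarrow> \<pi>' x \<in> C" using x' pg[OF x'(1)] unfolding I(2) D_def cut_def \<pi>'_def by simp
    qed
  qed
  moreover have "X' \<in> avoid Z f" using X cutZ[OF g0] cycle_space_sym_diff[OF Z X(1), of "cut D0"] f
    by (auto simp: X'_def avoid_def cut_def D0_def)
  moreover have "e \<in> X'" using X cutZ[OF g0] by (auto simp: X'_def)
  ultimately have sg: "signed (avoid Z f) e X' {0,1,2,3} \<pi>'" unfolding signed_def by simp
  have xX': "x \<in> X' \<longleftrightarrow> ((x \<in> X) \<noteq> (\<sigma> \<and> \<pi> x \<in> D0))" if "x \<in> ?E" for x
    using that by (auto simp: X'_def cut_def)
  have S: "signs (avoid Z f) e X' \<pi>' a b \<tau> \<longleftrightarrow> (\<exists>c\<in>S. marks Z e X \<pi> c (\<tau> \<noteq> (\<sigma> \<and> c \<in> D0)))"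
    if S: "\<And>c. c \<in> grid \<Longrightarrow> c \<noteq> (0,0) \<Longrightarrow> h c = {a, b} \<longleftrightarrow> c \<in> S" "(0,0) \<notin> S" for a b \<tau> S
  proof
    assume "signs (avoid Z f) e X' \<pi>' a b \<tau>"
    then obtain x where x: "x \<in> \<Union>?Y" "h (\<pi> x) = {a, b}" "(x \<in> X') = \<tau>" unfolding signs_def \<pi>'_def by blast
    then have x': "x \<in> ?E" "\<pi> x \<noteq> (0,0)" unfolding EY by auto
    have "\<pi> x \<in> S" using S(1)[OF pg[OF x'(1)] x'(2)] x(2) by simp
    moreover have "(x \<in> X) = (\<tau> \<noteq> (\<sigma> \<and> \<pi> x \<in> D0))" using xX'[OF x'(1)] x(3) by blast
    ultimately show "\<exists>c\<in>S. marks Z e X \<pi> c (\<tau> \<noteq> (\<sigma> \<and> c \<in> D0))"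
      unfolding marks_def using x'(1) by (intro bexI[of _ "\<pi> x"]) (rule bexI[of _ x], simp_all)
  next
    assume "\<exists>c\<in>S. marks Z e X \<pi> c (\<tau> \<noteq> (\<sigma> \<and> c \<in> D0))"
    then obtain c where c: "c \<in> S" "marks Z e X \<pi> c (\<tau> \<noteq> (\<sigma> \<and> c \<in> D0))" by (elim bexE)
    then obtain x where x: "x \<in> ?E" "\<pi> x = c" "(x \<in> X) = (\<tau> \<noteq> (\<sigma> \<and> c \<in> D0))"
      unfolding marks_def by (elim bexE conjE) (rule that)
    have "c \<noteq> (0,0)" using c(1) S(2) by blast
    then have "x \<in> \<Union>?Y" "h (\<pi> x) = {a, b}" unfolding EY using x S(1)[of c] c(1) pg[OF x(1)] by auto
    moreover have "(x \<in> X') = \<tau>" using xX'[OF x(1)] x(2,3) by blast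
    ultimately show "signs (avoid Z f) e X' \<pi>' a b \<tau>" unfolding signs_def \<pi>'_def by blast
  qed
  have hS: "h c = {0,1} \<longleftrightarrow> c \<in> {(0,1),(0,2)}" "h c = {2,3} \<longleftrightarrow> c \<in> {(1,0),(2,0)}" "h c = {0,2} \<longleftrightarrow> c \<in> {(1,1)}"
    "h c = {0,3} \<longleftrightarrow> c \<in> {(1,2)}" "h c = {1,2} \<longleftrightarrow> c \<in> {(2,1)}" "h c = {1,3} \<longleftrightarrow> c \<in> {(2,2)}"
    if "c \<in> grid" "c \<noteq> (0,0)" for c
    using gc[OF that(1)] that(2) by (elim disjE; simp add: h_def doubleton_eq_iff)+
  show ?thesis
  proof (rule that[OF sg])
    show "\<forall>\<tau>. signs (avoid Z f) e X' \<pi>' 0 1 \<tau> \<longleftrightarrow> marks Z e X \<pi> (0,1) (\<tau> \<noteq> \<sigma>) \<or> marks Z e X \<pi> (0,2) \<tau>"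
      by (subst S[OF hS(1)]) (simp_all add: D0_def)
    show "\<forall>\<tau>. signs (avoid Z f) e X' \<pi>' 2 3 \<tau> \<longleftrightarrow> marks Z e X \<pi> (1,0) (\<tau> \<noteq> \<sigma>) \<or> marks Z e X \<pi> (2,0) \<tau>"
      by (subst S[OF hS(2)]) (simp_all add: D0_def)
    show "\<forall>\<tau>. signs (avoid Z f) e X' \<pi>' 0 2 \<tau> \<longleftrightarrow> marks Z e X \<pi> (1,1) (\<tau> \<noteq> \<sigma>)"
      by (subst S[OF hS(3)]) (simp_all add: D0_def)
    show "\<forall>\<tau>. signs (avoid Z f) e X' \<pi>' 0 3 \<tau> \<longleftrightarrow> marks Z e X \<pi> (1,2) \<tau>"
      by (subst S[OF hS(4)]) (simp_all add: D0_def)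
    show "\<forall>\<tau>. signs (avoid Z f) e X' \<pi>' 1 2 \<tau> \<longleftrightarrow> marks Z e X \<pi> (2,1) \<tau>"
      by (subst S[OF hS(5)]) (simp_all add: D0_def)
    show "\<forall>\<tau>. signs (avoid Z f) e X' \<pi>' 1 3 \<tau> \<longleftrightarrow> marks Z e X \<pi> (2,2) \<tau>"
      by (subst S[OF hS(6)]) (simp_all add: D0_def)
  qed
qed

lemma matching_four:
  assumes Z: "tight Z" and s: "signed Z e X {0,1,2,3::nat} \<pi>" and m: "is_matching {0,1,2,3} (signs Z e X \<pi>)"
  defines "S \<equiv> \<lambda>a b. single (signs Z e X \<pi>) a b"
  shows "(\<not> S 0 1 \<and> \<not> S 2 3 \<and> S 0 2 \<and> S 0 3 \<and> S 1 2 \<and> S 1 3) \<or>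
    (\<not> S 0 2 \<and> \<not> S 1 3 \<and> S 0 1 \<and> S 2 3 \<and> S 0 3 \<and> S 1 2) \<or>
    (\<not> S 0 3 \<and> \<not> S 1 2 \<and> S 0 1 \<and> S 2 3 \<and> S 0 2 \<and> S 1 3)"
proof -
  interpret signed_class "realizable TYPE('a) :: nat set \<Rightarrow> _" by (rule signed_class_realizable)
  let ?B = "signs Z e X \<pi>"
  have G: "realizable TYPE('a) {0,1,2,3} ?B" by (rule realizableI[OF Z s]) simp
  obtain i j k l where V: "{0,1,2,3} = {i, j, k, l}" and ma: "matching_at ?B i j k l"
    using m unfolding is_matching_def by blast
  have sy: "S a b = S b a" for a b unfolding S_def single_def signs_sym[of Z e X \<pi> a b] ..
  obtain z where z: "z \<in> {0,1,2,3}" "z \<noteq> 0" "\<not> single ?B 0 z"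
  proof -
    have "(0::nat) \<in> {0,1,2,3}" by simp
    from matching_ex_partner[OF G ma V this] show ?thesis using that by blast
  qed
  have V2: "{0,1,2,3} = {0,2,1,3::nat}" and V3: "{0,1,2,3} = {0,3,1,2::nat}" by auto
  from z(1,2) consider "z = 1" | "z = 2" | "z = 3" by blast
  then show ?thesis
  proof cases
    case 1
    then show ?thesis using matching_partner[OF G _ ma V] z(3) unfolding S_def by simp
  next
    case 2
    then show ?thesis using matching_partner[OF G[unfolded V2] _ ma V[unfolded V2]] z(3) sy[of 1 2] unfolding S_def by simp
  next
    case 3
    then show ?thesis using matching_partner[OF G[unfolded V3] _ ma V[unfolded V3]] z(3) sy[of 1 3] sy[of 2 3] unfolding S_def by simp
  qed
qed

definition doubled :: "(bool \<Rightarrow> bool) \<Rightarrow> bool" where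
  "doubled C \<longleftrightarrow> C True \<and> C False"

text \<open>Without a star, the signed graph on four vertices is a matching, and its three possible
  pairings become conditions on the marks. In the last conclusion \<open>f\<close> supplies the mark
  of \<open>(0,0)\<close>: row 0 and column 0 each have an odd number of cells marked
  \<open>True\<close>.\<close>

lemma grid_match:
  assumes Z: "tight Z" and X: "X \<in> Z" "e \<in> X"
    and P: "pulled (avoid Z e) \<pi> grid (Collect grid_even)"
    and f: "f \<in> \<Union>(avoid Z e)" "\<pi> f = (0,0)"
    and nostar: "\<And>X' \<pi>' l. signed (avoid Z f) e X' {0,1,2,3::nat} \<pi>' \<Longrightarrow>
        \<not> star_at {0,1,2,3} (signs (avoid Z f) e X' \<pi>') l"
  defines "C \<equiv> marks Z e X \<pi>"
  shows "doubled (C (1,1)) \<Longrightarrow> \<not> doubled (C (2,0))"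
    and "doubled (C (1,2)) \<Longrightarrow> doubled (C (2,1))"
    and "(\<And>c. c \<in> grid \<Longrightarrow> \<not> doubled (C c)) \<Longrightarrow>
        ((C (0,1) True \<noteq> (f \<in> X)) \<noteq> C (0,2) True) \<and> ((C (1,0) True \<noteq> (f \<in> X)) \<noteq> C (2,0) True)"
proof -
  define \<sigma> where "\<sigma> = (f \<in> X)"
  obtain X' \<pi>' where s: "signed (avoid Z f) e X' {0,1,2,3::nat} \<pi>'"
    and B: "\<forall>\<tau>. signs (avoid Z f) e X' \<pi>' 0 1 \<tau> \<longleftrightarrow> C (0,1) (\<tau> \<noteq> \<sigma>) \<or> C (0,2) \<tau>"
    "\<forall>\<tau>. signs (avoid Z f) e X' \<pi>' 2 3 \<tau> \<longleftrightarrow> C (1,0) (\<tau> \<noteq> \<sigma>) \<or> C (2,0) \<tau>"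
    "\<forall>\<tau>. signs (avoid Z f) e X' \<pi>' 0 2 \<tau> \<longleftrightarrow> C (1,1) (\<tau> \<noteq> \<sigma>)"
    "\<forall>\<tau>. signs (avoid Z f) e X' \<pi>' 0 3 \<tau> \<longleftrightarrow> C (1,2) \<tau>"
    "\<forall>\<tau>. signs (avoid Z f) e X' \<pi>' 1 2 \<tau> \<longleftrightarrow> C (2,1) \<tau>"
    "\<forall>\<tau>. signs (avoid Z f) e X' \<pi>' 1 3 \<tau> \<longleftrightarrow> C (2,2) \<tau>"
    unfolding C_def by (rule grid_contract[OF tight_cycle_space[OF Z] X P f \<sigma>_def[symmetric]])
  let ?S = "single (signs (avoid Z f) e X' \<pi>')"
  have "is_matching {0,1,2,3} (signs (avoid Z f) e X' \<pi>')"
    using signed_classify[OF tight_avoid[OF Z] s] nostar[OF s] by auto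
  note M = matching_four[OF tight_avoid[OF Z] s this]
  have ne: "C c True \<or> C c False" if c: "c \<in> grid" for c
  proof -
    obtain x where "x \<in> \<Union>(avoid Z e)" "\<pi> x = c" using pulled_ex[OF P c] by (elim bexE) (rule that)
    then have "C c (x \<in> X)" unfolding C_def marks_def by (intro bexI[of _ x] conjI refl)
    then show ?thesis by (cases "x \<in> X") simp_all
  qed
  have n: "C (0,1) True \<or> C (0,1) False" "C (0,2) True \<or> C (0,2) False" "C (1,0) True \<or> C (1,0) False" "C (2,0) True \<or> C (2,0) False"
    by (rule ne; simp add: grid_def)+
  have s1: "?S 0 1 \<longleftrightarrow> \<not> ((C (0,1) (\<not> \<sigma>) \<or> C (0,2) True) \<and> (C (0,1) \<sigma> \<or> C (0,2) False))"
    "?S 2 3 \<longleftrightarrow> \<not> ((C (1,0) (\<not> \<sigma>) \<or> C (2,0) True) \<and> (C (1,0) \<sigma> \<or> C (2,0) False))"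
    unfolding single_def using B(1,2) by simp_all
  have s2: "?S 0 2 \<longleftrightarrow> \<not> doubled (C (1,1))"
    unfolding single_def doubled_def using B(3) by (cases \<sigma>) auto
  have s3: "?S 0 3 \<longleftrightarrow> \<not> doubled (C (1,2))" "?S 1 2 \<longleftrightarrow> \<not> doubled (C (2,1))" "?S 1 3 \<longleftrightarrow> \<not> doubled (C (2,2))"
    unfolding single_def doubled_def using B(4-6) by simp_all
  show "doubled (C (1,1)) \<Longrightarrow> \<not> doubled (C (2,0))"
  proof -
    assume "doubled (C (1,1))"
    then have "?S 2 3" using M s2 by blast
    then show ?thesis unfolding s1 doubled_def using n(3) by (cases \<sigma>) auto
  qed
  show "doubled (C (1,2)) \<Longrightarrow> doubled (C (2,1))" using M s3 by blast
  assume "\<And>c. c \<in> grid \<Longrightarrow> \<not> doubled (C c)"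
  then have nd: "\<not> doubled (C (0,1))" "\<not> doubled (C (0,2))" "\<not> doubled (C (1,0))" "\<not> doubled (C (2,0))"
    "\<not> doubled (C (1,1))" "\<not> doubled (C (1,2))" by (simp_all add: grid_def)
  \<comment> \<open>With \<open>02\<close> and \<open>03\<close> single, the doubled edges are
    \<open>01\<close> and \<open>23\<close>. Each of these collects two cells that are not doubled,
    so their marks differ after the shift.\<close>
  then have "\<not> ?S 0 1" "\<not> ?S 2 3" using M s2 s3 by blast+
  then show "((C (0,1) True \<noteq> (f \<in> X)) \<noteq> C (0,2) True) \<and> ((C (1,0) True \<noteq> (f \<in> X)) \<noteq> C (2,0) True)"
    unfolding s1 \<sigma>_def[symmetric] using nd(1-4) n unfolding doubled_def by (cases \<sigma>) auto
qed

text \<open>Brings the row or column \<open>a\<close> to position 0, so that facts about the cell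
  \<open>(0,0)\<close> become available for every cell.\<close>

definition swap0 :: "nat \<Rightarrow> nat \<Rightarrow> nat" where
  "swap0 a x = (if x = 0 then a else if x = a then 0 else x)"

lemma swap0_invol [simp]: "swap0 a (swap0 a x) = x"
  by (simp add: swap0_def)

lemma grid_even_swap:
  assumes "grid_even D" "a \<in> {0,1,2}" "b \<in> {0,1,2}"
  shows "grid_even {c \<in> grid. (swap0 a (fst c), swap0 b (snd c)) \<in> D}"
proof -
  have g: "((0,2) \<in> D) = (((0,0) \<in> D) \<noteq> ((0,1) \<in> D))" "((1,2) \<in> D) = (((1,0) \<in> D) \<noteq> ((1,1) \<in> D))"
      "((2,2) \<in> D) = (((2,0) \<in> D) \<noteq> ((2,1) \<in> D))" "((2,0) \<in> D) = (((0,0) \<in> D) \<noteq> ((1,0) \<in> D))"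
      "((2,1) \<in> D) = (((0,1) \<in> D) \<noteq> ((1,1) \<in> D))" using assms(1) unfolding grid_even_def by blast+
  have G: "(r, c) \<in> grid" if "r \<in> {0,1,2}" "c \<in> {0,1,2}" for r c using that by (auto simp: grid_def)
  let ?D = "{c \<in> grid. (swap0 a (fst c), swap0 b (snd c)) \<in> D}"
  have m: "(r, c) \<in> ?D \<longleftrightarrow> (swap0 a r, swap0 b c) \<in> D" if "r \<in> {0,1,2}" "c \<in> {0,1,2}" for r c
    using G[OF that] by simp
  have sw: "swap0 0 r = r" "swap0 1 0 = 1" "swap0 1 1 = 0" "swap0 1 2 = 2" "swap0 2 0 = 2" "swap0 2 1 = 1" "swap0 2 2 = 0" for r
    by (simp_all add: swap0_def)
  have mm: "(0,0) \<in> ?D \<longleftrightarrow> (swap0 a 0, swap0 b 0) \<in> D" "(0,1) \<in> ?D \<longleftrightarrow> (swap0 a 0, swap0 b 1) \<in> D" "(0,2) \<in> ?D \<longleftrightarrow> (swap0 a 0, swap0 b 2) \<in> D"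
    "(1,0) \<in> ?D \<longleftrightarrow> (swap0 a 1, swap0 b 0) \<in> D" "(1,1) \<in> ?D \<longleftrightarrow> (swap0 a 1, swap0 b 1) \<in> D" "(1,2) \<in> ?D \<longleftrightarrow> (swap0 a 1, swap0 b 2) \<in> D"
    "(2,0) \<in> ?D \<longleftrightarrow> (swap0 a 2, swap0 b 0) \<in> D" "(2,1) \<in> ?D \<longleftrightarrow> (swap0 a 2, swap0 b 1) \<in> D" "(2,2) \<in> ?D \<longleftrightarrow> (swap0 a 2, swap0 b 2) \<in> D"
    by (rule m; simp)+
  have "?D \<subseteq> grid" by blast
  then show ?thesis unfolding grid_even_def ball_simps mm
    using assms(2,3) by (elim insertE emptyE; simp only: sw) (use g in \<open>blast | argo\<close>)+
qed

lemma grid_relabel: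
  assumes P: "pulled W \<pi> grid (Collect grid_even)" and a: "a \<in> {0,1,2}" and b: "b \<in> {0,1,2}"
  shows "pulled W (\<lambda>x. (swap0 a (fst (\<pi> x)), swap0 b (snd (\<pi> x)))) grid (Collect grid_even)"
proof (rule pulledI)
  let ?s = "\<lambda>c. (swap0 a (fst c), swap0 b (snd c))"
  have G: "?s c \<in> grid" if "c \<in> grid" for c
    using that a b unfolding grid_def by (elim insertE emptyE; simp add: swap0_def)
  have ss: "?s (?s c) = c" for c by simp
  have pg: "\<pi> x \<in> grid" if "x \<in> \<Union>W" for x using pulled_surj[OF P] that by blast
  show "(\<lambda>x. ?s (\<pi> x)) ` \<Union>W = grid"
  proof
    show "(\<lambda>x. ?s (\<pi> x)) ` \<Union>W \<subseteq> grid" using G pg by blast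
    show "grid \<subseteq> (\<lambda>x. ?s (\<pi> x)) ` \<Union>W"
    proof
      fix c assume "c \<in> grid"
      then obtain x where x: "x \<in> \<Union>W" "\<pi> x = ?s c" using G pulled_surj[OF P] by (metis imageE)
      then have "?s (\<pi> x) = c" by simp
      then show "c \<in> (\<lambda>x. ?s (\<pi> x)) ` \<Union>W" using x(1) by (metis (no_types, lifting) imageI)
    qed
  qed
  fix z assume "z \<in> W"
  then obtain D where D: "D \<in> Collect grid_even" "z = {x \<in> \<Union>W. \<pi> x \<in> D}" by (rule pulledE[OF P])
  show "\<exists>D\<in>Collect grid_even. \<forall>x\<in>\<Union>W. x \<in> z \<longleftrightarrow> ?s (\<pi> x) \<in> D"
  proof (rule bexI[of _ "{c \<in> grid. ?s c \<in> D}"])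
    show "\<forall>x\<in>\<Union>W. x \<in> z \<longleftrightarrow> ?s (\<pi> x) \<in> {c \<in> grid. ?s c \<in> D}"
      using D(2) G pg by simp
    show "{c \<in> grid. ?s c \<in> D} \<in> Collect grid_even" using grid_even_swap[OF _ a b] D(1) by simp
  qed
next
  let ?s = "\<lambda>c. (swap0 a (fst c), swap0 b (snd c))"
  have pg: "\<pi> x \<in> grid" if "x \<in> \<Union>W" for x using pulled_surj[OF P] that by blast
  fix D assume "D \<in> Collect grid_even"
  then have "{c \<in> grid. ?s c \<in> D} \<in> Collect grid_even" using grid_even_swap[OF _ a b] by simp
  from pulled_mem[OF P this] show "\<exists>z\<in>W. \<forall>x\<in>\<Union>W. x \<in> z \<longleftrightarrow> ?s (\<pi> x) \<in> D"
    by (rule bexI[rotated]) (use pg in simp)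
qed

text \<open>Moving a doubled cell \<open>(0,0)\<close> once to \<open>(1,1)\<close> and once to
  \<open>(1,2)\<close> makes \<open>grid_match\<close> give opposite answers for the cell
  \<open>(2,1)\<close>.\<close>

lemma grid_no_doubled:
  assumes Z: "tight Z" and X: "X \<in> Z" "e \<in> X"
    and P: "pulled (avoid Z e) \<pi> grid (Collect grid_even)"
    and nostar: "\<And>f X' \<pi>' l. signed (avoid Z f) e X' {0,1,2,3::nat} \<pi>' \<Longrightarrow>
        \<not> star_at {0,1,2,3} (signs (avoid Z f) e X' \<pi>') l"
  shows "\<not> doubled (marks Z e X \<pi> (0,0))"
proof
  assume d: "doubled (marks Z e X \<pi> (0,0))"
  let ?E = "\<Union>(avoid Z e)"
  define \<pi>1 where "\<pi>1 x = (swap0 1 (fst (\<pi> x)), swap0 1 (snd (\<pi> x)))" for x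
  define \<pi>2 where "\<pi>2 x = (swap0 1 (fst (\<pi> x)), swap0 2 (snd (\<pi> x)))" for x
  have P1: "pulled (avoid Z e) \<pi>1 grid (Collect grid_even)" unfolding \<pi>1_def by (rule grid_relabel[OF P]) simp_all
  have P2: "pulled (avoid Z e) \<pi>2 grid (Collect grid_even)" unfolding \<pi>2_def by (rule grid_relabel[OF P]) simp_all
  have inv: "(swap0 a r, swap0 b c) = d \<longleftrightarrow> (r, c) = (swap0 a (fst d), swap0 b (snd d))" for a b r c d
    by (cases d) (auto simp del: swap0_invol, (metis swap0_invol)+)
  have m1: "marks Z e X \<pi>1 c = marks Z e X \<pi> (swap0 1 (fst c), swap0 1 (snd c))" for c
    unfolding marks_def[abs_def] \<pi>1_def inv by simp
  have m2: "marks Z e X \<pi>2 c = marks Z e X \<pi> (swap0 1 (fst c), swap0 2 (snd c))" for c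
    unfolding marks_def[abs_def] \<pi>2_def inv by simp
  have z: "(0,0) \<in> grid" by (simp add: grid_def)
  obtain f1 where f1: "f1 \<in> ?E" "\<pi>1 f1 = (0,0)" using pulled_ex[OF P1 z] by (elim bexE) (rule that)
  obtain f2 where f2: "f2 \<in> ?E" "\<pi>2 f2 = (0,0)" using pulled_ex[OF P2 z] by (elim bexE) (rule that)
  have "doubled (marks Z e X \<pi>1 (1,1))" using d by (simp add: m1 swap0_def)
  then have "\<not> doubled (marks Z e X \<pi>1 (2,0))" using grid_match(1)[OF Z X P1 f1 nostar] by blast
  moreover have "doubled (marks Z e X \<pi>2 (1,2))" using d by (simp add: m2 swap0_def)
  then have "doubled (marks Z e X \<pi>2 (2,1))" using grid_match(2)[OF Z X P2 f2 nostar] by blast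
  ultimately show False by (simp add: m1 m2 swap0_def)
qed

text \<open>Otherwise no cell is doubled and every line has an odd number of marked cells, so the
  unmarked cells form an even set. Adding its preimage to \<open>X\<close> gives a member that
  contains all elements of \<open>avoid Z e\<close>, against incomparability.\<close>

lemma grid_has_star:
  assumes Z: "tight Z" and X: "X \<in> Z" "e \<in> X"
    and P: "pulled (avoid Z e) \<pi> grid (Collect grid_even)"
  shows "\<exists>f X' \<pi>' l. signed (avoid Z f) e X' {0,1,2,3::nat} \<pi>' \<and> star_at {0,1,2,3} (signs (avoid Z f) e X' \<pi>') l"
proof (rule ccontr)
  assume "\<not> ?thesis"
  then have nostar: "\<And>f X' \<pi>' l. signed (avoid Z f) e X' {0,1,2,3::nat} \<pi>' \<Longrightarrow>
        \<not> star_at {0,1,2,3} (signs (avoid Z f) e X' \<pi>') l" by blast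
  let ?E = "\<Union>(avoid Z e)"
  define C where "C = marks Z e X \<pi>"
  have inv: "(swap0 a r, swap0 b c) = d \<longleftrightarrow> (r, c) = (swap0 a (fst d), swap0 b (snd d))" for a b r c d
    by (cases d) (auto simp del: swap0_invol, (metis swap0_invol)+)
  define \<rho> where "\<rho> a b x = (swap0 a (fst (\<pi> x)), swap0 b (snd (\<pi> x)))" for a b x
  have mr: "marks Z e X (\<rho> a b) c = C (swap0 a (fst c), swap0 b (snd c))" for a b c
    unfolding marks_def[abs_def] \<rho>_def inv C_def by simp
  have Pr: "pulled (avoid Z e) (\<rho> a b) grid (Collect grid_even)" if "a \<in> {0,1,2}" "b \<in> {0,1,2}" for a b
    unfolding \<rho>_def by (rule grid_relabel[OF P that])
  have nd: "\<not> doubled (C c)" if c: "c \<in> grid" for c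
  proof -
    have ab: "fst c \<in> {0,1,2}" "snd c \<in> {0,1,2}" using c unfolding grid_def by auto
    have "C c = marks Z e X (\<rho> (fst c) (snd c)) (0,0)" by (simp add: mr swap0_def)
    then show ?thesis using grid_no_doubled[OF Z X Pr[OF ab] nostar] by simp
  qed
  have ndr: "\<not> doubled (marks Z e X (\<rho> a b) c)" if "a \<in> {0,1,2}" "b \<in> {0,1,2}" "c \<in> grid" for a b c
  proof -
    have "(swap0 a (fst c), swap0 b (snd c)) \<in> grid"
      using that unfolding grid_def by (elim insertE emptyE; simp add: swap0_def)
    then show ?thesis unfolding mr by (rule nd)
  qed
  have sgn: "C (\<pi> x) True = (x \<in> X)" if x: "x \<in> ?E" for x
  proof -
    have "C (\<pi> x) (x \<in> X)" using x unfolding C_def marks_def by blast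
    moreover have "\<pi> x \<in> grid" using pulled_surj[OF P] x by blast
    ultimately show ?thesis using nd[of "\<pi> x"] unfolding doubled_def by (cases "x \<in> X") auto
  qed
  have odd: "((C (swap0 a 0, swap0 b 1) True \<noteq> C (swap0 a 0, swap0 b 0) True) \<noteq> C (swap0 a 0, swap0 b 2) True) \<and>
     ((C (swap0 a 1, swap0 b 0) True \<noteq> C (swap0 a 0, swap0 b 0) True) \<noteq> C (swap0 a 2, swap0 b 0) True)"
    if ab: "a \<in> {0,1,2}" "b \<in> {0,1,2}" for a b
  proof -
    have z: "(0,0) \<in> grid" by (simp add: grid_def)
    obtain f where f: "f \<in> ?E" "\<rho> a b f = (0,0)" using pulled_ex[OF Pr[OF ab] z] by (elim bexE) (rule that)
    have "\<pi> f = (swap0 a 0, swap0 b 0)" using f(2) unfolding \<rho>_def inv by (simp add: prod_eq_iff)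
    then have "C (swap0 a 0, swap0 b 0) True = (f \<in> X)" using sgn[OF f(1)] by simp
    then show ?thesis using grid_match(3)[OF Z X Pr[OF ab] f nostar ndr[OF ab]] unfolding mr by simp
  qed
  define D where "D = {c \<in> grid. \<not> C c True}"
  have m: "(0,0) \<in> D \<longleftrightarrow> \<not> C (0,0) True" "(0,1) \<in> D \<longleftrightarrow> \<not> C (0,1) True" "(0,2) \<in> D \<longleftrightarrow> \<not> C (0,2) True"
    "(1,0) \<in> D \<longleftrightarrow> \<not> C (1,0) True" "(1,1) \<in> D \<longleftrightarrow> \<not> C (1,1) True" "(1,2) \<in> D \<longleftrightarrow> \<not> C (1,2) True"
    "(2,0) \<in> D \<longleftrightarrow> \<not> C (2,0) True" "(2,1) \<in> D \<longleftrightarrow> \<not> C (2,1) True" "(2,2) \<in> D \<longleftrightarrow> \<not> C (2,2) True"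
    by (simp_all add: D_def grid_def)
  have sw: "swap0 0 r = r" "swap0 1 0 = 1" "swap0 1 1 = 0" "swap0 1 2 = 2" "swap0 2 0 = 2" "swap0 2 1 = 1" "swap0 2 2 = 0" for r
    by (simp_all add: swap0_def)
  have t: "0 \<in> {0,1,2::nat}" "1 \<in> {0,1,2::nat}" "2 \<in> {0,1,2::nat}" by simp_all
  note o = odd[OF t(1) t(1), unfolded sw] odd[OF t(2) t(1), unfolded sw] odd[OF t(3) t(1), unfolded sw]
     odd[OF t(1) t(2), unfolded sw] odd[OF t(1) t(3), unfolded sw]
  have "D \<subseteq> grid" by (auto simp: D_def)
  then have gD: "grid_even D" unfolding grid_even_def ball_simps m using o by blast
  define W where "W = {x \<in> ?E. \<pi> x \<in> D}"
  have "W \<in> avoid Z e" unfolding W_def by (rule pulled_mem[OF P]) (simp add: gD)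
  then have W: "W \<in> Z" "e \<notin> W" by (auto simp: avoid_def)
  define Y where "Y = sym_diff X W"
  have Y: "Y \<in> Z" "e \<in> Y" using cycle_space_sym_diff[OF tight_cycle_space[OF Z] X(1) W(1)] X(2) W(2) by (auto simp: Y_def)
  have all: "x \<in> Y" if x: "x \<in> ?E" for x
  proof -
    have "\<pi> x \<in> grid" using pulled_surj[OF P] x by blast
    then have "x \<in> W \<longleftrightarrow> \<not> C (\<pi> x) True" using x by (simp add: W_def D_def)
    then show ?thesis using sgn[OF x] by (auto simp: Y_def)
  qed
  have "(0,0) \<in> grid" by (simp add: grid_def)
  from pulled_ex[OF P this] obtain f where "f \<in> ?E" by (elim bexE) (rule that)
  then obtain z where z: "z \<in> avoid Z e" "f \<in> z" by blast
  then have "z \<in> Z" "z \<subseteq> Y" "z \<noteq> {}" "e \<notin> z" using all by (auto simp: avoid_def)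
  then have "z = Y" using clutterD[OF tight_clutter[OF Z] _ Y(1)] by blast
  then show False using Y(2) \<open>e \<notin> z\<close> by simp
qed

theorem tight_structure:
  fixes Z :: "'a set set"
  assumes "tight Z" "Z \<noteq> {{}}"
  shows "(\<exists>V \<pi>. finite (V :: nat set) \<and> 2 \<le> card V \<and> pulled Z \<pi> (edges V) (cuts V)) \<or>
    (\<exists>\<pi>. pulled Z \<pi> grid (Collect grid_even))"
  using assms
proof (induction "card (\<Union>Z)" arbitrary: Z rule: less_induct)
  case less
  note Z = \<open>tight Z\<close>
  note cy = tight_cycle_space[OF Z]
  have "{} \<in> Z" and fin: "finite (\<Union>Z)" using cy by (auto simp: cycle_space_def)
  then obtain X e where X: "X \<in> Z" "e \<in> X" using less.prems(2) by blast
  have star: ?case if s: "signed Z e' X' V \<pi>" and st: "star_at (V :: nat set) (signs Z e' X' \<pi>) l" for e' X' V \<pi> l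
  proof -
    obtain w \<pi>' where w: "w \<notin> V" "pulled Z \<pi>' (edges (insert w V)) (cuts (insert w V))"
      by (rule star_pulled[OF cy s st])
    have "l \<in> V" using st by (simp add: star_at_def)
    then have "1 \<le> card V" using signedD(1)[OF s] card_gt_0_iff[of V] by (metis Suc_leI One_nat_def empty_iff)
    then have "2 \<le> card (insert w V)" "finite (insert w V)" using w(1) signedD(1)[OF s] by simp_all
    with w(2) show ?thesis by blast
  qed
  show ?case
  proof (cases "avoid Z e = {{}}")
    case True
    \<comment> \<open>A graph with one vertex is a star without edges; \<open>star_pulled\<close>
      turns it into the cuts on two vertices, that is, into a single circuit.\<close>
    have ed: "edges {0::nat} = {}" by (auto simp: edges_def)
    have "pulled (avoid Z e) (\<lambda>_. {}) (edges {0::nat}) (cuts {0})"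
      by (rule pulledI) (use True in \<open>auto simp: ed cuts_def\<close>)
    then have s: "signed Z e X {0::nat} (\<lambda>_. {})" using X by (simp add: signed_def)
    moreover have "star_at {0} (signs Z e X (\<lambda>_. {})) (0::nat)"
      by (simp add: star_at_def balanced_on_def)
    ultimately show ?thesis by (rule star)
  next
    case False
    have "\<Union>(avoid Z e) \<subset> \<Union>Z" using X avoid_subset[of Z e] by (auto simp: avoid_def)
    then have "card (\<Union>(avoid Z e)) < card (\<Union>Z)" using fin by (rule psubset_card_mono[rotated])
    from less.hyps[OF this tight_avoid[OF Z] False] show ?thesis
    proof (elim disjE exE conjE)
      fix V :: "nat set" and \<pi> assume V: "finite V" "2 \<le> card V" "pulled (avoid Z e) \<pi> (edges V) (cuts V)"
      have s: "signed Z e X V \<pi>" using V X by (simp add: signed_def)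
      show ?thesis
      proof (cases "card V = 2")
        case True
        then obtain u v where uv: "V = {u, v}" "u \<noteq> v" by (auto simp: card_2_iff)
        have Vu: "V - {u} = {v}" using uv by auto
        \<comment> \<open>On two vertices a star just means that the edge is doubled, and
          incomparability provides this.\<close>
        have "\<exists>v\<in>V - {u}. \<not> single (signs Z e X \<pi>) u v" using no_single_star[OF Z s, of u v] uv by simp
        then have "\<not> single (signs Z e X \<pi>) u v" unfolding Vu by simp
        moreover have "balanced_on {v} (signs Z e X \<pi>)" by (simp add: balanced_on_def)
        ultimately have "star_at V (signs Z e X \<pi>) u" unfolding star_at_def Vu using uv(1) by simp
        with s show ?thesis by (rule star)
      next
        case False
        then have "3 \<le> card V" using V(2) by simp
        from signed_classify[OF Z s this] show ?thesis
        proof (elim disjE exE conjE)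
          fix l assume "star_at V (signs Z e X \<pi>) l" with s show ?thesis by (rule star)
        next
          assume "is_matching V (signs Z e X \<pi>)"
          then obtain i j k l where "V = {i, j, k, l}" "matching_at (signs Z e X \<pi>) i j k l"
            unfolding is_matching_def by blast
          then obtain \<pi>' where "pulled Z \<pi>' grid (Collect grid_even)" by (rule matching_pulled[OF cy s])
          then show ?thesis by (intro disjI2 exI)
        qed
      qed
    next
      \<comment> \<open>Deleting a different element \<open>f\<close> exhibits a star on four
        vertices. So the members avoiding \<open>f\<close> are the cuts on five vertices, and the
        classification can be repeated with \<open>f\<close> in place of \<open>e\<close>.\<close>
      fix \<pi> assume P: "pulled (avoid Z e) \<pi> grid (Collect grid_even)"
      obtain f X' \<pi>' l where s4: "signed (avoid Z f) e X' {0,1,2,3::nat} \<pi>'"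
        and st: "star_at {0,1,2,3} (signs (avoid Z f) e X' \<pi>') l"
        using grid_has_star[OF Z X P] by blast
      obtain w \<pi>2 where w: "w \<notin> {0,1,2,3::nat}" and P2: "pulled (avoid Z f) \<pi>2 (edges (insert w {0,1,2,3})) (cuts (insert w {0,1,2,3}))"
        by (rule star_pulled[OF cycle_space_avoid[OF cy] s4 st])
      let ?V = "insert w {0,1,2,3::nat}"
      have c5: "card ?V = 5" using w by simp
      show ?thesis
      proof (cases "f \<in> \<Union>Z")
        case True
        then obtain Y where Y: "Y \<in> Z" "f \<in> Y" by blast
        have s5: "signed Z f Y ?V \<pi>2" using P2 Y by (simp add: signed_def)
        have "3 \<le> card ?V" using c5 by simp
        \<comment> \<open>Matchings exist only on four vertices.\<close>
        from signed_classify[OF Z s5 this] c5 have "\<exists>l. star_at ?V (signs Z f Y \<pi>2) l" by simp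
        then show ?thesis using star[OF s5] by blast
      next
        case False
        \<comment> \<open>If \<open>f\<close> lies outside the ground set, the five vertices already
          describe \<open>Z\<close> itself.\<close>
        then have "avoid Z f = Z" by (auto simp: avoid_def)
        with P2 have "pulled Z \<pi>2 (edges ?V) (cuts ?V)" by simp
        moreover have "finite ?V" "2 \<le> card ?V" using c5 by simp_all
        ultimately show ?thesis by blast
      qed
    qed
  qed
qed

section \<open>Spaces containing the ground set\<close>

text \<open>The even subsets of a set with four elements: the pairs, which are the circuits of
  \<open>U(1,4)\<close>, and the empty and the full set.\<close>

definition even4 :: "nat set \<Rightarrow> bool" where
  "even4 D \<longleftrightarrow> D \<subseteq> {0,1,2,3} \<and> (((0 \<in> D) \<noteq> (1 \<in> D)) = ((2 \<in> D) \<noteq> (3 \<in> D)))"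

definition r10_ground :: "(nat \<times> nat) set" where
  "r10_ground = insert (3,3) grid"

text \<open>The cycle space of \<open>R10\<close>: deleting the point \<open>(3,3)\<close> leaves
  \<open>M(K(3,3))\<close>, and complements of members are members because the ground set is
  one.\<close>

definition r10_cycle :: "(nat \<times> nat) set \<Rightarrow> bool" where
  "r10_cycle D \<longleftrightarrow> grid_even D \<or> (D \<subseteq> r10_ground \<and> grid_even (r10_ground - D))"

text \<open>The contradiction comes from comparing the theorems of Ceva and Menelaus for a triangle of
  the Fano plane.\<close>

lemma affine_four:
  assumes Z: "cycle_space Z" and K: "represents K Z" and E: "\<Union>Z \<in> Z"
    and min: "\<And>y z. y \<in> Z \<Longrightarrow> z \<in> Z \<Longrightarrow> z \<noteq> \<Union>Z \<Longrightarrow> y \<noteq> {} \<Longrightarrow> y \<subseteq> z \<Longrightarrow> y = z"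
    and s: "signed Z e (\<Union>Z) {0,1,2,3::nat} \<pi>"
  shows False
proof -
  let ?E = "\<Union>Z" and ?F = "\<Union>(avoid Z e)"
  define cut where "cut I = cut_at (avoid Z e) \<pi> I" for I
  have sub: "?F \<subseteq> ?E" by (rule avoid_subset)
  have eE: "e \<in> ?E" "e \<notin> ?F" using signedD(3)[OF s] by (auto simp: avoid_def)
  \<comment> \<open>One element over each edge; together with \<open>e\<close> these are the points
    of a Fano plane. Its lines are the four cuts of single vertices and the three triples formed by
    \<open>e\<close> and two opposite edges.\<close>
  obtain x01 where x01: "x01 \<in> ?F" "\<pi> x01 = {0,1}" using signed_edge_ex[OF s, of 0 1] by auto
  obtain x02 where x02: "x02 \<in> ?F" "\<pi> x02 = {0,2}" using signed_edge_ex[OF s, of 0 2] by auto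
  obtain x03 where x03: "x03 \<in> ?F" "\<pi> x03 = {0,3}" using signed_edge_ex[OF s, of 0 3] by auto
  obtain x12 where x12: "x12 \<in> ?F" "\<pi> x12 = {1,2}" using signed_edge_ex[OF s, of 1 2] by auto
  obtain x13 where x13: "x13 \<in> ?F" "\<pi> x13 = {1,3}" using signed_edge_ex[OF s, of 1 3] by auto
  obtain x23 where x23: "x23 \<in> ?F" "\<pi> x23 = {2,3}" using signed_edge_ex[OF s, of 2 3] by auto
  have mem: "x \<in> cut I \<longleftrightarrow> (a \<in> I) \<noteq> (b \<in> I)" if "x \<in> ?F" "\<pi> x = {a,b}" for x a b I
    using that unfolding cut_def cut_at_def by simp
  note m = mem[OF x01] mem[OF x02] mem[OF x03] mem[OF x12] mem[OF x13] mem[OF x23]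
  have cutZ: "cut I \<in> Z" "e \<notin> cut I" "cut I \<subseteq> ?F" if "I \<subseteq> {0,1,2,3}" for I
    using cut_at_mem[OF s that] unfolding cut_def by (auto simp: cut_at_def)
  have coZ: "?E - z \<in> Z" if "z \<in> Z" for z
  proof -
    have "sym_diff ?E z = ?E - z" using that by blast
    then show ?thesis using cycle_space_sym_diff[OF Z E that] by simp
  qed
  have form: "\<exists>I. I \<subseteq> {0,1,2,3} \<and> 0 \<notin> I \<and> (z = cut I \<or> z = ?E - cut I)" if z: "z \<in> Z" for z
  proof -
    have av: "\<exists>I. I \<subseteq> {0,1,2,3} \<and> 0 \<notin> I \<and> y = cut I" if y: "y \<in> avoid Z e" for y
    proof -
      obtain I where I: "I \<subseteq> {0,1,2,3}" "y = cut I" unfolding cut_def by (rule signed_cutE[OF s y])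
      show ?thesis
      proof (cases "0 \<in> I")
        case True
        have "crosses I (\<pi> x) \<longleftrightarrow> crosses ({0,1,2,3} - I) (\<pi> x)" if x: "x \<in> ?F" for x
        proof -
          obtain a b where ab: "\<pi> x = {a, b}" "a \<in> {0,1,2,3}" "b \<in> {0,1,2,3}" "a \<noteq> b"
            using signed_edge[OF s x] by blast
          then show ?thesis unfolding ab(1) crosses_pair by blast
        qed
        then have "cut I = cut ({0,1,2,3} - I)" unfolding cut_def cut_at_def by blast
        then show ?thesis using True I(2) by (intro exI[of _ "{0,1,2,3} - I"]) auto
      qed (use I in blast)
    qed
    show ?thesis
    proof (cases "e \<in> z")
      case False
      then have "z \<in> avoid Z e" using z by (simp add: avoid_def)
      from av[OF this] show ?thesis by blast
    next
      case True
      then have "?E - z \<in> avoid Z e" using coZ[OF z] by (simp add: avoid_def)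
      from av[OF this] obtain I where I: "I \<subseteq> {0,1,2,3}" "0 \<notin> I" "?E - z = cut I" by blast
      have "z = ?E - cut I" using I(3) z by blast
      with I show ?thesis by blast
    qed
  qed
  have I8: "I = {} \<or> I = {1} \<or> I = {2} \<or> I = {3} \<or> I = {1,2} \<or> I = {1,3} \<or> I = {2,3} \<or> I = {1,2,3}"
    if "I \<subseteq> {0,1,2,3::nat}" "0 \<notin> I" for I
  proof -
    have "I \<subseteq> {1,2,3}" using that by blast
    then show ?thesis by blast
  qed
  have cut0: "cut {} = {}" by (auto simp: cut_def cut_at_def crosses_def)
  have all: "z = {} \<or> z = ?E \<or> z = cut {1} \<or> z = cut {2} \<or> z = cut {3} \<or> z = cut {1,2} \<or> z = cut {1,3} \<or> z = cut {2,3} \<or> z = cut {1,2,3}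
     \<or> z = ?E - cut {1} \<or> z = ?E - cut {2} \<or> z = ?E - cut {3} \<or> z = ?E - cut {1,2} \<or> z = ?E - cut {1,3} \<or> z = ?E - cut {2,3} \<or> z = ?E - cut {1,2,3}"
    if z: "z \<in> Z" for z
  proof -
    obtain I where I: "I \<subseteq> {0,1,2,3}" "0 \<notin> I" "z = cut I \<or> z = ?E - cut I" using form[OF z] by blast
    from I(3) I8[OF I(1,2)] show ?thesis by (elim disjE; hypsubst; simp add: cut0)
  qed
  have circ: "\<exists>k\<in>K. {x. k x \<noteq> 0} = z" if z: "z \<in> Z" "z \<noteq> {}" "z \<noteq> ?E" for z
  proof (rule represents_minimal[OF K z(1,2)])
    show "\<And>y. y \<in> Z \<Longrightarrow> y \<noteq> {} \<Longrightarrow> y \<subseteq> z \<Longrightarrow> y = z" using min[OF _ z(1,3)] by blast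
    show "\<And>k. k \<in> K \<Longrightarrow> {x. k x \<noteq> 0} = z \<Longrightarrow> ?thesis" by blast
  qed
  let ?C0 = "cut {1,2,3}"
  let ?w = "?E - ?C0"
  have C: "cut {1} \<in> Z" "cut {2} \<in> Z" "cut {3} \<in> Z" "?C0 \<in> Z" by (rule cutZ; simp)+
  have nE: "cut I \<noteq> ?E" if "I \<subseteq> {0,1,2,3}" for I using cutZ(2)[OF that] eE(1) by blast
  have ne: "cut {1} \<noteq> {}" "cut {2} \<noteq> {}" "cut {3} \<noteq> {}" "?C0 \<noteq> {}"
    using m(1)[of "{1}"] m(2)[of "{2}"] m(3)[of "{3}"] m(1)[of "{1,2,3}"] by auto
  obtain k0 where k0: "k0 \<in> K" "{x. k0 x \<noteq> 0} = ?C0" using circ[OF C(4) ne(4) nE] by auto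
  obtain k1 where k1: "k1 \<in> K" "{x. k1 x \<noteq> 0} = cut {1}" using circ[OF C(1) ne(1) nE] by auto
  obtain k2 where k2: "k2 \<in> K" "{x. k2 x \<noteq> 0} = cut {2}" using circ[OF C(2) ne(2) nE] by auto
  obtain k3 where k3: "k3 \<in> K" "{x. k3 x \<noteq> 0} = cut {3}" using circ[OF C(3) ne(3) nE] by auto
  have "?w \<noteq> {}" using eE(1) cutZ(2)[of "{1,2,3}"] by auto
  moreover have "x01 \<in> ?C0" "x01 \<in> ?E" using m(1)[of "{1,2,3}"] x01(1) sub by auto
  then have "?w \<noteq> ?E" by blast
  ultimately obtain w where w: "w \<in> K" "{x. w x \<noteq> 0} = ?w" using circ[OF coZ[OF C(4)]] by auto
  have sum: "cut {1,2,3} = sym_diff (sym_diff (cut {1}) (cut {2})) (cut {3})"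
  proof -
    have ed: "\<exists>a b. \<pi> x = {a, b}" if "x \<in> ?F" for x using signed_edge[OF s that] by metis
    have 1: "sym_diff {1} {2} = {1,2::nat}" "sym_diff {1,2} {3} = {1,2,3::nat}" by auto
    have "sym_diff (cut {1}) (cut {2}) = cut {1,2}"
      using cut_at_sym_diff[of "avoid Z e" \<pi> "{1}" "{2}"] ed unfolding cut_def 1 by simp
    moreover have "sym_diff (cut {1,2}) (cut {3}) = cut {1,2,3}"
      using cut_at_sym_diff[of "avoid Z e" \<pi> "{1,2}" "{3}"] ed unfolding cut_def 1 by simp
    ultimately show ?thesis by simp
  qed
  have xE: "x01 \<in> ?E" "x02 \<in> ?E" "x03 \<in> ?E" "x12 \<in> ?E" "x13 \<in> ?E" "x23 \<in> ?E"
    by (fact subsetD[OF sub x01(1)] subsetD[OF sub x02(1)] subsetD[OF sub x03(1)]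
        subsetD[OF sub x12(1)] subsetD[OF sub x13(1)] subsetD[OF sub x23(1)])+
  \<comment> \<open>\<open>w\<close> is the linear relation between \<open>e\<close> and the corners
    \<open>x12\<close>, \<open>x13\<close>, \<open>x23\<close> of the triangle. At the two corners
    on a side it is proportional to the relation of that side, which is the condition of Ceva for
    the point \<open>e\<close>.\<close>
  have cev: "k p * w q = k q * w p"
    if k: "k \<in> K" "{x. k x \<noteq> 0} = C" and CC: "C \<in> Z" and pq: "p \<in> C" "q \<in> C" "p \<notin> ?C0" "q \<notin> ?C0"
      and only: "\<And>z. z \<in> Z \<Longrightarrow> z \<noteq> {} \<Longrightarrow> z \<subseteq> C \<union> ?w \<Longrightarrow> z = C \<or> z = ?w \<or> z = sym_diff C ?w"
      and sd: "sym_diff C ?w \<noteq> {}" "sym_diff C ?w \<noteq> ?E" for k C p q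
  proof -
    have "sym_diff C ?w \<in> Z" by (rule cycle_space_sym_diff[OF Z CC coZ[OF C(4)]])
    from circ[OF this sd] obtain l where l: "l \<in> K" "{x. l x \<noteq> 0} = sym_diff C ?w" by blast
    have "p \<in> ?w" "q \<in> ?w" using pq CC by blast+
    moreover have "C \<noteq> ?w" using sd(1) by blast
    ultimately show ?thesis using proportional[OF K k(1) w(1) l(1) k(2) w(2) l(2) only, of p q] pq by auto
  qed
  have only1: "z = cut {1} \<or> z = ?w \<or> z = sym_diff (cut {1}) ?w" if z: "z \<in> Z" "z \<noteq> {}" "z \<subseteq> cut {1} \<union> ?w" for z
  proof -
    have "x02 \<notin> z" "x03 \<notin> z" using z(3) m(2,3)[of "{1}"] m(2,3)[of "{1,2,3}"] by auto
    then have "z = cut {1} \<or> z = ?w \<or> z = ?E - cut {2,3}" using all[OF z(1)] z(2) xE m(2,3) by (elim disjE; simp)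
    moreover have "?E - cut {2,3} = sym_diff (cut {1}) ?w"
    proof -
      have ed: "\<exists>a b. \<pi> x = {a, b}" if "x \<in> ?F" for x using signed_edge[OF s that] by metis
      have "sym_diff {1} {1,2,3} = {2,3::nat}" by auto
      then have "cut {2,3} = sym_diff (cut {1}) ?C0"
        using cut_at_sym_diff[of "avoid Z e" \<pi> "{1}" "{1,2,3}"] ed unfolding cut_def by simp
      then show ?thesis using C by blast
    qed
    ultimately show ?thesis by simp
  qed
  have only2: "z = cut {2} \<or> z = ?w \<or> z = sym_diff (cut {2}) ?w" if z: "z \<in> Z" "z \<noteq> {}" "z \<subseteq> cut {2} \<union> ?w" for z
  proof -
    have "x01 \<notin> z" "x03 \<notin> z" using z(3) m(1,3)[of "{2}"] m(1,3)[of "{1,2,3}"] by auto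
    then have "z = cut {2} \<or> z = ?w \<or> z = ?E - cut {1,3}" using all[OF z(1)] z(2) xE m(1,3) by (elim disjE; simp)
    moreover have "?E - cut {1,3} = sym_diff (cut {2}) ?w"
    proof -
      have ed: "\<exists>a b. \<pi> x = {a, b}" if "x \<in> ?F" for x using signed_edge[OF s that] by metis
      have "sym_diff {2} {1,2,3} = {1,3::nat}" by auto
      then have "cut {1,3} = sym_diff (cut {2}) ?C0"
        using cut_at_sym_diff[of "avoid Z e" \<pi> "{2}" "{1,2,3}"] ed unfolding cut_def by simp
      then show ?thesis using C by blast
    qed
    ultimately show ?thesis by simp
  qed
  have only3: "z = cut {3} \<or> z = ?w \<or> z = sym_diff (cut {3}) ?w" if z: "z \<in> Z" "z \<noteq> {}" "z \<subseteq> cut {3} \<union> ?w" for z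
  proof -
    have "x01 \<notin> z" "x02 \<notin> z" using z(3) m(1,2)[of "{3}"] m(1,2)[of "{1,2,3}"] by auto
    then have "z = cut {3} \<or> z = ?w \<or> z = ?E - cut {1,2}" using all[OF z(1)] z(2) xE m(1,2) by (elim disjE; simp)
    moreover have "?E - cut {1,2} = sym_diff (cut {3}) ?w"
    proof -
      have ed: "\<exists>a b. \<pi> x = {a, b}" if "x \<in> ?F" for x using signed_edge[OF s that] by metis
      have "sym_diff {3} {1,2,3} = {1,2::nat}" by auto
      then have "cut {1,2} = sym_diff (cut {3}) ?C0"
        using cut_at_sym_diff[of "avoid Z e" \<pi> "{3}" "{1,2,3}"] ed unfolding cut_def by simp
      then show ?thesis using C by blast
    qed
    ultimately show ?thesis by simp
  qed
  have sd1: "sym_diff (cut {1}) ?w \<noteq> {}" "sym_diff (cut {1}) ?w \<noteq> ?E"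
    using eE cutZ(2)[of "{1}"] cutZ(2)[of "{1,2,3}"] xE m(2)[of "{1}"] m(2)[of "{1,2,3}"] by auto
  have sd2: "sym_diff (cut {2}) ?w \<noteq> {}" "sym_diff (cut {2}) ?w \<noteq> ?E"
    using eE cutZ(2)[of "{2}"] cutZ(2)[of "{1,2,3}"] xE m(1)[of "{2}"] m(1)[of "{1,2,3}"] by auto
  have sd3: "sym_diff (cut {3}) ?w \<noteq> {}" "sym_diff (cut {3}) ?w \<noteq> ?E"
    using eE cutZ(2)[of "{3}"] cutZ(2)[of "{1,2,3}"] xE m(1)[of "{3}"] m(1)[of "{1,2,3}"] by auto
  have c1: "k1 x12 * w x13 = k1 x13 * w x12"
    by (rule cev[OF k1 C(1) _ _ _ _ only1 sd1]) (simp_all add: m)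
  have c2: "k2 x12 * w x23 = k2 x23 * w x12"
    by (rule cev[OF k2 C(2) _ _ _ _ only2 sd2]) (simp_all add: m)
  have c3: "k3 x13 * w x23 = k3 x23 * w x13"
    by (rule cev[OF k3 C(3) _ _ _ _ only3 sd3]) (simp_all add: m)
  have z1: "k1 x = 0 \<longleftrightarrow> x \<notin> cut {1}" and z2: "k2 x = 0 \<longleftrightarrow> x \<notin> cut {2}" and z3: "k3 x = 0 \<longleftrightarrow> x \<notin> cut {3}"
    and z0: "k0 x = 0 \<longleftrightarrow> x \<notin> ?C0" and zw: "w x = 0 \<longleftrightarrow> x \<notin> ?w" for x
    using k1(2) k2(2) k3(2) k0(2) w(2) by blast+
  have nz: "k1 x12 \<noteq> 0" "k1 x13 \<noteq> 0" "k2 x12 \<noteq> 0" "k2 x23 \<noteq> 0" "k3 x13 \<noteq> 0" "k3 x23 \<noteq> 0"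
    "w x12 \<noteq> 0" "w x13 \<noteq> 0" "w x23 \<noteq> 0" "k0 x01 \<noteq> 0" "k1 x23 = 0" "k2 x13 = 0" "k3 x12 = 0"
    "k0 x12 = 0" "k0 x13 = 0" "k0 x23 = 0"
    unfolding z1 z2 z3 z0 zw using xE by (simp_all add: m)
  \<comment> \<open>The relations of the three sides are combined so that \<open>x12\<close> and
    \<open>x13\<close> cancel, and the line \<open>cut {1,2,3}\<close> removes \<open>x01\<close>.
    No nonempty member fits into what is left, so \<open>x23\<close> cancels too; this is the
    condition of Menelaus for that line.\<close>
  define y where "y x = k1 x + - (k1 x12 / k2 x12) * k2 x" for x
  define y' where "y' x = y x + - (k1 x13 / k3 x13) * k3 x" for x
  define v where "v x = y' x + - (y' x01 / k0 x01) * k0 x" for x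
  have yK: "y \<in> K" unfolding y_def[abs_def] using represents_add[OF K k1(1) k2(1)] by blast
  have yK': "y' \<in> K" unfolding y'_def[abs_def] using represents_add[OF K yK k3(1)] by blast
  have vK: "v \<in> K" unfolding v_def[abs_def] using represents_add[OF K yK' k0(1)] by blast
  have v0: "v x12 = 0" "v x13 = 0" "v x01 = 0" "v e = 0"
    using nz z1[of e] z2[of e] z3[of e] z0[of e] cutZ(2)
    by (simp_all add: v_def y'_def y_def)
  have "v x23 = 0"
  proof (rule ccontr)
    assume "v x23 \<noteq> 0"
    obtain z where z: "z \<in> Z" "z \<noteq> {}" "z \<subseteq> {x. v x \<noteq> 0}"
      by (rule represents_support[OF K vK \<open>v x23 \<noteq> 0\<close>])
    have "x12 \<notin> z" "x13 \<notin> z" "x01 \<notin> z" "e \<notin> z" using z(3) v0 by auto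
    then show False using all[OF z(1)] z(2) xE eE(1) cutZ(2) m by (elim disjE; simp)
  qed
  moreover have "v x23 = - (k1 x12 / k2 x12) * k2 x23 - (k1 x13 / k3 x13) * k3 x23"
    using nz by (simp add: v_def y'_def y_def)
  ultimately have men: "(k1 x12 / k2 x12) * k2 x23 = - (k1 x13 / k3 x13) * k3 x23" by linarith
  have "k1 x12 * k2 x23 * k3 x13 = - (k1 x13 * k3 x23 * k2 x12)"
    using men nz by (simp add: field_simps)
  then have "k1 x12 * k2 x23 * k3 x13 * (w x13 * w x12 * w x23) = - (k1 x13 * k3 x23 * k2 x12) * (w x13 * w x12 * w x23)" by simp
  then have "(k1 x12 * w x13) * (k2 x23 * w x12) * (k3 x13 * w x23) = - ((k1 x13 * w x12) * (k3 x23 * w x13) * (k2 x12 * w x23))"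
    by (simp add: mult_ac)
  then have "(k1 x13 * w x12) * (k2 x23 * w x12) * (k3 x23 * w x13) = - ((k1 x13 * w x12) * (k3 x23 * w x13) * (k2 x23 * w x12))"
    unfolding c1 c2 c3 .
  then have "(k1 x13 * w x12) * (k2 x23 * w x12) * (k3 x23 * w x13) = 0" by (simp add: mult_ac)
  then show False using nz by simp
qed

lemma pulled_edges_relabel:
  assumes P: "pulled Z \<pi> (edges V) (cuts V)" and g: "bij_betw g V V'"
  shows "pulled Z (\<lambda>x. g ` \<pi> x) (edges V') (cuts V')"
proof -
  have inj: "g u = g v \<longleftrightarrow> u = v" if "u \<in> V" "v \<in> V" for u v
    using g that by (auto simp: bij_betw_def inj_on_def)
  have im: "g ` V = V'" using g by (simp add: bij_betw_def)
  have pe: "\<exists>u v. \<pi> x = {u, v} \<and> u \<in> V \<and> v \<in> V \<and> u \<noteq> v" if x: "x \<in> \<Union>Z" for x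
  proof -
    have "\<pi> x \<in> edges V" using pulled_surj[OF P] x by blast
    then show ?thesis unfolding edges_def by blast
  qed
  have cr: "crosses I' (g ` \<pi> x) \<longleftrightarrow> crosses {v \<in> V. g v \<in> I'} (\<pi> x)" if x: "x \<in> \<Union>Z" for x I'
  proof -
    obtain u v where "\<pi> x = {u, v}" "u \<in> V" "v \<in> V" using pe[OF x] by blast
    then show ?thesis by simp
  qed
  have ed: "g ` \<pi> x \<in> edges V'" if x: "x \<in> \<Union>Z" for x
  proof -
    obtain u v where "\<pi> x = {u, v}" "u \<in> V" "v \<in> V" "u \<noteq> v" using pe[OF x] by blast
    then show ?thesis using im inj[of u v] by (auto intro!: edgesI)
  qed
  show ?thesis
  proof (rule pulledI)
    show "(\<lambda>x. g ` \<pi> x) ` \<Union>Z = edges V'"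
    proof
      show "(\<lambda>x. g ` \<pi> x) ` \<Union>Z \<subseteq> edges V'" using ed by blast
      show "edges V' \<subseteq> (\<lambda>x. g ` \<pi> x) ` \<Union>Z"
      proof
        fix d assume "d \<in> edges V'"
        then obtain u' v' where d: "d = {u', v'}" "u' \<in> V'" "v' \<in> V'" "u' \<noteq> v'" unfolding edges_def by blast
        then obtain u v where uv: "u \<in> V" "v \<in> V" "u' = g u" "v' = g v" using im by blast
        then have "{u, v} \<in> edges V" using d(4) by (intro edgesI) auto
        from pulled_ex[OF P this] obtain x where x: "x \<in> \<Union>Z" "\<pi> x = {u, v}" by blast
        then have "d = g ` \<pi> x" using d(1) uv by simp
        then show "d \<in> (\<lambda>x. g ` \<pi> x) ` \<Union>Z" using x(1) by blast
      qed
    qed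
  next
    fix z assume "z \<in> Z"
    then obtain D where D: "D \<in> cuts V" "z = {x \<in> \<Union>Z. \<pi> x \<in> D}" by (rule pulledE[OF P])
    then obtain I where I: "I \<subseteq> V" "D = {d \<in> edges V. crosses I d}" unfolding cuts_def by blast
    have gI: "{v \<in> V. g v \<in> g ` I} = I" using I(1) inj by auto
    show "\<exists>D\<in>cuts V'. \<forall>x\<in>\<Union>Z. x \<in> z \<longleftrightarrow> g ` \<pi> x \<in> D"
    proof (rule bexI[of _ "{d \<in> edges V'. crosses (g ` I) d}"])
      show "\<forall>x\<in>\<Union>Z. x \<in> z \<longleftrightarrow> g ` \<pi> x \<in> {d \<in> edges V'. crosses (g ` I) d}"
      proof
        fix x assume x: "x \<in> \<Union>Z"
        have "\<pi> x \<in> edges V" using pulled_surj[OF P] x by blast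
        then show "x \<in> z \<longleftrightarrow> g ` \<pi> x \<in> {d \<in> edges V'. crosses (g ` I) d}"
          using x ed[OF x] cr[OF x, of "g ` I"] unfolding D(2) I(2) gI by simp
      qed
      show "{d \<in> edges V'. crosses (g ` I) d} \<in> cuts V'" unfolding cuts_def using I(1) im by blast
    qed
  next
    fix D assume "D \<in> cuts V'"
    then obtain I' where I': "I' \<subseteq> V'" "D = {d \<in> edges V'. crosses I' d}" unfolding cuts_def by blast
    have "{d \<in> edges V. crosses {v \<in> V. g v \<in> I'} d} \<in> cuts V" unfolding cuts_def by blast
    from pulled_mem[OF P this] show "\<exists>z\<in>Z. \<forall>x\<in>\<Union>Z. x \<in> z \<longleftrightarrow> g ` \<pi> x \<in> D"
    proof (rule bexI[rotated], intro ballI)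
      fix x assume x: "x \<in> \<Union>Z"
      have "\<pi> x \<in> edges V" using pulled_surj[OF P] x by blast
      then show "x \<in> {x \<in> \<Union>Z. \<pi> x \<in> {d \<in> edges V. crosses {v \<in> V. g v \<in> I'} d}} \<longleftrightarrow> g ` \<pi> x \<in> D"
        using x ed[OF x] cr[OF x, of I'] unfolding I'(2) by simp
    qed
  qed
qed

text \<open>With the ground set as \<open>X\<close> all signs are \<open>True\<close>. Among the
  complete graphs only three vertices survive: two contradict connectivity, four give a Fano plane,
  and five or more have a contraction that is neither a star nor a matching.\<close>

theorem affine_structure:
  assumes Z: "cycle_space Z" and K: "represents K Z" and E: "\<Union>Z \<in> Z" and ne: "\<Union>Z \<noteq> {}"
    and min: "\<And>y z. y \<in> Z \<Longrightarrow> z \<in> Z \<Longrightarrow> z \<noteq> \<Union>Z \<Longrightarrow> y \<noteq> {} \<Longrightarrow> y \<subseteq> z \<Longrightarrow> y = z"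
    and conn: "\<And>x y. x \<in> \<Union>Z \<Longrightarrow> y \<in> \<Union>Z \<Longrightarrow> \<exists>z\<in>Z. z \<noteq> \<Union>Z \<and> x \<in> z \<and> y \<in> z"
  shows "(\<exists>\<pi>. pulled Z \<pi> {0,1,2,3} (Collect even4)) \<or> (\<exists>\<pi>. pulled Z \<pi> r10_ground (Collect r10_cycle))"
proof -
  let ?E = "\<Union>Z"
  obtain e where e: "e \<in> ?E" using ne by blast
  let ?F = "\<Union>(avoid Z e)"
  have sub: "?F \<subseteq> ?E" by (rule avoid_subset)
  have eF: "e \<notin> ?F" by (auto simp: avoid_def)
  have coZ: "?E - z \<in> Z" if z: "z \<in> Z" for z
  proof -
    have "sym_diff ?E z = ?E - z" using z by blast
    then show ?thesis using cycle_space_sym_diff[OF Z E z] by simp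
  qed
  have "clutter (avoid Z e)" unfolding clutter_def
  proof (intro ballI impI)
    fix y z assume h: "y \<in> avoid Z e" "z \<in> avoid Z e" "y \<noteq> {}" "y \<subseteq> z"
    then have "z \<noteq> ?E" using e by (auto simp: avoid_def)
    then show "y = z" using min[of y z] h by (simp add: avoid_def)
  qed
  then have tight: "tight (avoid Z e)"
    unfolding tight_def using cycle_space_avoid[OF Z, of e] represents_avoid[OF K, of e] by (intro conjI exI)
  obtain z0 where z0: "z0 \<in> Z" "z0 \<noteq> ?E" "e \<in> z0" using conn[OF e e] by blast
  have "?E - z0 \<in> avoid Z e" using coZ[OF z0(1)] z0(3) by (simp add: avoid_def)
  moreover have "?E - z0 \<noteq> {}" using z0 by blast
  ultimately have "avoid Z e \<noteq> {{}}" by (metis singletonD)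
  from tight_structure[OF tight this] show ?thesis
  proof (elim disjE exE conjE)
    fix V :: "nat set" and \<pi> assume V: "finite V" "2 \<le> card V" and P: "pulled (avoid Z e) \<pi> (edges V) (cuts V)"
    have s: "signed Z e ?E V \<pi>" using V(1) P e E by (simp add: signed_def)
    have sg: "signs Z e ?E \<pi> u v \<tau> = \<tau>" if uv: "u \<in> V" "v \<in> V" "u \<noteq> v" for u v \<tau>
    proof -
      obtain x where x: "x \<in> ?F" "\<pi> x = {u, v}" by (rule signed_edge_ex[OF s uv])
      have "x \<in> ?E" if "x \<in> ?F" for x using that sub by (rule subsetD[rotated])
      then have "signs Z e ?E \<pi> u v \<tau> \<longleftrightarrow> (\<exists>x\<in>?F. \<pi> x = {u, v} \<and> \<tau>)"
        unfolding signs_def by (intro bex_cong refl) simp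
      then show ?thesis using x by simp metis
    qed
    consider "card V = 2" | "card V = 3" | "card V = 4" | "5 \<le> card V" using V(2) by linarith
    then show ?thesis
    proof cases
      case 1
      then obtain u v where uv: "V = {u, v}" "u \<noteq> v" by (auto simp: card_2_iff)
      \<comment> \<open>With only one edge, a member through \<open>e\<close> and an element over
        that edge is the whole ground set.\<close>
      obtain y where y: "y \<in> ?F" "\<pi> y = {u, v}" using signed_edge_ex[OF s, of u v] uv by auto
      obtain z where z: "z \<in> Z" "z \<noteq> ?E" "e \<in> z" "y \<in> z" using conn[OF e subsetD[OF sub y(1)]] by blast
      obtain I where I: "I \<subseteq> V" "\<forall>x\<in>?F. x \<in> z \<longleftrightarrow> ((e \<in> z \<and> x \<in> ?E) \<noteq> crosses I (\<pi> x))"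
        by (rule signed_form[OF Z s z(1)])
      have nc: "\<not> crosses I {u, v}" using I(2)[rule_format, OF y(1)] y z subsetD[OF sub y(1)] by simp
      have "x \<in> z" if x: "x \<in> ?E" for x
      proof (cases "x \<in> ?F")
        case True
        obtain a b where "\<pi> x = {a, b}" "a \<in> V" "b \<in> V" "a \<noteq> b" by (rule signed_edge[OF s True])
        then have "\<pi> x = {u, v}" using uv by auto
        then show ?thesis using I(2)[rule_format, OF True] nc z(3) x by simp
      next
        case False
        show ?thesis using class_iff[OF Z x False z(1)] z(3) by simp
      qed
      then have "z = ?E" using z(1) by blast
      with z(2) show ?thesis by simp
    next
      case 2
      then obtain a b c where V3: "V = {a, b, c}" "distinct [a, b, c]" by (auto simp: card_3_iff)
      have d: "a \<noteq> b" "a \<noteq> c" "b \<noteq> c" "b \<noteq> a" "c \<noteq> a" "c \<noteq> b" using V3(2) by auto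
      have dd: "{a, b} \<noteq> {a, c}" "{a, b} \<noteq> {b, c}" "{a, c} \<noteq> {b, c}" using d by (simp_all add: doubleton_eq_iff)
      \<comment> \<open>The three edges of the triangle and \<open>e\<close> become the four
        elements of \<open>U(1,4)\<close>.\<close>
      define \<pi>' :: "_ \<Rightarrow> nat" where "\<pi>' x = (if x \<notin> ?F then 3 else if \<pi> x = {a, b} then 0 else if \<pi> x = {a, c} then 1 else 2)" for x
      have N: "\<pi>' x = 3" if "x \<notin> ?F" for x using that by (simp add: \<pi>'_def)
      have p: "\<pi> x = {a, b} \<Longrightarrow> \<pi>' x = 0" "\<pi> x = {a, c} \<Longrightarrow> \<pi>' x = 1" "\<pi> x = {b, c} \<Longrightarrow> \<pi>' x = 2" if "x \<in> ?F" for x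
        using that by (simp_all only: \<pi>'_def dd dd[symmetric] simp_thms if_True if_False)
      have cs: "\<pi> x = {a, b} \<or> \<pi> x = {a, c} \<or> \<pi> x = {b, c}" if x: "x \<in> ?F" for x
      proof -
        obtain u v where "\<pi> x = {u, v}" "u \<in> V" "v \<in> V" "u \<noteq> v" by (rule signed_edge[OF s x])
        then show ?thesis unfolding V3(1) by (elim insertE emptyE) (simp_all add: insert_commute)
      qed
      have surj: "\<pi>' ` ?E = {0,1,2,3}"
      proof
        show "\<pi>' ` ?E \<subseteq> {0,1,2,3}" by (auto simp: \<pi>'_def)
        obtain x0 where x0: "x0 \<in> ?F" "\<pi> x0 = {a, b}" using signed_edge_ex[OF s, of a b] d V3(1) by auto
        obtain x1 where x1: "x1 \<in> ?F" "\<pi> x1 = {a, c}" using signed_edge_ex[OF s, of a c] d V3(1) by auto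
        obtain x2 where x2: "x2 \<in> ?F" "\<pi> x2 = {b, c}" using signed_edge_ex[OF s, of b c] d V3(1) by auto
        have "0 = \<pi>' x0" "1 = \<pi>' x1" "2 = \<pi>' x2" "3 = \<pi>' e" using p(1)[OF x0] p(2)[OF x1] p(3)[OF x2] N[OF eF] by simp_all
        moreover have "x0 \<in> ?E" "x1 \<in> ?E" "x2 \<in> ?E" using x0 x1 x2 sub by blast+
        ultimately show "{0,1,2,3} \<subseteq> \<pi>' ` ?E" using e by (metis empty_subsetI imageI insert_subset)
      qed
      have main: "\<forall>x\<in>?E. x \<in> z \<longleftrightarrow> \<pi>' x \<in> D"
        if z: "z \<in> Z" and f: "\<forall>x\<in>?F. x \<in> z \<longleftrightarrow> ((e \<in> z \<and> x \<in> ?E) \<noteq> crosses I (\<pi> x))"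
          and D: "3 \<in> D \<longleftrightarrow> e \<in> z" "0 \<in> D \<longleftrightarrow> (e \<in> z) \<noteq> ((a \<in> I) \<noteq> (b \<in> I))" "1 \<in> D \<longleftrightarrow> (e \<in> z) \<noteq> ((a \<in> I) \<noteq> (c \<in> I))"
            "2 \<in> D \<longleftrightarrow> (e \<in> z) \<noteq> ((b \<in> I) \<noteq> (c \<in> I))" for z I D
      proof
        fix x assume x: "x \<in> ?E"
        show "x \<in> z \<longleftrightarrow> \<pi>' x \<in> D"
        proof (cases "x \<in> ?F")
          case False
          show ?thesis unfolding class_iff[OF Z x False z] N[OF False] D(1) ..
        next
          case True
          have f': "x \<in> z \<longleftrightarrow> (e \<in> z) \<noteq> crosses I (\<pi> x)" using f[rule_format, OF True] x by simp
          from cs[OF True] show ?thesis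
          proof (elim disjE)
            assume h: "\<pi> x = {a, b}" show ?thesis unfolding f' p(1)[OF True h] D unfolding h crosses_pair ..
          next
            assume h: "\<pi> x = {a, c}" show ?thesis unfolding f' p(2)[OF True h] D unfolding h crosses_pair ..
          next
            assume h: "\<pi> x = {b, c}" show ?thesis unfolding f' p(3)[OF True h] D unfolding h crosses_pair ..
          qed
        qed
      qed
      have "pulled Z \<pi>' {0,1,2,3} (Collect even4)"
      proof (rule pulledI[OF surj])
        fix z assume z: "z \<in> Z"
        obtain I where I: "I \<subseteq> V" "\<forall>x\<in>?F. x \<in> z \<longleftrightarrow> ((e \<in> z \<and> x \<in> ?E) \<noteq> crosses I (\<pi> x))"
          by (rule signed_form[OF Z s z])
        define D :: "nat set" where "D = {n. n = 3 \<and> e \<in> z \<or> n = 0 \<and> ((e \<in> z) \<noteq> ((a \<in> I) \<noteq> (b \<in> I))) \<or>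
          n = 1 \<and> ((e \<in> z) \<noteq> ((a \<in> I) \<noteq> (c \<in> I))) \<or> n = 2 \<and> ((e \<in> z) \<noteq> ((b \<in> I) \<noteq> (c \<in> I)))}"
        have D: "3 \<in> D \<longleftrightarrow> e \<in> z" "0 \<in> D \<longleftrightarrow> (e \<in> z) \<noteq> ((a \<in> I) \<noteq> (b \<in> I))" "1 \<in> D \<longleftrightarrow> (e \<in> z) \<noteq> ((a \<in> I) \<noteq> (c \<in> I))"
            "2 \<in> D \<longleftrightarrow> (e \<in> z) \<noteq> ((b \<in> I) \<noteq> (c \<in> I))" unfolding D_def by simp_all
        have "D \<subseteq> {0,1,2,3}" unfolding D_def by blast
        then have "even4 D" unfolding even4_def D by blast
        then show "\<exists>D\<in>Collect even4. \<forall>x\<in>?E. x \<in> z \<longleftrightarrow> \<pi>' x \<in> D"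
          using main[OF z I(2) D] by (intro bexI[of _ D]) simp_all
      next
        fix D assume "D \<in> Collect even4"
        then have ev: "((0 \<in> D) \<noteq> (1 \<in> D)) = ((2 \<in> D) \<noteq> (3 \<in> D))" by (simp only: even4_def mem_Collect_eq)
        define I where "I = (if (0 \<in> D) \<noteq> (3 \<in> D) then {b} else {}) \<union> (if (1 \<in> D) \<noteq> (3 \<in> D) then {c} else {})"
        have I: "I \<subseteq> V" by (auto simp: I_def V3)
        have mI: "a \<notin> I" "b \<in> I \<longleftrightarrow> (0 \<in> D) \<noteq> (3 \<in> D)" "c \<in> I \<longleftrightarrow> (1 \<in> D) \<noteq> (3 \<in> D)" using d by (auto simp: I_def)
        obtain z where z: "z \<in> Z" "(e \<in> z) = (3 \<in> D)"
          "\<forall>x\<in>?F. x \<in> z \<longleftrightarrow> ((3 \<in> D \<and> x \<in> ?E) \<noteq> crosses I (\<pi> x))" by (rule signed_form_ex[OF Z s I])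
        have "3 \<in> D \<longleftrightarrow> e \<in> z" "0 \<in> D \<longleftrightarrow> (e \<in> z) \<noteq> ((a \<in> I) \<noteq> (b \<in> I))" "1 \<in> D \<longleftrightarrow> (e \<in> z) \<noteq> ((a \<in> I) \<noteq> (c \<in> I))"
            "2 \<in> D \<longleftrightarrow> (e \<in> z) \<noteq> ((b \<in> I) \<noteq> (c \<in> I))"
          unfolding z(2) using mI ev by blast+
        from main[OF z(1) z(3)[folded z(2)] this] show "\<exists>z\<in>Z. \<forall>x\<in>?E. x \<in> z \<longleftrightarrow> \<pi>' x \<in> D"
          using z(1) by blast
      qed
      then show ?thesis by (intro disjI1 exI)
    next
      case 3
      then obtain g where g: "bij_betw g V {0,1,2,3::nat}"
        using finite_same_card_bij[OF V(1), of "{0,1,2,3::nat}"] by auto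
      have "signed Z e ?E {0,1,2,3::nat} (\<lambda>x. g ` \<pi> x)"
        using pulled_edges_relabel[OF P g] e E by (simp add: signed_def)
      from affine_four[OF Z K E min this] show ?thesis by blast
    next
      case 4
      have "V \<noteq> {}" using 4 by auto
      then obtain i where i: "i \<in> V" by blast
      have "card (V - {i}) \<ge> 4" using 4 V(1) i by simp
      then have "V - {i} \<noteq> {}" by (metis card.empty not_numeral_le_zero)
      then obtain j where j: "j \<in> V" "i \<noteq> j" by blast
      have "card (V - {i, j}) \<ge> 3" using 4 V(1) i j by (subst card_Diff_subset) auto
      then obtain m n p where mnp: "{m, n, p} \<subseteq> V - {i, j}" "distinct [m, n, p]"
        by (metis card_3_iff distinct_length_2_or_more distinct_singleton obtain_subset_with_card_n)
      \<comment> \<open>Contracting an edge of sign \<open>True\<close> doubles all edges at the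
        merged vertex \<open>i\<close> and leaves \<open>True\<close> on all others. Two doubled
        edges at \<open>i\<close> exclude a matching, and three vertices with all signs
        \<open>True\<close> are not balanced, which excludes a star.\<close>
      obtain f where f: "f \<in> ?F" "\<pi> f = {i, j}" by (rule signed_edge_ex[OF s i j])
      have fX: "(f \<in> ?E) = True" using f(1) sub by blast
      obtain X' \<pi>' where s': "signed (avoid Z f) e X' (V - {j}) \<pi>'"
        and A': "\<forall>u\<in>V - {j}. \<forall>v\<in>V - {j}. u \<noteq> v \<longrightarrow> (\<forall>\<tau>.
         signs (avoid Z f) e X' \<pi>' u v \<tau> = contract_edge i j True (signs Z e ?E \<pi>) u v \<tau>)"
        using signed_contract[OF Z s i j f fX] by (elim exE conjE) (rule that)
      let ?S = "signs (avoid Z f) e X' \<pi>'"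
      have fE: "f \<in> ?E" using fX by simp
      have "clutter (avoid Z f)" unfolding clutter_def
      proof (intro ballI impI)
        fix y z assume h: "y \<in> avoid Z f" "z \<in> avoid Z f" "y \<noteq> {}" "y \<subseteq> z"
        then have "z \<noteq> ?E" using fE by (auto simp: avoid_def)
        then show "y = z" using min[of y z] h by (simp add: avoid_def)
      qed
      then have tf: "tight (avoid Z f)"
        unfolding tight_def using cycle_space_avoid[OF Z, of f] represents_avoid[OF K, of f] by (intro conjI exI)
      have Si: "?S i v \<tau>" if "v \<in> V - {i, j}" for v \<tau>
      proof -
        have "?S i v \<tau> = contract_edge i j True (signs Z e ?E \<pi>) i v \<tau>" using A' i j that by auto
        also have "\<dots> = (\<tau> \<or> (\<tau> \<noteq> True))" unfolding contract_edge_def using sg[of i v] sg[of j v] i j that by auto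
        finally show ?thesis by simp
      qed
      have So: "?S u v \<tau> = \<tau>" if "u \<in> V - {i, j}" "v \<in> V - {i, j}" "u \<noteq> v" for u v \<tau>
      proof -
        have "?S u v \<tau> = contract_edge i j True (signs Z e ?E \<pi>) u v \<tau>" using A' that by auto
        also have "\<dots> = \<tau>" unfolding contract_edge_def using sg[of u v] that by auto
        finally show ?thesis .
      qed
      have nm: "\<not> single ?S i m" "\<not> single ?S i n" using Si mnp(1) by (auto simp: single_def)
      have iV: "i \<in> V - {j}" "m \<in> V - {j}" "n \<in> V - {j}" "distinct [i, m, n]" using i j mnp by auto
      have "3 \<le> card (V - {j})" using 4 V(1) j by simp
      from signed_classify[OF tf s' this] have False
      proof (elim disjE exE conjE)
        fix l assume st: "star_at (V - {j}) ?S l"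
        have "l = i"
          using signed_class.star_center[OF signed_class_realizable st iV(1,2) _ nm(1)]
            signed_class.star_center[OF signed_class_realizable st iV(1,3) _ nm(2)] iV(4) by auto
        then have "balanced_on (V - {j} - {i}) ?S" using st by (simp add: star_at_def)
        then obtain \<chi> :: "nat \<Rightarrow> bool" where chi: "\<forall>u\<in>V - {j} - {i}. \<forall>v\<in>V - {j} - {i}. u \<noteq> v \<longrightarrow>
          (\<forall>\<tau>. ?S u v \<tau> \<longleftrightarrow> \<tau> = (\<chi> u \<noteq> \<chi> v))" unfolding balanced_on_def by (elim exE) (rule that)
        have x: "\<chi> u \<noteq> \<chi> v" if uv: "u \<in> {m, n, p}" "v \<in> {m, n, p}" "u \<noteq> v" for u v
        proof -
          have "?S u v True" using So[of u v True] mnp(1) uv by auto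
          moreover have "u \<in> V - {j} - {i}" "v \<in> V - {j} - {i}" using mnp(1) uv by auto
          ultimately show ?thesis using chi[rule_format, of u v True] uv(3) by blast
        qed
        show False using x[of m n] x[of m p] x[of n p] mnp(2) by auto
      next
        assume "is_matching (V - {j}) ?S"
        then obtain a b c d where V4: "V - {j} = {a, b, c, d}" and ma: "matching_at ?S a b c d"
          unfolding is_matching_def by blast
        have G: "realizable TYPE('a) (V - {j}) ?S" by (rule realizableI[OF tf s']) simp
        show False by (rule signed_class.matching_unique[OF signed_class_realizable G ma V4 iV nm])
      qed
      then show ?thesis ..
    qed
  next
    fix \<pi> assume P: "pulled (avoid Z e) \<pi> grid (Collect grid_even)"
    \<comment> \<open>The element \<open>e\<close> and everything in series with it become the
      additional point \<open>(3,3)\<close>.\<close>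
    define \<pi>' where "\<pi>' x = (if x \<in> ?F then \<pi> x else (3,3))" for x
    have n3: "(3,3) \<notin> grid" by (simp add: grid_def)
    have pg: "\<pi> x \<in> grid" if x: "x \<in> ?F" for x using pulled_surj[OF P] x by blast
    have surj: "\<pi>' ` ?E = r10_ground"
    proof
      show "\<pi>' ` ?E \<subseteq> r10_ground" by (rule image_subsetI) (simp add: \<pi>'_def r10_ground_def pg del: Union_iff)
      have "\<pi>' e = (3,3)" using eF by (simp add: \<pi>'_def)
      moreover have "c \<in> \<pi>' ` ?E" if c: "c \<in> grid" for c
      proof -
        obtain x where x: "x \<in> ?F" "\<pi> x = c" using pulled_ex[OF P c] by (elim bexE) (rule that)
        then have "\<pi>' x = c" by (simp add: \<pi>'_def)
        then show ?thesis using subsetD[OF sub x(1)] by blast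
      qed
      ultimately show "r10_ground \<subseteq> \<pi>' ` ?E" unfolding r10_ground_def using e by (metis image_eqI insert_subset subsetI)
    qed
    have pull: "x \<in> z \<longleftrightarrow> \<pi>' x \<in> D" if D: "grid_even D" "z = {x \<in> ?F. \<pi> x \<in> D}" for x z D
    proof -
      have "(3,3) \<notin> D" using D(1) n3 unfolding grid_even_def by blast
      then show ?thesis unfolding D(2) by (auto simp: \<pi>'_def)
    qed
    have pr: "\<pi>' x \<in> r10_ground" if x: "x \<in> ?E" for x using surj x by blast
    have "pulled Z \<pi>' r10_ground (Collect r10_cycle)"
    proof (rule pulledI[OF surj])
      fix z assume z: "z \<in> Z"
      show "\<exists>D\<in>Collect r10_cycle. \<forall>x\<in>?E. x \<in> z \<longleftrightarrow> \<pi>' x \<in> D"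
      proof (cases "e \<in> z")
        case False
        then have za: "z \<in> avoid Z e" using z by (simp add: avoid_def)
        obtain D where D: "D \<in> Collect grid_even" "z = {x \<in> ?F. \<pi> x \<in> D}" by (rule pulledE[OF P za])
        then show ?thesis using pull[of D z] by (intro bexI[of _ D]) (simp_all add: r10_cycle_def)
      next
        case True
        then have za: "?E - z \<in> avoid Z e" using coZ[OF z] by (simp add: avoid_def)
        obtain D where D: "D \<in> Collect grid_even" "?E - z = {x \<in> ?F. \<pi> x \<in> D}" by (rule pulledE[OF P za])
        then have gD: "grid_even D" by simp
        have "D \<subseteq> r10_ground" using gD unfolding grid_even_def r10_ground_def by blast
        then have "r10_ground - (r10_ground - D) = D" by blast
        then have "r10_cycle (r10_ground - D)" using gD by (simp add: r10_cycle_def)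
        moreover have "\<forall>x\<in>?E. x \<in> z \<longleftrightarrow> \<pi>' x \<in> r10_ground - D"
          using pull[OF gD D(2)] pr by blast
        ultimately show ?thesis by (intro bexI[of _ "r10_ground - D"]) simp_all
      qed
    next
      fix D assume "D \<in> Collect r10_cycle"
      then consider "grid_even D" | "D \<subseteq> r10_ground" "grid_even (r10_ground - D)" unfolding r10_cycle_def by blast
      then show "\<exists>z\<in>Z. \<forall>x\<in>?E. x \<in> z \<longleftrightarrow> \<pi>' x \<in> D"
      proof cases
        case 1
        have "{x \<in> ?F. \<pi> x \<in> D} \<in> avoid Z e" by (rule pulled_mem[OF P]) (simp add: 1)
        then show ?thesis using pull[OF 1 refl] by (intro bexI[of _ "{x \<in> ?F. \<pi> x \<in> D}"]) (simp_all add: avoid_def)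
      next
        case 2
        let ?z = "{x \<in> ?F. \<pi> x \<in> r10_ground - D}"
        have "?z \<in> avoid Z e" by (rule pulled_mem[OF P]) (simp add: 2)
        then have "?E - ?z \<in> Z" by (intro coZ) (simp add: avoid_def)
        moreover have "\<forall>x\<in>?E. x \<in> ?E - ?z \<longleftrightarrow> \<pi>' x \<in> D"
          using pull[OF 2(2) refl] pr 2(1) by blast
        ultimately show ?thesis by (rule bexI[rotated])
      qed
    qed
    then show ?thesis by (intro disjI2 exI)
  qed
qed

section \<open>Circuits and series extensions\<close>

context matroid
begin

lemma circuit_ex:
  assumes "X \<subseteq> ground M" "X \<notin> indeps M"
  obtains C where "circuit M C" "C \<subseteq> X"
proof -
  have fin: "finite X" using assms(1) finite_ground finite_subset by blast
  let ?P = "\<lambda>Y. Y \<subseteq> X \<and> Y \<notin> indeps M"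
  have "finite {Y. ?P Y}" using fin by simp
  moreover have "{Y. ?P Y} \<noteq> {}" using assms(2) by auto
  ultimately obtain C where C: "C \<in> {Y. ?P Y}" "\<forall>Y\<in>{Y. ?P Y}. Y \<subseteq> C \<longrightarrow> C = Y"
    using finite_has_minimal[of "{Y. ?P Y}"] by auto
  have "circuit M C" unfolding circuit_def
  proof (intro conjI allI impI)
    show "C \<subseteq> ground M" "C \<notin> indeps M" using C(1) assms(1) by auto
    fix Y assume "Y \<subset> C"
    then show "Y \<in> indeps M" using C by blast
  qed
  then show ?thesis using that C(1) by blast
qed

lemma circuit_not_subset_indep: "circuit M C \<Longrightarrow> X \<in> indeps M \<Longrightarrow> \<not> C \<subseteq> X"
  using indep_subset unfolding circuit_def by blast

lemma indep_iff_no_circuit: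
  "X \<in> indeps M \<longleftrightarrow> X \<subseteq> ground M \<and> (\<forall>C. circuit M C \<longrightarrow> \<not> C \<subseteq> X)"
  using circuit_ex indep_subset_ground circuit_not_subset_indep by metis

lemma indep_finite: "X \<in> indeps M \<Longrightarrow> finite X"
  using indep_subset_ground finite_ground finite_subset by blast

lemma basis_card_max: 
  assumes "basis M B" "X \<in> indeps M" shows "card X \<le> card B"
proof (rule ccontr)
  assume "\<not> card X \<le> card B"
  then obtain y where "y \<in> X - B" "insert y B \<in> indeps M"
    using augmentation[of B X] assms unfolding basis_def by auto
  then show False using assms(1) unfolding basis_def by (metis DiffD2 insertI1 subset_insertI)
qed

lemma basis_extend:
  assumes X: "X \<in> indeps M" and B0: "basis M B0"
  obtains B where "basis M B" "X \<subseteq> B" "B \<subseteq> X \<union> B0"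
proof -
  let ?P = "\<lambda>Y. Y \<in> indeps M \<and> X \<subseteq> Y \<and> Y \<subseteq> X \<union> B0"
  have "finite (X \<union> B0)" using X B0 indep_finite unfolding basis_def by blast
  then have "finite {Y. ?P Y}" by (rule_tac finite_subset[of _ "Pow (X \<union> B0)"]) auto
  moreover have "{Y. ?P Y} \<noteq> {}" using X by auto
  ultimately obtain B where B: "B \<in> {Y. ?P Y}" "\<forall>Y\<in>{Y. ?P Y}. B \<subseteq> Y \<longrightarrow> B = Y"
    using finite_has_maximal[of "{Y. ?P Y}"] by auto
  have "card B0 \<le> card B"
  proof (rule ccontr)
    assume "\<not> card B0 \<le> card B"
    then obtain y where y: "y \<in> B0 - B" "insert y B \<in> indeps M"
      using augmentation[of B B0] B B0 unfolding basis_def by auto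
    then have "insert y B \<in> {Y. ?P Y}" using B(1) by auto
    then show False using B(2) y(1) by blast
  qed
  have "basis M B" unfolding basis_def
  proof (intro conjI ballI impI)
    show "B \<in> indeps M" using B(1) by simp
    fix Y assume Y: "Y \<in> indeps M" "B \<subseteq> Y"
    then have "card Y \<le> card B" using basis_card_max[OF B0 Y(1)] \<open>card B0 \<le> card B\<close> by simp
    then show "Y = B" using Y indep_finite[OF Y(1)] card_seteq by blast
  qed
  then show ?thesis using that B(1) by blast
qed

lemma basis_exists: obtains B where "basis M B"
proof -
  have "finite (indeps M)"
    by (rule finite_subset[of _ "Pow (ground M)"]) (use indep_subset_ground finite_ground in auto)
  moreover have "indeps M \<noteq> {}" using empty_indep by auto
  ultimately obtain B where "B \<in> indeps M" "\<forall>Y\<in>indeps M. B \<subseteq> Y \<longrightarrow> B = Y"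
    using finite_has_maximal[of "indeps M"] by auto
  then have "basis M B" unfolding basis_def by auto
  then show ?thesis by (rule that)
qed

lemma basis_indep: "basis M B \<Longrightarrow> B \<in> indeps M"
  by (simp add: basis_def)

lemma basis_ground: "basis M B \<Longrightarrow> B \<subseteq> ground M"
  using basis_indep indep_subset_ground by blast

text \<open>Taking complements twice, the bases of the contraction are the bases through
  \<open>e\<close> with \<open>e\<close> removed; independence of \<open>{e}\<close> lets every
  basis be exchanged for one through \<open>e\<close>.\<close>

lemma contract_element:
  assumes e: "{e} \<in> indeps M"
  shows "contract_matroid M {e} =
    \<lparr>ground = ground M - {e}, indeps = {Y. Y \<subseteq> ground M - {e} \<and> insert e Y \<in> indeps M}\<rparr>"
proof -
  define D where "D = delete_matroid (dual_matroid M) {e}"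
  have gD: "ground D = ground M - {e}"
    by (simp add: D_def delete_matroid_def restrict_matroid_def dual_matroid_def)
  have iD: "X \<in> indeps D \<longleftrightarrow> X \<subseteq> ground M - {e} \<and> (\<exists>B. basis M B \<and> X \<inter> B = {})" for X
    by (auto simp: D_def delete_matroid_def restrict_matroid_def dual_matroid_def)
  have bD: "basis D X \<longleftrightarrow> (\<exists>B. basis M B \<and> e \<in> B \<and> X = ground M - B)" for X
  proof
    assume X: "basis D X"
    then obtain B where B: "basis M B" "X \<inter> B = {}" "X \<subseteq> ground M - {e}" unfolding basis_def iD by blast
    obtain B' where B': "basis M B'" "{e} \<subseteq> B'" "B' \<subseteq> {e} \<union> B" by (rule basis_extend[OF e B(1)])
    have "ground M - B' \<in> indeps D" unfolding iD using B' by blast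
    moreover have "X \<subseteq> ground M - B'" using B B' by blast
    ultimately have "X = ground M - B'" using X unfolding basis_def by blast
    with B' show "\<exists>B. basis M B \<and> e \<in> B \<and> X = ground M - B" by blast
  next
    assume "\<exists>B. basis M B \<and> e \<in> B \<and> X = ground M - B"
    then obtain B where B: "basis M B" "e \<in> B" "X = ground M - B" by blast
    show "basis D X" unfolding basis_def
    proof (intro conjI ballI impI)
      show "X \<in> indeps D" unfolding iD using B by blast
      fix Y assume Y: "Y \<in> indeps D" "X \<subseteq> Y"
      then obtain B2 where B2: "basis M B2" "Y \<inter> B2 = {}" unfolding iD by blast
      have "B2 \<subseteq> B" using B2 Y(2) B(3) basis_ground[OF B2(1)] by blast
      then have "B2 = B" using B2(1) basis_indep[OF B(1)] unfolding basis_def by blast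
      then show "Y = X" using B2(2) Y B(3) unfolding iD by blast
    qed
  qed
  have "Y \<subseteq> ground M - {e} \<and> (\<exists>X. basis D X \<and> Y \<inter> X = {}) \<longleftrightarrow> Y \<subseteq> ground M - {e} \<and> insert e Y \<in> indeps M" for Y
  proof (intro conj_cong refl iffI)
    assume Y: "Y \<subseteq> ground M - {e}" "\<exists>X. basis D X \<and> Y \<inter> X = {}"
    then obtain B where B: "basis M B" "e \<in> B" "Y \<inter> (ground M - B) = {}" unfolding bD by blast
    then have "insert e Y \<subseteq> B" using Y(1) by blast
    then show "insert e Y \<in> indeps M" using indep_subset basis_indep[OF B(1)] by blast
  next
    assume Y: "Y \<subseteq> ground M - {e}" "insert e Y \<in> indeps M"
    obtain B0 where "basis M B0" by (rule basis_exists)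
    then obtain B where "basis M B" "insert e Y \<subseteq> B" by (rule basis_extend[OF Y(2)])
    then show "\<exists>X. basis D X \<and> Y \<inter> X = {}" unfolding bD by blast
  qed
  moreover have "contract_matroid M {e} = dual_matroid D" by (simp add: contract_matroid_def D_def)
  ultimately show ?thesis by (simp add: dual_matroid_def[of D] gD)
qed

lemma indep_dual_iff: "X \<in> indeps (dual_matroid M) \<longleftrightarrow> X \<subseteq> ground M \<and> (\<exists>B. basis M B \<and> X \<inter> B = {})"
  by (simp add: dual_matroid_def)

text \<open>If a circuit \<open>C\<close> contained \<open>e\<close> but not \<open>f\<close>, then
  \<open>C - {e}\<close> would extend to a basis inside its union with a basis avoiding
  \<open>f\<close>. That basis avoids \<open>f\<close>, so it contains \<open>e\<close> and
  therefore \<open>C\<close>.\<close>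

lemma cocircuit_pair:
  assumes "cocircuit M {e, f}" "e \<noteq> f"
  shows "circuit M C \<Longrightarrow> e \<in> C \<Longrightarrow> f \<in> C" and "{e} \<in> indeps M"
proof -
  have c: "{e, f} \<subseteq> ground M" "\<not> (\<exists>B. basis M B \<and> {e, f} \<inter> B = {})"
    using assms(1) unfolding cocircuit_def circuit_def indep_dual_iff by (auto simp: dual_matroid_def)
  have "{f} \<subset> {e, f}" using assms(2) by auto
  then have "{f} \<in> indeps (dual_matroid M)" using assms(1) unfolding cocircuit_def circuit_def by blast
  then obtain Bf where Bf: "basis M Bf" "f \<notin> Bf" unfolding indep_dual_iff by blast
  show "f \<in> C" if C: "circuit M C" "e \<in> C"
  proof (rule ccontr)
    assume "f \<notin> C"
    have "C - {e} \<in> indeps M" using C unfolding circuit_def by blast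
    then obtain B where B: "basis M B" "C - {e} \<subseteq> B" "B \<subseteq> (C - {e}) \<union> Bf" by (rule basis_extend[OF _ Bf(1)])
    have "e \<in> B" using c(2) B Bf \<open>f \<notin> C\<close> by blast
    then have "C \<subseteq> B" using B(2) by blast
    then show False using circuit_not_subset_indep[OF C(1) basis_indep[OF B(1)]] by blast
  qed
  have "e \<in> Bf" using c(2) Bf by blast
  then show "{e} \<in> indeps M" using indep_subset[OF basis_indep[OF Bf(1)]] by blast
qed

text \<open>A basis avoiding both elements would give a circuit that passes through \<open>e\<close>
  and not through \<open>f\<close>. The circuit \<open>C0\<close> yields bases avoiding
  \<open>e\<close> and bases avoiding \<open>f\<close>, so neither element alone is dependent in the
  dual.\<close>

lemma cocircuit_pairI:
  assumes ef: "e \<noteq> f" "e \<in> ground M" "f \<in> ground M" and C0: "circuit M C0" "e \<in> C0"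
    and eq: "\<And>C. circuit M C \<Longrightarrow> e \<in> C \<longleftrightarrow> f \<in> C"
  shows "cocircuit M {e, f}"
proof -
  have av: "\<exists>B. basis M B \<and> x \<notin> B" if x: "x \<in> C0" for x
  proof -
    have i: "C0 - {x} \<in> indeps M" using C0(1) x unfolding circuit_def by blast
    obtain B0 where "basis M B0" by (rule basis_exists)
    then obtain B where B: "basis M B" "C0 - {x} \<subseteq> B" by (rule basis_extend[OF i])
    then have "x \<notin> B" using circuit_not_subset_indep[OF C0(1) basis_indep[OF B(1)]] by blast
    with B(1) show ?thesis by blast
  qed
  have f0: "f \<in> C0" using eq[OF C0(1)] C0(2) by simp
  have ie: "{e} \<in> indeps (dual_matroid M)" "{f} \<in> indeps (dual_matroid M)" "{} \<in> indeps (dual_matroid M)"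
    using av[OF C0(2)] av[OF f0] ef unfolding indep_dual_iff by auto
  have nd: "\<not> (\<exists>B. basis M B \<and> {e, f} \<inter> B = {})"
  proof
    assume "\<exists>B. basis M B \<and> {e, f} \<inter> B = {}"
    then obtain B where B: "basis M B" "e \<notin> B" "f \<notin> B" by blast
    have "insert e B \<notin> indeps M" using B unfolding basis_def by blast
    moreover have "insert e B \<subseteq> ground M" using ef basis_ground[OF B(1)] by blast
    ultimately obtain C where C: "circuit M C" "C \<subseteq> insert e B" by (metis circuit_ex)
    have "e \<in> C" using C circuit_not_subset_indep[OF C(1) basis_indep[OF B(1)]] by blast
    then show False using eq[OF C(1)] C(2) B ef(1) by blast
  qed
  show ?thesis unfolding cocircuit_def circuit_def
  proof (intro conjI allI impI)
    show "{e, f} \<subseteq> ground (dual_matroid M)" using ef by (simp add: dual_matroid_def)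
    show "{e, f} \<notin> indeps (dual_matroid M)" unfolding indep_dual_iff using nd by blast
    fix X assume "X \<subset> {e, f}"
    then have "X = {} \<or> X = {e} \<or> X = {f}" by blast
    then show "X \<in> indeps (dual_matroid M)" using ie by blast
  qed
qed

text \<open>In a series class every circuit of the contraction extends uniquely.\<close>

lemma circuit_contract_series:
  assumes ef: "e \<noteq> f" and e: "{e} \<in> indeps M"
    and eq: "\<And>C. circuit M C \<Longrightarrow> e \<in> C \<longleftrightarrow> f \<in> C"
    and N: "ground N = ground M - {e}" "\<And>Y. Y \<in> indeps N \<longleftrightarrow> Y \<subseteq> ground M - {e} \<and> insert e Y \<in> indeps M"
  shows "circuit N D \<longleftrightarrow> (\<exists>C. circuit M C \<and> D = C - {e})"
proof -
  have eM: "e \<in> ground M" using e indep_subset_ground by blast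
  have fwd: "circuit N (C - {e})" if C: "circuit M C" for C
    unfolding circuit_def
  proof (intro conjI allI impI)
    have CM: "C \<subseteq> ground M" using C by (simp add: circuit_def)
    then show "C - {e} \<subseteq> ground N" unfolding N(1) by blast
    have "\<not> insert e (C - {e}) \<in> indeps M" using circuit_not_subset_indep[OF C] by blast
    then show "C - {e} \<notin> indeps N" unfolding N(2) by blast
    fix Y assume Y: "Y \<subset> C - {e}"
    have YM: "Y \<subseteq> ground M - {e}" using Y CM by blast
    have "insert e Y \<in> indeps M"
    proof (rule ccontr)
      assume n: "insert e Y \<notin> indeps M"
      have "insert e Y \<subseteq> ground M" using YM eM by blast
      then obtain C' where C': "circuit M C'" "C' \<subseteq> insert e Y" using circuit_ex n by metis
      have YI: "Y \<in> indeps M" using C Y unfolding circuit_def by blast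
      have "e \<in> C'" using C' circuit_not_subset_indep[OF C'(1) YI] by blast
      then have "f \<in> C'" using eq[OF C'(1)] by simp
      then have "f \<in> C" using C'(2) Y ef by blast
      then have "e \<in> C" using eq[OF C] by simp
      then have "insert e Y \<subset> C" using Y by blast
      then show False using C n unfolding circuit_def by blast
    qed
    then show "Y \<in> indeps N" unfolding N(2) using YM by blast
  qed
  show ?thesis
  proof
    assume D: "circuit N D"
    then have Ds: "D \<subseteq> ground M - {e}" using N(1) by (simp add: circuit_def)
    have "D \<notin> indeps N" using D by (simp add: circuit_def)
    then have "insert e D \<notin> indeps M" unfolding N(2) using Ds by blast
    moreover have "insert e D \<subseteq> ground M" using Ds eM by blast
    ultimately obtain C where C: "circuit M C" "C \<subseteq> insert e D" using circuit_ex by metis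
    have cC: "circuit N (C - {e})" by (rule fwd[OF C(1)])
    have "C - {e} \<subseteq> D" using C(2) by blast
    moreover have "C - {e} \<notin> indeps N" using cC by (simp add: circuit_def)
    ultimately have "D = C - {e}" using D unfolding circuit_def by blast
    with C(1) show "\<exists>C. circuit M C \<and> D = C - {e}" by blast
  next
    assume "\<exists>C. circuit M C \<and> D = C - {e}"
    then show "circuit N D" using fwd by blast
  qed
qed

lemma matroid_contract_element:
  assumes e: "{e} \<in> indeps M"
    and N: "ground N = ground M - {e}" "\<And>Y. Y \<in> indeps N \<longleftrightarrow> Y \<subseteq> ground M - {e} \<and> insert e Y \<in> indeps M"
  shows "matroid N"
proof
  show "finite (ground N)" using finite_ground N(1) by simp
  show "X \<subseteq> ground N" if "X \<in> indeps N" for X using that N by simp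
  show "{} \<in> indeps N" using e N by simp
  show "Y \<in> indeps N" if "X \<in> indeps N" "Y \<subseteq> X" for X Y
  proof -
    have "insert e Y \<subseteq> insert e X" using that(2) by blast
    then show ?thesis using that indep_subset[of "insert e X" "insert e Y"] N(2) by blast
  qed
  show "\<exists>y\<in>Y - X. insert y X \<in> indeps N" if h: "X \<in> indeps N" "Y \<in> indeps N" "card X < card Y" for X Y
  proof -
    have i: "insert e X \<in> indeps M" "insert e Y \<in> indeps M" "e \<notin> X" "e \<notin> Y" "X \<subseteq> ground M - {e}" "Y \<subseteq> ground M - {e}"
      using h N(2) by auto
    have "finite X" "finite Y" using i(5,6) finite_ground by (meson finite_Diff finite_subset)+
    then have "card (insert e X) < card (insert e Y)" using h(3) i(3,4) by simp
    from augmentation[OF i(1,2) this] obtain y where y: "y \<in> insert e Y - insert e X" "insert y (insert e X) \<in> indeps M"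
      by blast
    then have "y \<in> Y - X" "insert y X \<in> indeps N" using i(5,6) unfolding N(2) by (auto simp: insert_commute)
    then show ?thesis by blast
  qed
qed

end

text \<open>Removing \<open>e\<close> maps the circuits of \<open>N'\<close> bijectively to those of
  \<open>N\<close>, because membership of \<open>e\<close> is a copy of membership of
  \<open>f\<close>. The map preserves whether two circuits meet, and it commutes with symmetric
  differences.\<close>

lemma circuit_difference_series_move:
  assumes "series_move N N'" "circuit_difference N"
  shows "circuit_difference N'"
proof -
  from assms(1) obtain e f where ef: "e \<notin> ground N" "f \<in> ground N" "cocircuit N' {e, f}"
    "contract_matroid N' {e} = N" and m: "matroid N'" unfolding series_move_def by blast
  interpret N': matroid N' by (rule m)
  have ne: "e \<noteq> f" using ef by blast
  have ei: "{e} \<in> indeps N'" by (rule N'.cocircuit_pair(2)[OF ef(3) ne])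
  have fe: "cocircuit N' {f, e}" using ef(3) by (simp add: insert_commute)
  have eq: "e \<in> C \<longleftrightarrow> f \<in> C" if "circuit N' C" for C
    using N'.cocircuit_pair(1)[OF ef(3) ne that] N'.cocircuit_pair(1)[OF fe ne[symmetric] that] by blast
  have N: "ground N = ground N' - {e}" "\<And>Y. Y \<in> indeps N \<longleftrightarrow> Y \<subseteq> ground N' - {e} \<and> insert e Y \<in> indeps N'"
    unfolding ef(4)[symmetric] N'.contract_element[OF ei] by simp_all
  have cir: "circuit N D \<longleftrightarrow> (\<exists>C. circuit N' C \<and> D = C - {e})" for D
    by (rule N'.circuit_contract_series[OF ne ei _ N]) (rule eq)
  have inj: "C = C'" if "circuit N' C" "circuit N' C'" "C - {e} = C' - {e}" for C C'
    using eq[OF that(1)] eq[OF that(2)] that(3) ne by blast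
  show ?thesis unfolding circuit_difference_def
  proof (intro allI impI, elim conjE)
    fix C1 C2 assume C: "circuit N' C1" "circuit N' C2" "C1 \<noteq> C2" "C1 \<inter> C2 \<noteq> {}"
    have "circuit N (C1 - {e})" "circuit N (C2 - {e})" using cir C by blast+
    moreover have "C1 - {e} \<noteq> C2 - {e}" using inj C by blast
    moreover have "(C1 - {e}) \<inter> (C2 - {e}) \<noteq> {}"
      using C(4) eq[OF C(1)] eq[OF C(2)] ne by blast
    ultimately have "circuit N (sym_diff (C1 - {e}) (C2 - {e}))"
      using assms(2) unfolding circuit_difference_def by blast
    from iffD1[OF cir this] obtain C3 where C3: "circuit N' C3" "sym_diff (C1 - {e}) (C2 - {e}) = C3 - {e}"
      by (elim exE conjE) (rule that)
    have "f \<in> C3 \<longleftrightarrow> (f \<in> C1) \<noteq> (f \<in> C2)" using C3(2) ne by blast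
    then have "e \<in> C3 \<longleftrightarrow> (e \<in> C1) \<noteq> (e \<in> C2)" using eq C C3(1) by blast
    then have "C3 = sym_diff C1 C2" using C3(2) by blast
    then show "circuit N' (sym_diff C1 C2)" using C3(1) by simp
  qed
qed

lemma circuit_difference_series_extension:
  assumes "series_extension N K" "circuit_difference N"
  shows "circuit_difference K"
  using assms unfolding series_extension_def
  by (induction rule: rtranclp_induct) (auto intro: circuit_difference_series_move)

text \<open>Two elements with the same image lie in the same circuits, and by \<open>cov\<close>
  they lie in some circuit, so they form a cocircuit. Contracting one of them preserves the
  hypotheses; once \<open>\<pi>\<close> is injective it is an isomorphism.\<close>

lemma series_extension_pullback:
  fixes M :: "'a set_system" and N0 :: "'b set_system"
  assumes "matroid M" and "\<pi> ` ground M = ground N0"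
    and "\<And>C. circuit M C \<longleftrightarrow> (\<exists>D. circuit N0 D \<and> C = {x \<in> ground M. \<pi> x \<in> D})"
    and N0: "\<And>X. X \<in> indeps N0 \<longleftrightarrow> X \<subseteq> ground N0 \<and> (\<forall>D. circuit N0 D \<longrightarrow> \<not> D \<subseteq> X)"
    and cov: "\<And>y. y \<in> ground N0 \<Longrightarrow> \<exists>D. circuit N0 D \<and> y \<in> D"
  shows "\<exists>N. series_extension N M \<and> matroid_iso N N0"
  using assms(1-3)
proof (induction "card (ground M)" arbitrary: M rule: less_induct)
  case less
  interpret M: matroid M by (rule less.prems(1))
  note sur = less.prems(2) and cir = less.prems(3)
  show ?case
  proof (cases "inj_on \<pi> (ground M)")
    case True
    have "matroid_iso M N0" unfolding matroid_iso_def
    proof (intro exI conjI allI impI)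
      show "bij_betw \<pi> (ground M) (ground N0)" using True sur by (simp add: bij_betw_def)
      fix X assume X: "X \<subseteq> ground M"
      have "(\<exists>C. circuit M C \<and> C \<subseteq> X) \<longleftrightarrow> (\<exists>D. circuit N0 D \<and> D \<subseteq> \<pi> ` X)"
      proof
        assume "\<exists>C. circuit M C \<and> C \<subseteq> X"
        then obtain D where D: "circuit N0 D" "{x \<in> ground M. \<pi> x \<in> D} \<subseteq> X" unfolding cir by blast
        have "D \<subseteq> \<pi> ` ground M" using D(1) sur unfolding circuit_def by blast
        then have "D \<subseteq> \<pi> ` X" using D(2) by blast
        with D(1) show "\<exists>D. circuit N0 D \<and> D \<subseteq> \<pi> ` X" by blast
      next
        assume "\<exists>D. circuit N0 D \<and> D \<subseteq> \<pi> ` X"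
        then obtain D where D: "circuit N0 D" "D \<subseteq> \<pi> ` X" by blast
        have "{x \<in> ground M. \<pi> x \<in> D} \<subseteq> X" using D(2) X True by (auto simp: inj_on_def)
        then show "\<exists>C. circuit M C \<and> C \<subseteq> X" unfolding cir using D(1) by blast
      qed
      then show "X \<in> indeps M \<longleftrightarrow> \<pi> ` X \<in> indeps N0"
        unfolding M.indep_iff_no_circuit N0 using X sur by blast
    qed
    then show ?thesis unfolding series_extension_def by blast
  next
    case False
    then obtain e f where ef: "e \<in> ground M" "f \<in> ground M" "e \<noteq> f" "\<pi> e = \<pi> f" unfolding inj_on_def by blast
    have eq: "e \<in> C \<longleftrightarrow> f \<in> C" if "circuit M C" for C using that ef unfolding cir by auto
    have "\<pi> e \<in> ground N0" using ef(1) sur by blast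
    then obtain D0 where D0: "circuit N0 D0" "\<pi> e \<in> D0" using cov by blast
    define C0 where "C0 = {x \<in> ground M. \<pi> x \<in> D0}"
    have C0: "circuit M C0" "e \<in> C0" using D0 ef(1) unfolding cir C0_def by auto
    have coc: "cocircuit M {e, f}" by (rule M.cocircuit_pairI[OF ef(3,1,2) C0 eq])
    have ei: "{e} \<in> indeps M" by (rule M.cocircuit_pair(2)[OF coc ef(3)])
    define N where "N = contract_matroid M {e}"
    have N: "ground N = ground M - {e}" "\<And>Y. Y \<in> indeps N \<longleftrightarrow> Y \<subseteq> ground M - {e} \<and> insert e Y \<in> indeps M"
      unfolding N_def M.contract_element[OF ei] by simp_all
    have mN: "matroid N" by (rule M.matroid_contract_element[OF ei N])
    have sm: "series_move N M"
    proof -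
      have "e \<notin> ground N" "f \<in> ground N" "ground M = insert e (ground N)" using N(1) ef by auto
      with mN less.prems(1) coc N_def show ?thesis unfolding series_move_def by metis
    qed
    have "card (ground N) < card (ground M)"
      unfolding N(1) using M.finite_ground ef(1) by (rule card_Diff1_less)
    moreover have "\<pi> ` ground N = ground N0" unfolding N(1) sur[symmetric] using ef by blast
    moreover have "circuit N C \<longleftrightarrow> (\<exists>D. circuit N0 D \<and> C = {x \<in> ground N. \<pi> x \<in> D})" for C
    proof -
      have "{x \<in> ground M. \<pi> x \<in> D} - {e} = {x \<in> ground N. \<pi> x \<in> D}" for D unfolding N(1) by blast
      moreover have "circuit N C \<longleftrightarrow> (\<exists>C'. circuit M C' \<and> C = C' - {e})"
        by (rule M.circuit_contract_series[OF ef(3) ei _ N]) (rule eq)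
      ultimately show ?thesis unfolding cir by metis
    qed
    ultimately obtain N1 where "series_extension N1 N" "matroid_iso N1 N0" using less.hyps[OF _ mN] by blast
    then show ?thesis using sm unfolding series_extension_def by (meson rtranclp.rtrancl_into_rtrancl)
  qed
qed

text \<open>The family may contain unions of circuits, as a cycle space does, so independence can be
  tested before the circuits are known.\<close>

lemma circuit_of_cycles:
  assumes ind: "\<And>X. X \<in> indeps N \<longleftrightarrow> X \<subseteq> ground N \<and> (\<forall>z\<in>Z. z \<noteq> {} \<longrightarrow> \<not> z \<subseteq> X)"
    and sub: "\<And>z. z \<in> Z \<Longrightarrow> z \<subseteq> ground N"
  shows "circuit N D \<longleftrightarrow> D \<in> Z \<and> D \<noteq> {} \<and> (\<forall>y\<in>Z. y \<noteq> {} \<longrightarrow> y \<subseteq> D \<longrightarrow> y = D)"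
proof
  assume D: "circuit N D"
  then have "D \<notin> indeps N" "D \<subseteq> ground N" by (auto simp: circuit_def)
  then obtain z where z: "z \<in> Z" "z \<noteq> {}" "z \<subseteq> D" unfolding ind by blast
  have min: "y = D" if "y \<in> Z" "y \<noteq> {}" "y \<subseteq> D" for y
  proof (rule ccontr)
    assume "y \<noteq> D"
    then have "y \<in> indeps N" using D that(3) unfolding circuit_def by blast
    then show False using that(1,2) unfolding ind by blast
  qed
  from min[OF z] z min show "D \<in> Z \<and> D \<noteq> {} \<and> (\<forall>y\<in>Z. y \<noteq> {} \<longrightarrow> y \<subseteq> D \<longrightarrow> y = D)" by blast
next
  assume D: "D \<in> Z \<and> D \<noteq> {} \<and> (\<forall>y\<in>Z. y \<noteq> {} \<longrightarrow> y \<subseteq> D \<longrightarrow> y = D)"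
  show "circuit N D" unfolding circuit_def
  proof (intro conjI allI impI)
    show Ds: "D \<subseteq> ground N" using D sub by blast
    show "D \<notin> indeps N" unfolding ind using D by blast
    fix X assume X: "X \<subset> D"
    show "X \<in> indeps N" unfolding ind
    proof (intro conjI ballI impI notI)
      show "X \<subseteq> ground N" using X Ds by blast
      fix z assume "z \<in> Z" "z \<noteq> {}" "z \<subseteq> X"
      then show False using D X by blast
    qed
  qed
qed

lemma circuit_iso:
  assumes f: "bij_betw f (ground M) (ground N)" "\<And>X. X \<subseteq> ground M \<Longrightarrow> X \<in> indeps M \<longleftrightarrow> f ` X \<in> indeps N"
    and C: "C \<subseteq> ground M"
  shows "circuit M C \<longleftrightarrow> circuit N (f ` C)"
proof -
  have inj: "inj_on f (ground M)" and im: "f ` ground M = ground N" using f(1) by (auto simp: bij_betw_def)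
  have "(\<forall>X. X \<subset> C \<longrightarrow> X \<in> indeps M) \<longleftrightarrow> (\<forall>Y. Y \<subset> f ` C \<longrightarrow> Y \<in> indeps N)"
  proof
    assume h: "\<forall>X. X \<subset> C \<longrightarrow> X \<in> indeps M"
    show "\<forall>Y. Y \<subset> f ` C \<longrightarrow> Y \<in> indeps N"
    proof (intro allI impI)
      fix Y assume Y: "Y \<subset> f ` C"
      define X where "X = {x \<in> C. f x \<in> Y}"
      have fX: "f ` X = Y" using Y unfolding X_def by blast
      have "X \<subset> C" using Y fX unfolding X_def by blast
      then have "X \<in> indeps M" "X \<subseteq> ground M" using h C by blast+
      then show "Y \<in> indeps N" using f(2) fX by blast
    qed
  next
    assume h: "\<forall>Y. Y \<subset> f ` C \<longrightarrow> Y \<in> indeps N"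
    show "\<forall>X. X \<subset> C \<longrightarrow> X \<in> indeps M"
    proof (intro allI impI)
      fix X assume X: "X \<subset> C"
      have "f ` X \<subset> f ` C"
      proof -
        obtain c where c: "c \<in> C" "c \<notin> X" using X by blast
        have "f c \<notin> f ` X" using c X C inj by (auto simp: inj_on_def)
        then show ?thesis using c X by blast
      qed
      then have "f ` X \<in> indeps N" using h by blast
      then show "X \<in> indeps M" using f(2)[of X] X C by blast
    qed
  qed
  moreover have "f ` C \<subseteq> ground N" using C im by blast
  ultimately show ?thesis unfolding circuit_def using f(2)[OF C] C by blast
qed

lemma circuit_difference_iso:
  assumes "matroid_iso M N" "circuit_difference N"
  shows "circuit_difference M"
proof -
  obtain f where f: "bij_betw f (ground M) (ground N)" "\<And>X. X \<subseteq> ground M \<Longrightarrow> X \<in> indeps M \<longleftrightarrow> f ` X \<in> indeps N"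
    using assms(1) unfolding matroid_iso_def by blast
  have inj: "inj_on f (ground M)" using f(1) by (auto simp: bij_betw_def)
  note cir = circuit_iso[OF f]
  show ?thesis unfolding circuit_difference_def
  proof (intro allI impI, elim conjE)
    fix C1 C2 assume C: "circuit M C1" "circuit M C2" "C1 \<noteq> C2" "C1 \<inter> C2 \<noteq> {}"
    have s: "C1 \<subseteq> ground M" "C2 \<subseteq> ground M" using C(1,2) by (auto simp: circuit_def)
    have "f ` C1 \<noteq> f ` C2" using C(3) s inj by (simp add: inj_on_image_eq_iff)
    moreover have "f ` C1 \<inter> f ` C2 \<noteq> {}" using C(4) by blast
    ultimately have "circuit N (sym_diff (f ` C1) (f ` C2))"
      using C(1,2) assms(2) cir s unfolding circuit_difference_def by blast
    moreover have "sym_diff (f ` C1) (f ` C2) = f ` sym_diff C1 C2"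
    proof -
      have "f ` (C1 - C2) = f ` C1 - f ` C2" "f ` (C2 - C1) = f ` C2 - f ` C1"
        by (rule inj_on_image_set_diff[OF inj]; use s in blast)+
      then show ?thesis by (simp only: image_Un)
    qed
    ultimately show "circuit M (sym_diff C1 C2)" using cir[of "sym_diff C1 C2"] s by auto
  qed
qed

lemma circuit_restrict:
  assumes "Q \<subseteq> ground M"
  shows "circuit (restrict_matroid M Q) C \<longleftrightarrow> circuit M C \<and> C \<subseteq> Q"
  using assms unfolding circuit_def restrict_matroid_def by auto

lemma matroid_restrict:
  assumes "matroid M" "Q \<subseteq> ground M" shows "matroid (restrict_matroid M Q)"
proof -
  interpret M: matroid M by (rule assms(1))
  show ?thesis
  proof
    show "finite (ground (restrict_matroid M Q))"
      using assms(2) M.finite_ground finite_subset by (auto simp: restrict_matroid_def)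
    show "{} \<in> indeps (restrict_matroid M Q)" using M.empty_indep by (simp add: restrict_matroid_def)
    show "Y \<in> indeps (restrict_matroid M Q)" if "X \<in> indeps (restrict_matroid M Q)" "Y \<subseteq> X" for X Y
      using that M.indep_subset by (auto simp: restrict_matroid_def)
    show "\<exists>y\<in>Y - X. insert y X \<in> indeps (restrict_matroid M Q)"
      if h: "X \<in> indeps (restrict_matroid M Q)" "Y \<in> indeps (restrict_matroid M Q)" "card X < card Y" for X Y
      using M.augmentation[of X Y] h by (auto simp: restrict_matroid_def)
  qed (auto simp: restrict_matroid_def)
qed

section \<open>Cycle matroids and R10\<close>

text \<open>The cyclic shift is a bijection, so \<open>b\<close> holds equally often at a position
  and at its successor. Hence the changes from true to false are as many as those from false to
  true.\<close>

lemma card_cyclic_changes_even: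
  fixes b :: "nat \<Rightarrow> bool"
  shows "even (card {i. i < n \<and> b i \<noteq> b (Suc i mod n)})"
proof (cases "n = 0")
  case False
  let ?A = "{i. i < n \<and> b i}" and ?B = "{i. i < n \<and> b (Suc i mod n)}"
  have inj: "inj_on (\<lambda>i. Suc i mod n) ?B"
  proof (rule inj_onI)
    fix i j assume h: "i \<in> ?B" "j \<in> ?B" "Suc i mod n = Suc j mod n"
    then show "i = j" by (cases "Suc i = n"; cases "Suc j = n") auto
  qed
  have "(\<lambda>i. Suc i mod n) ` ?B = ?A"
  proof
    show "(\<lambda>i. Suc i mod n) ` ?B \<subseteq> ?A" using False by auto
    show "?A \<subseteq> (\<lambda>i. Suc i mod n) ` ?B"
    proof
      fix i assume i: "i \<in> ?A"
      define j where "j = (if i = 0 then n - 1 else i - 1)"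
      have "Suc j mod n = i" "j < n" using i False by (auto simp: j_def)
      then show "i \<in> (\<lambda>i. Suc i mod n) ` ?B" using i by (intro image_eqI[of _ _ j]) auto
    qed
  qed
  then have c: "card ?A = card ?B" using card_image[OF inj] by simp
  have "{i. i < n \<and> b i \<noteq> b (Suc i mod n)} = (?A - ?B) \<union> (?B - ?A)" by auto
  moreover have "card ((?A - ?B) \<union> (?B - ?A)) = card (?A - ?B) + card (?B - ?A)"
    by (rule card_Un_disjoint) auto
  moreover have "card (?A - ?B) = card ?A - card (?A \<inter> ?B)" "card (?B - ?A) = card ?B - card (?A \<inter> ?B)"
    by (simp_all add: card_Diff_subset_Int Int_commute)
  ultimately show ?thesis using c by simp
qed simp

text \<open>A cycle of length at least three has distinct edges at distinct positions, so its
  crossing edges correspond to the changes of a cyclic Boolean sequence.\<close>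

lemma cycle_crosses_even:
  assumes "is_cycle C"
  shows "even (card {d \<in> C. crosses I d})"
proof -
  obtain vs where vs: "distinct vs" "3 \<le> length vs" "C = cycle_edges vs"
    using assms unfolding is_cycle_def by blast
  let ?n = "length vs"
  define e where "e i = {vs ! i, vs ! (Suc i mod ?n)}" for i
  have C: "C = e ` {..<?n}" unfolding vs(3) cycle_edges_def e_def by auto
  have nth: "vs ! i = vs ! j \<longleftrightarrow> i = j" if "i < ?n" "j < ?n" for i j
    using vs(1) that by (simp add: nth_eq_iff_index_eq)
  have sm: "Suc i mod ?n < ?n" for i using vs(2) by (intro mod_less_divisor) linarith
  have inj: "inj_on e {..<?n}"
  proof (rule inj_onI)
    fix i j assume ij: "i \<in> {..<?n}" "j \<in> {..<?n}" "e i = e j"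
    then have "i = j \<or> (i = Suc j mod ?n \<and> Suc i mod ?n = j)"
      unfolding e_def doubleton_eq_iff using nth sm by auto
    moreover have "\<not> (i = Suc j mod ?n \<and> Suc i mod ?n = j)"
      using ij(1,2) vs(2) by (cases "Suc i = ?n"; cases "Suc j = ?n") auto
    ultimately show "i = j" by blast
  qed
  have "{d \<in> C. crosses I d} = e ` {i. i < ?n \<and> (vs ! i \<in> I) \<noteq> (vs ! (Suc i mod ?n) \<in> I)}"
    unfolding C e_def by auto
  moreover have "inj_on e {i. i < ?n \<and> (vs ! i \<in> I) \<noteq> (vs ! (Suc i mod ?n) \<in> I)}"
    using inj by (rule inj_on_subset) auto
  ultimately have "card {d \<in> C. crosses I d} = card {i. i < ?n \<and> (vs ! i \<in> I) \<noteq> (vs ! (Suc i mod ?n) \<in> I)}"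
    by (simp add: card_image)
  then show ?thesis using card_cyclic_changes_even[of ?n "\<lambda>i. vs ! i \<in> I"] by simp
qed

lemma cycle_crosses_not_single:
  assumes "is_cycle C" "{d \<in> C. crosses I d} = {d0}" shows False
  using cycle_crosses_even[OF assms(1), of I] unfolding assms(2) by simp

lemma cycle_nonempty: "is_cycle C \<Longrightarrow> C \<noteq> {}"
proof -
  assume "is_cycle C"
  then obtain vs where vs: "3 \<le> length vs" "C = cycle_edges vs" unfolding is_cycle_def by blast
  then have "0 < length vs" by linarith
  then have "{vs ! 0, vs ! (Suc 0 mod length vs)} \<in> C" unfolding vs(2) cycle_edges_def by blast
  then show "C \<noteq> {}" by blast
qed

definition adj :: "'v set set \<Rightarrow> ('v \<times> 'v) set" where
  "adj B = {(x, y). {x, y} \<in> B}"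

text \<open>A walk is shortened as it grows: when it returns to a vertex already visited, it is cut
  off there.\<close>

lemma path_exists:
  assumes "(u, v) \<in> (adj B)\<^sup>*"
  shows "\<exists>vs. vs \<noteq> [] \<and> hd vs = u \<and> last vs = v \<and> distinct vs \<and> successively (\<lambda>x y. {x, y} \<in> B) vs"
  using assms
proof (induction rule: rtrancl_induct)
  case base
  show ?case by (intro exI[of _ "[u]"]) simp
next
  case (step y z)
  then obtain vs where vs: "vs \<noteq> []" "hd vs = u" "last vs = y" "distinct vs" "successively (\<lambda>x y. {x, y} \<in> B) vs" by blast
  show ?case
  proof (cases "z \<in> set vs")
    case True
    then obtain xs ys where xy: "vs = xs @ z # ys" by (meson split_list)
    have "successively (\<lambda>x y. {x, y} \<in> B) (xs @ [z])"
      using vs(5) unfolding xy by (auto simp: successively_append_iff successively_Cons)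
    moreover have "hd (xs @ [z]) = u" using vs(2) unfolding xy by (cases xs) auto
    ultimately show ?thesis using vs(4) unfolding xy by (intro exI[of _ "xs @ [z]"]) auto
  next
    case False
    have "successively (\<lambda>x y. {x, y} \<in> B) (vs @ [z])"
      using vs step(2) by (auto simp: successively_append_iff adj_def)
    then show ?thesis using vs False by (intro exI[of _ "vs @ [z]"]) auto
  qed
qed

text \<open>A path from \<open>u\<close> to \<open>v\<close> in \<open>B\<close> has at least three
  vertices because \<open>uv\<close> itself is missing; the edge then closes it to a cycle.\<close>

lemma cycle_through_edge:
  assumes "(u, v) \<in> (adj B)\<^sup>*" "u \<noteq> v" "{u, v} \<notin> B"
  shows "\<exists>C. is_cycle C \<and> C \<subseteq> insert {u, v} B"
proof -
  obtain vs where vs: "vs \<noteq> []" "hd vs = u" "last vs = v" "distinct vs" "successively (\<lambda>x y. {x, y} \<in> B) vs"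
    using path_exists[OF assms(1)] by blast
  let ?n = "length vs"
  have st: "{vs ! i, vs ! Suc i} \<in> B" if "Suc i < ?n" for i
    using vs(5) that by (simp add: successively_conv_nth)
  have n1: "?n \<noteq> 1" using vs(1-3) assms(2) by (cases vs) auto
  have n2: "?n \<noteq> 2"
  proof
    assume n: "?n = 2"
    have "vs ! 0 = u" "vs ! 1 = v" using vs(1-3) n by (simp_all add: hd_conv_nth last_conv_nth)
    then show False using st[of 0] n assms(3) by simp
  qed
  have "?n \<noteq> 0" using vs(1) by simp
  then have n3: "3 \<le> ?n" using n1 n2 by linarith
  have "cycle_edges vs \<subseteq> insert {u, v} B"
  proof
    fix d assume "d \<in> cycle_edges vs"
    then obtain i where i: "i < ?n" "d = {vs ! i, vs ! (Suc i mod ?n)}" unfolding cycle_edges_def by blast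
    show "d \<in> insert {u, v} B"
    proof (cases "Suc i = ?n")
      case True
      then have "vs ! i = v" "vs ! (Suc i mod ?n) = u" using vs(1-3) by (simp_all add: hd_conv_nth last_conv_nth[OF vs(1)] True[symmetric])
      then show ?thesis using i(2) by (simp add: insert_commute)
    next
      case False
      then have "Suc i < ?n" using i(1) by simp
      then show ?thesis using st[of i] i(2) by simp
    qed
  qed
  then show ?thesis using vs(4) n3 unfolding is_cycle_def by blast
qed

lemma complete_graph_edges: "complete_graph n = edges {..<n}"
  unfolding complete_graph_def edges_def by (auto simp: card_2_iff)

lemma ground_cycle_matroid [simp]: "ground (cycle_matroid G) = G"
  by (simp add: cycle_matroid_def)

lemma indep_cycle_matroid: "X \<in> indeps (cycle_matroid G) \<longleftrightarrow> X \<subseteq> G \<and> (\<forall>C. is_cycle C \<longrightarrow> \<not> C \<subseteq> X)"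
  by (simp add: cycle_matroid_def)

text \<open>An edge across a cut that a forest avoids can be added to the forest, as a cycle meets
  every cut evenly. So a basis meets every nonempty cut. Conversely, if a maximal forest outside
  \<open>X\<close> were not a basis, the cut of one of its components would have to lie inside
  \<open>X\<close>.\<close>

lemma indep_dual_complete:
  fixes V :: "'v set"
  assumes V: "finite V"
  defines "N \<equiv> dual_matroid (cycle_matroid (edges V))"
  shows "X \<in> indeps N \<longleftrightarrow> X \<subseteq> edges V \<and> (\<forall>z\<in>cuts V. z \<noteq> {} \<longrightarrow> \<not> z \<subseteq> X)"
proof -
  let ?M = "cycle_matroid (edges V)"
  have fin: "finite (edges V)"
    by (rule finite_subset[of _ "Pow V"]) (use V in \<open>auto simp: edges_def\<close>)
  have iN: "X \<in> indeps N \<longleftrightarrow> X \<subseteq> edges V \<and> (\<exists>B. basis ?M B \<and> X \<inter> B = {})"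
    by (simp add: N_def dual_matroid_def)
  have no_cyc: "insert d B \<in> indeps ?M"
    if B: "B \<in> indeps ?M" and d: "d \<in> edges V" "crosses I d" and nc: "\<And>b. b \<in> B \<Longrightarrow> \<not> crosses I b" for B d I
    unfolding indep_cycle_matroid
  proof (intro conjI allI impI notI)
    show "insert d B \<subseteq> edges V" using B d by (simp add: indep_cycle_matroid)
    fix C assume C: "is_cycle C" "C \<subseteq> insert d B"
    have "d \<in> C" using C B unfolding indep_cycle_matroid by blast
    then have "{c \<in> C. crosses I c} = {d}" using C(2) d(2) nc by blast
    with C(1) show False by (rule cycle_crosses_not_single)
  qed
  show ?thesis unfolding iN
  proof (intro conj_cong refl iffI ballI impI notI)
    fix z assume h: "\<exists>B. basis ?M B \<and> X \<inter> B = {}" "z \<in> cuts V" "z \<noteq> {}" "z \<subseteq> X"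
    then obtain B where B: "basis ?M B" "X \<inter> B = {}" by blast
    obtain I where I: "z = {d \<in> edges V. crosses I d}" using h(2) unfolding cuts_def by blast
    obtain d where d: "d \<in> z" using h(3) by blast
    have Bi: "B \<in> indeps ?M" using B(1) by (simp add: basis_def)
    have "insert d B \<in> indeps ?M"
    proof (rule no_cyc[OF Bi])
      show "d \<in> edges V" "crosses I d" using d I by auto
      fix b assume b: "b \<in> B"
      then have "b \<in> edges V" "b \<notin> z" using Bi B(2) h(4) unfolding indep_cycle_matroid by blast+
      then show "\<not> crosses I b" using I by blast
    qed
    then have "d \<in> B" using B(1) unfolding basis_def by blast
    then show False using d h(4) B(2) by blast
  next
    assume X: "X \<subseteq> edges V" and h: "\<forall>z\<in>cuts V. z \<noteq> {} \<longrightarrow> \<not> z \<subseteq> X"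
    let ?P = "{B \<in> indeps ?M. B \<subseteq> edges V - X}"
    have "finite ?P" by (rule finite_subset[of _ "Pow (edges V)"]) (use fin in auto)
    moreover have "?P \<noteq> {}"
    proof -
      have "{} \<in> indeps ?M" unfolding indep_cycle_matroid using cycle_nonempty by auto
      then show ?thesis by blast
    qed
    ultimately obtain B where B: "B \<in> ?P" "\<forall>B'\<in>?P. B \<subseteq> B' \<longrightarrow> B = B'"
      using finite_has_maximal[of ?P] by auto
    have "basis ?M B" unfolding basis_def
    proof (intro conjI ballI impI)
      show Bi: "B \<in> indeps ?M" using B(1) by simp
      fix Y assume Y: "Y \<in> indeps ?M" "B \<subseteq> Y"
      show "Y = B"
      proof (rule ccontr)
        assume "Y \<noteq> B"
        then obtain d where d: "d \<in> Y" "d \<notin> B" using Y(2) by blast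
        then have "d \<in> edges V" using Y(1) unfolding indep_cycle_matroid by blast
        then obtain u v where uv: "d = {u, v}" "u \<in> V" "v \<in> V" "u \<noteq> v" unfolding edges_def by blast
        \<comment> \<open>The component of \<open>u\<close> in the forest \<open>B\<close>.\<close>
        define I where "I = {w \<in> V. (u, w) \<in> (adj B)\<^sup>*}"
        have "v \<notin> I"
        proof
          assume "v \<in> I"
          then have "(u, v) \<in> (adj B)\<^sup>*" by (simp add: I_def)
          from cycle_through_edge[OF this uv(4)] d(2) uv(1) obtain C where "is_cycle C" "C \<subseteq> insert {u, v} B" by blast
          then have "is_cycle C" "C \<subseteq> Y" using d(1) Y(2) uv(1) by auto
          then show False using Y(1) unfolding indep_cycle_matroid by blast
        qed
        moreover have "u \<in> I" using uv by (simp add: I_def)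
        ultimately have "d \<in> {d \<in> edges V. crosses I d}" using \<open>d \<in> edges V\<close> uv(1) by simp
        then have "{d \<in> edges V. crosses I d} \<noteq> {}" by (rule ex_in_conv[THEN iffD1, OF exI])
        moreover have "{d \<in> edges V. crosses I d} \<in> cuts V"
          unfolding cuts_def by (rule imageI) (simp add: I_def)
        ultimately have "\<not> {d \<in> edges V. crosses I d} \<subseteq> X" using h by (simp only: simp_thms)
        then obtain d' where d': "d' \<in> edges V" "crosses I d'" "d' \<notin> X" by blast
        have nc: "\<not> crosses I b" if b: "b \<in> B" for b
        proof
          assume "crosses I b"
          then obtain p q where pq: "b = {p, q}" "p \<in> I" "q \<notin> I" unfolding crosses_def by blast
          have "b \<in> edges V" using b Bi unfolding indep_cycle_matroid by blast
          then have "q \<in> V" using pq(1) unfolding edges_def by auto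
          have "(p, q) \<in> adj B" using b pq(1) by (simp add: adj_def)
          then have "q \<in> I" using pq(2) \<open>q \<in> V\<close> unfolding I_def by (auto intro: rtrancl_into_rtrancl)
          with pq(3) show False ..
        qed
        have "insert d' B \<in> indeps ?M" by (rule no_cyc[OF Bi d'(1,2) nc])
        then have "insert d' B \<in> ?P" using B(1) d' by blast
        then have "d' \<in> B" using B(2) by blast
        then show False using nc d'(2) by blast
      qed
    qed
    then show "\<exists>B. basis ?M B \<and> X \<inter> B = {}" using B(1) by blast
  qed
qed

text \<open>In a complete graph every vertex of \<open>I\<close> is adjacent to every vertex outside
  \<open>I\<close>. If all these edges cross \<open>J\<close>, then \<open>J\<close> induces the
  same partition of the vertices.\<close>

lemma cuts_minimal:
  assumes "y \<in> cuts V" "z \<in> cuts V" "y \<noteq> {}" "y \<subseteq> z"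
  shows "y = z"
proof -
  obtain I J where I: "I \<subseteq> V" "y = {d \<in> edges V. crosses I d}" and J: "J \<subseteq> V" "z = {d \<in> edges V. crosses J d}"
    using assms(1,2) unfolding cuts_def by blast
  obtain d where d: "d \<in> edges V" "crosses I d" using assms(3) I(2) by blast
  then obtain u v where uv0: "d = {u, v}" "u \<in> I" "v \<notin> I" unfolding crosses_def by blast
  have "d \<subseteq> V" using d(1) unfolding edges_def by blast
  then have uv: "d = {u, v}" "u \<in> V" "v \<in> V" "u \<in> I" "v \<notin> I" using uv0 by auto
  have key: "(a \<in> J) \<noteq> (b \<in> J)" if "a \<in> V" "b \<in> V" "a \<in> I" "b \<notin> I" for a b
  proof -
    have "a \<noteq> b" using that by blast
    then have "{a, b} \<in> y" unfolding I(2) using that edgesI[of a V b] by simp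
    then show ?thesis using assms(4) J(2) by auto
  qed
  have "z \<subseteq> y"
  proof
    fix d' assume "d' \<in> z"
    then obtain a b where ab: "d' = {a, b}" "a \<in> V" "b \<in> V" "a \<noteq> b" "(a \<in> J) \<noteq> (b \<in> J)"
      unfolding J(2) edges_def by auto
    have "(a \<in> I) \<noteq> (b \<in> I)"
      using key[OF ab(2) uv(3)] key[OF uv(2) ab(2)] key[OF ab(3) uv(3)] key[OF uv(2) ab(3)] key[OF uv(2,3)] ab(5) uv(4,5) by blast
    then show "d' \<in> y" unfolding I(2) ab(1) using edgesI[OF ab(2-4)] by simp
  qed
  with assms(4) show ?thesis by blast
qed

lemma cuts_sym_diff:
  assumes "y \<in> cuts V" "z \<in> cuts V" shows "sym_diff y z \<in> cuts V"
proof -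
  obtain I J where I: "I \<subseteq> V" "y = {d \<in> edges V. crosses I d}" and J: "J \<subseteq> V" "z = {d \<in> edges V. crosses J d}"
    using assms unfolding cuts_def by blast
  have "crosses (sym_diff I J) d \<longleftrightarrow> crosses I d \<noteq> crosses J d" if "d \<in> edges V" for d
    using that unfolding edges_def by auto
  then have "sym_diff y z = {d \<in> edges V. crosses (sym_diff I J) d}" unfolding I(2) J(2) by blast
  moreover have "sym_diff I J \<subseteq> V" using I(1) J(1) by blast
  ultimately show ?thesis unfolding cuts_def by blast
qed

lemma circuit_dual_complete:
  assumes "finite V"
  shows "circuit (dual_matroid (cycle_matroid (edges V))) D \<longleftrightarrow> D \<in> cuts V \<and> D \<noteq> {}"
proof -
  have g: "ground (dual_matroid (cycle_matroid (edges V))) = edges V" by (simp add: dual_matroid_def)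
  have "circuit (dual_matroid (cycle_matroid (edges V))) D \<longleftrightarrow>
    D \<in> cuts V \<and> D \<noteq> {} \<and> (\<forall>y\<in>cuts V. y \<noteq> {} \<longrightarrow> y \<subseteq> D \<longrightarrow> y = D)"
    by (rule circuit_of_cycles) (use indep_dual_complete[OF assms] g in \<open>auto simp: cuts_def\<close>)
  then show ?thesis using cuts_minimal by blast
qed

text \<open>Rephrases independence by coefficient functions on the elements instead of on the
  vectors. Equal vectors at two elements appear as the function with the values 1 and -1.\<close>

lemma vector_matroid_indep:
  fixes \<phi> :: "'a \<Rightarrow> 'f::field vec"
  assumes finE: "finite E" and car: "\<phi> ` E \<subseteq> carrier_vec r"
  shows "X \<in> indeps (vector_matroid r E \<phi>) \<longleftrightarrow> X \<subseteq> E \<and>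
    (\<forall>k. (\<forall>x. k x \<noteq> 0 \<longrightarrow> x \<in> X) \<longrightarrow> (\<forall>i<r. (\<Sum>x\<in>X. k x * \<phi> x $ i) = 0) \<longrightarrow> (\<forall>x. k x = 0))"
proof -
  interpret vec_space "TYPE('f)" r .
  have li: "lincomb a A = 0\<^sub>v r \<longleftrightarrow> (\<forall>i<r. (\<Sum>v\<in>A. a v * v $ i) = 0)" if A: "A \<subseteq> carrier_vec r" for a A
  proof
    assume h: "lincomb a A = 0\<^sub>v r"
    show "\<forall>i<r. (\<Sum>v\<in>A. a v * v $ i) = 0"
    proof (intro allI impI)
      fix i assume i: "i < r"
      have "(\<Sum>v\<in>A. a v * v $ i) = lincomb a A $ i" using lincomb_index[OF i A] by simp
      then show "(\<Sum>v\<in>A. a v * v $ i) = 0" using h i by simp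
    qed
  next
    assume h: "\<forall>i<r. (\<Sum>v\<in>A. a v * v $ i) = 0"
    have c: "lincomb a A \<in> carrier_vec r" using A by (simp add: lincomb_closed)
    show "lincomb a A = 0\<^sub>v r"
    proof (rule eq_vecI)
      fix i assume "i < dim_vec (0\<^sub>v r :: 'f vec)"
      then have i: "i < r" by simp
      show "lincomb a A $ i = 0\<^sub>v r $ i" using lincomb_index[OF i A] h i by simp
    qed (use c in simp)
  qed
  show ?thesis
  proof (cases "X \<subseteq> E")
    case True
    have finX: "finite X" by (rule finite_subset[OF True finE])
    have Xc: "\<phi> ` X \<subseteq> carrier_vec r" using image_mono[OF True, of \<phi>] car by (rule subset_trans)
    have "inj_on \<phi> X \<and> \<not> lin_dep (\<phi> ` X) \<longleftrightarrow>
      (\<forall>k. (\<forall>x. k x \<noteq> 0 \<longrightarrow> x \<in> X) \<longrightarrow> (\<forall>i<r. (\<Sum>x\<in>X. k x * \<phi> x $ i) = 0) \<longrightarrow> (\<forall>x. k x = 0))" (is "?L \<longleftrightarrow> ?R")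
    proof
      assume L: ?L
      show ?R
      proof (intro allI impI)
        fix k x assume k: "\<forall>x. k x \<noteq> 0 \<longrightarrow> x \<in> X" "\<forall>i<r. (\<Sum>x\<in>X. k x * \<phi> x $ i) = 0"
        show "k x = 0"
        proof (rule ccontr)
          assume kx: "k x \<noteq> 0"
          then have xX: "x \<in> X" using k(1) by blast
          define a where "a v = k (the_inv_into X \<phi> v)" for v
          have a: "a (\<phi> y) = k y" if "y \<in> X" for y using L that by (simp add: a_def the_inv_into_f_f)
          have "(\<Sum>v\<in>\<phi> ` X. a v * v $ i) = (\<Sum>x\<in>X. k x * \<phi> x $ i)" for i
            using L a by (simp add: sum.reindex)
          then have "lincomb a (\<phi> ` X) = 0\<^sub>v r" unfolding li[OF Xc] using k(2) by simp
          moreover have "a (\<phi> x) \<noteq> 0" using a xX kx by simp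
          ultimately have "lin_dep (\<phi> ` X)" unfolding lin_dep_def
            by (intro exI[of _ "\<phi> ` X"] exI[of _ a] exI[of _ "\<phi> x"] conjI)
              (use finX xX in simp_all)
          then show False using L by simp
        qed
      qed
    next
      assume R: ?R
      have inj: "inj_on \<phi> X"
      proof (rule inj_onI, rule ccontr)
        fix x y assume h: "x \<in> X" "y \<in> X" "\<phi> x = \<phi> y" "x \<noteq> y"
        define k :: "'a \<Rightarrow> 'f" where "k z = (if z = x then 1 else if z = y then -1 else 0)" for z
        have z0: "(\<Sum>z\<in>X. k z * \<phi> z $ i) = 0" for i
        proof -
          have "(\<Sum>z\<in>X. k z * \<phi> z $ i) = (\<Sum>z\<in>{x, y}. k z * \<phi> z $ i)"
            by (rule sum.mono_neutral_right) (use h(1,2) finX in \<open>auto simp: k_def\<close>)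
          also have "\<dots> = k x * \<phi> x $ i + k y * \<phi> y $ i" using h(4) by simp
          also have "\<dots> = 0" using h(3) h(4)[symmetric] by (simp add: k_def)
          finally show ?thesis .
        qed
        have kX: "\<forall>z. k z \<noteq> 0 \<longrightarrow> z \<in> X"
        proof (intro allI impI)
          fix z assume "k z \<noteq> 0"
          then have "z = x \<or> z = y" by (auto simp: k_def split: if_splits)
          then show "z \<in> X" using h(1,2) by blast
        qed
        have "\<forall>i<r. (\<Sum>z\<in>X. k z * \<phi> z $ i) = 0" by (intro allI impI z0)
        from R[THEN spec, THEN mp, OF kX, THEN mp, OF this] have "k x = 0" by (rule spec)
        then show False by (simp add: k_def)
      qed
      moreover have "\<not> lin_dep (\<phi> ` X)"
      proof
        assume "lin_dep (\<phi> ` X)"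
        then obtain A a v where A: "finite A" "A \<subseteq> \<phi> ` X" "lincomb a A = 0\<^sub>v r" "v \<in> A" "a v \<noteq> 0"
          unfolding lin_dep_def by blast
        define k where "k x = (if x \<in> X \<and> \<phi> x \<in> A then a (\<phi> x) else 0)" for x
        have Ac: "A \<subseteq> carrier_vec r" using A(2) Xc by blast
        have "(\<Sum>x\<in>X. k x * \<phi> x $ i) = (\<Sum>v\<in>A. a v * v $ i)" for i
        proof -
          let ?Y = "{x \<in> X. \<phi> x \<in> A}"
          have Y: "\<phi> ` ?Y = A" using A(2) by blast
          have "(\<Sum>x\<in>X. k x * \<phi> x $ i) = (\<Sum>x\<in>?Y. k x * \<phi> x $ i)"
            using finX by (intro sum.mono_neutral_right) (auto simp: k_def)
          also have "\<dots> = (\<Sum>x\<in>?Y. a (\<phi> x) * \<phi> x $ i)" by (intro sum.cong) (auto simp: k_def)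
          also have "\<dots> = (\<Sum>v\<in>\<phi> ` ?Y. a v * v $ i)"
            by (subst sum.reindex) (use inj in \<open>auto intro: inj_on_subset\<close>)
          finally show ?thesis unfolding Y .
        qed
        moreover have "\<forall>i<r. (\<Sum>v\<in>A. a v * v $ i) = 0" using A(3) unfolding li[OF Ac] .
        ultimately have s: "\<forall>i<r. (\<Sum>x\<in>X. k x * \<phi> x $ i) = 0" by (simp only:)
        have kX: "\<forall>x. k x \<noteq> 0 \<longrightarrow> x \<in> X" by (simp add: k_def)
        have "\<forall>x. k x = 0" by (rule R[THEN spec, THEN mp, OF kX, THEN mp, OF s])
        moreover obtain x where "x \<in> X" "v = \<phi> x" using A(2,4) by blast
        ultimately have "a v = 0" using A(4) unfolding k_def by (metis (full_types))
        then show False using A(5) by simp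
      qed
      ultimately show ?L by blast
    qed
    then show ?thesis using True by (simp add: vector_matroid_def)
  qed (simp add: vector_matroid_def)
qed

section \<open>A real space of functions for a regular matroid\<close>

definition kernel_of :: "'a set_system \<Rightarrow> ('a \<Rightarrow> real) set \<Rightarrow> bool" where
  "kernel_of M K \<longleftrightarrow> (\<forall>k\<in>K. \<forall>l\<in>K. \<forall>t. (\<lambda>x. k x + t * l x) \<in> K) \<and>
     (\<forall>C. circuit M C \<longrightarrow> (\<exists>k\<in>K. {x. k x \<noteq> 0} = C)) \<and>
     (\<forall>k\<in>K. (\<exists>x. k x \<noteq> 0) \<longrightarrow> (\<exists>C. circuit M C \<and> C \<subseteq> {x. k x \<noteq> 0}))"

text \<open>The kernel of the matrix is carried to the ground set by the isomorphism and extended by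
  zero. A set is dependent iff it carries a nonzero kernel function, and on a circuit such a
  function cannot vanish anywhere, since proper subsets are independent.\<close>

lemma regular_kernel:
  assumes "regular_matroid M"
  obtains K where "kernel_of M K"
proof -
  interpret M: matroid M using assms by (simp add: regular_matroid_def)
  obtain A where iso: "matroid_iso M (column_matroid (A :: real mat))"
    using assms unfolding regular_matroid_def by blast
  let ?r = "dim_row A" and ?E = "{..<dim_col A}" and ?G = "ground M"
  have g: "ground (column_matroid A) = ?E" by (simp add: column_matroid_def vector_matroid_def)
  obtain f where f: "bij_betw f ?G ?E"
    "\<And>X. X \<subseteq> ?G \<Longrightarrow> X \<in> indeps M \<longleftrightarrow> f ` X \<in> indeps (column_matroid A)"
    using iso unfolding matroid_iso_def g by blast
  have inj: "inj_on f ?G" and im: "f ` ?G = ?E" using f(1) by (auto simp: bij_betw_def)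
  have ci: "Y \<in> indeps (column_matroid A) \<longleftrightarrow> Y \<subseteq> ?E \<and>
    (\<forall>k. (\<forall>x. k x \<noteq> 0 \<longrightarrow> x \<in> Y) \<longrightarrow> (\<forall>i<?r. (\<Sum>x\<in>Y. k x * col A x $ i) = 0) \<longrightarrow> (\<forall>x. k x = 0))" for Y
    unfolding column_matroid_def by (rule vector_matroid_indep) auto
  define K :: "('a \<Rightarrow> real) set" where "K = {k. (\<forall>x. k x \<noteq> 0 \<longrightarrow> x \<in> ?G) \<and> (\<forall>i<?r. (\<Sum>x\<in>?G. k x * col A (f x) $ i) = 0)}"
  have fin: "finite ?G" by (rule M.finite_ground)
  have sub: "(\<Sum>x\<in>?G. k x * col A (f x) $ i) = (\<Sum>x\<in>X. k x * col A (f x) $ i)"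
    if "X \<subseteq> ?G" "\<forall>x. k x \<noteq> 0 \<longrightarrow> x \<in> X" for X i and k :: "'a \<Rightarrow> real"
    using that fin by (intro sum.mono_neutral_right) auto
  have ind: "X \<in> indeps M \<longleftrightarrow> (\<forall>k\<in>K. (\<forall>x. k x \<noteq> 0 \<longrightarrow> x \<in> X) \<longrightarrow> (\<forall>x. k x = 0))" if X: "X \<subseteq> ?G" for X
  proof -
    have injX: "inj_on f X" using inj X by (rule inj_on_subset)
    show ?thesis
    proof
      assume "X \<in> indeps M"
      then have fX: "f ` X \<in> indeps (column_matroid A)" using f(2)[OF X] by simp
      show "\<forall>k\<in>K. (\<forall>x. k x \<noteq> 0 \<longrightarrow> x \<in> X) \<longrightarrow> (\<forall>x. k x = 0)"
      proof (intro ballI impI)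
        fix k assume k: "k \<in> K" "\<forall>x. k x \<noteq> 0 \<longrightarrow> x \<in> X"
        define k' where "k' y = (if y \<in> f ` X then k (the_inv_into X f y) else 0)" for y
        have k': "k' (f x) = k x" if "x \<in> X" for x using that injX by (simp add: k'_def the_inv_into_f_f)
        have "(\<Sum>y\<in>f ` X. k' y * col A y $ i) = 0" if "i < ?r" for i
        proof -
          have "(\<Sum>y\<in>f ` X. k' y * col A y $ i) = (\<Sum>x\<in>X. k x * col A (f x) $ i)"
            using injX k' by (simp add: sum.reindex)
          also have "\<dots> = 0" using k(1) sub[OF X k(2)] that unfolding K_def by simp
          finally show ?thesis .
        qed
        moreover have "\<forall>y. k' y \<noteq> 0 \<longrightarrow> y \<in> f ` X" by (simp add: k'_def)
        ultimately have z: "\<forall>y. k' y = 0" using fX unfolding ci by blast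
        show "\<forall>x. k x = 0"
        proof
          fix x show "k x = 0" using k(2) k'[of x] z by (cases "x \<in> X") auto
        qed
      qed
    next
      assume h: "\<forall>k\<in>K. (\<forall>x. k x \<noteq> 0 \<longrightarrow> x \<in> X) \<longrightarrow> (\<forall>x. k x = 0)"
      have "f ` X \<in> indeps (column_matroid A)" unfolding ci
      proof (intro conjI allI impI)
        show "f ` X \<subseteq> ?E" using X im by blast
        fix k' y assume k': "\<forall>y. k' y \<noteq> 0 \<longrightarrow> y \<in> f ` X" "\<forall>i<?r. (\<Sum>y\<in>f ` X. k' y * col A y $ i) = 0"
        define k where "k x = (if x \<in> X then k' (f x) else 0)" for x
        have kX: "\<forall>x. k x \<noteq> 0 \<longrightarrow> x \<in> X" by (simp add: k_def)
        have "(\<Sum>x\<in>X. k x * col A (f x) $ i) = (\<Sum>y\<in>f ` X. k' y * col A y $ i)" for i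
          using injX by (simp add: sum.reindex k_def)
        then have "k \<in> K" unfolding K_def using sub[OF X kX] k'(2) kX X by auto
        then have "\<forall>x. k x = 0" using h kX by blast
        then show "k' y = 0" using k'(1) unfolding k_def by (metis imageE)
      qed
      then show "X \<in> indeps M" using f(2)[OF X] by simp
    qed
  qed
  have "kernel_of M K" unfolding kernel_of_def
  proof (intro conjI ballI allI impI)
    fix k l t assume k: "k \<in> K" and l: "l \<in> K"
    have "(\<Sum>x\<in>?G. (k x + t * l x) * col A (f x) $ i) = (\<Sum>x\<in>?G. k x * col A (f x) $ i) + t * (\<Sum>x\<in>?G. l x * col A (f x) $ i)" for i
      by (simp add: sum.distrib sum_distrib_left algebra_simps)
    moreover have "k x + t * l x \<noteq> 0 \<longrightarrow> x \<in> ?G" for x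
    proof -
      have "x \<notin> ?G \<Longrightarrow> k x = 0" "x \<notin> ?G \<Longrightarrow> l x = 0" using k l unfolding K_def by blast+
      then show ?thesis by fastforce
    qed
    ultimately show "(\<lambda>x. k x + t * l x) \<in> K" using k l unfolding K_def by simp
  next
    fix C assume C: "circuit M C"
    then have CG: "C \<subseteq> ?G" "C \<notin> indeps M" by (auto simp: circuit_def)
    then obtain k where k: "k \<in> K" "\<forall>x. k x \<noteq> 0 \<longrightarrow> x \<in> C" "\<not> (\<forall>x. k x = 0)" using ind[OF CG(1)] by blast
    have "{x. k x \<noteq> 0} = C"
    proof (rule ccontr)
      assume "{x. k x \<noteq> 0} \<noteq> C"
      then have ps: "{x. k x \<noteq> 0} \<subset> C" using k(2) by blast
      then have "{x. k x \<noteq> 0} \<in> indeps M" using C unfolding circuit_def by blast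
      moreover have "{x. k x \<noteq> 0} \<subseteq> ?G" using ps CG(1) by blast
      ultimately show False using ind[of "{x. k x \<noteq> 0}"] k(1,3) by blast
    qed
    then show "\<exists>k\<in>K. {x. k x \<noteq> 0} = C" using k(1) by blast
  next
    fix k assume k: "k \<in> K" "\<exists>x. k x \<noteq> 0"
    have s: "{x. k x \<noteq> 0} \<subseteq> ?G" using k(1) unfolding K_def by blast
    have "{x. k x \<noteq> 0} \<notin> indeps M" using ind[OF s] k by blast
    then show "\<exists>C. circuit M C \<and> C \<subseteq> {x. k x \<noteq> 0}" using M.circuit_ex[OF s] by metis
  qed
  then show ?thesis by (rule that)
qed

section \<open>The circuits of \<open>M(K(3,3))\<close>\<close>

lemma grid_evenD:
  assumes "grid_even D"
  shows "D \<subseteq> grid" "((0,2) \<in> D) = (((0,0) \<in> D) \<noteq> ((0,1) \<in> D))" "((1,2) \<in> D) = (((1,0) \<in> D) \<noteq> ((1,1) \<in> D))"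
    "((2,2) \<in> D) = (((2,0) \<in> D) \<noteq> ((2,1) \<in> D))" "((2,0) \<in> D) = (((0,0) \<in> D) \<noteq> ((1,0) \<in> D))"
    "((2,1) \<in> D) = (((0,1) \<in> D) \<noteq> ((1,1) \<in> D))" "((2,2) \<in> D) = (((0,2) \<in> D) \<noteq> ((1,2) \<in> D))"
  using assms unfolding grid_even_def by blast+

lemma grid_evenI:
  assumes "D \<subseteq> grid" "((0,2) \<in> D) = (((0,0) \<in> D) \<noteq> ((0,1) \<in> D))" "((1,2) \<in> D) = (((1,0) \<in> D) \<noteq> ((1,1) \<in> D))"
    "((2,2) \<in> D) = (((2,0) \<in> D) \<noteq> ((2,1) \<in> D))" "((2,0) \<in> D) = (((0,0) \<in> D) \<noteq> ((1,0) \<in> D))"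
    "((2,1) \<in> D) = (((0,1) \<in> D) \<noteq> ((1,1) \<in> D))"
  shows "grid_even D"
  using assms unfolding grid_even_def by blast

lemma grid_subsetI:
  assumes "D1 \<subseteq> grid" "(0,0) \<in> D1 \<Longrightarrow> (0,0) \<in> D2" "(0,1) \<in> D1 \<Longrightarrow> (0,1) \<in> D2" "(0,2) \<in> D1 \<Longrightarrow> (0,2) \<in> D2"
    "(1,0) \<in> D1 \<Longrightarrow> (1,0) \<in> D2" "(1,1) \<in> D1 \<Longrightarrow> (1,1) \<in> D2" "(1,2) \<in> D1 \<Longrightarrow> (1,2) \<in> D2"
    "(2,0) \<in> D1 \<Longrightarrow> (2,0) \<in> D2" "(2,1) \<in> D1 \<Longrightarrow> (2,1) \<in> D2" "(2,2) \<in> D1 \<Longrightarrow> (2,2) \<in> D2"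
  shows "D1 \<subseteq> D2"
proof
  fix c assume c: "c \<in> D1"
  then have "c \<in> grid" using assms(1) by blast
  then show "c \<in> D2" unfolding grid_def using c assms(2-) by blast
qed

lemma grid_even_sym_diff: "grid_even D1 \<Longrightarrow> grid_even D2 \<Longrightarrow> grid_even (sym_diff D1 D2)"
  using grid_evenD[of D1] grid_evenD[of D2] by (intro grid_evenI) blast+

text \<open>All vertices of \<open>K(3,3)\<close> have degree three, so edge-disjoint cycles would
  be vertex-disjoint, but each needs four of the six vertices. The formal proof is a propositional
  check in which an even set is determined by its four cells in rows and columns 0 and 1.\<close>

lemma grid_even_disjoint:
  assumes "grid_even D1" "grid_even D2" "D1 \<inter> D2 = {}"
  shows "D1 = {} \<or> D2 = {}"
proof -
  have n: "\<not> (c \<in> D1 \<and> c \<in> D2)" for c using assms(3) by blast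
  have e: "D = {}" if D: "grid_even D" "(0,0) \<notin> D" "(0,1) \<notin> D" "(1,0) \<notin> D" "(1,1) \<notin> D" for D
    using grid_subsetI[of D "{}"] grid_evenD[OF D(1)] D(2-) by blast
  have "((0,0) \<notin> D1 \<and> (0,1) \<notin> D1 \<and> (1,0) \<notin> D1 \<and> (1,1) \<notin> D1) \<or> ((0,0) \<notin> D2 \<and> (0,1) \<notin> D2 \<and> (1,0) \<notin> D2 \<and> (1,1) \<notin> D2)"
    using grid_evenD(2-)[OF assms(1)] grid_evenD(2-)[OF assms(2)]
      n[of "(0,0)"] n[of "(0,1)"] n[of "(0,2)"] n[of "(1,0)"] n[of "(1,1)"] n[of "(1,2)"] n[of "(2,0)"] n[of "(2,1)"] n[of "(2,2)"]
    by argo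
  then show ?thesis using e[OF assms(1)] e[OF assms(2)] by blast
qed

text \<open>The difference \<open>D2 - D1\<close> is even and disjoint from
  \<open>D1\<close>.\<close>

lemma grid_even_minimal:
  assumes "grid_even D1" "grid_even D2" "D1 \<noteq> {}" "D1 \<subseteq> D2" shows "D1 = D2"
proof -
  have "grid_even (D2 - D1)" using grid_even_sym_diff[OF assms(1,2)] assms(4) by (simp add: Diff_eq_empty_iff[THEN iffD2])
  from grid_even_disjoint[OF assms(1) this] assms(3,4) show ?thesis by blast
qed

definition k33_edge :: "nat \<times> nat \<Rightarrow> (nat + nat) set" where
  "k33_edge c = {Inl (fst c), Inr (snd c)}"

lemma k33_edge_eq [simp]: "k33_edge c = k33_edge d \<longleftrightarrow> c = d"
  unfolding k33_edge_def by (auto simp: doubleton_eq_iff prod_eq_iff)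

lemma k33_ground: "complete_bipartite_graph 3 3 = k33_edge ` grid"
proof -
  have l3: "i < 3 \<longleftrightarrow> i = 0 \<or> i = 1 \<or> i = (2::nat)" for i by auto
  show ?thesis
  proof
    show "complete_bipartite_graph 3 3 \<subseteq> k33_edge ` grid"
    proof
      fix d assume "d \<in> complete_bipartite_graph 3 3"
      then obtain i j where ij: "d = {Inl i, Inr j}" "i < 3" "j < 3" unfolding complete_bipartite_graph_def by blast
      have "(i, j) \<in> grid" using ij(2,3) unfolding l3 grid_def by auto
      moreover have "d = k33_edge (i, j)" using ij(1) by (simp add: k33_edge_def)
      ultimately show "d \<in> k33_edge ` grid" by blast
    qed
    show "k33_edge ` grid \<subseteq> complete_bipartite_graph 3 3"
    proof (rule image_subsetI)
      fix c assume "c \<in> grid"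
      then have "fst c < 3" "snd c < 3" unfolding grid_def by auto
      then show "k33_edge c \<in> complete_bipartite_graph 3 3"
        unfolding complete_bipartite_graph_def k33_edge_def by blast
    qed
  qed
qed

lemma even_card_three:
  assumes "a \<noteq> b" "a \<noteq> c" "b \<noteq> c" "even (card {x \<in> C. x = a \<or> x = b \<or> x = c})"
  shows "(c \<in> C) = ((a \<in> C) \<noteq> (b \<in> C))"
proof -
  have "{x \<in> C. x = a \<or> x = b \<or> x = c} = (if a \<in> C then {a} else {}) \<union> (if b \<in> C then {b} else {}) \<union> (if c \<in> C then {c} else {})"
    by auto
  then show ?thesis using assms by (cases "a \<in> C"; cases "b \<in> C"; cases "c \<in> C") auto
qed

text \<open>A row or a column is the cut of one vertex, and a cycle crosses it evenly.\<close>

lemma k33_cycle_even: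
  assumes C: "is_cycle C" "C \<subseteq> k33_edge ` grid"
  shows "grid_even {c \<in> grid. k33_edge c \<in> C}"
proof -
  let ?D = "{c \<in> grid. k33_edge c \<in> C}"
  have row: "((r,2) \<in> ?D) = (((r,0) \<in> ?D) \<noteq> ((r,1) \<in> ?D))" if r: "r \<in> {0,1,2}" for r
  proof -
    have g: "(r,0) \<in> grid" "(r,1) \<in> grid" "(r,2) \<in> grid" using r by (auto simp: grid_def)
    have "crosses {Inl r} d \<longleftrightarrow> d = k33_edge (r,0) \<or> d = k33_edge (r,1) \<or> d = k33_edge (r,2)" if "d \<in> C" for d
    proof -
      obtain c where c: "c \<in> grid" "d = k33_edge c" using C(2) \<open>d \<in> C\<close> by blast
      have "crosses {Inl r} d \<longleftrightarrow> fst c = r" unfolding c(2) k33_edge_def by simp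
      then show ?thesis using c(1) unfolding c(2) k33_edge_eq grid_def by (cases c) auto
    qed
    then have "{d \<in> C. crosses {Inl r} d} = {d \<in> C. d = k33_edge (r,0) \<or> d = k33_edge (r,1) \<or> d = k33_edge (r,2)}" by blast
    then have "even (card {d \<in> C. d = k33_edge (r,0) \<or> d = k33_edge (r,1) \<or> d = k33_edge (r,2)})"
      using cycle_crosses_even[OF C(1), of "{Inl r}"] by (simp only:)
    from even_card_three[OF _ _ _ this] have "(k33_edge (r,2) \<in> C) = ((k33_edge (r,0) \<in> C) \<noteq> (k33_edge (r,1) \<in> C))"
      by (simp only: k33_edge_eq prod.inject) simp
    then show ?thesis using g by simp
  qed
  have col: "((2,s) \<in> ?D) = (((0,s) \<in> ?D) \<noteq> ((1,s) \<in> ?D))" if s: "s \<in> {0,1,2}" for s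
  proof -
    have g: "(0,s) \<in> grid" "(1,s) \<in> grid" "(2,s) \<in> grid" using s by (auto simp: grid_def)
    have "crosses {Inr s} d \<longleftrightarrow> d = k33_edge (0,s) \<or> d = k33_edge (1,s) \<or> d = k33_edge (2,s)" if "d \<in> C" for d
    proof -
      obtain c where c: "c \<in> grid" "d = k33_edge c" using C(2) \<open>d \<in> C\<close> by blast
      have "crosses {Inr s} d \<longleftrightarrow> snd c = s" unfolding c(2) k33_edge_def by simp
      then show ?thesis using c(1) unfolding c(2) k33_edge_eq grid_def by (cases c) auto
    qed
    then have "{d \<in> C. crosses {Inr s} d} = {d \<in> C. d = k33_edge (0,s) \<or> d = k33_edge (1,s) \<or> d = k33_edge (2,s)}" by blast
    then have "even (card {d \<in> C. d = k33_edge (0,s) \<or> d = k33_edge (1,s) \<or> d = k33_edge (2,s)})"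
      using cycle_crosses_even[OF C(1), of "{Inr s}"] by (simp only:)
    from even_card_three[OF _ _ _ this] have "(k33_edge (2,s) \<in> C) = ((k33_edge (0,s) \<in> C) \<noteq> (k33_edge (1,s) \<in> C))"
      by (simp only: k33_edge_eq prod.inject) simp
    then show ?thesis using g by simp
  qed
  have "?D \<subseteq> grid" by blast
  with row col show ?thesis unfolding grid_even_def by blast
qed

text \<open>Summing the parities of the lines in \<open>I\<close> shows that an even set has an even
  number of crossing cells. With \<open>R\<close> and \<open>S\<close> recording the rows and
  columns in \<open>I\<close>, this is checked for each of the nine positions of
  \<open>d0\<close>.\<close>

lemma grid_even_crosses_not_single:
  assumes D: "grid_even D" and d: "d0 \<in> D"
    and only: "\<And>c. c \<in> D \<Longrightarrow> crosses I (k33_edge c) \<longleftrightarrow> c = d0"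
  shows False
proof -
  define R where "R i \<longleftrightarrow> Inl i \<in> I" for i
  define S where "S j \<longleftrightarrow> Inr j \<in> I" for j
  have o: "(i, j) \<in> D \<Longrightarrow> (R i \<noteq> S j) = ((i, j) = d0)" for i j
    using only[of "(i, j)"] unfolding k33_edge_def R_def S_def by simp
  have f: "(i, j) \<in> D \<longrightarrow> R i = S j" if "(i, j) \<noteq> d0" for i j using o[of i j] that by blast
  have f0: "R (fst d0) \<noteq> S (snd d0)" using o[of "fst d0" "snd d0"] d by simp
  have "d0 \<in> grid" using d grid_evenD(1)[OF D] by blast
  then consider "d0 = (0,0)" | "d0 = (0,1)" | "d0 = (0,2)" | "d0 = (1,0)" | "d0 = (1,1)" | "d0 = (1,2)" | "d0 = (2,0)" | "d0 = (2,1)" | "d0 = (2,2)"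
    unfolding grid_def by blast
  then show False
  proof cases
    case 1
    have "(0,1) \<in> D \<longrightarrow> R 0 = S 1" "(0,2) \<in> D \<longrightarrow> R 0 = S 2" "(1,0) \<in> D \<longrightarrow> R 1 = S 0" "(1,1) \<in> D \<longrightarrow> R 1 = S 1" "(1,2) \<in> D \<longrightarrow> R 1 = S 2" "(2,0) \<in> D \<longrightarrow> R 2 = S 0" "(2,1) \<in> D \<longrightarrow> R 2 = S 1" "(2,2) \<in> D \<longrightarrow> R 2 = S 2"
      by (rule f; simp add: 1)+
    moreover have "R 0 \<noteq> S 0" "(0,0) \<in> D" using f0 d 1 by simp_all
    ultimately show ?thesis using grid_evenD(2-)[OF D] by (smt (verit))
  next
    case 2
    have "(0,0) \<in> D \<longrightarrow> R 0 = S 0" "(0,2) \<in> D \<longrightarrow> R 0 = S 2" "(1,0) \<in> D \<longrightarrow> R 1 = S 0" "(1,1) \<in> D \<longrightarrow> R 1 = S 1" "(1,2) \<in> D \<longrightarrow> R 1 = S 2" "(2,0) \<in> D \<longrightarrow> R 2 = S 0" "(2,1) \<in> D \<longrightarrow> R 2 = S 1" "(2,2) \<in> D \<longrightarrow> R 2 = S 2"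
      by (rule f; simp add: 2)+
    moreover have "R 0 \<noteq> S 1" "(0,1) \<in> D" using f0 d 2 by simp_all
    ultimately show ?thesis using grid_evenD(2-)[OF D] by (smt (verit))
  next
    case 3
    have "(0,0) \<in> D \<longrightarrow> R 0 = S 0" "(0,1) \<in> D \<longrightarrow> R 0 = S 1" "(1,0) \<in> D \<longrightarrow> R 1 = S 0" "(1,1) \<in> D \<longrightarrow> R 1 = S 1" "(1,2) \<in> D \<longrightarrow> R 1 = S 2" "(2,0) \<in> D \<longrightarrow> R 2 = S 0" "(2,1) \<in> D \<longrightarrow> R 2 = S 1" "(2,2) \<in> D \<longrightarrow> R 2 = S 2"
      by (rule f; simp add: 3)+
    moreover have "R 0 \<noteq> S 2" "(0,2) \<in> D" using f0 d 3 by simp_all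
    ultimately show ?thesis using grid_evenD(2-)[OF D] by (smt (verit))
  next
    case 4
    have "(0,0) \<in> D \<longrightarrow> R 0 = S 0" "(0,1) \<in> D \<longrightarrow> R 0 = S 1" "(0,2) \<in> D \<longrightarrow> R 0 = S 2" "(1,1) \<in> D \<longrightarrow> R 1 = S 1" "(1,2) \<in> D \<longrightarrow> R 1 = S 2" "(2,0) \<in> D \<longrightarrow> R 2 = S 0" "(2,1) \<in> D \<longrightarrow> R 2 = S 1" "(2,2) \<in> D \<longrightarrow> R 2 = S 2"
      by (rule f; simp add: 4)+
    moreover have "R 1 \<noteq> S 0" "(1,0) \<in> D" using f0 d 4 by simp_all
    ultimately show ?thesis using grid_evenD(2-)[OF D] by (smt (verit))
  next
    case 5
    have "(0,0) \<in> D \<longrightarrow> R 0 = S 0" "(0,1) \<in> D \<longrightarrow> R 0 = S 1" "(0,2) \<in> D \<longrightarrow> R 0 = S 2" "(1,0) \<in> D \<longrightarrow> R 1 = S 0" "(1,2) \<in> D \<longrightarrow> R 1 = S 2" "(2,0) \<in> D \<longrightarrow> R 2 = S 0" "(2,1) \<in> D \<longrightarrow> R 2 = S 1" "(2,2) \<in> D \<longrightarrow> R 2 = S 2"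
      by (rule f; simp add: 5)+
    moreover have "R 1 \<noteq> S 1" "(1,1) \<in> D" using f0 d 5 by simp_all
    ultimately show ?thesis using grid_evenD(2-)[OF D] by (smt (verit))
  next
    case 6
    have "(0,0) \<in> D \<longrightarrow> R 0 = S 0" "(0,1) \<in> D \<longrightarrow> R 0 = S 1" "(0,2) \<in> D \<longrightarrow> R 0 = S 2" "(1,0) \<in> D \<longrightarrow> R 1 = S 0" "(1,1) \<in> D \<longrightarrow> R 1 = S 1" "(2,0) \<in> D \<longrightarrow> R 2 = S 0" "(2,1) \<in> D \<longrightarrow> R 2 = S 1" "(2,2) \<in> D \<longrightarrow> R 2 = S 2"
      by (rule f; simp add: 6)+
    moreover have "R 1 \<noteq> S 2" "(1,2) \<in> D" using f0 d 6 by simp_all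
    ultimately show ?thesis using grid_evenD(2-)[OF D] by (smt (verit))
  next
    case 7
    have "(0,0) \<in> D \<longrightarrow> R 0 = S 0" "(0,1) \<in> D \<longrightarrow> R 0 = S 1" "(0,2) \<in> D \<longrightarrow> R 0 = S 2" "(1,0) \<in> D \<longrightarrow> R 1 = S 0" "(1,1) \<in> D \<longrightarrow> R 1 = S 1" "(1,2) \<in> D \<longrightarrow> R 1 = S 2" "(2,1) \<in> D \<longrightarrow> R 2 = S 1" "(2,2) \<in> D \<longrightarrow> R 2 = S 2"
      by (rule f; simp add: 7)+
    moreover have "R 2 \<noteq> S 0" "(2,0) \<in> D" using f0 d 7 by simp_all
    ultimately show ?thesis using grid_evenD(2-)[OF D] by (smt (verit))
  next
    case 8
    have "(0,0) \<in> D \<longrightarrow> R 0 = S 0" "(0,1) \<in> D \<longrightarrow> R 0 = S 1" "(0,2) \<in> D \<longrightarrow> R 0 = S 2" "(1,0) \<in> D \<longrightarrow> R 1 = S 0" "(1,1) \<in> D \<longrightarrow> R 1 = S 1" "(1,2) \<in> D \<longrightarrow> R 1 = S 2" "(2,0) \<in> D \<longrightarrow> R 2 = S 0" "(2,2) \<in> D \<longrightarrow> R 2 = S 2"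
      by (rule f; simp add: 8)+
    moreover have "R 2 \<noteq> S 1" "(2,1) \<in> D" using f0 d 8 by simp_all
    ultimately show ?thesis using grid_evenD(2-)[OF D] by (smt (verit))
  next
    case 9
    have "(0,0) \<in> D \<longrightarrow> R 0 = S 0" "(0,1) \<in> D \<longrightarrow> R 0 = S 1" "(0,2) \<in> D \<longrightarrow> R 0 = S 2" "(1,0) \<in> D \<longrightarrow> R 1 = S 0" "(1,1) \<in> D \<longrightarrow> R 1 = S 1" "(1,2) \<in> D \<longrightarrow> R 1 = S 2" "(2,0) \<in> D \<longrightarrow> R 2 = S 0" "(2,1) \<in> D \<longrightarrow> R 2 = S 1"
      by (rule f; simp add: 9)+
    moreover have "R 2 \<noteq> S 2" "(2,2) \<in> D" using f0 d 9 by simp_all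
    ultimately show ?thesis using grid_evenD(2-)[OF D] by (smt (verit))
  qed
qed

text \<open>A nonempty even set contains a cycle: if removing \<open>d0\<close> separated its ends,
  the component of one end would be crossed by \<open>d0\<close> alone.\<close>

lemma indep_k33:
  "X \<in> indeps (cycle_matroid (complete_bipartite_graph 3 3)) \<longleftrightarrow> X \<subseteq> k33_edge ` grid \<and>
     (\<forall>z\<in>(\<lambda>D. k33_edge ` D) ` Collect grid_even. z \<noteq> {} \<longrightarrow> \<not> z \<subseteq> X)"
  unfolding indep_cycle_matroid k33_ground
proof (intro conj_cong refl iffI ballI allI impI notI)
  fix z assume X: "X \<subseteq> k33_edge ` grid" and h: "\<forall>C. is_cycle C \<longrightarrow> \<not> C \<subseteq> X"
    and z: "z \<in> (\<lambda>D. k33_edge ` D) ` Collect grid_even" "z \<noteq> {}" "z \<subseteq> X"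
  obtain D where D: "grid_even D" "z = k33_edge ` D" using z(1) by blast
  then obtain d0 where d0: "d0 \<in> D" using z(2) by blast
  define B where "B = z - {k33_edge d0}"
  let ?u = "Inl (fst d0) :: nat + nat" and ?v = "Inr (snd d0) :: nat + nat"
  have e0: "k33_edge d0 = {?u, ?v}" by (simp add: k33_edge_def)
  define I where "I = {w. (?u, w) \<in> (adj B)\<^sup>*}"
  have "?v \<in> I"
  proof (rule ccontr)
    assume v: "?v \<notin> I"
    show False
    proof (rule grid_even_crosses_not_single[OF D(1) d0, of I])
      fix c assume c: "c \<in> D"
      show "crosses I (k33_edge c) \<longleftrightarrow> c = d0"
      proof
        assume cr: "crosses I (k33_edge c)"
        show "c = d0"
        proof (rule ccontr)
          assume "c \<noteq> d0"
          then have cB: "k33_edge c \<in> B" using c unfolding B_def D(2) by simp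
          obtain p q where pq: "k33_edge c = {p, q}" "p \<in> I" "q \<notin> I" using cr unfolding crosses_def by blast
          have "(p, q) \<in> adj B" using cB pq(1) by (simp add: adj_def)
          then have "q \<in> I" using pq(2) unfolding I_def by (simp add: rtrancl_into_rtrancl)
          with pq(3) show False ..
        qed
      next
        assume "c = d0"
        moreover have "?u \<in> I" by (simp add: I_def)
        ultimately show "crosses I (k33_edge c)" using v e0 by simp
      qed
    qed
  qed
  then have "(?u, ?v) \<in> (adj B)\<^sup>*" by (simp add: I_def)
  moreover have "{?u, ?v} \<notin> B" using e0 by (simp add: B_def)
  moreover have "?u \<noteq> ?v" by simp
  ultimately obtain C where C: "is_cycle C" "C \<subseteq> insert {?u, ?v} B" using cycle_through_edge by metis
  have "insert {?u, ?v} B \<subseteq> z" using d0 e0[symmetric] unfolding B_def D(2) by auto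
  with C(2) z(3) have "C \<subseteq> X" by (meson subset_trans)
  then show False using h C(1) by simp
next
  fix C assume X: "X \<subseteq> k33_edge ` grid" and h: "\<forall>z\<in>(\<lambda>D. k33_edge ` D) ` Collect grid_even. z \<noteq> {} \<longrightarrow> \<not> z \<subseteq> X"
    and C: "is_cycle C" "C \<subseteq> X"
  have CG: "C \<subseteq> k33_edge ` grid" using C(2) X by blast
  have "k33_edge ` {c \<in> grid. k33_edge c \<in> C} = C" using CG by blast
  moreover have "grid_even {c \<in> grid. k33_edge c \<in> C}" by (rule k33_cycle_even[OF C(1) CG])
  ultimately have "C \<in> (\<lambda>D. k33_edge ` D) ` Collect grid_even" by (metis (mono_tags) imageI mem_Collect_eq)
  then show False using h C(2) cycle_nonempty[OF C(1)] by blast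
qed

lemma circuit_k33:
  "circuit (cycle_matroid (complete_bipartite_graph 3 3)) C \<longleftrightarrow> (\<exists>D. grid_even D \<and> D \<noteq> {} \<and> C = k33_edge ` D)"
proof -
  let ?Z = "(\<lambda>D. k33_edge ` D) ` Collect grid_even"
  have inj: "inj k33_edge" by (simp add: inj_def)
  have "circuit (cycle_matroid (complete_bipartite_graph 3 3)) C \<longleftrightarrow>
    C \<in> ?Z \<and> C \<noteq> {} \<and> (\<forall>y\<in>?Z. y \<noteq> {} \<longrightarrow> y \<subseteq> C \<longrightarrow> y = C)"
  proof (rule circuit_of_cycles)
    show "X \<in> indeps (cycle_matroid (complete_bipartite_graph 3 3)) \<longleftrightarrow>
      X \<subseteq> ground (cycle_matroid (complete_bipartite_graph 3 3)) \<and> (\<forall>z\<in>?Z. z \<noteq> {} \<longrightarrow> \<not> z \<subseteq> X)" for X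
      unfolding ground_cycle_matroid k33_ground by (rule indep_k33[unfolded k33_ground])
    fix z assume "z \<in> ?Z"
    then obtain D where "grid_even D" "z = k33_edge ` D" by blast
    then show "z \<subseteq> ground (cycle_matroid (complete_bipartite_graph 3 3))"
      by (simp only: ground_cycle_matroid k33_ground image_mono grid_evenD(1))
  qed
  also have "\<dots> \<longleftrightarrow> C \<in> ?Z \<and> C \<noteq> {}"
  proof -
    have "y = C" if y: "y \<in> ?Z" "C \<in> ?Z" "y \<noteq> {}" "y \<subseteq> C" for y
    proof -
      obtain D1 D2 where D: "grid_even D1" "y = k33_edge ` D1" "grid_even D2" "C = k33_edge ` D2" using y(1,2) by blast
      have "D1 \<subseteq> D2" using y(4) inj unfolding D(2,4) by (simp add: inj_image_subset_iff)
      moreover have "D1 \<noteq> {}" using y(3) unfolding D(2) by simp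
      ultimately have "D1 = D2" by (intro grid_even_minimal[OF D(1,3)])
      then show ?thesis unfolding D(2,4) by simp
    qed
    note eq = this
    show ?thesis
    proof
      assume "C \<in> ?Z \<and> C \<noteq> {}"
      then show "C \<in> ?Z \<and> C \<noteq> {} \<and> (\<forall>y\<in>?Z. y \<noteq> {} \<longrightarrow> y \<subseteq> C \<longrightarrow> y = C)"
        by (intro conjI ballI impI eq) simp_all
    qed simp
  qed
  also have "\<dots> \<longleftrightarrow> (\<exists>D. grid_even D \<and> D \<noteq> {} \<and> C = k33_edge ` D)" by auto
  finally show ?thesis .
qed

text \<open>\<open>R10\<close> as an extension of \<open>M(K33)\<close>: the cell \<open>(i, c)\<close> of the grid is sent to a triple, with
  the columns 0, 1, 2 standing for the intersections \<open>{3, 4}\<close>, \<open>{3}\<close>, \<open>{4}\<close> of the triple with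
  \<open>{3, 4}\<close>; the additional element \<open>(3, 3)\<close> is the triple \<open>{0, 1, 2}\<close>.\<close>

definition r10_triple :: "nat \<times> nat \<Rightarrow> nat set" where
  "r10_triple c = (if c = (3,3) then {0,1,2} else if snd c = 0 then {fst c, 3, 4}
     else if snd c = 1 then insert 3 ({0,1,2} - {fst c}) else insert 4 ({0,1,2} - {fst c}))"

definition r10_vec :: "nat \<times> nat \<Rightarrow> bit vec" where
  "r10_vec c = vec 5 (\<lambda>i. if i \<in> r10_triple c then 1 else 0)"

lemma r10_triple_simps:
  "r10_triple (3,3) = {0,1,2}" "r10_triple (0,0) = {0,3,4}" "r10_triple (1,0) = {1,3,4}" "r10_triple (2,0) = {2,3,4}"
  "r10_triple (0,1) = {1,2,3}" "r10_triple (1,1) = {0,2,3}" "r10_triple (2,1) = {0,1,3}"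
  "r10_triple (0,2) = {1,2,4}" "r10_triple (1,2) = {0,2,4}" "r10_triple (2,2) = {0,1,4}"
  by (auto simp: r10_triple_def)

lemma r10_ground_list:
  "r10_ground = {(3,3),(0,0),(0,1),(0,2),(1,0),(1,1),(1,2),(2,0),(2,1),(2,2)}"
  by (simp add: r10_ground_def grid_def)

definition r10_list :: "nat set list" where
  "r10_list = [{0,1,2},{0,3,4},{1,2,3},{1,2,4},{1,3,4},{0,2,3},{0,2,4},{2,3,4},{0,1,3},{0,1,4}]"

lemma r10_triples: "r10_triple ` r10_ground = {T. T \<subseteq> {..<5} \<and> card T = 3}"
proof
  show "r10_triple ` r10_ground \<subseteq> {T. T \<subseteq> {..<5} \<and> card T = 3}"
    unfolding r10_ground_list by (simp add: r10_triple_simps[unfolded One_nat_def] r10_triple_simps)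
  show "{T. T \<subseteq> {..<5} \<and> card T = 3} \<subseteq> r10_triple ` r10_ground"
  proof
    fix T :: "nat set" assume "T \<in> {T. T \<subseteq> {..<5} \<and> card T = 3}"
    then have T: "T \<subseteq> {..<5}" "card T = 3" by auto
    then obtain a b c where abc: "T = {a, b, c}" "distinct [a, b, c]" by (auto simp: card_3_iff)
    have l: "x = 0 \<or> x = 1 \<or> x = 2 \<or> x = 3 \<or> x = 4" if "x < 5" for x :: nat using that by linarith
    have "a < 5" "b < 5" "c < 5" using T(1) abc(1) by auto
    from this[THEN l] have "T \<in> set r10_list" using abc(2) unfolding abc(1) r10_list_def
      by (elim disjE) (simp_all add: insert_commute)
    then show "T \<in> r10_triple ` r10_ground"
      unfolding r10_list_def r10_ground_list image_insert r10_triple_simps by simp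
  qed
qed

lemma r10_vec_nth: "i < 5 \<Longrightarrow> r10_vec c $ i = (if i \<in> r10_triple c then 1 else 0)"
  by (simp add: r10_vec_def)

text \<open>The ground set and its image both have ten elements.\<close>

lemma r10_triple_inj: "inj_on r10_triple r10_ground"
proof -
  have "card {T. T \<subseteq> {..<5::nat} \<and> card T = 3} = 5 choose 3" by (simp add: n_subsets)
  also have "\<dots> = 10" by (simp add: numeral_eq_Suc)
  finally have "card (r10_triple ` r10_ground) = 10" by (simp add: r10_triples)
  moreover have "card r10_ground = 10" unfolding r10_ground_list by simp
  ultimately show ?thesis by (intro eq_card_imp_inj_on) (simp_all add: r10_ground_list)
qed

lemma r10_sub5: "c \<in> r10_ground \<Longrightarrow> r10_triple c \<subseteq> {..<5}"
  using r10_triples by blast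

lemma r10_vec_inj: "inj_on r10_vec r10_ground"
proof (rule inj_onI)
  fix c d assume h: "c \<in> r10_ground" "d \<in> r10_ground" "r10_vec c = r10_vec d"
  have "i \<in> r10_triple c \<longleftrightarrow> i \<in> r10_triple d" for i
  proof (cases "i < 5")
    case True
    have "r10_vec c $ i = r10_vec d $ i" using h(3) by simp
    then show ?thesis unfolding r10_vec_nth[OF True] by (simp split: if_splits)
  next
    case False
    then show ?thesis using r10_sub5[OF h(1)] r10_sub5[OF h(2)] by auto
  qed
  then have "r10_triple c = r10_triple d" by blast
  then show "c = d" using r10_triple_inj h(1,2) by (simp add: inj_on_def)
qed

lemma r10_ground_image: "ground R10 = r10_vec ` r10_ground"
proof -
  have "v \<in> r10_vec ` r10_ground" if v: "v \<in> carrier_vec 5" "card {i. i < 5 \<and> v $ i \<noteq> 0} = 3" for v :: "bit vec"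
  proof -
    have "{i. i < 5 \<and> v $ i \<noteq> 0} \<in> r10_triple ` r10_ground" unfolding r10_triples using v(2) by auto
    then obtain c where c: "c \<in> r10_ground" "{i. i < 5 \<and> v $ i \<noteq> 0} = r10_triple c" by auto
    have "v = r10_vec c"
    proof (rule eq_vecI)
      show "dim_vec v = dim_vec (r10_vec c)" using v(1) by (simp add: r10_vec_def)
      fix i assume "i < dim_vec (r10_vec c)"
      then have i: "i < 5" by (simp add: r10_vec_def)
      have "i \<in> r10_triple c \<longleftrightarrow> v $ i \<noteq> 0" using c(2) i by auto
      then show "v $ i = r10_vec c $ i" unfolding r10_vec_nth[OF i] by (cases "v $ i") auto
    qed
    then show ?thesis using c(1) by blast
  qed
  moreover have "r10_vec c \<in> carrier_vec 5 \<and> card {i. i < 5 \<and> r10_vec c $ i \<noteq> 0} = 3" if c: "c \<in> r10_ground" for c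
  proof -
    have "{i. i < 5 \<and> r10_vec c $ i \<noteq> 0} = r10_triple c" using r10_sub5[OF c] by (auto simp: r10_vec_nth split: if_splits)
    moreover have "card (r10_triple c) = 3" using r10_triples c by blast
    ultimately show ?thesis by (simp add: r10_vec_def)
  qed
  ultimately show ?thesis unfolding R10_def vector_matroid_def by auto
qed

definition bit_of :: "bool \<Rightarrow> bit" where "bit_of b = (if b then 1 else 0)"

lemma bit_of_eq: "bit_of a + bit_of b = bit_of (a \<noteq> b)"
  by (cases a; cases b) (simp_all add: bit_of_def)

text \<open>Summing over all ten elements turns each coordinate into an explicit Boolean expression
  in the memberships \<open>c \<in> D\<close>.\<close>

lemma r10_coordinate:
  assumes D: "D \<subseteq> r10_ground" and i: "i < 5"
  shows "(\<Sum>c\<in>D. r10_vec c $ i) = (\<Sum>c\<in>r10_ground. bit_of (c \<in> D \<and> i \<in> r10_triple c))"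
proof -
  have fin: "finite r10_ground" by (simp add: r10_ground_list)
  have "(\<Sum>c\<in>r10_ground. bit_of (c \<in> D \<and> i \<in> r10_triple c)) = (\<Sum>c\<in>D. bit_of (c \<in> D \<and> i \<in> r10_triple c))"
    by (rule sum.mono_neutral_right[OF fin D]) (simp add: bit_of_def)
  also have "\<dots> = (\<Sum>c\<in>D. r10_vec c $ i)" by (rule sum.cong) (simp_all add: bit_of_def r10_vec_nth[OF i])
  finally show ?thesis ..
qed

text \<open>The five coordinate sums become exclusive disjunctions. Complements appear because each
  coordinate occurs in six of the ten triples, so all ten vectors sum to zero.\<close>

lemma r10_sum_zero:
  assumes D: "D \<subseteq> r10_ground"
  shows "(\<forall>i<5. (\<Sum>c\<in>D. r10_vec c $ i) = 0) \<longleftrightarrow> r10_cycle D"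
proof -
  let ?b = "\<lambda>c. c \<in> D"
  have b0: "bit_of False = 0" "bit_of b = 0 \<longleftrightarrow> \<not> b" for b by (simp_all add: bit_of_def)
  have ex: "(\<Sum>c\<in>r10_ground. f c) = f (3,3) + (f (0,0) + (f (0,1) + (f (0,2) + (f (1,0) + (f (1,1) + (f (1,2) + (f (2,0) + (f (2,1) + f (2,2)))))))))" for f :: "_ \<Rightarrow> bit"
    unfolding r10_ground_list by simp
  have all5: "(\<forall>i<5. P i) \<longleftrightarrow> P 0 \<and> P 1 \<and> P 2 \<and> P 3 \<and> P (4::nat)" for P
    by (simp add: numeral_eq_Suc All_less_Suc conj_ac)
  have "(\<forall>i<5. (\<Sum>c\<in>D. r10_vec c $ i) = 0) \<longleftrightarrow>
    (\<forall>i<5. (\<Sum>c\<in>r10_ground. bit_of (c \<in> D \<and> i \<in> r10_triple c)) = 0)" by (simp add: r10_coordinate[OF D])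
  also have "\<dots> \<longleftrightarrow>
    \<not> (?b (3,3) \<noteq> (?b (0,0) \<noteq> (?b (1,1) \<noteq> (?b (1,2) \<noteq> (?b (2,1) \<noteq> ?b (2,2)))))) \<and>
    \<not> (?b (3,3) \<noteq> (?b (0,1) \<noteq> (?b (0,2) \<noteq> (?b (1,0) \<noteq> (?b (2,1) \<noteq> ?b (2,2)))))) \<and>
    \<not> (?b (3,3) \<noteq> (?b (0,1) \<noteq> (?b (0,2) \<noteq> (?b (1,1) \<noteq> (?b (1,2) \<noteq> ?b (2,0)))))) \<and>
    \<not> (?b (0,0) \<noteq> (?b (0,1) \<noteq> (?b (1,0) \<noteq> (?b (1,1) \<noteq> (?b (2,0) \<noteq> ?b (2,1)))))) \<and>
    \<not> (?b (0,0) \<noteq> (?b (0,2) \<noteq> (?b (1,0) \<noteq> (?b (1,2) \<noteq> (?b (2,0) \<noteq> ?b (2,2))))))"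
    unfolding all5 ex r10_triple_simps by (simp add: b0 bit_of_eq del: One_nat_def)
  also have "\<dots> \<longleftrightarrow> r10_cycle D"
  proof -
    have g9: "((i, c) \<in> r10_ground) = True" if "i \<in> {0,1,2}" "c \<in> {0,1,2}" for i c
      using that by (auto simp: r10_ground_def grid_def)
    have D': "(D \<subseteq> r10_ground) = True" using D by simp
    have n3: "(3,3) \<notin> grid" by (simp add: grid_def)
    have s1: "D \<subseteq> grid \<longleftrightarrow> (3,3) \<notin> D" using D n3 unfolding r10_ground_def by blast
    have s2: "r10_ground - D \<subseteq> grid \<longleftrightarrow> (3,3) \<in> D" using n3 unfolding r10_ground_def by blast
    have mem: "(0::nat) \<in> {0,1,2}" "(1::nat) \<in> {0,1,2}" "(2::nat) \<in> {0,1,2}" by simp_all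
    show ?thesis unfolding r10_cycle_def grid_even_def s1 s2 ball_simps Diff_iff D' g9[OF mem(1) mem(1)] g9[OF mem(1) mem(2)]
        g9[OF mem(1) mem(3)] g9[OF mem(2) mem(1)] g9[OF mem(2) mem(2)] g9[OF mem(2) mem(3)] g9[OF mem(3) mem(1)]
        g9[OF mem(3) mem(2)] g9[OF mem(3) mem(3)] simp_thms
      by (smt (verit))
  qed
  finally show ?thesis .
qed

text \<open>Over two elements a coefficient function is the indicator of its support, so linear
  relations are the same as sets with vanishing sum.\<close>

lemma indep_R10:
  "X \<in> indeps R10 \<longleftrightarrow> X \<subseteq> ground R10 \<and> (\<forall>z\<in>(\<lambda>D. r10_vec ` D) ` Collect r10_cycle. z \<noteq> {} \<longrightarrow> \<not> z \<subseteq> X)"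
proof -
  let ?G = "ground R10"
  have finG: "finite ?G" unfolding r10_ground_image by (simp add: r10_ground_list)
  have gG: "?G = {v \<in> carrier_vec 5. card {i. i < 5 \<and> v $ i \<noteq> 0} = 3}" by (simp add: R10_def vector_matroid_def)
  have car: "(\<lambda>v. v) ` ?G \<subseteq> carrier_vec 5" unfolding gG by auto
  have R: "R10 = vector_matroid 5 ?G (\<lambda>v. v)" by (subst gG) (rule R10_def)
  have rs: "D \<subseteq> r10_ground" if "r10_cycle D" for D
    using that unfolding r10_cycle_def grid_even_def r10_ground_def by blast
  have "X \<in> indeps R10 \<longleftrightarrow> X \<subseteq> ?G \<and> (\<forall>k. (\<forall>x. k x \<noteq> 0 \<longrightarrow> x \<in> X) \<longrightarrow> (\<forall>i<5. (\<Sum>x\<in>X. k x * x $ i) = 0) \<longrightarrow> (\<forall>x. k x = (0::bit)))"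
    by (subst R) (rule vector_matroid_indep[OF finG car])
  also have "\<dots> \<longleftrightarrow> X \<subseteq> ?G \<and> (\<forall>z\<in>(\<lambda>D. r10_vec ` D) ` Collect r10_cycle. z \<noteq> {} \<longrightarrow> \<not> z \<subseteq> X)"
  proof (rule conj_cong[OF refl])
    assume X: "X \<subseteq> ?G"
    have finX: "finite X" using X finG finite_subset by blast
    have inj: "inj_on r10_vec D" if "D \<subseteq> r10_ground" for D using r10_vec_inj that by (rule inj_on_subset)
    show "(\<forall>k. (\<forall>x. k x \<noteq> 0 \<longrightarrow> x \<in> X) \<longrightarrow> (\<forall>i<5. (\<Sum>x\<in>X. k x * x $ i) = 0) \<longrightarrow> (\<forall>x. k x = (0::bit))) \<longleftrightarrow>
      (\<forall>z\<in>(\<lambda>D. r10_vec ` D) ` Collect r10_cycle. z \<noteq> {} \<longrightarrow> \<not> z \<subseteq> X)" (is "?L \<longleftrightarrow> ?R")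
    proof
      assume L: ?L
      show ?R
      proof (intro ballI impI notI)
        fix z assume "z \<in> (\<lambda>D. r10_vec ` D) ` Collect r10_cycle" and zn: "z \<noteq> {}" "z \<subseteq> X"
        then obtain D where D: "r10_cycle D" "z = r10_vec ` D" by blast
        define k :: "bit vec \<Rightarrow> bit" where "k x = (if x \<in> z then 1 else 0)" for x
        have "(\<Sum>x\<in>X. k x * x $ i) = 0" if i: "i < 5" for i
        proof -
          have "(\<Sum>x\<in>X. k x * x $ i) = (\<Sum>x\<in>z. k x * x $ i)"
            by (rule sum.mono_neutral_right[OF finX zn(2)]) (simp add: k_def)
          also have "\<dots> = (\<Sum>x\<in>z. x $ i)" by (rule sum.cong) (simp_all add: k_def)
          also have "\<dots> = (\<Sum>c\<in>D. r10_vec c $ i)" unfolding D(2) using inj[OF rs[OF D(1)]] by (simp add: sum.reindex)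
          also have "\<dots> = 0" using r10_sum_zero[OF rs[OF D(1)]] D(1) i by simp
          finally show ?thesis .
        qed
        then have s: "\<forall>i<5. (\<Sum>x\<in>X. k x * x $ i) = 0" by blast
        have kX: "\<forall>x. k x \<noteq> 0 \<longrightarrow> x \<in> X" using zn(2) by (auto simp: k_def)
        have "\<forall>x. k x = 0" by (rule L[THEN spec, THEN mp, OF kX, THEN mp, OF s])
        moreover obtain x where "x \<in> z" using zn(1) by blast
        ultimately show False unfolding k_def by (metis one_neq_zero)
      qed
    next
      assume R': ?R
      show ?L
      proof (intro allI impI)
        fix k :: "bit vec \<Rightarrow> bit" and x assume k: "\<forall>x. k x \<noteq> 0 \<longrightarrow> x \<in> X" "\<forall>i<5. (\<Sum>x\<in>X. k x * x $ i) = 0"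
        define z where "z = {x. k x \<noteq> 0}"
        define D where "D = {c \<in> r10_ground. r10_vec c \<in> z}"
        have zX: "z \<subseteq> X" using k(1) by (auto simp: z_def)
        have zD: "z = r10_vec ` D" using zX X unfolding D_def r10_ground_image by blast
        have Dg: "D \<subseteq> r10_ground" by (auto simp: D_def)
        have "(\<Sum>c\<in>D. r10_vec c $ i) = 0" if i: "i < 5" for i
        proof -
          have "(\<Sum>x\<in>X. k x * x $ i) = (\<Sum>x\<in>z. k x * x $ i)"
            by (rule sum.mono_neutral_right[OF finX zX]) (simp add: z_def)
          also have "\<dots> = (\<Sum>x\<in>z. x $ i)"
          proof (rule sum.cong[OF refl])
            fix x assume "x \<in> z" then have "k x = 1" unfolding z_def by (cases "k x") auto
            then show "k x * x $ i = x $ i" by simp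
          qed
          also have "\<dots> = (\<Sum>c\<in>D. r10_vec c $ i)" unfolding zD using inj[OF Dg] by (simp add: sum.reindex)
          finally show ?thesis using k(2) i by simp
        qed
        then have "r10_cycle D" using r10_sum_zero[OF Dg] by blast
        then have "z = {}" using R' zX zD by blast
        then show "k x = 0" by (auto simp: z_def)
      qed
    qed
  qed
  finally show ?thesis .
qed

text \<open>The point \<open>(3,3)\<close> tells an even set from the complement of one. An even set
  inside a complement is handled by \<open>grid_even_disjoint\<close>, and two complements reverse
  the inclusion.\<close>

lemma r10_cycle_minimal:
  assumes "r10_cycle y" "r10_cycle D" "D \<noteq> r10_ground" "y \<noteq> {}" "y \<subseteq> D"
  shows "y = D"
proof -
  have cases: "grid_even D \<or> D \<subseteq> r10_ground \<and> grid_even (r10_ground - D)" "grid_even y \<or> y \<subseteq> r10_ground \<and> grid_even (r10_ground - y)"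
    using assms(1,2) by (auto simp: r10_cycle_def)
  have n3: "(3,3) \<notin> A" if "grid_even A" for A using grid_evenD(1)[OF that] by (auto simp: grid_def)
  have g3: "(3,3) \<in> r10_ground" by (simp add: r10_ground_def)
  show ?thesis
  proof (cases "grid_even D")
    case True
    then have "(3,3) \<notin> y" using n3 assms(5) by blast
    then have "grid_even y" using cases(2) n3[of "r10_ground - y"] g3 by blast
    then show ?thesis using grid_even_minimal[OF _ True assms(4,5)] by blast
  next
    case False
    then have D: "D \<subseteq> r10_ground" "grid_even (r10_ground - D)" using cases(1) by auto
    have ne: "r10_ground - D \<noteq> {}" using assms(3) D(1) by blast
    show ?thesis
    proof (cases "grid_even y")
      case True
      have "y \<inter> (r10_ground - D) = {}" using assms(5) by blast
      from grid_even_disjoint[OF True D(2) this] show ?thesis using assms(4) ne by blast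
    next
      case False
      then have y: "y \<subseteq> r10_ground" "grid_even (r10_ground - y)" using cases(2) by auto
      have "r10_ground - D = r10_ground - y" by (rule grid_even_minimal[OF D(2) y(2) ne]) (use assms(5) in blast)
      then show ?thesis using D(1) y(1) by blast
    qed
  qed
qed

lemma circuit_R10:
  "circuit R10 C \<longleftrightarrow> (\<exists>D. r10_cycle D \<and> D \<noteq> {} \<and> D \<noteq> r10_ground \<and> C = r10_vec ` D)"
proof -
  let ?Z = "(\<lambda>D. r10_vec ` D) ` Collect r10_cycle"
  have rs: "D \<subseteq> r10_ground" if "r10_cycle D" for D
    using that unfolding r10_cycle_def grid_even_def r10_ground_def by blast
  have sub: "D1 \<subseteq> D2" if "r10_cycle D1" "r10_cycle D2" "r10_vec ` D1 \<subseteq> r10_vec ` D2" for D1 D2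
    using that(3) rs[OF that(1)] rs[OF that(2)] r10_vec_inj unfolding inj_on_def by blast
  have "circuit R10 C \<longleftrightarrow> C \<in> ?Z \<and> C \<noteq> {} \<and> (\<forall>y\<in>?Z. y \<noteq> {} \<longrightarrow> y \<subseteq> C \<longrightarrow> y = C)"
  proof (rule circuit_of_cycles[OF indep_R10])
    fix z assume "z \<in> ?Z"
    then obtain D where "r10_cycle D" "z = r10_vec ` D" by blast
    then show "z \<subseteq> ground R10" by (simp only: r10_ground_image image_mono rs)
  qed
  also have "\<dots> \<longleftrightarrow> (\<exists>D. r10_cycle D \<and> D \<noteq> {} \<and> D \<noteq> r10_ground \<and> C = r10_vec ` D)"
  proof
    assume h: "C \<in> ?Z \<and> C \<noteq> {} \<and> (\<forall>y\<in>?Z. y \<noteq> {} \<longrightarrow> y \<subseteq> C \<longrightarrow> y = C)"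
    then obtain D where D: "r10_cycle D" "C = r10_vec ` D" by blast
    have "D \<noteq> r10_ground"
    proof
      assume "D = r10_ground"
      \<comment> \<open>A 4-cycle of \<open>K(3,3)\<close>: a nonempty member properly inside the
        ground set, which is therefore not a circuit.\<close>
      define D' :: "(nat \<times> nat) set" where "D' = {(0,0),(0,1),(1,0),(1,1)}"
      have D': "grid_even D'" by (simp add: D'_def grid_even_def grid_def)
      then have r: "r10_cycle D'" by (simp add: r10_cycle_def)
      have "r10_vec ` D' \<in> ?Z" using r by blast
      moreover have "r10_vec ` D' \<noteq> {}" by (simp add: D'_def)
      moreover have "r10_vec ` D' \<subseteq> C" unfolding D(2) \<open>D = r10_ground\<close> using rs[OF r] by (rule image_mono)
      ultimately have "r10_vec ` D' = C" by (rule h[THEN conjunct2, THEN conjunct2, THEN bspec, THEN mp, THEN mp])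
      then have "D \<subseteq> D'" by (intro sub[OF D(1) r]) (simp add: D(2))
      moreover have "(2,2) \<in> D" "(2,2) \<notin> D'" using \<open>D = r10_ground\<close> by (simp_all add: r10_ground_list D'_def)
      ultimately show False by blast
    qed
    moreover have "D \<noteq> {}" using h D(2) by blast
    ultimately show "\<exists>D. r10_cycle D \<and> D \<noteq> {} \<and> D \<noteq> r10_ground \<and> C = r10_vec ` D" using D by blast
  next
    assume "\<exists>D. r10_cycle D \<and> D \<noteq> {} \<and> D \<noteq> r10_ground \<and> C = r10_vec ` D"
    then obtain D where D: "r10_cycle D" "D \<noteq> {}" "D \<noteq> r10_ground" "C = r10_vec ` D" by blast
    have "y = C" if y: "y \<in> ?Z" "y \<noteq> {}" "y \<subseteq> C" for y
    proof -
      obtain D1 where D1: "r10_cycle D1" "y = r10_vec ` D1" using y(1) by blast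
      have "D1 = D"
        by (rule r10_cycle_minimal[OF D1(1) D(1,3)]) (use y(2,3) D1 D sub in auto)
      then show ?thesis using D1(2) D(4) by simp
    qed
    moreover have "C \<in> ?Z" unfolding D(4) using D(1) by (intro imageI CollectI)
    moreover have "C \<noteq> {}" using D(2,4) by simp
    ultimately show "C \<in> ?Z \<and> C \<noteq> {} \<and> (\<forall>y\<in>?Z. y \<noteq> {} \<longrightarrow> y \<subseteq> C \<longrightarrow> y = C)" by (intro conjI ballI impI)
  qed
  finally show ?thesis .
qed

lemma indep_circuits_of_cycles:
  assumes fin: "finite (ground N)"
    and ind: "\<And>X. X \<in> indeps N \<longleftrightarrow> X \<subseteq> ground N \<and> (\<forall>z\<in>Z. z \<noteq> {} \<longrightarrow> \<not> z \<subseteq> X)"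
  shows "X \<in> indeps N \<longleftrightarrow> X \<subseteq> ground N \<and> (\<forall>D. circuit N D \<longrightarrow> \<not> D \<subseteq> X)"
proof (intro iffI conjI allI impI notI)
  fix D assume X: "X \<in> indeps N" and D: "circuit N D" "D \<subseteq> X"
  have "D \<in> indeps N" using X D(2) unfolding ind by blast
  then show False using D(1) by (simp add: circuit_def)
next
  assume h: "X \<subseteq> ground N \<and> (\<forall>D. circuit N D \<longrightarrow> \<not> D \<subseteq> X)"
  show "X \<in> indeps N"
  proof (rule ccontr)
    assume n: "X \<notin> indeps N"
    let ?S = "{Y. Y \<subseteq> X \<and> Y \<notin> indeps N}"
    have "finite X" using h fin finite_subset by blast
    then have "finite ?S" by simp
    moreover have "?S \<noteq> {}" using n by auto
    ultimately obtain C where C: "C \<in> ?S" "\<forall>Y\<in>?S. Y \<subseteq> C \<longrightarrow> C = Y"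
      using finite_has_minimal[of ?S] by auto
    have "circuit N C" unfolding circuit_def
    proof (intro conjI allI impI)
      show "C \<subseteq> ground N" "C \<notin> indeps N" using C(1) h by auto
      fix Y assume Y: "Y \<subset> C"
      show "Y \<in> indeps N"
      proof (rule ccontr)
        assume "Y \<notin> indeps N"
        then have "Y \<in> ?S" using Y C(1) by auto
        then show False using C(2) Y by blast
      qed
    qed
    then show False using h C(1) by blast
  qed
qed (simp add: ind)

section \<open>Uniform matroids, and the circuit-difference property of the listed matroids\<close>

lemma circuit_uniform_zero: "circuit (uniform_matroid 0 1) C \<longleftrightarrow> C = {0}"
proof -
  have "circuit (uniform_matroid 0 1) C \<longleftrightarrow>
    C \<subseteq> {0} \<and> C \<noteq> {} \<and> (\<forall>X. X \<subset> C \<longrightarrow> X \<subseteq> {0} \<and> card X = 0)"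
    unfolding circuit_def uniform_matroid_def by (auto simp: subset_singleton_iff)
  also have "\<dots> \<longleftrightarrow> C = {0}" by (auto simp: subset_singleton_iff psubset_eq)
  finally show ?thesis .
qed

lemma circuit_uniform_one:
  "circuit (uniform_matroid 1 m) C \<longleftrightarrow> (\<exists>i j. i < m \<and> j < m \<and> i \<noteq> j \<and> C = {i, j})"
proof
  assume h: "circuit (uniform_matroid 1 m) C"
  have g: "C \<subseteq> {..<m}" and d: "\<not> card C \<le> 1" and p: "\<And>X. X \<subset> C \<Longrightarrow> card X \<le> 1"
    using h unfolding circuit_def uniform_matroid_def by auto
  have "finite C" using g finite_subset by blast
  then obtain i j where ij: "i \<in> C" "j \<in> C" "i \<noteq> j" using d card_le_Suc0_iff_eq[of C] by auto
  have "C = {i, j}"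
  proof (rule ccontr)
    assume "C \<noteq> {i, j}"
    then have "{i, j} \<subset> C" using ij by blast
    from p[OF this] ij(3) show False by simp
  qed
  then show "\<exists>i j. i < m \<and> j < m \<and> i \<noteq> j \<and> C = {i, j}" using g ij by blast
next
  assume "\<exists>i j. i < m \<and> j < m \<and> i \<noteq> j \<and> C = {i, j}"
  then obtain i j where ij: "i < m" "j < m" "i \<noteq> j" "C = {i, j}" by blast
  have "card X \<le> 1" if "X \<subset> C" for X
    using psubset_card_mono[OF _ that] ij by simp
  then show "circuit (uniform_matroid 1 m) C" using ij
    unfolding circuit_def uniform_matroid_def by auto
qed

lemma indep_uniform_one:
  "X \<in> indeps (uniform_matroid 1 m) \<longleftrightarrow>
    X \<subseteq> ground (uniform_matroid 1 m) \<and> (\<forall>D. circuit (uniform_matroid 1 m) D \<longrightarrow> \<not> D \<subseteq> X)"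
proof -
  have "card X \<le> 1 \<longleftrightarrow> (\<forall>D. circuit (uniform_matroid 1 m) D \<longrightarrow> \<not> D \<subseteq> X)" if X: "X \<subseteq> {..<m}"
  proof -
    have "finite X" using X finite_subset by blast
    then have "card X \<le> 1 \<longleftrightarrow> (\<forall>i\<in>X. \<forall>j\<in>X. i = j)" using card_le_Suc0_iff_eq[of X] by simp
    also have "\<dots> \<longleftrightarrow> (\<forall>D. circuit (uniform_matroid 1 m) D \<longrightarrow> \<not> D \<subseteq> X)"
    proof
      assume "\<forall>i\<in>X. \<forall>j\<in>X. i = j"
      then show "\<forall>D. circuit (uniform_matroid 1 m) D \<longrightarrow> \<not> D \<subseteq> X" unfolding circuit_uniform_one by blast
    next
      assume r: "\<forall>D. circuit (uniform_matroid 1 m) D \<longrightarrow> \<not> D \<subseteq> X"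
      show "\<forall>i\<in>X. \<forall>j\<in>X. i = j"
      proof (intro ballI, rule ccontr)
        fix i j assume ij: "i \<in> X" "j \<in> X" "i \<noteq> j"
        then have "circuit (uniform_matroid 1 m) {i, j}" unfolding circuit_uniform_one using X by blast
        then show False using r ij by blast
      qed
    qed
    finally show ?thesis .
  qed
  then show ?thesis by (auto simp: uniform_matroid_def)
qed

lemma circuit_difference_uniform_zero: "circuit_difference (uniform_matroid 0 1)"
  unfolding circuit_difference_def circuit_uniform_zero by blast

lemma circuit_difference_uniform_one: "circuit_difference (uniform_matroid 1 m)"
  unfolding circuit_difference_def
proof (intro allI impI, elim conjE)
  fix C1 C2 assume h: "circuit (uniform_matroid 1 m) C1" "circuit (uniform_matroid 1 m) C2" "C1 \<noteq> C2" "C1 \<inter> C2 \<noteq> {}"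
  obtain a where a: "a \<in> C1" "a \<in> C2" using h(4) by blast
  obtain b where b: "C1 = {a, b}" "b \<noteq> a" "b < m" using h(1) a(1) unfolding circuit_uniform_one by auto
  obtain c where c: "C2 = {a, c}" "c \<noteq> a" "c < m" using h(2) a(2) unfolding circuit_uniform_one by auto
  have "b \<noteq> c" using h(3) b c by blast
  moreover from this have "sym_diff C1 C2 = {b, c}" using b c by blast
  ultimately show "circuit (uniform_matroid 1 m) (sym_diff C1 C2)" unfolding circuit_uniform_one using b c by blast
qed

lemma circuit_difference_dual_complete:
  "circuit_difference (dual_matroid (cycle_matroid (complete_graph n)))"
  unfolding circuit_difference_def complete_graph_edges circuit_dual_complete[OF finite_lessThan]
proof (intro allI impI, elim conjE, intro conjI)
  fix C1 C2 assume h: "C1 \<in> cuts {..<n}" "C2 \<in> cuts {..<n}" "C1 \<noteq> C2"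
  show "sym_diff C1 C2 \<in> cuts {..<n}" by (rule cuts_sym_diff[OF h(1,2)])
  show "sym_diff C1 C2 \<noteq> {}" using h(3) by blast
qed

lemma image_sym_diff:
  assumes "inj_on f E" "A \<subseteq> E" "B \<subseteq> E"
  shows "f ` sym_diff A B = sym_diff (f ` A) (f ` B)"
proof -
  have "f ` (A - B) = f ` A - f ` B" "f ` (B - A) = f ` B - f ` A"
    using assms by (auto intro!: inj_on_image_set_diff[OF assms(1)])
  then show ?thesis by (simp add: image_Un)
qed

lemma circuit_difference_k33: "circuit_difference (cycle_matroid (complete_bipartite_graph 3 3))"
  unfolding circuit_difference_def circuit_k33
proof (intro allI impI, elim conjE exE)
  fix C1 C2 D1 D2 assume h: "C1 \<noteq> C2" "grid_even D1" "grid_even D2" "C1 = k33_edge ` D1" "C2 = k33_edge ` D2"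
  have "sym_diff C1 C2 = k33_edge ` sym_diff D1 D2"
    unfolding h(4,5) by (rule image_sym_diff[symmetric, of _ UNIV]) (auto simp: inj_on_def)
  moreover have "sym_diff D1 D2 \<noteq> {}" using h by blast
  ultimately show "\<exists>D. grid_even D \<and> D \<noteq> {} \<and> sym_diff C1 C2 = k33_edge ` D"
    using grid_even_sym_diff[OF h(2,3)] by blast
qed

lemma r10_cycle_subset: "r10_cycle D \<Longrightarrow> D \<subseteq> r10_ground"
  unfolding r10_cycle_def grid_even_def r10_ground_def by blast

lemma r10_cycle_sym_diff:
  assumes "r10_cycle D1" "r10_cycle D2"
  shows "r10_cycle (sym_diff D1 D2)"
proof -
  let ?E = r10_ground
  have s: "D1 \<subseteq> ?E" "D2 \<subseteq> ?E" using assms by (simp_all add: r10_cycle_subset)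
  then have sub: "sym_diff D1 D2 \<subseteq> ?E" by blast
  have c: "grid_even D1 \<or> grid_even (?E - D1)" "grid_even D2 \<or> grid_even (?E - D2)"
    using assms unfolding r10_cycle_def by blast+
  have e: "sym_diff (?E - D1) (?E - D2) = sym_diff D1 D2" "sym_diff D1 (?E - D2) = ?E - sym_diff D1 D2"
    "sym_diff (?E - D1) D2 = ?E - sym_diff D1 D2" using s by blast+
  show ?thesis
    using c grid_even_sym_diff[of D1 D2] grid_even_sym_diff[of D1 "?E - D2"]
      grid_even_sym_diff[of "?E - D1" D2] grid_even_sym_diff[of "?E - D1" "?E - D2"] sub
    unfolding r10_cycle_def e by blast
qed

text \<open>The ground set is the one nonempty member of the cycle space that is not a circuit, and
  it is not the symmetric difference of two circuits with a common element.\<close>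

lemma circuit_difference_R10: "circuit_difference R10"
  unfolding circuit_difference_def circuit_R10
proof (intro allI impI, elim conjE exE)
  fix C1 C2 D1 D2
  assume h: "C1 \<noteq> C2" "C1 \<inter> C2 \<noteq> {}" "r10_cycle D1" "r10_cycle D2" "C1 = r10_vec ` D1" "C2 = r10_vec ` D2"
  have s: "D1 \<subseteq> r10_ground" "D2 \<subseteq> r10_ground" using h(3,4) by (simp_all add: r10_cycle_subset)
  have "sym_diff C1 C2 = r10_vec ` sym_diff D1 D2"
    unfolding h(5,6) by (rule image_sym_diff[symmetric, OF r10_vec_inj s])
  moreover have "sym_diff D1 D2 \<noteq> {}" using h(1,5,6) by blast
  moreover have "D1 \<inter> D2 \<noteq> {}"
  proof -
    obtain c d where "c \<in> D1" "d \<in> D2" "r10_vec c = r10_vec d" using h(2,5,6) by blast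
    then have "c = d" using s r10_vec_inj by (auto simp: inj_on_def)
    then show ?thesis using \<open>c \<in> D1\<close> \<open>d \<in> D2\<close> by blast
  qed
  then have "sym_diff D1 D2 \<noteq> r10_ground" using s by blast
  ultimately show "\<exists>D. r10_cycle D \<and> D \<noteq> {} \<and> D \<noteq> r10_ground \<and> sym_diff C1 C2 = r10_vec ` D"
    using r10_cycle_sym_diff[OF h(3,4)] by blast
qed

text \<open>Two circuits through a common element \<open>x\<close> both lie in the class of
  \<open>x\<close>.\<close>

lemma components_circuit_difference:
  assumes "\<And>K. K \<in> components M \<Longrightarrow> circuit_difference K"
  shows "circuit_difference M"
  unfolding circuit_difference_def
proof (intro allI impI, elim conjE)
  fix C1 C2 assume C: "circuit M C1" "circuit M C2" "C1 \<noteq> C2" "C1 \<inter> C2 \<noteq> {}"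
  obtain x where x: "x \<in> C1" "x \<in> C2" using C(4) by blast
  define Q where "Q = connected_rel M `` {x}"
  have g: "C \<subseteq> ground M" if "circuit M C" for C using that by (simp add: circuit_def)
  have Q: "Q \<subseteq> ground M" unfolding Q_def connected_rel_def by blast
  have "Q \<in> ground M // connected_rel M" unfolding Q_def by (rule quotientI) (use x(1) g[OF C(1)] in blast)
  then have K: "circuit_difference (restrict_matroid M Q)" using assms by (simp add: components_def)
  have s: "C \<subseteq> Q" if "circuit M C" "x \<in> C" for C
    using that g[OF that(1)] unfolding Q_def connected_rel_def by blast
  have "circuit (restrict_matroid M Q) (sym_diff C1 C2)"
    using K C s[OF C(1) x(1)] s[OF C(2) x(2)] unfolding circuit_difference_def circuit_restrict[OF Q] by blast
  then show "circuit M (sym_diff C1 C2)" unfolding circuit_restrict[OF Q] by blast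
qed

section \<open>Connected circuit-difference matroids\<close>

locale difference_matroid = matroid M for M :: "'a set_system" +
  assumes difference: "circuit M C \<Longrightarrow> circuit M D \<Longrightarrow> C \<noteq> D \<Longrightarrow> C \<inter> D \<noteq> {} \<Longrightarrow> circuit M (sym_diff C D)"
begin

lemma circuit_nonempty: "circuit M C \<Longrightarrow> C \<noteq> {}"
  using empty_indep by (auto simp: circuit_def)

lemma circuit_ground: "circuit M C \<Longrightarrow> C \<subseteq> ground M"
  by (simp add: circuit_def)

lemma circuit_incomparable: "circuit M C \<Longrightarrow> circuit M D \<Longrightarrow> C \<subseteq> D \<Longrightarrow> C = D"
  unfolding circuit_def by blast

text \<open>Transitivity of connectivity; in a circuit-difference matroid a symmetric difference
  gives the required circuit at once.\<close>

lemma circuit_join: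
  assumes "circuit M C" "a \<in> C" "b \<in> C" "circuit M D" "b \<in> D" "c \<in> D"
  shows "\<exists>E. circuit M E \<and> a \<in> E \<and> c \<in> E"
proof (cases "c \<in> C \<or> a \<in> D")
  case True
  then show ?thesis using assms by blast
next
  case False
  have "circuit M (sym_diff C D)" by (rule difference[OF assms(1,4)]) (use assms False in blast)+
  then show ?thesis using False assms by blast
qed

text \<open>Otherwise the symmetric difference of the circuits \<open>D\<close> and \<open>D \<triangle> C \<triangle> C'\<close> would be the
  circuit \<open>C \<union> C'\<close>.\<close>

lemma circuit_meets_disjoint:
  assumes C: "circuit M C" "circuit M C'" "C \<inter> C' = {}" and D: "circuit M D" "D \<inter> C \<noteq> {}" "D \<inter> C' \<noteq> {}"
  shows "D \<subseteq> C \<union> C'"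
proof (rule ccontr)
  assume "\<not> D \<subseteq> C \<union> C'"
  then obtain x where x: "x \<in> D" "x \<notin> C" "x \<notin> C'" by blast
  obtain y where y: "y \<in> D" "y \<in> C" using D(2) by blast
  have E1: "circuit M (sym_diff D C)" (is "circuit M ?E1") by (rule difference[OF D(1) C(1)]) (use D(2) x in blast)+
  have E2: "circuit M (sym_diff ?E1 C')" (is "circuit M ?E2") by (rule difference[OF E1 C(2)]) (use D(3) C(3) x in blast)+
  have "circuit M (sym_diff D ?E2)" by (rule difference[OF D(1) E2]) (use x y C(3) in blast)+
  moreover have "sym_diff D ?E2 = C \<union> C'" using C(3) by blast
  ultimately have "C = C \<union> C'" by (intro circuit_incomparable[OF C(1)]) auto
  then show False using C(3) D(3) by blast
qed

text \<open>A circuit \<open>D\<close> meets two parts \<open>p\<close> and \<open>q\<close>. For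
  two further parts \<open>a\<close> and \<open>b\<close>, the disjoint circuits
  \<open>p \<union> a\<close> and \<open>q \<union> b\<close> both meet \<open>D\<close>, so
  \<open>D\<close> lies in their union. Three further parts give unions with intersection
  \<open>p \<union> q\<close>; hence the bound five.\<close>

lemma circuit_of_parts:
  assumes PP: "\<And>p q. p \<in> PP \<Longrightarrow> q \<in> PP \<Longrightarrow> p \<noteq> q \<Longrightarrow> p \<inter> q = {} \<and> circuit M (p \<union> q)"
    and ne: "\<And>p. p \<in> PP \<Longrightarrow> p \<noteq> {}" and cov: "\<Union>PP = ground M" and five: "finite PP" "5 \<le> card PP"
  shows "circuit M D \<longleftrightarrow> (\<exists>p\<in>PP. \<exists>q\<in>PP. p \<noteq> q \<and> D = p \<union> q)"
proof
  assume D: "circuit M D"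
  have other: "\<exists>r. r \<in> PP \<and> r \<notin> set A" if "length A < 5" for A
  proof (rule ccontr)
    assume "\<not> ?thesis"
    then have "PP \<subseteq> set A" by blast
    from card_mono[OF finite_set this] show False using that card_length[of A] five(2) by linarith
  qed
  obtain x where "x \<in> D" using circuit_nonempty[OF D] by blast
  then obtain p where p: "p \<in> PP" "D \<inter> p \<noteq> {}" using circuit_ground[OF D] cov by blast
  obtain q0 where q0: "q0 \<in> PP" "q0 \<notin> {p}" using other[of "[p]"] by auto
  have "\<not> D \<subseteq> p"
  proof
    assume s: "D \<subseteq> p"
    have "D = p \<union> q0" by (rule circuit_incomparable[OF D]) (use PP[OF p(1) q0(1)] q0(2) s in auto)
    then show False using s PP[OF p(1) q0(1)] q0(2) ne[OF q0(1)] by blast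
  qed
  then obtain y where "y \<in> D" "y \<notin> p" by blast
  then obtain q where q: "q \<in> PP" "D \<inter> q \<noteq> {}" "p \<noteq> q" using circuit_ground[OF D] cov by blast
  obtain r where r: "r \<in> PP" "r \<notin> {p, q}" using other[of "[p, q]"] by auto
  obtain s where s: "s \<in> PP" "s \<notin> {p, q, r}" using other[of "[p, q, r]"] by auto
  obtain t where t: "t \<in> PP" "t \<notin> {p, q, r, s}" using other[of "[p, q, r, s]"] by auto
  have inside: "D \<subseteq> (p \<union> a) \<union> (q \<union> b)" if ab: "a \<in> PP" "b \<in> PP" "a \<noteq> b" "a \<notin> {p, q}" "b \<notin> {p, q}" for a b
  proof (rule circuit_meets_disjoint[OF _ _ _ D])
    show "circuit M (p \<union> a)" "circuit M (q \<union> b)" using PP[OF p(1) ab(1)] PP[OF q(1) ab(2)] ab by auto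
    show "(p \<union> a) \<inter> (q \<union> b) = {}"
    proof -
      have "p \<inter> q = {}" "p \<inter> b = {}" "a \<inter> q = {}" "a \<inter> b = {}"
        using PP[OF p(1) q(1) q(3)] PP[OF p(1) ab(2)] PP[OF ab(1) q(1)] PP[OF ab(1,2,3)] ab(4,5) by (simp_all add: eq_commute[of p b])
      then show ?thesis by blast
    qed
    show "D \<inter> (p \<union> a) \<noteq> {}" "D \<inter> (q \<union> b) \<noteq> {}" using p(2) q(2) by blast+
  qed
  have "r \<noteq> s" "r \<noteq> t" "s \<noteq> t" using s(2) t(2) by auto
  then have "r \<inter> s = {}" "r \<inter> t = {}" "s \<inter> t = {}" using PP[OF r(1) s(1)] PP[OF r(1) t(1)] PP[OF s(1) t(1)] by simp_all
  moreover have "D \<subseteq> (p \<union> r) \<union> (q \<union> s)" "D \<subseteq> (p \<union> r) \<union> (q \<union> t)" "D \<subseteq> (p \<union> s) \<union> (q \<union> t)"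
    using inside[OF r(1) s(1)] inside[OF r(1) t(1)] inside[OF s(1) t(1)] r(2) s(2) t(2) \<open>r \<noteq> s\<close> \<open>r \<noteq> t\<close> \<open>s \<noteq> t\<close> by simp_all
  ultimately have "D \<subseteq> p \<union> q" by blast
  then have "D = p \<union> q" using circuit_incomparable[OF D] PP[OF p(1) q(1,3)] by simp
  then show "\<exists>p\<in>PP. \<exists>q\<in>PP. p \<noteq> q \<and> D = p \<union> q" using p(1) q(1,3) by blast
next
  assume "\<exists>p\<in>PP. \<exists>q\<in>PP. p \<noteq> q \<and> D = p \<union> q"
  then show "circuit M D" using PP by blast
qed

text \<open>The parts are the fibres of a map to the ground set of \<open>U(1,m)\<close>, where
  \<open>m\<close> is their number.\<close>

lemma parts_series_extension:
  assumes PP: "\<And>p q. p \<in> PP \<Longrightarrow> q \<in> PP \<Longrightarrow> p \<noteq> q \<Longrightarrow> p \<inter> q = {} \<and> circuit M (p \<union> q)"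
    and ne: "\<And>p. p \<in> PP \<Longrightarrow> p \<noteq> {}" and cov: "\<Union>PP = ground M" and five: "finite PP" "5 \<le> card PP"
  shows "\<exists>m\<ge>1. \<exists>N. series_extension N M \<and> matroid_iso N (uniform_matroid 1 m)"
proof -
  let ?U = "uniform_matroid 1 (card PP)"
  have gU: "ground ?U = {..<card PP}" by (simp add: uniform_matroid_def)
  obtain f where "bij_betw f PP {0..<card PP}" using ex_bij_betw_finite_nat[OF five(1)] by blast
  then have f: "inj_on f PP" "f ` PP = {..<card PP}" by (auto simp: bij_betw_def lessThan_atLeast0)
  define \<pi> where "\<pi> x = f (SOME p. p \<in> PP \<and> x \<in> p)" for x
  have \<pi>: "\<pi> x = f p" if "p \<in> PP" "x \<in> p" for x p
  proof -
    have "(SOME p. p \<in> PP \<and> x \<in> p) = p"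
    proof (rule some_equality)
      fix q assume "q \<in> PP \<and> x \<in> q"
      then show "q = p" using PP[of p q] that by blast
    qed (use that in blast)
    then show ?thesis by (simp add: \<pi>_def)
  qed
  have pre: "{x \<in> ground M. \<pi> x \<in> {f p, f q}} = p \<union> q" if pq: "p \<in> PP" "q \<in> PP" for p q
  proof (intro equalityI subsetI)
    fix x assume "x \<in> {x \<in> ground M. \<pi> x \<in> {f p, f q}}"
    then have x: "x \<in> \<Union>PP" "\<pi> x \<in> {f p, f q}" unfolding cov by simp_all
    from x(1) obtain r where r: "r \<in> PP" "x \<in> r" by blast
    have "f r \<in> {f p, f q}" using x(2) unfolding \<pi>[OF r] .
    then have "r = p \<or> r = q" using f(1) pq r(1) by (auto simp: inj_on_def)
    then show "x \<in> p \<union> q" using r(2) by blast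
  next
    fix x assume x: "x \<in> p \<union> q"
    then have "x \<in> ground M" using pq cov by blast
    moreover have "\<pi> x \<in> {f p, f q}" using x \<pi>[OF pq(1), of x] \<pi>[OF pq(2), of x] by auto
    ultimately show "x \<in> {x \<in> ground M. \<pi> x \<in> {f p, f q}}" by simp
  qed
  have "\<exists>N. series_extension N M \<and> matroid_iso N ?U"
  proof (rule series_extension_pullback[OF matroid_axioms, of \<pi>])
    show "\<pi> ` ground M = ground ?U"
    proof (intro equalityI subsetI)
      fix y assume "y \<in> \<pi> ` ground M"
      then obtain x where "x \<in> \<Union>PP" "y = \<pi> x" unfolding cov by blast
      then obtain p where "p \<in> PP" "y = f p" using \<pi> by blast
      then show "y \<in> ground ?U" using f(2) unfolding gU by blast
    next
      fix y assume "y \<in> ground ?U"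
      then obtain p where p: "p \<in> PP" "y = f p" unfolding gU using f(2) by blast
      then obtain x where "x \<in> p" using ne by blast
      then show "y \<in> \<pi> ` ground M" using p \<pi> cov by (metis UnionI imageI)
    qed
    show "circuit M C \<longleftrightarrow> (\<exists>D. circuit ?U D \<and> C = {x \<in> ground M. \<pi> x \<in> D})" for C
    proof
      assume "circuit M C"
      then obtain p q where pq: "p \<in> PP" "q \<in> PP" "p \<noteq> q" "C = p \<union> q" using circuit_of_parts[OF PP ne cov five] by blast
      have "f p < card PP" "f q < card PP" "f p \<noteq> f q" using f pq(1-3) by (auto simp: inj_on_def)
      then have "circuit ?U {f p, f q}" unfolding circuit_uniform_one by blast
      then show "\<exists>D. circuit ?U D \<and> C = {x \<in> ground M. \<pi> x \<in> D}" using pre[OF pq(1,2)] pq(4) by blast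
    next
      assume "\<exists>D. circuit ?U D \<and> C = {x \<in> ground M. \<pi> x \<in> D}"
      then obtain i j where ij: "i < card PP" "j < card PP" "i \<noteq> j" "C = {x \<in> ground M. \<pi> x \<in> {i, j}}"
        unfolding circuit_uniform_one by blast
      obtain p where p: "p \<in> PP" "i = f p" using ij(1) f(2) by (metis imageE lessThan_iff)
      obtain q where q: "q \<in> PP" "j = f q" using ij(2) f(2) by (metis imageE lessThan_iff)
      have "p \<noteq> q" using ij(3) p q by blast
      moreover have "C = p \<union> q" using pre[OF p(1) q(1)] ij(4) p(2) q(2) by simp
      ultimately show "circuit M C" using PP[OF p(1) q(1)] by blast
    qed
    show "X \<in> indeps ?U \<longleftrightarrow> X \<subseteq> ground ?U \<and> (\<forall>D. circuit ?U D \<longrightarrow> \<not> D \<subseteq> X)" for X by (rule indep_uniform_one)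
    show "\<exists>D. circuit ?U D \<and> y \<in> D" if "y \<in> ground ?U" for y
    proof -
      have "y < card PP" using that unfolding gU by simp
      moreover have "\<exists>j. j < card PP \<and> y \<noteq> j" using five(2) by (intro exI[of _ "if y = 0 then 1 else 0"]) auto
      ultimately show ?thesis unfolding circuit_uniform_one by blast
    qed
  qed
  then show ?thesis using five(2) by (intro exI[of _ "card PP"]) auto
qed

end

locale connected_difference_matroid = difference_matroid +
  assumes conn: "x \<in> ground M \<Longrightarrow> y \<in> ground M \<Longrightarrow> \<exists>C. circuit M C \<and> x \<in> C \<and> y \<in> C"
begin

text \<open>Each element outside \<open>C \<union> C'\<close> is joined by circuits to
  \<open>c\<close> and to \<open>c'\<close>. These circuits meet \<open>C\<close> and
  \<open>C'\<close> in sets \<open>A\<close> and \<open>B\<close> that turn out not to depend on the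
  element, and the outside falls into parts of the same kind.\<close>

lemma parallel_case:
  assumes C: "circuit M C" "circuit M C'" "C \<inter> C' = {}" and x0: "x0 \<in> ground M" "x0 \<notin> C" "x0 \<notin> C'"
  shows "\<exists>m\<ge>1. \<exists>N. series_extension N M \<and> matroid_iso N (uniform_matroid 1 m)"
proof -
  define R where "R = ground M - C - C'"
  obtain c c' where c: "c \<in> C" "c' \<in> C'" using circuit_nonempty C(1,2) by blast
  note gr = circuit_ground[OF C(1)] circuit_ground[OF C(2)]
  \<comment> \<open>The three sets are the future parts of \<open>c\<close>, \<open>c'\<close> and
    \<open>x\<close>.\<close>
  define good where "good x A B T \<longleftrightarrow> circuit M (A \<union> T) \<and> circuit M (B \<union> T) \<and> circuit M (A \<union> B) \<and>
    A \<subseteq> C \<and> B \<subseteq> C' \<and> c \<in> A \<and> c' \<in> B \<and> x \<in> T \<and> T \<subseteq> R" for x A B T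
  have ex: "\<exists>A B T. good x A B T" if x: "x \<in> R" for x
  proof -
    have xg: "x \<in> ground M" "x \<notin> C" "x \<notin> C'" using x by (auto simp: R_def)
    obtain D where D: "circuit M D" "x \<in> D" "c \<in> D" using conn[of x c] xg(1) c gr by blast
    obtain D' where D': "circuit M D'" "x \<in> D'" "c' \<in> D'" using conn[of x c'] xg(1) c gr by blast
    have n: "D \<inter> C' = {}" using circuit_meets_disjoint[OF C D(1)] c D xg by blast
    have n': "D' \<inter> C = {}" using circuit_meets_disjoint[OF C D'(1)] c D' xg by blast
    have E: "circuit M (sym_diff D D')" by (rule difference[OF D(1) D'(1)]) (use D D' c n n' in blast)+
    have sE: "sym_diff D D' \<subseteq> C \<union> C'" by (rule circuit_meets_disjoint[OF C E]) (use D D' c n n' in blast)+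
    \<comment> \<open>The symmetric difference of \<open>D\<close> and \<open>D'\<close> lies in
      \<open>C \<union> C'\<close>, so both circuits have the same elements outside.\<close>
    have T: "D - C = D' - C'" using sE n n' by blast
    have e: "(D \<inter> C) \<union> (D - C) = D" "(D' \<inter> C') \<union> (D - C) = D'" "(D \<inter> C) \<union> (D' \<inter> C') = sym_diff D D'"
      using T sE n n' by blast+
    have "good x (D \<inter> C) (D' \<inter> C') (D - C)"
      unfolding good_def e using D D' E c n xg circuit_ground[OF D(1)] by (auto simp: R_def)
    then show ?thesis by blast
  qed
  \<comment> \<open>A circuit from \<open>C\<close> to \<open>C'\<close> cannot split
    \<open>A\<close>: its symmetric difference with \<open>A \<union> T\<close> would still meet
    \<open>C\<close> and \<open>C'\<close> and yet contain \<open>T\<close>. The same holds for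
    \<open>B\<close>.\<close>
  have cut: "(D \<inter> A = {} \<or> D \<inter> C = A) \<and> (D \<inter> B = {} \<or> D \<inter> C' = B)"
    if g: "good x A B T" and D: "circuit M D" "D \<inter> C \<noteq> {}" "D \<inter> C' \<noteq> {}" for x A B T D
  proof -
    have s: "D \<subseteq> C \<union> C'" by (rule circuit_meets_disjoint[OF C D])
    have a: "circuit M (A \<union> T)" "circuit M (B \<union> T)" "A \<subseteq> C" "B \<subseteq> C'" "x \<in> T" "T \<inter> C = {}" "T \<inter> C' = {}"
      using g by (auto simp: good_def R_def)
    have "D \<inter> C = A" if m: "D \<inter> A \<noteq> {}"
    proof (rule ccontr)
      assume n: "D \<inter> C \<noteq> A"
      have F: "circuit M (sym_diff D (A \<union> T))" by (rule difference[OF D(1) a(1)]) (use m s a in blast)+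
      have "sym_diff D (A \<union> T) \<subseteq> C \<union> C'"
        by (rule circuit_meets_disjoint[OF C F]) (use n D C(3) a in blast)+
      then show False using s a by blast
    qed
    moreover have "D \<inter> C' = B" if m: "D \<inter> B \<noteq> {}"
    proof (rule ccontr)
      assume n: "D \<inter> C' \<noteq> B"
      have F: "circuit M (sym_diff D (B \<union> T))" by (rule difference[OF D(1) a(2)]) (use m s a in blast)+
      have "sym_diff D (B \<union> T) \<subseteq> C \<union> C'"
        by (rule circuit_meets_disjoint[OF C F]) (use n D C(3) a in blast)+
      then show False using s a by blast
    qed
    ultimately show ?thesis by blast
  qed
  have uniq: "A2 = A \<and> B2 = B" if g: "good x A B T" "good y A2 B2 T2" for x A B T y A2 B2 T2
  proof -
    have h: "circuit M (A2 \<union> B2)" "A2 \<subseteq> C" "B2 \<subseteq> C'" "c \<in> A2" "c' \<in> B2" "c \<in> A" "c' \<in> B"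
      using g by (auto simp: good_def)
    have "(A2 \<union> B2) \<inter> C \<noteq> {}" "(A2 \<union> B2) \<inter> C' \<noteq> {}" using h c by blast+
    from cut[OF g(1) h(1) this] have "(A2 \<union> B2) \<inter> C = A" "(A2 \<union> B2) \<inter> C' = B" using h by blast+
    then show ?thesis using h(2,3) C(3) by blast
  qed
  have "x0 \<in> R" using x0 by (simp add: R_def)
  from ex[OF this] obtain A B T0 where g0: "good x0 A B T0" by blast
  have AB: "circuit M (A \<union> B)" "A \<subseteq> C" "B \<subseteq> C'" "c \<in> A" "c' \<in> B" using g0 by (auto simp: good_def)
  define TT where "TT = {T. \<exists>x\<in>R. good x A B T}"
  have TT: "circuit M (A \<union> T) \<and> circuit M (B \<union> T) \<and> T \<noteq> {} \<and> T \<subseteq> R" if "T \<in> TT" for T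
    using that unfolding TT_def good_def by blast
  have covR: "\<Union>TT = R"
  proof (intro equalityI subsetI)
    fix x assume x: "x \<in> R"
    obtain A2 B2 T where "good x A2 B2 T" using ex[OF x] by blast
    moreover from uniq[OF g0 this] have "A2 = A" "B2 = B" by simp_all
    ultimately have "T \<in> TT" "x \<in> T" using x by (auto simp: TT_def good_def)
    then show "x \<in> \<Union>TT" by blast
  qed (use TT in blast)
  have T0: "T0 \<in> TT" using g0 \<open>x0 \<in> R\<close> by (auto simp: TT_def)
  \<comment> \<open>The symmetric difference of \<open>T\<close> and \<open>T2\<close> is a circuit
    disjoint from \<open>C\<close>, and \<open>A \<union> T\<close> meets both circuits. So
    \<open>A \<union> T\<close> lies in their union, which has no element of
    \<open>T \<inter> T2\<close>.\<close>
  have dT': "T \<inter> T2 = {}" if h: "T \<in> TT" "T2 \<in> TT" "\<not> T \<subseteq> T2" for T T2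
  proof -
    have o: "T \<inter> C = {}" "T2 \<inter> C = {}" using TT[OF h(1)] TT[OF h(2)] by (auto simp: R_def)
    have ne: "A \<union> T \<noteq> A \<union> T2" using h(3) o AB(2) by blast
    have "circuit M (sym_diff (A \<union> T) (A \<union> T2))"
      by (rule difference) (use TT[OF h(1)] TT[OF h(2)] ne AB in blast)+
    moreover have "sym_diff (A \<union> T) (A \<union> T2) = sym_diff T T2" using o AB(2) by blast
    ultimately have F: "circuit M (sym_diff T T2)" by simp
    have "A \<union> T \<subseteq> C \<union> sym_diff T T2"
      by (rule circuit_meets_disjoint[OF C(1) F]) (use TT[OF h(1)] o AB h(3) in blast)+
    then show ?thesis using o by blast
  qed
  have dT: "T \<inter> T2 = {}" if h: "T \<in> TT" "T2 \<in> TT" "T \<noteq> T2" for T T2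
    using dT'[OF h(1,2)] dT'[OF h(2,1)] h(3) by blast
  have TT_C: "T \<inter> C = {}" "T \<inter> C' = {}" if "T \<in> TT" for T using TT[OF that] by (auto simp: R_def)
  \<comment> \<open>\<open>C\<close> and \<open>C'\<close> contribute two parts each and the outside
    at least one, which makes up the five parts needed.\<close>
  define PP where "PP = {A, C - A, B, C' - B} \<union> TT"
  have notin: "circuit M X \<Longrightarrow> X \<subseteq> Y \<Longrightarrow> circuit M Y \<Longrightarrow> X = Y" for X Y by (rule circuit_incomparable)
  have D1: "circuit M ((C - A) \<union> T0)"
  proof -
    have "circuit M (sym_diff C (A \<union> T0))"
      by (rule difference[OF C(1)]) (use TT[OF T0] TT_C[OF T0] AB c in blast)+
    moreover have "sym_diff C (A \<union> T0) = (C - A) \<union> T0" using TT_C[OF T0] AB by blast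
    ultimately show ?thesis by simp
  qed
  have D2: "circuit M ((C' - B) \<union> T0)"
  proof -
    have "circuit M (sym_diff C' (B \<union> T0))"
      by (rule difference[OF C(2)]) (use TT[OF T0] TT_C[OF T0] AB c in blast)+
    moreover have "sym_diff C' (B \<union> T0) = (C' - B) \<union> T0" using TT_C[OF T0] AB by blast
    ultimately show ?thesis by simp
  qed
  have D3: "circuit M (A \<union> (C' - B))"
  proof -
    have "circuit M (sym_diff C' (A \<union> B))"
      by (rule difference[OF C(2) AB(1)]) (use AB c C(3) in blast)+
    moreover have "sym_diff C' (A \<union> B) = A \<union> (C' - B)" using AB C(3) by blast
    ultimately show ?thesis by simp
  qed
  have neC: "C - A \<noteq> {}"
  proof
    assume e: "C - A = {}"
    have "T0 = A \<union> T0" by (rule notin) (use D1 e TT[OF T0] in auto)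
    then show False using AB TT_C[OF T0] c by blast
  qed
  have neC': "C' - B \<noteq> {}"
  proof
    assume e: "C' - B = {}"
    have "T0 = B \<union> T0" by (rule notin) (use D2 e TT[OF T0] in auto)
    then show False using AB TT_C[OF T0] c by blast
  qed
  have ne: "p \<noteq> {}" if "p \<in> PP" for p using that neC neC' AB TT by (auto simp: PP_def)
  \<comment> \<open>It suffices to pair every part with \<open>A\<close>, since the union of two
    other parts is the symmetric difference of two such circuits.\<close>
  have withA: "circuit M (A \<union> p) \<and> A \<inter> p = {}" if p: "p \<in> PP" "p \<noteq> A" for p
  proof -
    consider "p = C - A" | "p = B" | "p = C' - B" | "p \<in> TT" using p by (auto simp: PP_def)
    then show ?thesis
    proof cases
      case 1
      then have "A \<union> p = C" using AB by blast
      then show ?thesis using C(1) 1 by auto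
    next
      case 2 then show ?thesis using AB C(3) by blast
    next
      case 3 then show ?thesis using D3 AB C(3) by blast
    next
      case 4 then show ?thesis using TT[OF 4] TT_C[OF 4] AB by blast
    qed
  qed
  have disj: "p \<inter> q = {}" if pq: "p \<in> PP" "q \<in> PP" "p \<noteq> q" for p q
  proof -
    have t: "T \<inter> A = {}" "T \<inter> B = {}" "T \<inter> (C - A) = {}" "T \<inter> (C' - B) = {}" if "T \<in> TT" for T
      using TT_C[OF that] AB by blast+
    have t': "A \<inter> T = {}" "B \<inter> T = {}" "(C - A) \<inter> T = {}" "(C' - B) \<inter> T = {}" if "T \<in> TT" for T
      using t[OF that] by blast+
    have u: "A \<inter> (C - A) = {}" "A \<inter> B = {}" "A \<inter> (C' - B) = {}" "(C - A) \<inter> B = {}" "(C - A) \<inter> (C' - B) = {}" "B \<inter> (C' - B) = {}"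
      using C(3) AB by blast+
    have u': "(C - A) \<inter> A = {}" "B \<inter> A = {}" "(C' - B) \<inter> A = {}" "B \<inter> (C - A) = {}" "(C' - B) \<inter> (C - A) = {}" "(C' - B) \<inter> B = {}"
      using u by blast+
    have "p = A \<or> p = C - A \<or> p = B \<or> p = C' - B \<or> p \<in> TT" "q = A \<or> q = C - A \<or> q = B \<or> q = C' - B \<or> q \<in> TT"
      using pq(1,2) by (auto simp: PP_def)
    then show ?thesis using pq(3)
      by (elim disjE) (simp_all add: t t' u u' dT)
  qed
  have PP: "p \<inter> q = {} \<and> circuit M (p \<union> q)" if pq: "p \<in> PP" "q \<in> PP" "p \<noteq> q" for p q
  proof -
    note d = disj[OF pq]
    consider "p = A" | "q = A" | "p \<noteq> A" "q \<noteq> A" by blast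
    then have "circuit M (p \<union> q)"
    proof cases
      case 1 then show ?thesis using withA pq by blast
    next
      case 2 then show ?thesis using withA[OF pq(1)] pq(3) by (simp add: Un_commute)
    next
      case 3
      have "circuit M (sym_diff (A \<union> p) (A \<union> q))"
        by (rule difference) (use withA[OF pq(1) 3(1)] withA[OF pq(2) 3(2)] AB pq(3) in blast)+
      moreover have "sym_diff (A \<union> p) (A \<union> q) = p \<union> q"
        using withA[OF pq(1) 3(1)] withA[OF pq(2) 3(2)] d by blast
      ultimately show ?thesis by simp
    qed
    with d show ?thesis by blast
  qed
  have cov: "\<Union>PP = ground M"
  proof -
    have "A \<union> (C - A) = C" "B \<union> (C' - B) = C'" using AB by blast+
    then have "\<Union>PP = C \<union> C' \<union> \<Union>TT" unfolding PP_def by (simp add: Un_assoc[symmetric])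
    then show ?thesis unfolding covR R_def using gr by blast
  qed
  have fin: "finite PP"
  proof (rule finite_subset)
    show "PP \<subseteq> Pow (ground M)" using cov by blast
  qed (simp add: finite_ground)
  have "card {A, C - A, B, C' - B, T0} = 5"
  proof -
    have "A \<noteq> C - A" "A \<noteq> B" "A \<noteq> C' - B" "A \<noteq> T0" "C - A \<noteq> B" "C - A \<noteq> C' - B" "C - A \<noteq> T0" "B \<noteq> C' - B" "B \<noteq> T0" "C' - B \<noteq> T0"
      using AB C(3) neC neC' TT_C[OF T0] c by blast+
    then show ?thesis by simp
  qed
  moreover have "card {A, C - A, B, C' - B, T0} \<le> card PP" by (rule card_mono[OF fin]) (use T0 in \<open>auto simp: PP_def\<close>)
  ultimately have five: "5 \<le> card PP" by simp
  show ?thesis by (rule parts_series_extension[OF PP ne cov fin five])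
qed

end

text \<open>The flag \<open>b\<close> is set for spaces like those of \<open>U(1,4)\<close> and
  \<open>R10\<close>, where the full set may be a member but is not counted as a circuit. The map
  \<open>h\<close> renames the labels in \<open>F\<close> to the elements of the target
  matroid.\<close>

lemma pulled_series_extension:
  assumes M: "matroid M" and P: "pulled Z \<pi> F Z0" and g: "\<Union>Z = ground M"
    and cM: "\<And>C. circuit M C \<longleftrightarrow> C \<in> Z \<and> C \<noteq> {} \<and> (b \<longrightarrow> C \<noteq> ground M)"
    and covM: "\<And>x. x \<in> ground M \<Longrightarrow> \<exists>C. circuit M C \<and> x \<in> C"
    and N0: "\<And>X. X \<in> indeps N0 \<longleftrightarrow> X \<subseteq> ground N0 \<and> (\<forall>D. circuit N0 D \<longrightarrow> \<not> D \<subseteq> X)"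
    and h: "inj_on h F" "ground N0 = h ` F" and sub: "\<And>D. D \<in> Z0 \<Longrightarrow> D \<subseteq> F"
    and cN: "\<And>D. circuit N0 D \<longleftrightarrow> (\<exists>D0\<in>Z0. D0 \<noteq> {} \<and> (b \<longrightarrow> D0 \<noteq> F) \<and> D = h ` D0)"
  shows "\<exists>N. series_extension N M \<and> matroid_iso N N0"
proof -
  define pre where "pre D = {x \<in> ground M. \<pi> x \<in> D}" for D
  have im: "\<pi> ` ground M = F" and Z: "Z = pre ` Z0"
    using P unfolding pulled_def g pre_def by blast+
  have preh: "{x \<in> ground M. h (\<pi> x) \<in> h ` D} = pre D" if "D \<in> Z0" for D
  proof -
    have "h (\<pi> x) \<in> h ` D \<longleftrightarrow> \<pi> x \<in> D" if "x \<in> ground M" for x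
      using inj_on_image_mem_iff[OF h(1) _ sub[OF \<open>D \<in> Z0\<close>]] im that by blast
    then show ?thesis unfolding pre_def by blast
  qed
  have pe: "pre D = {} \<longleftrightarrow> D = {}" if "D \<in> Z0" for D
    using sub[OF that] im unfolding pre_def by blast
  have pF: "pre D = ground M \<longleftrightarrow> D = F" if "D \<in> Z0" for D
    using sub[OF that] im unfolding pre_def by blast
  have cir: "circuit M C \<longleftrightarrow> (\<exists>D. circuit N0 D \<and> C = {x \<in> ground M. h (\<pi> x) \<in> D})" for C
  proof
    assume "circuit M C"
    then have C: "C \<in> Z" "C \<noteq> {}" "b \<longrightarrow> C \<noteq> ground M" unfolding cM by simp_all
    obtain D where D: "D \<in> Z0" "C = pre D" using C(1) unfolding Z by (rule imageE)
    have "circuit N0 (h ` D)" unfolding cN using D pe pF C(2,3) by (intro bexI[OF _ D(1)]) simp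
    then show "\<exists>D. circuit N0 D \<and> C = {x \<in> ground M. h (\<pi> x) \<in> D}"
      using preh[OF D(1)] D(2) by (intro exI[of _ "h ` D"]) simp
  next
    assume "\<exists>D. circuit N0 D \<and> C = {x \<in> ground M. h (\<pi> x) \<in> D}"
    then obtain D where D: "circuit N0 D" "C = {x \<in> ground M. h (\<pi> x) \<in> D}" by blast
    from D(1) obtain D0 where D0: "D0 \<in> Z0" "D0 \<noteq> {}" "b \<longrightarrow> D0 \<noteq> F" "D = h ` D0" unfolding cN by blast
    have C: "C = pre D0" using D(2) preh[OF D0(1)] D0(4) by simp
    have "C \<in> Z" unfolding Z C using D0(1) by (rule imageI)
    then show "circuit M C" unfolding cM using pe[OF D0(1)] pF[OF D0(1)] D0(2,3) C by simp
  qed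
  show ?thesis
  proof (rule series_extension_pullback[OF M _ cir N0])
    show "(\<lambda>x. h (\<pi> x)) ` ground M = ground N0" unfolding h(2) im[symmetric] by (simp add: image_image)
    fix y assume "y \<in> ground N0"
    then obtain x where x: "x \<in> ground M" "y = h (\<pi> x)" unfolding h(2) im[symmetric] by blast
    obtain C where C: "circuit M C" "x \<in> C" using covM[OF x(1)] by blast
    then obtain D where D: "circuit N0 D" "C = {x \<in> ground M. h (\<pi> x) \<in> D}" using cir by blast
    then show "\<exists>D. circuit N0 D \<and> y \<in> D" using C(2) x(2) by blast
  qed
qed

text \<open>Serves both for the circuits with the empty set and for the space that also contains the
  ground set.\<close>

lemma represents_circuits:
  assumes K: "kernel_of M K" and ne: "\<And>C. circuit M C \<Longrightarrow> C \<noteq> {}"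
    and Z: "\<And>C. circuit M C \<Longrightarrow> C \<in> Z" "\<And>z. z \<in> Z \<Longrightarrow> z \<noteq> {} \<Longrightarrow> \<exists>C. circuit M C \<and> C \<subseteq> z"
  shows "represents K Z"
  unfolding represents_def
proof (intro conjI)
  have K2: "\<exists>k\<in>K. {x. k x \<noteq> 0} = C" if "circuit M C" for C
    using K that unfolding kernel_of_def by simp
  have K3: "\<exists>C. circuit M C \<and> C \<subseteq> {x. k x \<noteq> 0}" if "k \<in> K" "\<exists>x. k x \<noteq> 0" for k
    using K that unfolding kernel_of_def by simp
  show "\<forall>k\<in>K. \<forall>l\<in>K. \<forall>t. (\<lambda>x. k x + t * l x) \<in> K" using K unfolding kernel_of_def by (rule conjunct1)
  show "\<forall>z\<in>Z. z \<noteq> {} \<longrightarrow> (\<forall>y\<in>Z. y \<noteq> {} \<longrightarrow> y \<subseteq> z \<longrightarrow> y = z) \<longrightarrow> (\<exists>k\<in>K. {x. k x \<noteq> 0} = z)"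
  proof (intro ballI impI)
    fix z assume z: "z \<in> Z" "z \<noteq> {}" "\<forall>y\<in>Z. y \<noteq> {} \<longrightarrow> y \<subseteq> z \<longrightarrow> y = z"
    obtain C where C: "circuit M C" "C \<subseteq> z" using Z(2)[OF z(1,2)] by blast
    have "C = z" using z(3) Z(1)[OF C(1)] ne[OF C(1)] C(2) by blast
    with K2[OF C(1)] show "\<exists>k\<in>K. {x. k x \<noteq> 0} = z" by simp
  qed
  show "\<forall>k\<in>K. (\<exists>x. k x \<noteq> 0) \<longrightarrow> (\<exists>z\<in>Z. z \<noteq> {} \<and> z \<subseteq> {x. k x \<noteq> 0})"
  proof (intro ballI impI)
    fix k assume "k \<in> K" "\<exists>x. k x \<noteq> 0"
    from K3[OF this] obtain C where "circuit M C" "C \<subseteq> {x. k x \<noteq> 0}" by blast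
    then show "\<exists>z\<in>Z. z \<noteq> {} \<and> z \<subseteq> {x. k x \<noteq> 0}" using Z(1) ne by (intro bexI[of _ C]) simp_all
  qed
qed

definition extremal :: "'b set_system \<Rightarrow> bool" where
  "extremal N \<longleftrightarrow> matroid_iso N (uniform_matroid 0 1) \<or>
       (\<exists>m \<ge> 1. matroid_iso N (uniform_matroid 1 m)) \<or>
       (\<exists>n \<ge> 1. matroid_iso N (dual_matroid (cycle_matroid (complete_graph n)))) \<or>
       matroid_iso N (cycle_matroid (complete_bipartite_graph 3 3)) \<or>
       matroid_iso N R10"

lemma extremal_circuit_difference: "extremal N \<Longrightarrow> circuit_difference N"
  unfolding extremal_def
  using circuit_difference_iso circuit_difference_uniform_zero circuit_difference_uniform_one
    circuit_difference_dual_complete circuit_difference_k33 circuit_difference_R10 by metis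

lemma indep_circuits_k33:
  "X \<in> indeps (cycle_matroid (complete_bipartite_graph 3 3)) \<longleftrightarrow>
    X \<subseteq> ground (cycle_matroid (complete_bipartite_graph 3 3)) \<and>
    (\<forall>D. circuit (cycle_matroid (complete_bipartite_graph 3 3)) D \<longrightarrow> \<not> D \<subseteq> X)"
proof -
  have g: "ground (cycle_matroid (complete_bipartite_graph 3 3)) = k33_edge ` grid" by (simp add: k33_ground)
  show ?thesis by (rule indep_circuits_of_cycles[OF _ indep_k33[folded g]]) (simp add: k33_ground grid_def)
qed

lemma indep_circuits_R10:
  "X \<in> indeps R10 \<longleftrightarrow> X \<subseteq> ground R10 \<and> (\<forall>D. circuit R10 D \<longrightarrow> \<not> D \<subseteq> X)"
proof (rule indep_circuits_of_cycles[OF _ indep_R10])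
  show "finite (ground R10)" unfolding r10_ground_image by (simp add: r10_ground_def grid_def)
qed

lemma indep_circuits_dual_complete:
  fixes V :: "'v set"
  assumes "finite V"
  shows "X \<in> indeps (dual_matroid (cycle_matroid (edges V))) \<longleftrightarrow>
    X \<subseteq> ground (dual_matroid (cycle_matroid (edges V))) \<and>
    (\<forall>D. circuit (dual_matroid (cycle_matroid (edges V))) D \<longrightarrow> \<not> D \<subseteq> X)"
proof -
  have g: "ground (dual_matroid (cycle_matroid (edges V))) = edges V" by (simp add: dual_matroid_def)
  show ?thesis unfolding g indep_dual_complete[OF assms] circuit_dual_complete[OF assms] by blast
qed

lemma even4_pairs:
  "even4 D \<and> D \<noteq> {} \<and> D \<noteq> {0,1,2,3} \<longleftrightarrow> (\<exists>i j. i < 4 \<and> j < 4 \<and> i \<noteq> j \<and> D = {i, j})"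
proof
  assume h: "even4 D \<and> D \<noteq> {} \<and> D \<noteq> {0,1,2,3}"
  then have s: "D \<subseteq> {0,1,2,3}" and e: "((0 \<in> D) \<noteq> (1 \<in> D)) = ((2 \<in> D) \<noteq> (3 \<in> D))" by (simp_all add: even4_def)
  have "D = {0,1} \<or> D = {0,2} \<or> D = {0,3} \<or> D = {1,2} \<or> D = {1,3} \<or> D = {2,3}"
  proof -
    have D: "D = (if 0 \<in> D then {0} else {}) \<union> (if 1 \<in> D then {1} else {}) \<union> (if 2 \<in> D then {2} else {}) \<union> (if 3 \<in> D then {3} else {})"
      (is "D = ?R") using s by auto
    show ?thesis
      by (cases "0 \<in> D"; cases "1 \<in> D"; cases "2 \<in> D"; cases "3 \<in> D")
        (use h e D in \<open>simp_all add: insert_commute\<close>)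
  qed
  then show "\<exists>i j. i < 4 \<and> j < 4 \<and> i \<noteq> j \<and> D = {i, j}"
    by (elim disjE) (rule exI, rule exI, (intro conjI; (assumption | simp)))+
next
  assume "\<exists>i j. i < 4 \<and> j < 4 \<and> i \<noteq> j \<and> D = {i, j}"
  then obtain i j :: nat where ij: "i < 4" "j < 4" "i \<noteq> j" "D = {i, j}" by blast
  have l: "x = 0 \<or> x = 1 \<or> x = 2 \<or> x = 3" if "x < 4" for x :: nat using that by linarith
  have "even4 {i, j}" using l[OF ij(1)] l[OF ij(2)] ij(3) unfolding even4_def by (elim disjE) simp_all
  moreover have "{i, j} \<noteq> {0,1,2,3}"
  proof
    assume "{i, j} = {0,1,2,3}"
    then have "card {i, j} = card {0,1,2,3::nat}" by simp
    then show False using ij(3) by simp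
  qed
  ultimately show "even4 D \<and> D \<noteq> {} \<and> D \<noteq> {0,1,2,3}" using ij(4) by simp
qed

context connected_difference_matroid
begin

lemma covered: "x \<in> ground M \<Longrightarrow> \<exists>C. circuit M C \<and> x \<in> C"
  using conn by blast

lemma clutter_case:
  assumes K: "kernel_of M K" and ne: "ground M \<noteq> {}"
    and meet: "\<And>C D. circuit M C \<Longrightarrow> circuit M D \<Longrightarrow> C \<inter> D \<noteq> {}"
  shows "\<exists>N. series_extension N M \<and> extremal N"
proof -
  define Z where "Z = insert {} {C. circuit M C}"
  have U: "\<Union>Z = ground M" unfolding Z_def using circuit_ground covered by blast
  have "cycle_space Z" unfolding cycle_space_def U
  proof (intro conjI ballI finite_ground)
    show "{} \<in> Z" by (simp add: Z_def)
    fix a b assume ab: "a \<in> Z" "b \<in> Z"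
    show "sym_diff a b \<in> Z"
    proof (cases "a = {} \<or> b = {} \<or> a = b")
      case True then show ?thesis using ab by (auto simp: Z_def)
    next
      case False
      then have "circuit M a" "circuit M b" "a \<noteq> b" using ab by (auto simp: Z_def)
      then show ?thesis using difference meet by (simp add: Z_def)
    qed
  qed
  moreover have "clutter Z" unfolding clutter_def
  proof (intro ballI impI)
    fix y z assume h: "y \<in> Z" "z \<in> Z" "y \<noteq> {}" "y \<subseteq> z"
    then have "circuit M y" "circuit M z" by (auto simp: Z_def)
    then show "y = z" using circuit_incomparable h(4) by blast
  qed
  moreover have "represents K Z"
    by (rule represents_circuits[OF K circuit_nonempty]) (auto simp: Z_def)
  ultimately have "tight Z" unfolding tight_def by blast
  moreover have "Z \<noteq> {{}}" using U ne by auto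
  ultimately have T: "(\<exists>V \<pi>. finite (V::nat set) \<and> 2 \<le> card V \<and> pulled Z \<pi> (edges V) (cuts V)) \<or>
    (\<exists>\<pi>. pulled Z \<pi> grid (Collect grid_even))" by (rule tight_structure)
  have cM: "circuit M C \<longleftrightarrow> C \<in> Z \<and> C \<noteq> {} \<and> (False \<longrightarrow> C \<noteq> ground M)" for C
    using circuit_nonempty by (auto simp: Z_def)
  note series = pulled_series_extension[OF matroid_axioms _ U cM covered]
  from T show ?thesis
  proof (elim disjE exE conjE)
    fix V :: "nat set" and \<pi> assume V: "finite V" "2 \<le> card V" "pulled Z \<pi> (edges V) (cuts V)"
    obtain g where "bij_betw g V {0..<card V}" using ex_bij_betw_finite_nat[OF V(1)] by blast
    then have g: "bij_betw g V {..<card V}" by (simp add: lessThan_atLeast0)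
    have "\<exists>N. series_extension N M \<and> matroid_iso N (dual_matroid (cycle_matroid (edges {..<card V})))"
    proof (rule series[OF pulled_edges_relabel[OF V(3) g], where h = id])
      show "D \<subseteq> edges {..<card V}" if "D \<in> cuts {..<card V}" for D using that unfolding cuts_def by blast
    qed (simp_all add: indep_circuits_dual_complete circuit_dual_complete, simp add: dual_matroid_def, blast?)
    then show ?thesis unfolding extremal_def complete_graph_edges using V(2) by (metis le_trans one_le_numeral)
  next
    fix \<pi> assume P: "pulled Z \<pi> grid (Collect grid_even)"
    have "\<exists>N. series_extension N M \<and> matroid_iso N (cycle_matroid (complete_bipartite_graph 3 3))"
    proof (rule series[OF P _ indep_circuits_k33, where h = k33_edge])
      show "D \<subseteq> grid" if "D \<in> Collect grid_even" for D using that grid_evenD(1) by blast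
      show "ground (cycle_matroid (complete_bipartite_graph 3 3)) = k33_edge ` grid" by (simp add: k33_ground)
      show "circuit (cycle_matroid (complete_bipartite_graph 3 3)) D \<longleftrightarrow>
        (\<exists>D0\<in>Collect grid_even. D0 \<noteq> {} \<and> (False \<longrightarrow> D0 \<noteq> grid) \<and> D = k33_edge ` D0)" for D
        unfolding circuit_k33 by simp
    qed (simp_all add: inj_on_def)
    then show ?thesis unfolding extremal_def by blast
  qed
qed

text \<open>Adding the ground set makes the circuits and the empty set a space: disjoint circuits
  are complementary, and the complement of a circuit other than \<open>A\<close> and
  \<open>A'\<close> is a circuit because it arises by adding first \<open>A\<close> and then
  \<open>A'\<close>.\<close>

lemma affine_case:
  assumes K: "kernel_of M K"
    and A: "circuit M A" "circuit M A'" "A \<inter> A' = {}"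
    and cover: "\<And>C C'. circuit M C \<Longrightarrow> circuit M C' \<Longrightarrow> C \<inter> C' = {} \<Longrightarrow> C \<union> C' = ground M"
  shows "\<exists>N. series_extension N M \<and> extremal N"
proof -
  let ?E = "ground M"
  define Z where "Z = insert ?E (insert {} {C. circuit M C})"
  have U: "\<Union>Z = ?E" unfolding Z_def using circuit_ground by blast
  have AE: "A \<union> A' = ?E" by (rule cover[OF A])
  have nA: "A \<noteq> {}" "A' \<noteq> {}" using A circuit_nonempty by blast+
  have nE: "\<not> circuit M ?E"
  proof
    assume "circuit M ?E"
    from circuit_incomparable[OF A(1) this] have "A = ?E" using AE by blast
    then show False using A(3) nA AE by blast
  qed
  have comp: "circuit M (?E - C)" if C: "circuit M C" for C
  proof -
    consider "C = A" | "C = A'" | "C \<noteq> A" "C \<noteq> A'" by blast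
    then show ?thesis
    proof cases
      case 1
      then have "?E - C = A'" using AE A(3) by blast
      then show ?thesis using A(2) by simp
    next
      case 2
      then have "?E - C = A" using AE A(3) by blast
      then show ?thesis using A(1) by simp
    next
      case 3
      have "\<not> C \<subseteq> A" "\<not> C \<subseteq> A'" "\<not> A \<subseteq> C" "\<not> A' \<subseteq> C" using circuit_incomparable C A 3 by blast+
      then have m: "C \<inter> A \<noteq> {}" "C \<inter> A' \<noteq> {}" "\<not> A \<subseteq> C" using AE circuit_ground[OF C] by blast+
      have "circuit M (sym_diff C A)" by (rule difference[OF C A(1) 3(1) m(1)])
      then have "circuit M (sym_diff (sym_diff C A) A')"
        by (rule difference[OF _ A(2)]) (use m A(3) in blast)+
      moreover have "sym_diff (sym_diff C A) A' = ?E - C" using A(3) AE circuit_ground[OF C] by blast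
      ultimately show ?thesis by simp
    qed
  qed
  have Z: "cycle_space Z" unfolding cycle_space_def U
  proof (intro conjI ballI finite_ground)
    show "{} \<in> Z" by (simp add: Z_def)
    fix a b assume ab: "a \<in> Z" "b \<in> Z"
    have s: "a \<subseteq> ?E" "b \<subseteq> ?E" using ab U by blast+
    have cZ: "?E - z \<in> Z" if "z \<in> Z" for z using that comp by (auto simp: Z_def)
    show "sym_diff a b \<in> Z"
    proof (cases "a = {} \<or> b = {} \<or> a = b")
      case True then show ?thesis using ab by (auto simp: Z_def)
    next
      case n: False
      show ?thesis
      proof (cases "a = ?E \<or> b = ?E")
        case True
        then have "sym_diff a b = ?E - b \<or> sym_diff a b = ?E - a" using s by blast
        then show ?thesis using cZ ab by metis
      next
        case False
        then have c: "circuit M a" "circuit M b" "a \<noteq> b" using ab n by (auto simp: Z_def)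
        show ?thesis
        proof (cases "a \<inter> b = {}")
          case True
          then have "sym_diff a b = ?E" using cover[OF c(1,2)] by blast
          then show ?thesis by (simp add: Z_def)
        next
          case False
          then show ?thesis using difference[OF c] by (simp add: Z_def)
        qed
      qed
    qed
  qed
  have R: "represents K Z"
    by (rule represents_circuits[OF K circuit_nonempty]) (use A AE in \<open>auto simp: Z_def\<close>)
  have EZ: "\<Union>Z \<in> Z" "\<Union>Z \<noteq> {}" unfolding U using nA AE by (auto simp: Z_def)
  have min: "y = z" if h: "y \<in> Z" "z \<in> Z" "z \<noteq> \<Union>Z" "y \<noteq> {}" "y \<subseteq> z" for y z
  proof -
    have "circuit M z" using h(2-5) unfolding U by (auto simp: Z_def)
    moreover have "circuit M y"
    proof -
      have "y \<noteq> ?E" using h(3,5) circuit_ground[OF \<open>circuit M z\<close>] unfolding U by blast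
      then show ?thesis using h(1,4) by (auto simp: Z_def)
    qed
    ultimately show ?thesis using circuit_incomparable h(5) by blast
  qed
  have con: "\<exists>z\<in>Z. z \<noteq> \<Union>Z \<and> x \<in> z \<and> y \<in> z" if "x \<in> \<Union>Z" "y \<in> \<Union>Z" for x y
  proof -
    obtain C where "circuit M C" "x \<in> C" "y \<in> C" using conn \<open>x \<in> \<Union>Z\<close> \<open>y \<in> \<Union>Z\<close> unfolding U by blast
    then show ?thesis unfolding U using nE by (intro bexI[of _ C]) (auto simp: Z_def)
  qed
  from affine_structure[OF Z R EZ min con]
  have T: "(\<exists>\<pi>. pulled Z \<pi> {0,1,2,3} (Collect even4)) \<or> (\<exists>\<pi>. pulled Z \<pi> r10_ground (Collect r10_cycle))" .
  have cM: "circuit M C \<longleftrightarrow> C \<in> Z \<and> C \<noteq> {} \<and> (True \<longrightarrow> C \<noteq> ?E)" for C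
    using circuit_nonempty nE by (auto simp: Z_def)
  note series = pulled_series_extension[OF matroid_axioms _ U cM covered]
  from T show ?thesis
  proof (elim disjE exE)
    fix \<pi> assume P: "pulled Z \<pi> {0,1,2,3} (Collect even4)"
    have g: "{..<4} = {0,1,2,3::nat}" by auto
    have "\<exists>N. series_extension N M \<and> matroid_iso N (uniform_matroid 1 4)"
    proof (rule series[OF P _ indep_uniform_one, where h = id])
      show "ground (uniform_matroid 1 4) = id ` {0,1,2,3}" unfolding uniform_matroid_def g by simp
      show "D \<subseteq> {0,1,2,3}" if "D \<in> Collect even4" for D using that by (simp add: even4_def)
      show "circuit (uniform_matroid 1 4) D \<longleftrightarrow>
        (\<exists>D0\<in>Collect even4. D0 \<noteq> {} \<and> (True \<longrightarrow> D0 \<noteq> {0,1,2,3}) \<and> D = id ` D0)" for D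
        unfolding circuit_uniform_one even4_pairs[symmetric] by auto
    qed (simp_all add: inj_on_def)
    moreover have "(1::nat) \<le> 4" by simp
    ultimately show ?thesis unfolding extremal_def by blast
  next
    fix \<pi> assume P: "pulled Z \<pi> r10_ground (Collect r10_cycle)"
    have "\<exists>N. series_extension N M \<and> matroid_iso N R10"
    proof (rule series[OF P _ indep_circuits_R10 r10_vec_inj r10_ground_image])
      show "D \<subseteq> r10_ground" if "D \<in> Collect r10_cycle" for D using that r10_cycle_subset by blast
    qed (auto simp: circuit_R10)
    then show ?thesis unfolding extremal_def by blast
  qed
qed

theorem connected_structure:
  assumes K: "kernel_of M K" and ne: "ground M \<noteq> {}"
  shows "\<exists>N. series_extension N M \<and> extremal N"
proof (cases "\<forall>C D. circuit M C \<longrightarrow> circuit M D \<longrightarrow> C \<inter> D \<noteq> {}")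
  case True
  then show ?thesis by (intro clutter_case[OF K ne]) blast
next
  case n: False
  then obtain A A' where A: "circuit M A" "circuit M A'" "A \<inter> A' = {}" by blast
  show ?thesis
  proof (cases "\<forall>C C'. circuit M C \<longrightarrow> circuit M C' \<longrightarrow> C \<inter> C' = {} \<longrightarrow> C \<union> C' = ground M")
    case True
    then show ?thesis by (intro affine_case[OF K A]) blast
  next
    case False
    then obtain C C' where C: "circuit M C" "circuit M C'" "C \<inter> C' = {}" "C \<union> C' \<noteq> ground M" by blast
    then obtain x where "x \<in> ground M" "x \<notin> C" "x \<notin> C'" using circuit_ground by blast
    from parallel_case[OF C(1-3) this] show ?thesis unfolding extremal_def by blast
  qed
qed

end

text \<open>An element on no circuit is a component of its own and gives \<open>U(1,1)\<close>. Any
  other component is represented by those functions of the real space that vanish outside it; a loop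
  falls under this case.\<close>

lemma component_structure:
  assumes M: "difference_matroid M" and K0: "kernel_of M K0" and K: "K \<in> components M"
  shows "\<exists>N. series_extension N K \<and> extremal N"
proof -
  interpret difference_matroid M by (rule M)
  obtain Q where "Q \<in> ground M // connected_rel M" and KQ: "K = restrict_matroid M Q"
    using K unfolding components_def by blast
  then obtain x where x: "x \<in> ground M" and Qx: "Q = connected_rel M `` {x}" by (auto elim: quotientE)
  have Q: "y \<in> Q \<longleftrightarrow> y \<in> ground M \<and> (x = y \<or> (\<exists>C. circuit M C \<and> x \<in> C \<and> y \<in> C))" for y
    unfolding Qx connected_rel_def using x by blast
  have Qg: "Q \<subseteq> ground M" using Q by blast
  have gK: "ground K = Q" by (simp add: KQ restrict_matroid_def)
  have cK: "circuit K C \<longleftrightarrow> circuit M C \<and> C \<subseteq> Q" for C unfolding KQ by (rule circuit_restrict[OF Qg])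
  have mK: "matroid K" unfolding KQ by (rule matroid_restrict[OF matroid_axioms Qg])
  show ?thesis
  proof (cases "\<exists>C. circuit M C \<and> x \<in> C")
    case True
    then have Q': "y \<in> Q \<longleftrightarrow> y \<in> ground M \<and> (\<exists>C. circuit M C \<and> x \<in> C \<and> y \<in> C)" for y unfolding Q by blast
    have "connected_difference_matroid K"
    proof (intro connected_difference_matroid.intro difference_matroid.intro difference_matroid_axioms.intro
        connected_difference_matroid_axioms.intro mK)
      show "circuit K (sym_diff C D)" if "circuit K C" "circuit K D" "C \<noteq> D" "C \<inter> D \<noteq> {}" for C D
        using that difference[of C D] unfolding cK by blast
      fix y z assume "y \<in> ground K" "z \<in> ground K"
      then obtain C D where CD: "circuit M C" "x \<in> C" "y \<in> C" "circuit M D" "x \<in> D" "z \<in> D" unfolding gK Q' by blast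
      obtain E where E: "circuit M E" "y \<in> E" "z \<in> E" using circuit_join[OF CD(1,3,2,4,5,6)] by blast
      have "E \<subseteq> Q"
      proof
        fix w assume w: "w \<in> E"
        have "\<exists>F. circuit M F \<and> x \<in> F \<and> w \<in> F" by (rule circuit_join[OF CD(1,2,3) E(1,2) w])
        then show "w \<in> Q" unfolding Q' using w circuit_ground[OF E(1)] by blast
      qed
      then show "\<exists>C. circuit K C \<and> y \<in> C \<and> z \<in> C" using E cK by blast
    qed
    then interpret K: connected_difference_matroid K .
    have K02: "\<exists>k\<in>K0. {x. k x \<noteq> 0} = C" if "circuit M C" for C
      using K0 that unfolding kernel_of_def by simp
    have K03: "\<exists>C. circuit M C \<and> C \<subseteq> {x. k x \<noteq> 0}" if "k \<in> K0" "\<exists>x. k x \<noteq> 0" for k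
      using K0 that unfolding kernel_of_def by simp
    define K1 where "K1 = {k \<in> K0. \<forall>x. k x \<noteq> 0 \<longrightarrow> x \<in> Q}"
    have "kernel_of K K1" unfolding kernel_of_def
    proof (intro conjI ballI allI impI)
      fix k l t assume k: "k \<in> K1" and l: "l \<in> K1"
      have "(\<lambda>x. k x + t * l x) \<in> K0" using k l K0 unfolding kernel_of_def K1_def by simp
      moreover have "x \<in> Q" if "k x + t * l x \<noteq> 0" for x
      proof -
        have "k x \<noteq> 0 \<or> l x \<noteq> 0" using that by auto
        then show ?thesis using k l unfolding K1_def by blast
      qed
      ultimately show "(\<lambda>x. k x + t * l x) \<in> K1" unfolding K1_def by blast
    next
      fix C assume C: "circuit K C"
      then obtain k where "k \<in> K0" "{x. k x \<noteq> 0} = C" using K02 unfolding cK by blast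
      then show "\<exists>k\<in>K1. {x. k x \<noteq> 0} = C" using C unfolding K1_def cK by blast
    next
      fix k assume k: "k \<in> K1" "\<exists>x. k x \<noteq> 0"
      have "k \<in> K0" using k(1) by (simp add: K1_def)
      from K03[OF this k(2)] obtain C where "circuit M C" "C \<subseteq> {x. k x \<noteq> 0}" by blast
      then show "\<exists>C. circuit K C \<and> C \<subseteq> {x. k x \<noteq> 0}" unfolding cK using k(1) unfolding K1_def by blast
    qed
    moreover have "ground K \<noteq> {}" unfolding gK using Q x by blast
    ultimately show ?thesis by (rule K.connected_structure)
  next
    case False
    then have Qx: "Q = {x}" using x unfolding set_eq_iff Q by blast
    have "{x} \<in> indeps M" unfolding indep_iff_no_circuit
    proof (intro conjI allI impI notI)
      fix C assume C: "circuit M C" "C \<subseteq> {x}"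
      then show False using circuit_nonempty[OF C(1)] False by blast
    qed (use x in simp)
    then have iK: "X \<in> indeps K" if "X \<subseteq> {x}" for X using that indep_subset unfolding KQ Qx restrict_matroid_def by auto
    have "matroid_iso K (uniform_matroid 1 1)" unfolding matroid_iso_def gK Qx
    proof (intro exI[of _ "\<lambda>_. 0"] conjI allI impI)
      show "bij_betw (\<lambda>_. 0) {x} (ground (uniform_matroid 1 1))" by (auto simp: bij_betw_def uniform_matroid_def)
      fix X assume X: "X \<subseteq> {x}"
      have "(\<lambda>_. 0::nat) ` X \<subseteq> {0}" by blast
      then have "card ((\<lambda>_. 0::nat) ` X) \<le> 1" "(\<lambda>_. 0::nat) ` X \<subseteq> {..<1}" using card_mono[of "{0::nat}"] by auto
      then show "X \<in> indeps K \<longleftrightarrow> (\<lambda>_. 0) ` X \<in> indeps (uniform_matroid 1 1)" using iK[OF X] by (simp add: uniform_matroid_def)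
    qed
    then have "extremal K" unfolding extremal_def by blast
    then show ?thesis unfolding series_extension_def by blast
  qed
qed

theorem corollary1p4:
  fixes M :: "'a set_system"
  assumes "regular_matroid M"
  shows "circuit_difference M \<longleftrightarrow>
    (\<forall>K \<in> components M. \<exists>N. series_extension N K \<and>
      (matroid_iso N (uniform_matroid 0 1) \<or>
       (\<exists>m \<ge> 1. matroid_iso N (uniform_matroid 1 m)) \<or>
       (\<exists>n \<ge> 1. matroid_iso N (dual_matroid (cycle_matroid (complete_graph n)))) \<or>
       matroid_iso N (cycle_matroid (complete_bipartite_graph 3 3)) \<or>
       matroid_iso N R10))"
  unfolding extremal_def[symmetric]
proof (intro iffI ballI)
  fix K assume cd: "circuit_difference M" and K: "K \<in> components M"
  have "matroid M" using assms by (simp add: regular_matroid_def)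
  then have "difference_matroid M"
    using cd unfolding circuit_difference_def by (intro difference_matroid.intro difference_matroid_axioms.intro) blast+
  moreover obtain K0 where "kernel_of M K0" using regular_kernel[OF assms] by blast
  ultimately show "\<exists>N. series_extension N K \<and> extremal N" using K by (rule component_structure)
next
  assume "\<forall>K\<in>components M. \<exists>N. series_extension N K \<and> extremal N"
  then show "circuit_difference M"
    using components_circuit_difference circuit_difference_series_extension extremal_circuit_difference by metis
qed

end
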